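(* Let $d,r,s$ be positive integers, let $b_0,\tilde b_0\in (l_0(\mathbb{Z}^d))^{r\times r}$, $b_1,\dots,b_s,\tilde b_1,\dots,\tilde b_s\in (l_0(\mathbb{Z}^d))^{1\times r}$ be finitely supported filters and let $\mathsf M_0,\dots,\mathsf M_s$ be $d\times d$ dilation matrices. Suppose $\psi^0,\tilde\psi^0\in(L_2(\mathbb{R}^d))^r$ are compactly supported standard $\mathsf M_0$-refinable vector functions (associated to $b_0$ and $\tilde b_0$ respectively) satisfying $$\widehat{\psi^0}(\mathsf M_0^{\mathsf T}\xi)=\widehat{b_0}(\xi)\widehat{\psi^0}(\xi),\qquad\widehat{\tilde\psi^0}(\mathsf M_0^{\mathsf T}\xi)=\widehat{\tilde b_0}(\xi)\widehat{\tilde\psi^0}(\xi),\qquad\xi\in\mathbb{R}^d,$$ and $\overline{\widehat{\psi^0}(0)}^{\mathsf T}\widehat{\tilde\psi^0}(0)=1$. Define $\psi^1,\dots,\psi^s,\tilde\psi^1,\dots,\tilde\psi^s\in L_2(\mathbb{R}^d)$ by $$\widehat{\psi^l}(\xi)=\widehat{b_l}(\mathsf M_0^{-\mathsf T}\xi)\widehat{\psi^0}(\mathsf M_0^{-\mathsf T}\xi),\qquad\widehat{\tilde\psi^l}(\xi)=\widehat{\tilde b_l}(\mathsf M_0^{-\mathsf T}\xi)\widehat{\tilde\psi^0}(\mathsf M_0^{-\mathsf T}\xi),\qquad\xi\in\mathbb{R}^d,\ l=1,\dots,s.$$ Consider the statements: (i) $(\{b_l!\mathsf M_l\}_{l=0}^s,\{\tilde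 b_l!\mathsf M_l\}_{l=0}^s)$ is a dual framelet filter bank with mixed dilation factors, and both $\{b_l!\mathsf M_l\}_{l=0}^s$ and $\{\tilde b_l!\mathsf M_l\}_{l=0}^s$ have stability in $l_2(\mathbb{Z}^d)$. (ii) $(\{\psi^l!\mathsf M_l\}_{l=0}^s,\{\tilde\psi^l!\mathsf M_l\}_{l=0}^s)$ is a dual framelet in $L_2(\mathbb{R}^d)$ with mixed dilation factors, and there exists $C>0$ such that $$[\widehat{\psi^0},\widehat{\psi^0}](\xi)+[\widehat{\tilde\psi^0},\widehat{\tilde\psi^0}](\xi)\le CI_r\qquad\text{for a.e. }\xi\in\mathbb{R}^d.$$ Then (i) implies (ii). Conversely, if in addition $$[\widehat{\psi^0},\widehat{\psi^0}](\xi)\ge C'I_r,\qquad[\widehat{\tilde\psi^0},\widehat{\tilde\psi^0}](\xi)\ge C'I_r\qquad\text{for a.e. }\xi\in\mathbb{R}^d$$ for some constant $C'>0$, then (ii) implies (i).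
   Context: A $d\times d$ dilation matrix is an integer matrix all of whose eigenvalues have modulus greater than $1$. $(l_0(\mathbb{Z}^d))^{p\times q}$: finitely supported sequences $\mathbb{Z}^d\to\mathbb{C}^{p\times q}$; $(l_2(\mathbb{Z}^d))^{p\times q}$: square-summable ones. For a sequence $u$, $\widehat u(\xi):=\sum_{k}u(k)e^{-ik\cdot\xi}$. For functions, $\widehat f(\xi)=\int_{\mathbb{R}^d}f(x)e^{-ix\cdot\xi}dx$, extended to $L_2$ and tempered distributions and applied entrywise. $\overline A^{\mathsf T}$ is the conjugate transpose; $A\le B$ for square matrices means $B-A$ is positive semidefinite; $\boldsymbol\delta(0)=1$, $\boldsymbol\delta(x)=0$ for $x\ne0$. Elements of $(L_2(\mathbb{R}^d))^r$ are column vectors. For matrix-valued $f,g$ with the same number of columns, $\langle f,g\rangle:=\int_{\mathbb{R}^d}f(x)\overline{g(x)}^{\mathsf T}dx$. The bracket product is $[f,g](\xi):=\sum_{k\in\mathbb{Z}^d}f(\xi+2\pi k)\overline{g(\xi+2\pi k)}^{\mathsf T}$. Standard refinable function: $b_0\in(l_0(\mathbb{Z}^d))^{r\times r}$ is assumed to satisfy, for some $C_0,C_b,\tau>0$, $u\in(l_0(\mathbb{Z}^d))^{r\times1}$ and some fixed matrix norm $|||\cdot|||$: $\log_2(|||\widehat{b_0}(0)|||+C_0)\le\tau$ and $\|\widehat{b_0}(\xi)\widehat u(\xi)-\widehat u(\mathsf M_0^{\mathsf T}\xi)\|\le C_b\|\xi\|^\tau$ for $\xi\in[-\pi,\pi]^d$.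 The standard $\mathsf M_0$-refinable vector function associated to $b_0$ is then the compactly supported vector distribution $\psi^0$ with $\widehat{\psi^0}(\xi)=\lim_{n\to\infty}\left(\prod_{j=1}^n\widehat{b_0}((\mathsf M_0^{-\mathsf T})^j\xi)\right)\widehat u((\mathsf M_0^{-\mathsf T})^n\xi)$, where the matrix product is taken with factors $j=1,2,\dots,n$ from left to right (the limit is a bounded measurable function with $\widehat{\psi^0}(\xi)=\widehat u(\xi)+O(\|\xi\|^\tau)$ as $\xi\to0$). The same applies to $\tilde b_0$ and $\tilde\psi^0$. Dual framelet filter bank with mixed dilation factors: with $\Omega_l:=[\mathsf M_l^{-\mathsf T}\mathbb{Z}^d]\cap[0,1)^d$ and $\chi_E$ the indicator function of $E$, $\sum_{l=0}^s\chi_{\Omega_l}(\omega)\overline{\widehat{b_l}(\xi)}^{\mathsf T}\widehat{\tilde b_l}(\xi+2\pi\omega)=\boldsymbol\delta(\omega)I_r$ for a.e. $\xi\in\mathbb{R}^d$ and all $\omega\in\bigcup_{l=0}^s\Omega_l$. Stability in $l_2(\mathbb{Z}^d)$ of $\{b_l!\mathsf M_l\}_{l=0}^s$: with $[\mathcal T_{b,\mathsf M}u](n):=|\det(\mathsf M)|^{1/2}\sum_{k\in\mathbb{Z}^d}u(k)\overline{b(k-\mathsf Mn)}^{\mathsf T}$, $v_{0,0}:=v$, $v_{l,j}:=\mathcal T_{b_l,\mathsf M_l}v_{0,j-1}$ and $\mathcal W_Jv:=(v_{1,1},\dots,v_{s,1},\dots,v_{1,J},\dots,v_{s,J},v_{0,J})$,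 there are positive constants $c_1,c_2$ with $c_1\|v\|^2\le\|\mathcal W_Jv\|^2\le c_2\|v\|^2$ ($l_2$ norms) for all $J\in\mathbb N$ and $v\in(l_2(\mathbb{Z}^d))^{1\times r}$; similarly for $\{\tilde b_l!\mathsf M_l\}_{l=0}^s$. For an invertible real matrix $U$ and $k\in\mathbb{R}^d$, $f_{U;k}(x):=|\det(U)|^{1/2}f(Ux-k)$. The affine system, with $\psi^0=(\psi^0_1,\dots,\psi^0_r)^{\mathsf T}$, is $$\mathrm{AS}(\{\psi^l!\mathsf M_l\}_{l=0}^s):=\{\psi^0_q(\cdot-k):q=1,\dots,r;k\in\mathbb{Z}^d\}\cup\{|\det(\mathsf M_0^{-1}\mathsf M_l)|^{\frac12}\psi^l_{\mathsf M_0^j;\mathsf M_0^{-1}\mathsf M_lk}:l=1,\dots,s;\ j\in\mathbb N_0;\ k\in\mathbb{Z}^d\}.$$ $(\{\psi^l!\mathsf M_l\}_{l=0}^s,\{\tilde\psi^l!\mathsf M_l\}_{l=0}^s)$ is a dual framelet in $L_2(\mathbb{R}^d)$ with mixed dilation factors if both $\mathrm{AS}(\{\psi^l!\mathsf M_l\}_{l=0}^s)$ and $\mathrm{AS}(\{\tilde\psi^l!\mathsf M_l\}_{l=0}^s)$ are frames of $L_2(\mathbb{R}^d)$ and, for all $f,g\in L_2(\mathbb{R}^d)$, $$\langle f,g\rangle=\sum_{k\in\mathbb{Z}^d}\langle f,\psi^0(\cdot-k)\rangle\langle\tilde\psi^0(\cdot-k),g\rangle+\sum_{l=1}^s\sum_{j=0}^\infty\sum_{k\in\mathbb{Z}^d}|\det(\mathsf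 M_0^{-1}\mathsf M_l)|\langle f,\psi^l_{\mathsf M_0^j;\mathsf M_0^{-1}\mathsf M_lk}\rangle\langle\tilde\psi^l_{\mathsf M_0^j;\mathsf M_0^{-1}\mathsf M_lk},g\rangle,$$ with the series converging absolutely. *)

theory Defs
  imports "HOL-Analysis.Analysis"
begin

text \<open>
  Conventions.  The dimension $d$ and the multiplicity $r$ are the cardinalities of the index types
  \<open>'d\<close> and \<open>'r\<close>.  Row vectors (the $l_2$ sequences with $1 \times r$ entries) and column vectors
  (the elements of $(L_2)^r$ and the sequence $u$) are both of type \<open>complex ^ 'r\<close>; rows are
  multiplied by \<open>v*\<close> and columns by \<open>*v\<close>.  Elements of $L_2$ are represented by functions.
  Of \<open>b, psi :: nat \<Rightarrow> _\<close> only the entries $1, \dots, s$ are used; the lowpass data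
  $b_0$, $\psi^0$ have other types and are kept as separate arguments.
\<close>

section \<open>Matrices\<close>

abbreviation rvec :: "int ^ 'd \<Rightarrow> real ^ 'd"
  where "rvec k \<equiv> (\<chi> i. real_of_int (k $ i))"

abbreviation rmat :: "int ^ 'd ^ 'd \<Rightarrow> real ^ 'd ^ 'd"
  where "rmat M \<equiv> map_matrix real_of_int M"

definition dilation_matrix :: "int ^ 'd ^ 'd \<Rightarrow> bool"
  where "dilation_matrix M \<longleftrightarrow>
    (\<forall>(c::complex) v. v \<noteq> 0 \<and> map_matrix of_int M *v v = c *s v \<longrightarrow> cmod c > 1)"

text \<open>The operation \<open>^\<close> on type \<open>vec\<close> is entrywise, hence an explicit matrix power.\<close>

definition matpow :: "real ^ 'd ^ 'd \<Rightarrow> nat \<Rightarrow> real ^ 'd ^ 'd"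
  where "matpow A n = (((**) A) ^^ n) (mat 1)"

definition inv_transpose :: "int ^ 'd ^ 'd \<Rightarrow> real ^ 'd ^ 'd"
  where "inv_transpose M = transpose (matrix_inv (rmat M))"

definition herm :: "complex ^ 'q ^ 'p \<Rightarrow> complex ^ 'p ^ 'q"
  where "herm A = (\<chi> i j. cnj (A $ j $ i))"

definition pos_semidef :: "complex ^ 'n ^ 'n \<Rightarrow> bool"
  where "pos_semidef A \<longleftrightarrow> herm A = A \<and> (\<forall>x. 0 \<le> Re (\<Sum>i\<in>UNIV. cnj (x $ i) * (A *v x) $ i))"

definition loewner_le :: "complex ^ 'n ^ 'n \<Rightarrow> complex ^ 'n ^ 'n \<Rightarrow> bool"
  where "loewner_le A B \<longleftrightarrow> pos_semidef (B - A)"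

text \<open>A matrix norm is a norm on the space of square matrices that is moreover submultiplicative.\<close>

definition matrix_norm :: "(complex ^ 'n ^ 'n \<Rightarrow> real) \<Rightarrow> bool"
  where "matrix_norm N \<longleftrightarrow>
    (\<forall>A. 0 \<le> N A \<and> (N A = 0 \<longleftrightarrow> A = 0)) \<and>
    (\<forall>c A. N (\<chi> i j. c * A $ i $ j) = cmod c * N A) \<and>
    (\<forall>A B. N (A + B) \<le> N A + N B) \<and>
    (\<forall>A B. N (A ** B) \<le> N A * N B)"


section \<open>Sequences\<close>

definition finitely_supported :: "(int ^ 'd \<Rightarrow> 'a::zero) \<Rightarrow> bool"
  where "finitely_supported u \<longleftrightarrow> finite {k. u k \<noteq> 0}"

definition seq_hat :: "(int ^ 'd \<Rightarrow> complex) \<Rightarrow> real ^ 'd \<Rightarrow> complex"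
  where "seq_hat u \<xi> = (\<Sum>\<^sub>\<infinity>k. u k * exp (- \<i> * complex_of_real (rvec k \<bullet> \<xi>)))"

definition vseq_hat :: "(int ^ 'd \<Rightarrow> complex ^ 'p) \<Rightarrow> real ^ 'd \<Rightarrow> complex ^ 'p"
  where "vseq_hat u \<xi> = (\<chi> i. seq_hat (\<lambda>k. u k $ i) \<xi>)"

definition mseq_hat :: "(int ^ 'd \<Rightarrow> complex ^ 'q ^ 'p) \<Rightarrow> real ^ 'd \<Rightarrow> complex ^ 'q ^ 'p"
  where "mseq_hat b \<xi> = (\<chi> i j. seq_hat (\<lambda>k. b k $ i $ j) \<xi>)"

definition l2 :: "(int ^ 'd \<Rightarrow> complex ^ 'p) set"
  where "l2 = {v. (\<lambda>k. (norm (v k))\<^sup>2) summable_on UNIV}"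

definition l2_normsq :: "(int ^ 'd \<Rightarrow> complex ^ 'p) \<Rightarrow> real"
  where "l2_normsq v = (\<Sum>\<^sub>\<infinity>k. (norm (v k))\<^sup>2)"


section \<open>Square integrable functions and the Fourier transform\<close>

definition L2 :: "(real ^ 'd \<Rightarrow> complex) set"
  where "L2 = {f. f \<in> borel_measurable lebesgue \<and> integrable lebesgue (\<lambda>x. (cmod (f x))\<^sup>2)}"

definition L2_normsq :: "(real ^ 'd \<Rightarrow> complex) \<Rightarrow> real"
  where "L2_normsq f = (LINT x|lebesgue. (cmod (f x))\<^sup>2)"

definition L2_inner :: "(real ^ 'd \<Rightarrow> complex) \<Rightarrow> (real ^ 'd \<Rightarrow> complex) \<Rightarrow> complex"
  where "L2_inner f g = (LINT x|lebesgue. f x * cnj (g x))"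

definition fourier :: "(real ^ 'd \<Rightarrow> complex) \<Rightarrow> real ^ 'd \<Rightarrow> complex"
  where "fourier f \<xi> = (LINT x|lebesgue. f x * exp (- \<i> * complex_of_real (x \<bullet> \<xi>)))"

text \<open>
  Entrywise transform given by the integral, hence defined at every point.  It is only applied to
  compactly supported elements of $(L_2)^r$, whose entries are integrable.
\<close>

definition vfourier :: "(real ^ 'd \<Rightarrow> complex ^ 'r) \<Rightarrow> real ^ 'd \<Rightarrow> complex ^ 'r"
  where "vfourier f \<xi> = (\<chi> i. fourier (\<lambda>x. f x $ i) \<xi>)"

text \<open>
  The extension of the Fourier transform from $L_1 \cap L_2$ to $L_2$ by density: \<open>F\<close> represents
  the transform of \<open>f\<close> (both are determined up to null sets).  The $L_2$ distances are Lebesgue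
  integrals with values in $[0, \infty]$, so convergence to $0$ is not affected by the value that the
  Bochner integral assigns to non-integrable functions.
\<close>

definition has_L2_fourier :: "(real ^ 'd \<Rightarrow> complex) \<Rightarrow> (real ^ 'd \<Rightarrow> complex) \<Rightarrow> bool"
  where "has_L2_fourier f F \<longleftrightarrow> f \<in> L2 \<and> F \<in> L2 \<and>
    (\<exists>g. (\<forall>n::nat. g n \<in> L2 \<and> integrable lebesgue (g n)) \<and>
      (\<lambda>n. \<integral>\<^sup>+x. ennreal ((cmod (g n x - f x))\<^sup>2) \<partial>lebesgue) \<longlonglongrightarrow> 0 \<and>
      (\<lambda>n. \<integral>\<^sup>+\<xi>. ennreal ((cmod (fourier (g n) \<xi> - F \<xi>))\<^sup>2) \<partial>lebesgue) \<longlonglongrightarrow> 0)"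

definition compactly_supported :: "(real ^ 'd \<Rightarrow> complex ^ 'r) \<Rightarrow> bool"
  where "compactly_supported f \<longleftrightarrow> (\<exists>K. compact K \<and> (AE x in lebesgue. x \<notin> K \<longrightarrow> f x = 0))"

definition bracket ::
    "(real ^ 'd \<Rightarrow> complex ^ 'p) \<Rightarrow> (real ^ 'd \<Rightarrow> complex ^ 'q) \<Rightarrow> real ^ 'd \<Rightarrow> complex ^ 'q ^ 'p"
  where "bracket f g \<xi> =
    (\<chi> i j. \<Sum>\<^sub>\<infinity>k::int ^ 'd. f (\<xi> + (2 * pi) *\<^sub>R rvec k) $ i * cnj (g (\<xi> + (2 * pi) *\<^sub>R rvec k) $ j))"


section \<open>Standard refinable functions\<close>

primrec mask_product ::
    "int ^ 'd ^ 'd \<Rightarrow> (int ^ 'd \<Rightarrow> complex ^ 'r ^ 'r) \<Rightarrow> nat \<Rightarrow> real ^ 'd \<Rightarrow> complex ^ 'r ^ 'r"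
  where
    "mask_product M b 0 \<xi> = mat 1"
  | "mask_product M b (Suc n) \<xi> =
       mask_product M b n \<xi> ** mseq_hat b (matpow (inv_transpose M) (Suc n) *v \<xi>)"

definition standard_refinable ::
    "int ^ 'd ^ 'd \<Rightarrow> (int ^ 'd \<Rightarrow> complex ^ 'r ^ 'r) \<Rightarrow> (real ^ 'd \<Rightarrow> complex ^ 'r) \<Rightarrow> bool"
  where "standard_refinable M b \<phi> \<longleftrightarrow> compactly_supported \<phi> \<and>
    (\<exists>C0 Cb \<tau> u N. C0 > 0 \<and> Cb > 0 \<and> \<tau> > 0 \<and> finitely_supported u \<and> matrix_norm N \<and>
      log 2 (N (mseq_hat b 0) + C0) \<le> \<tau> \<and>
      (\<forall>\<xi>. (\<forall>i. - pi \<le> \<xi> $ i \<and> \<xi> $ i \<le> pi) \<longrightarrow>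
        norm (mseq_hat b \<xi> *v vseq_hat u \<xi> - vseq_hat u (transpose (rmat M) *v \<xi>))
          \<le> Cb * norm \<xi> powr \<tau>) \<and>
      (\<forall>\<xi>. (\<lambda>n. mask_product M b n \<xi> *v vseq_hat u (matpow (inv_transpose M) n *v \<xi>))
        \<longlonglongrightarrow> vfourier \<phi> \<xi>))"


section \<open>Filter banks with mixed dilation factors\<close>

definition Omega :: "int ^ 'd ^ 'd \<Rightarrow> (real ^ 'd) set"
  where "Omega M = {\<omega>. (\<exists>n. \<omega> = inv_transpose M *v rvec n) \<and> (\<forall>i. 0 \<le> \<omega> $ i \<and> \<omega> $ i < 1)}"

definition dual_framelet_filter_bank ::
    "nat \<Rightarrow> (nat \<Rightarrow> int ^ 'd ^ 'd)
      \<Rightarrow> (int ^ 'd \<Rightarrow> complex ^ 'r ^ 'r) \<Rightarrow> (nat \<Rightarrow> int ^ 'd \<Rightarrow> complex ^ 'r ^ 1)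
      \<Rightarrow> (int ^ 'd \<Rightarrow> complex ^ 'r ^ 'r) \<Rightarrow> (nat \<Rightarrow> int ^ 'd \<Rightarrow> complex ^ 'r ^ 1) \<Rightarrow> bool"
  where "dual_framelet_filter_bank s M b0 b bt0 bt \<longleftrightarrow>
    (AE \<xi> in lebesgue. \<forall>\<omega> \<in> (\<Union>l\<in>{0..s}. Omega (M l)).
      indicator (Omega (M 0)) \<omega> *\<^sub>R (herm (mseq_hat b0 \<xi>) ** mseq_hat bt0 (\<xi> + (2 * pi) *\<^sub>R \<omega>))
      + (\<Sum>l = 1..s. indicator (Omega (M l)) \<omega> *\<^sub>R
          (herm (mseq_hat (b l) \<xi>) ** mseq_hat (bt l) (\<xi> + (2 * pi) *\<^sub>R \<omega>)))
      = (if \<omega> = 0 then mat 1 else 0))"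

definition transition ::
    "(int ^ 'd \<Rightarrow> complex ^ 'r ^ 'q) \<Rightarrow> int ^ 'd ^ 'd \<Rightarrow> (int ^ 'd \<Rightarrow> complex ^ 'r)
      \<Rightarrow> int ^ 'd \<Rightarrow> complex ^ 'q"
  where "transition b M u n =
    sqrt \<bar>det (rmat M)\<bar> *\<^sub>R (\<Sum>\<^sub>\<infinity>k. u k v* herm (b (k - M *v n)))"

definition lowpass_coeffs ::
    "(nat \<Rightarrow> int ^ 'd ^ 'd) \<Rightarrow> (int ^ 'd \<Rightarrow> complex ^ 'r ^ 'r) \<Rightarrow> (int ^ 'd \<Rightarrow> complex ^ 'r)
      \<Rightarrow> nat \<Rightarrow> int ^ 'd \<Rightarrow> complex ^ 'r"
  where "lowpass_coeffs M b0 v j = ((transition b0 (M 0)) ^^ j) v"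

text \<open>The squared $l_2$ norm of $\mathcal{W}_J v$.\<close>

definition analysis_normsq ::
    "nat \<Rightarrow> (nat \<Rightarrow> int ^ 'd ^ 'd)
      \<Rightarrow> (int ^ 'd \<Rightarrow> complex ^ 'r ^ 'r) \<Rightarrow> (nat \<Rightarrow> int ^ 'd \<Rightarrow> complex ^ 'r ^ 1)
      \<Rightarrow> nat \<Rightarrow> (int ^ 'd \<Rightarrow> complex ^ 'r) \<Rightarrow> real"
  where "analysis_normsq s M b0 b J v =
    (\<Sum>j = 1..J. \<Sum>l = 1..s. l2_normsq (transition (b l) (M l) (lowpass_coeffs M b0 v (j - 1))))
    + l2_normsq (lowpass_coeffs M b0 v J)"

definition l2_stable ::
    "nat \<Rightarrow> (nat \<Rightarrow> int ^ 'd ^ 'd)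
      \<Rightarrow> (int ^ 'd \<Rightarrow> complex ^ 'r ^ 'r) \<Rightarrow> (nat \<Rightarrow> int ^ 'd \<Rightarrow> complex ^ 'r ^ 1) \<Rightarrow> bool"
  where "l2_stable s M b0 b \<longleftrightarrow>
    (\<exists>c1 c2. c1 > 0 \<and> c2 > 0 \<and> (\<forall>J \<ge> 1. \<forall>v \<in> l2.
      c1 * l2_normsq v \<le> analysis_normsq s M b0 b J v \<and>
      analysis_normsq s M b0 b J v \<le> c2 * l2_normsq v))"


section \<open>Framelets with mixed dilation factors\<close>

definition is_frame :: "'i set \<Rightarrow> ('i \<Rightarrow> real ^ 'd \<Rightarrow> complex) \<Rightarrow> bool"
  where "is_frame I e \<longleftrightarrow> (\<forall>i\<in>I. e i \<in> L2) \<and>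
    (\<exists>A B. A > 0 \<and> B > 0 \<and> (\<forall>f \<in> L2.
      (\<lambda>i. (cmod (L2_inner f (e i)))\<^sup>2) summable_on I \<and>
      A * L2_normsq f \<le> (\<Sum>\<^sub>\<infinity>i\<in>I. (cmod (L2_inner f (e i)))\<^sup>2) \<and>
      (\<Sum>\<^sub>\<infinity>i\<in>I. (cmod (L2_inner f (e i)))\<^sup>2) \<le> B * L2_normsq f))"

definition dilate_shift ::
    "real ^ 'd ^ 'd \<Rightarrow> real ^ 'd \<Rightarrow> (real ^ 'd \<Rightarrow> complex) \<Rightarrow> real ^ 'd \<Rightarrow> complex"
  where "dilate_shift U k f x = complex_of_real (sqrt \<bar>det U\<bar>) * f (U *v x - k)"

definition rel_dilation :: "(nat \<Rightarrow> int ^ 'd ^ 'd) \<Rightarrow> nat \<Rightarrow> real ^ 'd ^ 'd"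
  where "rel_dilation M l = matrix_inv (rmat (M 0)) ** rmat (M l)"

definition generator_shift :: "(real ^ 'd \<Rightarrow> complex ^ 'r) \<Rightarrow> 'r \<Rightarrow> int ^ 'd \<Rightarrow> real ^ 'd \<Rightarrow> complex"
  where "generator_shift psi0 q k x = psi0 (x - rvec k) $ q"

text \<open>$\psi^l_{\mathsf{M}_0^j;\, \mathsf{M}_0^{-1}\mathsf{M}_l k}$\<close>

definition wavelet ::
    "(nat \<Rightarrow> int ^ 'd ^ 'd) \<Rightarrow> (nat \<Rightarrow> real ^ 'd \<Rightarrow> complex) \<Rightarrow> nat \<Rightarrow> nat \<Rightarrow> int ^ 'd
      \<Rightarrow> real ^ 'd \<Rightarrow> complex"
  where "wavelet M psi l j k =
    dilate_shift (matpow (rmat (M 0)) j) (rel_dilation M l *v rvec k) (psi l)"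

text \<open>
  The affine system is a family, indexed by the parameters $(q, k)$ and $(l, j, k)$, so that
  coinciding elements are counted with multiplicity, as is customary for frames.
\<close>

datatype ('r, 'd::finite) as_index = Generator 'r "int ^ 'd" | Wavelet nat nat "int ^ 'd"

definition AS_indices :: "nat \<Rightarrow> ('r, 'd::finite) as_index set"
  where "AS_indices s = {Generator q k |q k. True} \<union> {Wavelet l j k |l j k. 1 \<le> l \<and> l \<le> s}"

primrec AS ::
    "(nat \<Rightarrow> int ^ 'd ^ 'd) \<Rightarrow> (real ^ 'd \<Rightarrow> complex ^ 'r) \<Rightarrow> (nat \<Rightarrow> real ^ 'd \<Rightarrow> complex)
      \<Rightarrow> ('r, 'd::finite) as_index \<Rightarrow> real ^ 'd \<Rightarrow> complex"
  where
    "AS M psi0 psi (Generator q k) = generator_shift psi0 q k"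
  | "AS M psi0 psi (Wavelet l j k) =
       (\<lambda>x. complex_of_real (sqrt \<bar>det (rel_dilation M l)\<bar>) * wavelet M psi l j k x)"

definition dual_framelet ::
    "nat \<Rightarrow> (nat \<Rightarrow> int ^ 'd ^ 'd)
      \<Rightarrow> (real ^ 'd \<Rightarrow> complex ^ 'r) \<Rightarrow> (nat \<Rightarrow> real ^ 'd \<Rightarrow> complex)
      \<Rightarrow> (real ^ 'd \<Rightarrow> complex ^ 'r) \<Rightarrow> (nat \<Rightarrow> real ^ 'd \<Rightarrow> complex) \<Rightarrow> bool"
  where "dual_framelet s M psi0 psi psit0 psit \<longleftrightarrow>
    is_frame (AS_indices s) (AS M psi0 psi) \<and> is_frame (AS_indices s) (AS M psit0 psit) \<and>
    (\<forall>f \<in> L2. \<forall>g \<in> L2.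
      (let gen = (\<lambda>k. \<Sum>q\<in>UNIV. L2_inner f (generator_shift psi0 q k)
                                * L2_inner (generator_shift psit0 q k) g);
           wav = (\<lambda>l j k. complex_of_real \<bar>det (rel_dilation M l)\<bar>
                          * L2_inner f (wavelet M psi l j k) * L2_inner (wavelet M psit l j k) g)
       in (\<lambda>k. cmod (gen k)) summable_on UNIV \<and>
          (\<forall>l\<in>{1..s}. (\<lambda>(j, k). cmod (wav l j k)) summable_on UNIV) \<and>
          L2_inner f g = (\<Sum>\<^sub>\<infinity>k. gen k) + (\<Sum>l = 1..s. \<Sum>\<^sub>\<infinity>j. \<Sum>\<^sub>\<infinity>k. wav l j k)))"

end

theory Submission
  imports Defs "HOL-Probability.Probability" "HOL-Computational_Algebra.Fundamental_Theorem_Algebra"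
begin

text \<open>
  Put \<open>c\<^sub>j f(k)\<^sub>q = |det M\<^sub>0|\<^bsup>j/2\<^esup> \<langle>f, \<psi>\<^sup>0\<^sub>q(M\<^sub>0\<^sup>j \<cdot> - k)\<rangle>\<close>. In the time domain the refinement equations say that
  \<open>c\<^sub>j f\<close> is the lowpass output of the filter bank for the input \<open>c\<^bsub>j+1\<^esub> f\<close> and that the wavelet coefficients
  of level \<open>j\<close> are its highpass outputs; hence the part of the affine system below level \<open>J\<close>, tested on \<open>f\<close>,
  has the energy of \<open>\<W>\<^sub>J\<close> applied to \<open>c\<^sub>J f\<close>. By independence of characters the filter bank condition
  is perfect reconstruction in \<open>l\<^sub>2\<close>, tested on sequences supported at one point.

  For (i) \<open>\<Longrightarrow>\<close> (ii), perfect reconstruction telescopes to level \<open>J\<close>, and \<open>\<langle>c\<^sub>J f, d\<^sub>J g\<rangle> \<rightarrow> \<langle>f, g\<rangle>\<close> for the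
  coefficients \<open>d\<^sub>J\<close> of the dual system, since for test functions this is a Riemann sum. The upper
  frame bounds are those of the filter banks, and the arithmetic-geometric mean inequality turns the
  upper bound of one system into a lower bound of its dual.

  For (ii) \<open>\<Longrightarrow>\<close> (i), subtracting the reconstruction formula for \<open>f, g\<close> from that for their dilates leaves
  perfect reconstruction of \<open>c\<^sub>0 f\<close> and \<open>d\<^sub>0 g\<close>. The lower bracket bound makes the integer shifts of
  \<open>\<psi>\<^sup>0\<close> a Riesz sequence, so that the \<open>c\<^sub>0 f\<close> are dense in \<open>l\<^sub>2\<close> with control of \<open>f\<close>, which also transfers the
  upper frame bound to the filter bank.
\<close>

section \<open>Matrices\<close>

text \<open>The data are given on the frequency side, while frames, samples and filter banks live on
  the time side. Injectivity of the Fourier transform carries the refinement equations over. For the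
  bracket product the bridge is Bessel's inequality for a periodization: the bracket form is at most
  the periodized energy, whose mean over a period is exactly the squared norm, so a lower bracket
  bound becomes a lower Riesz bound.

  Uniformity in \<open>J\<close> is the other obstacle. Crude bounds for \<open>J\<close> steps of a
  filter bank depend on \<open>J\<close>; the uniform ones come from dilation invariance, by which
  every \<open>c_0 f\<close> is also the level-\<open>J\<close> sample of a function of the same
  norm. Density of these samples comes from a Richardson iteration with the Gram operator of the
  shifts, whose iterates stay finite combinations; its tolerance may depend on \<open>J\<close>
  since the final constant \<open>8 B / C\<close>, with \<open>B\<close> the upper frame bound, does
  not.

  Different dilations do not conflict: \<open>\<psi>^l\<close> is shifted by
  \<open>M_0^{-1} M_l k\<close>, one level finer the integer point \<open>M_l k\<close>, and all
  \<open>Omega (M l)\<close> lie in one cube, where distinct points give distinct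
  characters.\<close>

definition lat :: "int ^ 'd \<Rightarrow> real ^ 'd"
  where "lat k = rvec k"

lemma lat_component [simp]: "lat k $ i = real_of_int (k $ i)"
  by (simp add: lat_def)

lemma lat_0 [simp]: "lat 0 = 0"
  and lat_add: "lat (m + n) = lat m + lat n"
  and lat_diff: "lat (m - n) = lat m - lat n"
  and lat_minus: "lat (- m) = - lat m"
  by (simp_all add: vec_eq_iff)

lemma lat_eq_iff: "lat m = lat n \<longleftrightarrow> m = n"
  by (simp add: vec_eq_iff)

lemma rmat_mult_lat: "rmat M *v lat n = lat (M *v n)"
  by (simp add: vec_eq_iff matrix_vector_mult_def map_matrix_def)

lemma norm_vector_smult: "norm (c *s x) = cmod c * norm x" for x :: "complex ^ 'd"
  by (simp add: norm_vec_def vector_scalar_mult_def norm_mult L2_set_right_distrib)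

abbreviation cvec :: "real ^ 'd \<Rightarrow> complex ^ 'd"
  where "cvec y \<equiv> (\<chi> i. complex_of_real (y $ i))"

lemma cvec_mult: "map_matrix complex_of_real A *v cvec y = cvec (A *v y)"
  by (simp add: vec_eq_iff matrix_vector_mult_def map_matrix_def)

lemma norm_cvec: "norm (cvec y) = norm y"
  by (simp add: norm_vec_def L2_set_def)

text \<open>A kernel vector would be an eigenvector for the eigenvalue 0, whose modulus does not
  exceed 1.\<close>

lemma dilation_det_nz:
  fixes M :: "int ^ 'd ^ 'd"
  assumes "dilation_matrix M"
  shows "det (rmat M) \<noteq> 0"
proof
  assume "det (rmat M) = 0"
  then have "\<not> (\<exists>B. B ** rmat M = mat 1)"
    using invertible_det_nz[of "rmat M"] invertible_left_inverse[of "rmat M"] by auto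
  then obtain x where x: "rmat M *v x = 0" "x \<noteq> 0"
    using matrix_left_invertible_ker[of "rmat M"] by auto
  have eq: "map_matrix of_int M = map_matrix complex_of_real (rmat M)"
    by (simp add: map_matrix_def vec_eq_iff)
  have "map_matrix of_int M *v cvec x = 0 *s cvec x"
    unfolding eq cvec_mult x by (simp add: vec_eq_iff)
  moreover have "cvec x \<noteq> 0"
    using x by (auto simp: vec_eq_iff)
  ultimately have "cmod 0 > 1"
    using assms unfolding dilation_matrix_def by blast
  then show False by simp
qed

text \<open>The affine map \<open>t \<mapsto> q t + (1 - q) r / 2\<close> has the fixed point
  \<open>r / 2\<close>. Once \<open>e\<close> is below \<open>(1 - q) r / 2\<close>, the norms stay
  below \<open>r / 2\<close> plus a geometrically decaying excess.\<close>

lemma perturbed_contraction_tendsto_0: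
  fixes x :: "nat \<Rightarrow> 'a::real_normed_vector"
  assumes q: "0 \<le> q" "q < 1" and step: "\<And>n. norm (x (Suc n)) \<le> q * norm (x n) + e n"
    and e: "e \<longlonglongrightarrow> 0"
  shows "x \<longlonglongrightarrow> 0"
proof (rule LIMSEQ_I)
  fix r :: real assume r: "r > 0"
  have "(1 - q) * (r / 2) > 0" using q r by simp
  from LIMSEQ_D[OF e this] obtain N where N: "\<And>n. n \<ge> N \<Longrightarrow> \<bar>e n\<bar> < (1 - q) * (r / 2)"
    by auto
  have bd: "norm (x (N + k)) \<le> q ^ k * norm (x N) + r / 2" for k
  proof (induction k)
    case (Suc k)
    have "norm (x (N + Suc k)) \<le> q * norm (x (N + k)) + e (N + k)"
      using step[of "N + k"] by simp
    also have "\<dots> \<le> q * (q ^ k * norm (x N) + r / 2) + (1 - q) * (r / 2)"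
      using Suc N[of "N + k"] q by (intro add_mono mult_left_mono) auto
    also have "\<dots> = q ^ Suc k * norm (x N) + r / 2"
      by (simp add: field_simps)
    finally show ?case .
  qed (use r in simp)
  have "(\<lambda>k. q ^ k * norm (x N)) \<longlonglongrightarrow> 0"
    using q by (intro tendsto_mult_left_zero LIMSEQ_realpow_zero) auto
  from LIMSEQ_D[OF this, of "r / 2"] r obtain K
    where "\<forall>k\<ge>K. norm (q ^ k * norm (x N) - 0) < r / 2"
    by auto
  then have K: "\<And>k. k \<ge> K \<Longrightarrow> q ^ k * norm (x N) < r / 2"
    using q by (simp add: abs_mult)
  show "\<exists>no. \<forall>n\<ge>no. norm (x n - 0) < r"
  proof (intro exI allI impI)
    fix n assume "n \<ge> N + K"
    then have "norm (x (N + (n - N))) < r"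
      using bd[of "n - N"] K[of "n - N"] by linarith
    then show "norm (x n - 0) < r" using \<open>n \<ge> N + K\<close> by simp
  qed
qed

section \<open>Polynomials in a linear map and the decay of its iterates\<close>

definition poly_act :: "(complex ^ 'd \<Rightarrow> complex ^ 'd) \<Rightarrow> complex poly \<Rightarrow> complex ^ 'd \<Rightarrow> complex ^ 'd"
  where "poly_act f p v = (\<Sum>i\<le>degree p. coeff p i *s (f ^^ i) v)"

lemma poly_act_eq: "degree p \<le> n \<Longrightarrow> poly_act f p v = (\<Sum>i\<le>n. coeff p i *s (f ^^ i) v)"
  unfolding poly_act_def by (rule sum.mono_neutral_left) (auto simp: coeff_eq_0)

context
  fixes f :: "complex ^ 'd \<Rightarrow> complex ^ 'd"
  assumes f_add: "\<And>v w. f (v + w) = f v + f w" and f_smult: "\<And>c v. f (c *s v) = c *s f v"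
begin

lemma iterate_smult: "(f ^^ n) (c *s v) = c *s (f ^^ n) v"
  by (induction n) (auto simp: f_smult)

lemma f_diff: "f (v - w) = f v - f w"
  using f_add[of "v - w" w] by (simp add: algebra_simps)

lemma iterate_diff: "(f ^^ n) (v - w) = (f ^^ n) v - (f ^^ n) w"
  by (induction n) (auto simp: f_diff)

lemma f_sum: "finite S \<Longrightarrow> f (\<Sum>i\<in>S. g i) = (\<Sum>i\<in>S. f (g i))"
proof (induction S rule: finite_induct)
  case empty
  show ?case using f_diff[of 0 0] by simp
qed (simp add: f_add)

lemma poly_act_linear_factor:
  "poly_act f ([:-c, 1:] * q) v = f (poly_act f q v) - c *s poly_act f q v"
proof -
  let ?n = "degree q"
  have deg: "degree ([:-c, 1:] * q) \<le> Suc ?n"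
    using degree_mult_le[of "[:-c, 1:]" q] by simp
  have "poly_act f ([:-c, 1:] * q) v
      = (\<Sum>i\<le>Suc ?n. (- c * coeff q i) *s (f ^^ i) v) + (\<Sum>i\<le>Suc ?n. coeff (pCons 0 q) i *s (f ^^ i) v)"
    unfolding poly_act_eq[OF deg] by (simp add: sum.distrib[symmetric] vec.scale_left_distrib)
  also have "(\<Sum>i\<le>Suc ?n. (- c * coeff q i) *s (f ^^ i) v) = - c *s poly_act f q v"
    by (simp add: poly_act_def coeff_eq_0 vec.scale_sum_right)
  also have "(\<Sum>i\<le>Suc ?n. coeff (pCons 0 q) i *s (f ^^ i) v) = f (poly_act f q v)"
    by (subst sum.atMost_Suc_shift) (simp add: poly_act_def f_sum f_smult)
  finally show ?thesis by simp
qed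

lemma poly_act_commute: "f (poly_act f q v) - c *s poly_act f q v = poly_act f q (f v - c *s v)"
proof -
  have "f (poly_act f q v) = (\<Sum>i\<le>degree q. coeff q i *s (f ^^ i) (f v))"
    by (simp add: poly_act_def f_sum f_smult funpow_swap1)
  moreover have "c *s poly_act f q v = (\<Sum>i\<le>degree q. coeff q i *s (f ^^ i) (c *s v))"
    unfolding poly_act_def vec.scale_sum_right iterate_smult by (simp add: mult.commute)
  ultimately show ?thesis
    unfolding poly_act_def[of f q "f v - c *s v"] iterate_diff vec.scale_right_diff_distrib sum_subtractf
    by simp
qed

text \<open>The vectors \<open>v, f v, ...\<close> eventually outnumber the real dimension, and a
  real linear dependence is in particular a complex one. Repeated iterates are a separate case
  because \<open>dependent\<close> speaks of a set of vectors.\<close>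

lemma annihilating_poly: "\<exists>p. p \<noteq> 0 \<and> poly_act f p v = 0"
proof -
  let ?k = "DIM(complex ^ 'd)"
  have "\<exists>a::nat \<Rightarrow> complex. (\<exists>i\<le>?k. a i \<noteq> 0) \<and> (\<Sum>i\<le>?k. a i *s (f ^^ i) v) = 0"
  proof (cases "inj_on (\<lambda>i. (f ^^ i) v) {..?k}")
    case True
    then have "card ((\<lambda>i. (f ^^ i) v) ` {..?k}) = Suc ?k"
      by (simp add: card_image)
    then have "dependent ((\<lambda>i. (f ^^ i) v) ` {..?k})"
      by (intro dependent_biggerset) auto
    then obtain u where u: "\<exists>w\<in>(\<lambda>i. (f ^^ i) v) ` {..?k}. u w \<noteq> 0"
      "(\<Sum>w\<in>(\<lambda>i. (f ^^ i) v) ` {..?k}. u w *\<^sub>R w) = 0"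
      by (auto simp: dependent_finite)
    have sc: "c *\<^sub>R w = complex_of_real c *s w" for c and w :: "complex ^ 'd"
      unfolding vec_eq_iff vector_scaleR_component by (simp add: scaleR_conv_of_real[where 'a=complex])
    have "(\<Sum>i\<le>?k. complex_of_real (u ((f ^^ i) v)) *s (f ^^ i) v) = 0"
      using u(2) unfolding sum.reindex[OF True] sc by (simp add: o_def)
    with u(1) show ?thesis
      by (intro exI[of _ "\<lambda>i. complex_of_real (u ((f ^^ i) v))"]) auto
  next
    case False
    then obtain i j where ij: "i \<le> ?k" "j \<le> ?k" "i \<noteq> j" "(f ^^ i) v = (f ^^ j) v"
      by (auto simp: inj_on_def)
    let ?a = "\<lambda>l. if l = i then 1 else if l = j then -1 else (0::complex)"
    have "(\<Sum>l\<le>?k. ?a l *s (f ^^ l) v) = (\<Sum>l\<in>{i, j}. ?a l *s (f ^^ l) v)"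
      using ij by (intro sum.mono_neutral_right) auto
    also have "\<dots> = 0" using ij by simp
    finally show ?thesis using ij by (intro exI[of _ ?a]) auto
  qed
  then obtain a :: "nat \<Rightarrow> complex" and i
    where a: "i \<le> ?k" "a i \<noteq> 0" "(\<Sum>i\<le>?k. a i *s (f ^^ i) v) = 0"
    by blast
  let ?p = "\<Sum>i\<le>?k. monom (a i) i"
  have c: "coeff ?p j = (if j \<le> ?k then a j else 0)" for j
    by (simp add: coeff_sum)
  have "degree ?p \<le> ?k" by (rule degree_le) (use c in auto)
  then have "poly_act f ?p v = (\<Sum>i\<le>?k. coeff ?p i *s (f ^^ i) v)" by (rule poly_act_eq)
  also have "\<dots> = (\<Sum>i\<le>?k. a i *s (f ^^ i) v)" unfolding c by (rule sum.cong) auto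
  finally have "poly_act f ?p v = 0" using a(3) by simp
  moreover have "?p \<noteq> 0" using c[of i] a by auto
  ultimately show ?thesis by blast
qed

text \<open>Induction on the degree of an annihilating polynomial of \<open>v\<close> takes the
  place of a Jordan form. Split off a root \<open>c\<close> with cofactor \<open>q\<close>. If
  \<open>q\<close> does not annihilate \<open>v\<close> already, \<open>poly_act f q v\<close> is an
  eigenvector, so \<open>cmod c < 1\<close>; moreover \<open>q\<close> annihilates
  \<open>f v - c *s v\<close>, whose orbit therefore tends to 0 and perturbs the contraction by
  \<open>c\<close>.\<close>

lemma iterate_tendsto_0:
  assumes eig: "\<And>c v. v \<noteq> 0 \<Longrightarrow> f v = c *s v \<Longrightarrow> cmod c < 1"
  shows "(\<lambda>n. (f ^^ n) v) \<longlonglongrightarrow> 0"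
proof -
  have "p \<noteq> 0 \<Longrightarrow> poly_act f p v = 0 \<Longrightarrow> degree p = n \<Longrightarrow> (\<lambda>n. (f ^^ n) v) \<longlonglongrightarrow> 0" for p v n
  proof (induction n arbitrary: p v)
    case 0
    then obtain a where p: "p = [:a:]" by (metis degree_eq_zeroE)
    with 0 have "v = 0" by (simp add: poly_act_def)
    moreover have "f 0 = 0" using f_diff[of 0 0] by simp
    ultimately have "(f ^^ n) v = 0" for n by (induction n) auto
    then show ?case by simp
  next
    case (Suc n)
    have "\<not> constant (poly p)" using Suc.prems(3) by (simp add: constant_degree)
    then obtain c where "poly p c = 0" using fundamental_theorem_of_algebra by blast
    then obtain q where q: "p = [:-c, 1:] * q" by (auto simp: poly_eq_0_iff_dvd)
    with Suc.prems have q0: "q \<noteq> 0" by auto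
    with Suc.prems(3) have dq: "degree q = n"
      unfolding q by (subst (asm) degree_mult_eq) auto
    show ?case
    proof (cases "poly_act f q v = 0")
      case True
      then show ?thesis using Suc.IH q0 dq by blast
    next
      case False
      have eigv: "f (poly_act f q v) = c *s poly_act f q v"
        using Suc.prems(2) unfolding q poly_act_linear_factor by simp
      then have c: "cmod c < 1" using eig False by blast
      have "poly_act f q (f v - c *s v) = 0"
        unfolding poly_act_commute[symmetric] using eigv by simp
      then have IH: "(\<lambda>n. (f ^^ n) (f v - c *s v)) \<longlonglongrightarrow> 0"
        using Suc.IH q0 dq by blast
      show ?thesis
      proof (rule perturbed_contraction_tendsto_0)
        show "(\<lambda>n. norm ((f ^^ n) (f v - c *s v))) \<longlonglongrightarrow> 0"
          using IH by (rule tendsto_norm_zero)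
        fix n
        have "(f ^^ Suc n) v = c *s (f ^^ n) v + (f ^^ n) (f v - c *s v)"
          by (simp add: iterate_diff iterate_smult funpow_swap1)
        then show "norm ((f ^^ Suc n) v) \<le> cmod c * norm ((f ^^ n) v) + norm ((f ^^ n) (f v - c *s v))"
          by (metis norm_triangle_ineq norm_vector_smult)
      qed (use c in auto)
    qed
  qed
  then show ?thesis using annihilating_poly[of v] by blast
qed

end

section \<open>Powers and inverses of real matrices\<close>

lemma matpow_0 [simp]: "matpow A 0 = mat 1"
  and matpow_Suc: "matpow A (Suc n) = A ** matpow A n"
  by (simp_all add: matpow_def)

lemma matpow_Suc2: "matpow A (Suc n) = matpow A n ** A"
  by (induction n) (simp_all add: matpow_Suc matrix_mul_assoc)

lemma matpow_inverse: "A ** B = mat 1 \<Longrightarrow> matpow A n ** matpow B n = mat 1"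
proof (induction n)
  case (Suc n)
  have "matpow A (Suc n) ** matpow B (Suc n) = matpow A n ** (A ** B) ** matpow B n"
    unfolding matpow_Suc2[of A] matpow_Suc[of B] by (simp only: matrix_mul_assoc)
  with Suc show ?case by simp
qed simp

lemma det_matpow: "det (matpow A n) = det A ^ n"
  by (induction n) (simp_all add: matpow_Suc det_mul)

lemma matrix_inv_cancel:
  fixes A :: "real ^ 'd ^ 'd"
  assumes "det A \<noteq> 0"
  shows "A ** matrix_inv A = mat 1" "matrix_inv A ** A = mat 1"
    "A *v (matrix_inv A *v x) = x" "matrix_inv A *v (A *v x) = x"
    "det (matrix_inv A) = 1 / det A"
proof -
  have "invertible A" using assms by (simp add: invertible_det_nz)
  then show a: "A ** matrix_inv A = mat 1" and b: "matrix_inv A ** A = mat 1"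
    using someI_ex[of "\<lambda>B. A ** B = mat 1 \<and> B ** A = mat 1"]
    unfolding invertible_def matrix_inv_def by auto
  then show "A *v (matrix_inv A *v x) = x" "matrix_inv A *v (A *v x) = x"
    by (simp_all add: matrix_vector_mul_assoc)
  have "det A * det (matrix_inv A) = 1" using a by (metis det_I det_mul)
  then show "det (matrix_inv A) = 1 / det A" using assms by (simp add: field_simps)
qed

text \<open>The eigenvalues of the inverse are the reciprocals of those of \<open>M\<close>, hence
  of modulus below 1. The real vector is embedded in complex space, where the eigenvalue condition
  lives.\<close>

lemma inverse_powers_tendsto_0:
  fixes M :: "int ^ 'd ^ 'd"
  assumes dil: "dilation_matrix M"
  shows "(\<lambda>n. matpow (matrix_inv (rmat M)) n *v y) \<longlonglongrightarrow> 0"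
proof -
  note inv = matrix_inv_cancel[OF dilation_det_nz[OF dil]]
  let ?A = "map_matrix complex_of_real (matrix_inv (rmat M))"
  let ?M = "map_matrix of_int M :: complex ^ 'd ^ 'd"
  have eq: "?M = map_matrix complex_of_real (rmat M)"
    by (simp add: map_matrix_def vec_eq_iff)
  have mm: "?M ** ?A = map_matrix complex_of_real (rmat M ** matrix_inv (rmat M))"
    unfolding eq by (simp add: map_matrix_def vec_eq_iff matrix_matrix_mult_def)
  have "?M ** ?A = mat 1"
    unfolding mm inv by (simp add: map_matrix_def vec_eq_iff mat_def)
  then have MA: "?M *v (?A *v v) = v" for v
    by (simp add: matrix_vector_mul_assoc)
  have "(\<lambda>n. (((*v) ?A) ^^ n) (cvec y)) \<longlonglongrightarrow> 0"
  proof (rule iterate_tendsto_0)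
    fix c v assume v: "v \<noteq> 0" "?A *v v = c *s v"
    have v2: "v = c *s (?M *v v)"
      using MA[of v] unfolding v(2) by (simp add: matrix_vector_mult_scaleR vec.scale)
    with v(1) have c: "c \<noteq> 0" by auto
    have "?M *v v = (1 / c) *s v"
      by (subst (2) v2) (use c in \<open>simp add: vector_smult_assoc\<close>)
    then have "cmod (1 / c) > 1"
      using dil v(1) unfolding dilation_matrix_def by blast
    then show "cmod c < 1" using c by (simp add: norm_divide field_simps)
  qed (auto simp: matrix_vector_right_distrib vec.scale)
  moreover have "(((*v) ?A) ^^ n) (cvec y) = cvec (matpow (matrix_inv (rmat M)) n *v y)" for n
    by (induction n) (simp_all add: cvec_mult matpow_Suc matrix_vector_mul_assoc)
  ultimately have "(\<lambda>n. norm (cvec (matpow (matrix_inv (rmat M)) n *v y))) \<longlonglongrightarrow> 0"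
    by (simp add: tendsto_norm_zero)
  then show ?thesis unfolding norm_cvec by (simp add: tendsto_norm_zero_iff)
qed

section \<open>Linear changes of variables\<close>

text \<open>Both sides are multiplicative in \<open>A\<close>, so it suffices to treat matrices with
  a zero row, diagonal matrices, transpositions of coordinates and shears. For the last two a check
  on boxes is enough.\<close>

lemma measure_matrix_image_aux:
  fixes A :: "real ^ 'd ^ 'd"
  shows "\<forall>S\<in>lmeasurable. (*v) A ` S \<in> lmeasurable \<and>
    measure lebesgue ((*v) A ` S) = \<bar>det A\<bar> * measure lebesgue S"
proof (rule induct_matrix_elementary_alt)
  fix A B :: "real ^ 'd ^ 'd"
  assume A: "\<forall>S\<in>lmeasurable. (*v) A ` S \<in> lmeasurable \<and> measure lebesgue ((*v) A ` S) = \<bar>det A\<bar> * measure lebesgue S"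
    and B: "\<forall>S\<in>lmeasurable. (*v) B ` S \<in> lmeasurable \<and> measure lebesgue ((*v) B ` S) = \<bar>det B\<bar> * measure lebesgue S"
  show "\<forall>S\<in>lmeasurable. (*v) (A ** B) ` S \<in> lmeasurable \<and> measure lebesgue ((*v) (A ** B) ` S) = \<bar>det (A ** B)\<bar> * measure lebesgue S"
    unfolding matrix_vector_mult_matrix_matrix_mult_compose image_comp[symmetric]
    using A B by (simp add: det_mul abs_mult)
next
  fix A :: "real ^ 'd ^ 'd" and i assume row: "row i A = 0"
  then have det: "det A = 0" by (metis det_zero_row(2) row_def vec_lambda_eta)
  have "\<not> inj ((*v) A)"
    using det det_nz_iff_inj[of "(*v) A"] by (simp add: matrix_of_matrix_vector_mul)
  then have "negligible ((*v) A ` S)" for S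
    by (intro negligible_linear_singular_image) auto
  then show "\<forall>S\<in>lmeasurable. (*v) A ` S \<in> lmeasurable \<and> measure lebesgue ((*v) A ` S) = \<bar>det A\<bar> * measure lebesgue S"
    by (simp add: det negligible_iff_measure)
next
  fix A :: "real ^ 'd ^ 'd" assume diag: "\<And>i j. i \<noteq> j \<Longrightarrow> A $ i $ j = 0"
  have "A *v x = (\<chi> k. A $ k $ k * x $ k)" for x
  proof -
    have "(\<Sum>j\<in>UNIV. A $ i $ j * x $ j) = (\<Sum>j\<in>{i}. A $ i $ j * x $ j)" for i
      by (rule sum.mono_neutral_right) (auto simp: diag)
    then show ?thesis by (simp add: matrix_vector_mult_def vec_eq_iff)
  qed
  then have "(*v) A = (\<lambda>x. \<chi> k. A $ k $ k * x $ k)" by auto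
  then show "\<forall>S\<in>lmeasurable. (*v) A ` S \<in> lmeasurable \<and> measure lebesgue ((*v) A ` S) = \<bar>det A\<bar> * measure lebesgue S"
    by (simp add: measurable_stretch measure_stretch det_diagonal[OF diag])
next
  fix m n :: 'd assume mn: "m \<noteq> n"
  let ?t = "Transposition.transpose m n"
  let ?A = "(\<chi> i j. mat 1 $ i $ ?t j) :: real ^ 'd ^ 'd"
  have A: "?A *v x = (\<chi> i. x $ ?t i)" for x
  proof -
    have "(\<Sum>j\<in>UNIV. mat 1 $ i $ ?t j * x $ j) = (\<Sum>j\<in>{?t i}. mat 1 $ i $ ?t j * x $ j)" for i
      by (rule sum.mono_neutral_right) (auto simp: mat_def)
    then show ?thesis by (simp add: matrix_vector_mult_def vec_eq_iff mat_def)
  qed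
  have det: "\<bar>det ?A\<bar> = 1"
    by (simp add: det_permute_columns permutes_swap_id sign_swap_id abs_mult mn)
  have cb: "measure lebesgue ((*v) ?A ` cbox a b) = \<bar>det ?A\<bar> * measure lebesgue (cbox a b)" for a b :: "real ^ 'd"
  proof -
    let ?h = "\<lambda>x::real ^ 'd. \<chi> i. x $ ?t i"
    have eq: "(*v) ?A ` cbox a b = cbox (?h a) (?h b)"
    proof (intro set_eqI iffI)
      fix x assume x: "x \<in> cbox (?h a) (?h b)"
      have "?h x \<in> cbox a b"
        using x by (auto simp: mem_box_cart) (metis transpose_involutory)+
      moreover have "x = ?A *v ?h x" unfolding A by (simp add: vec_eq_iff)
      ultimately show "x \<in> (*v) ?A ` cbox a b" by blast
    qed (auto simp: A mem_box_cart)
    have ne: "(cbox (?h a) (?h b) = {}) = (cbox a b = {})"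
      unfolding eq[symmetric] by simp
    show ?thesis
    proof (cases "cbox a b = {}")
      case False
      then show ?thesis
        using ne prod.permute[OF permutes_swap_id, where S=UNIV and g="\<lambda>i. (b - a) $ i", of m n, symmetric]
        unfolding eq det by (simp add: content_cbox_cart o_def)
    qed simp
  qed
  show "\<forall>S\<in>lmeasurable. (*v) ?A ` S \<in> lmeasurable \<and> measure lebesgue ((*v) ?A ` S) = \<bar>det ?A\<bar> * measure lebesgue S"
    using measure_linear_sufficient[OF matrix_vector_mul_linear _ cb] by simp
next
  fix m n :: 'd assume mn: "m \<noteq> n"
  let ?A = "(\<chi> i j. of_bool (i = m \<and> j = n \<or> i = j)) :: real ^ 'd ^ 'd"
  let ?h = "\<lambda>x::real ^ 'd. \<chi> i. if i = m then x $ m + x $ n else x $ i"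
  have Av: "?A *v x = ?h x" for x
  proof -
    have "(\<Sum>j\<in>UNIV. of_bool (m = m \<and> j = n \<or> m = j) * x $ j) = (\<Sum>j\<in>{m, n}. of_bool (m = m \<and> j = n \<or> m = j) * x $ j)"
      by (rule sum.mono_neutral_right) auto
    then have "(\<Sum>j\<in>UNIV. of_bool (m = m \<and> j = n \<or> m = j) * x $ j) = x $ m + x $ n"
      using mn by simp
    moreover have "(\<Sum>j\<in>UNIV. of_bool (i = m \<and> j = n \<or> i = j) * x $ j) = x $ i" if "i \<noteq> m" for i
      using that by simp
    ultimately show ?thesis by (simp add: matrix_vector_mult_def vec_eq_iff)
  qed
  have "?A = (\<chi> k. if k = m then row m (mat 1) + 1 *s row n (mat 1) else row k (mat 1))"
    using mn by (auto simp: vec_eq_iff row_def mat_def)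
  then have det: "det ?A = 1"
    using det_row_operation[OF mn, of "mat 1" 1] by (simp add: det_I)
  have cb: "measure lebesgue ((*v) ?A ` cbox a b) = \<bar>det ?A\<bar> * measure lebesgue (cbox a b)" for a b :: "real ^ 'd"
  proof (cases "cbox a b = {}")
    case False
    \<comment> \<open>The box is translated to the corner 0, since the shear formula asks for a
      nonnegative coordinate of the lower corner.\<close>
    have ab: "cbox a b = (+) a ` cbox 0 (b - a)"
      by (simp add: cbox_translation[symmetric])
    then have "cbox 0 (b - a) \<noteq> {}" using False by auto
    then have sh: "measure lebesgue (?h ` cbox 0 (b - a)) = measure lebesgue (cbox 0 (b - a))"
      by (intro measure_shear_interval[OF mn]) auto
    have "(*v) ?A ` cbox a b = (+) (?A *v a) ` ((*v) ?A ` cbox 0 (b - a))"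
      unfolding ab by (simp add: image_comp o_def matrix_vector_right_distrib)
    also have "(*v) ?A ` cbox 0 (b - a) = ?h ` cbox 0 (b - a)"
      by (intro image_cong refl Av)
    finally have "measure lebesgue ((*v) ?A ` cbox a b) = measure lebesgue (cbox 0 (b - a))"
      by (simp only: measure_translation sh)
    also have "\<dots> = measure lebesgue (cbox a b)"
      by (simp only: ab measure_translation)
    finally show ?thesis
      unfolding det by simp
  qed simp
  show "\<forall>S\<in>lmeasurable. (*v) ?A ` S \<in> lmeasurable \<and> measure lebesgue ((*v) ?A ` S) = \<bar>det ?A\<bar> * measure lebesgue S"
    using measure_linear_sufficient[OF matrix_vector_mul_linear _ cb] by simp
qed

lemma measure_matrix_image:
  fixes A :: "real ^ 'd ^ 'd"
  assumes "S \<in> lmeasurable"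
  shows "(*v) A ` S \<in> lmeasurable" "measure lebesgue ((*v) A ` S) = \<bar>det A\<bar> * measure lebesgue S"
  using measure_matrix_image_aux assms by blast+

lemma measurable_matrix_borel [measurable]: "(*v) A \<in> borel \<rightarrow>\<^sub>M borel" for A :: "real ^ 'd ^ 'd"
  by (intro borel_measurable_continuous_onI matrix_vector_mult_linear_continuous_on)

text \<open>\<open>lborel\<close> is determined by its values on boxes, and the preimage of a box
  under \<open>A\<close> is its image under the inverse matrix.\<close>

lemma lborel_matrix:
  fixes A :: "real ^ 'd ^ 'd"
  assumes "det A \<noteq> 0"
  shows "lborel = density (distr lborel borel ((*v) A)) (\<lambda>_. ennreal \<bar>det A\<bar>)"
proof (rule lborel_eqI)
  note inv = matrix_inv_cancel[OF assms]
  fix l u :: "real ^ 'd" assume le: "\<And>b. b \<in> Basis \<Longrightarrow> l \<bullet> b \<le> u \<bullet> b"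
  have vim: "(*v) A -` box l u = (*v) (matrix_inv A) ` box l u"
    using inv(3,4) by (auto simp: image_iff) metis
  have bm: "box l u \<in> lmeasurable" by (simp add: lmeasurable_box)
  have "emeasure lborel ((*v) A -` box l u) = emeasure lebesgue ((*v) A -` box l u)"
    using measurable_sets[OF measurable_matrix_borel[of A], of "box l u"] by simp
  also have "\<dots> = ennreal (measure lebesgue ((*v) (matrix_inv A) ` box l u))"
    unfolding vim by (rule emeasure_eq_measure2) (use measure_matrix_image(1)[OF bm, of "matrix_inv A"] in \<open>simp add: fmeasurable_def del: emeasure_completion\<close>)
  also have "\<dots> = ennreal (1 / \<bar>det A\<bar> * (\<Prod>b\<in>Basis. (u - l) \<bullet> b))"
    using le by (simp add: measure_matrix_image[OF bm] inv measure_lborel_box_eq)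
  finally have "emeasure lborel ((*v) A -` box l u) = ennreal (1 / \<bar>det A\<bar> * (\<Prod>b\<in>Basis. (u - l) \<bullet> b))" .
  then show "emeasure (density (distr lborel borel ((*v) A)) (\<lambda>_. ennreal \<bar>det A\<bar>)) (box l u) = (\<Prod>b\<in>Basis. (u - l) \<bullet> b)"
    using assms by (simp add: emeasure_density nn_integral_cmult_indicator emeasure_distr ennreal_mult'[symmetric])
qed simp

text \<open>A nonsingular matrix preserves null sets in both directions, so the Borel identity
  survives completion.\<close>

lemma lebesgue_matrix:
  fixes A :: "real ^ 'd ^ 'd"
  assumes det: "det A \<noteq> 0"
  shows "(*v) A \<in> lebesgue \<rightarrow>\<^sub>M lebesgue"
    and "lebesgue = density (distr lebesgue lebesgue ((*v) A)) (\<lambda>_. ennreal \<bar>det A\<bar>)"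
proof -
  let ?T = "(*v) A"
  have "emeasure lborel S = 0 \<longleftrightarrow> emeasure (distr lebesgue lborel ?T) S = 0" if S: "S \<in> sets borel" for S
  proof -
    have "emeasure lborel S = 0 \<longleftrightarrow> emeasure (density (distr lborel borel ?T) (\<lambda>_. ennreal \<bar>det A\<bar>)) S = 0"
      by (subst lborel_matrix[OF det, symmetric]) auto
    also have "\<dots> \<longleftrightarrow> emeasure (distr lebesgue lborel ?T) S = 0"
      using S det by (simp add: distr_completion emeasure_density nn_integral_cmult cong: distr_cong)
    finally show ?thesis .
  qed
  then have eq: "null_sets lborel = null_sets (distr lebesgue lborel ?T)"
    by (auto simp: null_sets_def)
  show "?T \<in> lebesgue \<rightarrow>\<^sub>M lebesgue"
    by (simp add: completion.measurable_completion2 eq measurable_completion)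
  have "lebesgue = completion (density (distr lborel borel ?T) (\<lambda>_. ennreal \<bar>det A\<bar>))"
    by (subst lborel_matrix[OF det]) simp
  also have "\<dots> = density (completion (distr lebesgue lborel ?T)) (\<lambda>_. ennreal \<bar>det A\<bar>)"
    using det by (auto intro!: always_eventually completion_density_eq simp: distr_completion cong: distr_cong)
  also have "\<dots> = density (distr lebesgue lebesgue ?T) (\<lambda>_. ennreal \<bar>det A\<bar>)"
    by (subst completion.completion_distr_eq) (auto simp: eq measurable_completion)
  finally show "lebesgue = density (distr lebesgue lebesgue ?T) (\<lambda>_. ennreal \<bar>det A\<bar>)" .
qed

lemma lebesgue_shift:
  fixes a :: "'a::euclidean_space"
  shows "(\<lambda>x. x - a) \<in> lebesgue \<rightarrow>\<^sub>M lebesgue" and "lebesgue = distr lebesgue lebesgue (\<lambda>x. x - a)"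
proof -
  have T: "(\<lambda>x. x - a) = (\<lambda>x. - a + (\<Sum>j\<in>Basis. (1 * (x \<bullet> j)) *\<^sub>R j))"
    by (simp add: euclidean_representation)
  show "(\<lambda>x. x - a) \<in> lebesgue \<rightarrow>\<^sub>M lebesgue"
    unfolding T by (rule lebesgue_affine_measurable) simp
  show "lebesgue = distr lebesgue lebesgue (\<lambda>x. x - a)"
    using lebesgue_affine_euclidean[of "\<lambda>_. 1" "- a"] unfolding T by (simp add: density_1)
qed

lemma lebesgue_affine:
  fixes A :: "real ^ 'd ^ 'd"
  assumes det: "det A \<noteq> 0"
  shows "(\<lambda>x. A *v x - a) \<in> lebesgue \<rightarrow>\<^sub>M lebesgue"
    and "lebesgue = density (distr lebesgue lebesgue (\<lambda>x. A *v x - a)) (\<lambda>_. ennreal \<bar>det A\<bar>)"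
proof -
  note A = lebesgue_matrix[OF det]
  show "(\<lambda>x. A *v x - a) \<in> lebesgue \<rightarrow>\<^sub>M lebesgue"
    using measurable_compose[OF A(1) lebesgue_shift(1)] .
  have "lebesgue = distr (density (distr lebesgue lebesgue ((*v) A)) (\<lambda>_. ennreal \<bar>det A\<bar>)) lebesgue (\<lambda>x. x - a)"
    using A(2) lebesgue_shift(2) by metis
  also have "\<dots> = density (distr (distr lebesgue lebesgue ((*v) A)) lebesgue (\<lambda>x. x - a)) (\<lambda>_. ennreal \<bar>det A\<bar>)"
    by (rule density_distr[symmetric]) (simp_all add: lebesgue_shift(1))
  also have "\<dots> = density (distr lebesgue lebesgue (\<lambda>x. A *v x - a)) (\<lambda>_. ennreal \<bar>det A\<bar>)"
    by (subst distr_distr) (simp_all add: lebesgue_shift(1) A(1) o_def)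
  finally show "lebesgue = density (distr lebesgue lebesgue (\<lambda>x. A *v x - a)) (\<lambda>_. ennreal \<bar>det A\<bar>)" .
qed

lemma lebesgue_integral_affine:
  fixes f :: "real ^ 'd \<Rightarrow> 'b::{banach, second_countable_topology}"
  assumes det: "det A \<noteq> 0" and f: "f \<in> borel_measurable lebesgue"
  shows "integrable lebesgue (\<lambda>x. f (A *v x - a)) \<longleftrightarrow> integrable lebesgue f"
    and "(LINT x|lebesgue. f (A *v x - a)) = (1 / \<bar>det A\<bar>) *\<^sub>R (LINT x|lebesgue. f x)"
    and "(\<lambda>x. f (A *v x - a)) \<in> borel_measurable lebesgue"
proof -
  note A = lebesgue_affine[OF det, of a]
  let ?T = "\<lambda>x. A *v x - a"
  have fd: "f \<in> borel_measurable (distr lebesgue lebesgue ?T)"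
    using f by simp
  have "integrable lebesgue f \<longleftrightarrow> integrable (density (distr lebesgue lebesgue ?T) (\<lambda>_. ennreal \<bar>det A\<bar>)) f"
    using A(2) by simp
  also have "\<dots> \<longleftrightarrow> integrable (distr lebesgue lebesgue ?T) (\<lambda>x. \<bar>det A\<bar> *\<^sub>R f x)"
    by (rule integrable_density) (use fd in auto)
  also have "\<dots> \<longleftrightarrow> integrable lebesgue (\<lambda>x. \<bar>det A\<bar> *\<^sub>R f (?T x))"
    by (rule integrable_distr_eq) (use A f in auto)
  also have "\<dots> \<longleftrightarrow> integrable lebesgue (\<lambda>x. f (?T x))"
    using det integrable_scaleR_right[of "\<bar>det A\<bar>" lebesgue "\<lambda>x. f (?T x)"]
      integrable_scaleR_right[of "1 / \<bar>det A\<bar>" lebesgue "\<lambda>x. \<bar>det A\<bar> *\<^sub>R f (?T x)"] by auto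
  finally show "integrable lebesgue (\<lambda>x. f (A *v x - a)) \<longleftrightarrow> integrable lebesgue f" by simp
  have "(LINT x|lebesgue. f x) = (LINT x|density (distr lebesgue lebesgue ?T) (\<lambda>_. ennreal \<bar>det A\<bar>). f x)"
    using A(2) by simp
  also have "\<dots> = (LINT x|distr lebesgue lebesgue ?T. \<bar>det A\<bar> *\<^sub>R f x)"
    by (rule integral_density) (use fd in auto)
  also have "\<dots> = (LINT x|lebesgue. \<bar>det A\<bar> *\<^sub>R f (?T x))"
    by (rule integral_distr) (use A f in auto)
  finally show "(LINT x|lebesgue. f (A *v x - a)) = (1 / \<bar>det A\<bar>) *\<^sub>R (LINT x|lebesgue. f x)"
    using det by simp
  show "(\<lambda>x. f (A *v x - a)) \<in> borel_measurable lebesgue"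
    using measurable_compose[OF A(1) f] .
qed

lemma AE_lebesgue_affine:
  fixes A :: "real ^ 'd ^ 'd"
  assumes det: "det A \<noteq> 0" and P: "AE x in lebesgue. P x"
  shows "AE x in lebesgue. P (A *v x - a)"
proof -
  note A = lebesgue_affine[OF det, of a]
  obtain N where N: "N \<in> null_sets lebesgue" "{x. \<not> P x} \<subseteq> N"
    using P by (auto simp: eventually_ae_filter)
  let ?T = "\<lambda>x. A *v x - a"
  have "emeasure lebesgue N = emeasure (density (distr lebesgue lebesgue ?T) (\<lambda>_. ennreal \<bar>det A\<bar>)) N"
    using A(2) by simp
  also have "\<dots> = ennreal \<bar>det A\<bar> * emeasure lebesgue (?T -` N)"
    using N A(1) by (subst emeasure_density) (auto simp: nn_integral_cmult_indicator emeasure_distr null_sets_def simp del: emeasure_completion)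
  finally have "emeasure lebesgue (?T -` N) = 0"
    using N det by (auto simp: null_sets_def simp del: emeasure_completion)
  moreover have "?T -` N \<in> sets lebesgue"
    using measurable_sets[OF A(1), of N] N by (auto simp: null_sets_def)
  ultimately have "?T -` N \<in> null_sets lebesgue" by (auto simp: null_sets_def)
  then show ?thesis by (rule AE_I') (use N in auto)
qed

section \<open>The unit cube and the characters of the lattice\<close>

text \<open>Normalised to period 1, so that lattice points pair to 1 with lattice points; characters
  in the angular frequency of \<open>fourier\<close> are written with \<open>cis\<close>.\<close>

definition ee :: "real \<Rightarrow> complex"
  where "ee t = cis (2 * pi * t)"

lemma ee_add: "ee (s + t) = ee s * ee t"
  by (simp add: ee_def cis_mult ring_distribs)

lemma ee_0 [simp]: "ee 0 = 1"
  by (simp add: ee_def)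

lemma ee_minus: "ee (- t) = cnj (ee t)"
  by (simp add: ee_def cis_cnj)

lemma ee_diff: "ee (s - t) = ee s * cnj (ee t)"
  using ee_add[of s "- t"] by (simp add: ee_minus)

lemma norm_ee [simp]: "cmod (ee t) = 1"
  by (simp add: ee_def)

lemma ee_of_int [simp]: "ee (of_int k) = 1"
  by (simp add: ee_def complex_eq_iff)

lemma ee_eq_1_imp_Ints: "ee t = 1 \<Longrightarrow> t \<in> \<int>"
proof -
  assume "ee t = 1"
  then have "cos (2 * pi * t) = 1" by (simp add: ee_def complex_eq_iff)
  then obtain n where "2 * pi * t = 2 * pi * of_int n"
    by (subst (asm) cos_one_2pi_int) (auto simp: mult_ac)
  then have "t = of_int n" by simp
  then show ?thesis by simp
qed

lemma continuous_ee [continuous_intros]: "continuous_on S f \<Longrightarrow> continuous_on S (\<lambda>x. ee (f x))"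
  unfolding ee_def cis_conv_exp by (intro continuous_intros)

lemma ee_borel_measurable [measurable]: "ee \<in> borel_measurable borel"
  by (intro borel_measurable_continuous_onI continuous_ee continuous_on_id)

lemma lat_inner: "lat m \<bullet> lat n = of_int (\<Sum>i\<in>UNIV. m $ i * n $ i)"
  by (simp add: inner_vec_def)

lemma ee_lat_inner [simp]: "ee (lat m \<bullet> lat n) = 1"
  unfolding lat_inner by (rule ee_of_int)

definition unit_cube :: "(real ^ 'd) set"
  where "unit_cube = {x. \<forall>i. 0 \<le> x $ i \<and> x $ i < 1}"

definition floorv :: "real ^ 'd \<Rightarrow> int ^ 'd"
  where "floorv x = (\<chi> i. \<lfloor>x $ i\<rfloor>)"

definition fracv :: "real ^ 'd \<Rightarrow> real ^ 'd"
  where "fracv x = x - lat (floorv x)"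

lemma floorv_add_lat: "floorv (x + lat n) = floorv x + n"
  by (simp add: floorv_def vec_eq_iff)

lemma floorv_eq_0_iff: "floorv x = 0 \<longleftrightarrow> x \<in> unit_cube"
  by (auto simp: floorv_def vec_eq_iff unit_cube_def floor_eq_iff)

lemma floorv_diff_lat: "floorv (x - lat n) = floorv x - n"
  by (simp add: floorv_def vec_eq_iff)

lemma floorv_eq_iff: "floorv x = n \<longleftrightarrow> x - lat n \<in> unit_cube"
  unfolding floorv_eq_0_iff[symmetric] floorv_diff_lat by simp

lemma fracv_in_unit_cube: "fracv x \<in> unit_cube"
  unfolding fracv_def by (rule floorv_eq_iff[THEN iffD1]) simp

lemma fracv_add: "lat (floorv x) + fracv x = x"
  by (simp add: fracv_def)

lemma unit_cube_borel [measurable]: "unit_cube \<in> sets borel"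
  unfolding unit_cube_def by measurable

lemma box_subset_unit_cube: "box 0 1 \<subseteq> unit_cube" "unit_cube \<subseteq> cbox 0 1"
  by (auto simp: unit_cube_def mem_box_cart less_imp_le)

lemma emeasure_unit_cube: "emeasure lborel (unit_cube :: (real ^ 'd) set) = 1"
proof (rule antisym)
  have one: "(1 :: real ^ 'd) \<bullet> b = 1" if "b \<in> Basis" for b
    using that by (auto simp: Basis_vec_def inner_axis)
  have "emeasure lborel (unit_cube :: (real ^ 'd) set) \<le> emeasure lborel (cbox 0 1 :: (real ^ 'd) set)"
    by (intro emeasure_mono box_subset_unit_cube) simp
  also have "\<dots> = 1" by (simp add: emeasure_lborel_cbox_eq one)
  finally show "emeasure lborel (unit_cube :: (real ^ 'd) set) \<le> 1" .
  have "1 = emeasure lborel (box 0 1 :: (real ^ 'd) set)" by (simp add: emeasure_lborel_box_eq one)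
  also have "\<dots> \<le> emeasure lborel (unit_cube :: (real ^ 'd) set)"
    by (intro emeasure_mono box_subset_unit_cube) simp
  finally show "1 \<le> emeasure lborel (unit_cube :: (real ^ 'd) set)" .
qed

lemma lebesgue_unit_cube:
  "(unit_cube :: (real ^ 'd) set) \<in> sets lebesgue"
  "emeasure lebesgue (unit_cube :: (real ^ 'd) set) = 1" "(unit_cube :: (real ^ 'd) set) \<in> lmeasurable"
  "measure lebesgue (unit_cube :: (real ^ 'd) set) = 1"
proof -
  show 1: "(unit_cube :: (real ^ 'd) set) \<in> sets lebesgue" by simp
  show 2: "emeasure lebesgue (unit_cube :: (real ^ 'd) set) = 1"
    by (simp add: emeasure_unit_cube)
  show "(unit_cube :: (real ^ 'd) set) \<in> lmeasurable"
    using 1 2 by (simp add: fmeasurable_def del: emeasure_completion)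
  show "measure lebesgue (unit_cube :: (real ^ 'd) set) = 1"
    unfolding measure_def 2 by simp
qed

section \<open>Lattice points in parallelepipeds, and dual lattices\<close>

lemma finite_bounded_lattice: "bounded S \<Longrightarrow> finite {n :: int ^ 'd. lat n \<in> S}"
proof -
  assume "bounded S"
  then obtain K where K: "\<And>x. x \<in> S \<Longrightarrow> norm x \<le> K" by (auto simp: bounded_iff)
  let ?P = "PiE (UNIV :: 'd set) (\<lambda>_. {- \<lfloor>K\<rfloor>..\<lfloor>K\<rfloor>})"
  have "{n :: int ^ 'd. lat n \<in> S} \<subseteq> vec_lambda ` ?P"
  proof
    fix n :: "int ^ 'd" assume "n \<in> {n. lat n \<in> S}"
    then have "\<bar>lat n $ i\<bar> \<le> K" for i
      using K[of "lat n"] component_le_norm_cart[of "lat n" i] by simp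
    then have "\<bar>n $ i\<bar> \<le> \<lfloor>K\<rfloor>" for i
      by (simp add: le_floor_iff)
    then have "(\<lambda>i. n $ i) \<in> ?P" by (auto simp: PiE_def abs_le_iff minus_le_iff)
    then show "n \<in> vec_lambda ` ?P" by (metis image_eqI vec_nth_inverse)
  qed
  then show ?thesis by (rule finite_subset) (simp add: finite_PiE)
qed

lemma emeasure_shift: "emeasure lebesgue ((\<lambda>x::'a::euclidean_space. x - a) -` S) = emeasure lebesgue S"
  if "S \<in> sets lebesgue"
proof -
  have "emeasure lebesgue S = emeasure (distr lebesgue lebesgue (\<lambda>x. x - a)) S"
    using lebesgue_shift(2)[of a] by simp
  also have "\<dots> = emeasure lebesgue ((\<lambda>x. x - a) -` S)"
    using that lebesgue_shift(1)[of a] by (subst emeasure_distr) auto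
  finally show ?thesis by simp
qed

lemma floorv_borel [measurable]: "floorv -` {n} \<in> sets borel"
proof -
  have "floorv -` {n} = (\<lambda>x. x - lat n) -` unit_cube" by (simp add: set_eq_iff floorv_eq_iff)
  also have "\<dots> \<in> sets borel"
    using measurable_sets[of "\<lambda>x. x - lat n" borel borel unit_cube] by simp
  finally show ?thesis .
qed

lemma emeasure_floorv: "emeasure lebesgue (floorv -` {n :: int ^ 'd}) = 1"
proof -
  have "floorv -` {n} = (\<lambda>x. x - lat n) -` unit_cube" by (simp add: set_eq_iff floorv_eq_iff)
  then show ?thesis using emeasure_shift[OF lebesgue_unit_cube(1)] lebesgue_unit_cube(2) by metis
qed

text \<open>
  The index of the lattice \<open>W \<int>\<^sup>d\<close> in \<open>\<int>\<^sup>d\<close> is found by cutting the parallelepiped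
  \<open>W [0,1)\<^sup>d\<close> into its intersections with unit cubes and translating those of one residue class
  into a single unit cube, which they tile.
\<close>

lemma card_lattice_points:
  fixes W :: "int ^ 'd ^ 'd"
  assumes det: "det (rmat W) \<noteq> 0"
  defines "N \<equiv> {n. lat n \<in> (*v) (rmat W) ` unit_cube}"
  shows "finite N" "real (card N) = \<bar>det (rmat W)\<bar>"
proof -
  note inv = matrix_inv_cancel[OF det]
  let ?S = "(*v) (rmat W) ` unit_cube"
  let ?V = "matrix_inv (rmat W)"
  have "bounded (unit_cube :: (real ^ 'd) set)"
    by (rule bounded_subset[OF bounded_cbox box_subset_unit_cube(2)])
  then have "bounded ?S"
    by (rule bounded_linear_image) (rule matrix_vector_mul_bounded_linear)
  then show fin: "finite N" unfolding N_def by (rule finite_bounded_lattice)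
  have S_lm: "?S \<in> lmeasurable" and S_m: "measure lebesgue ?S = \<bar>det (rmat W)\<bar>"
    using measure_matrix_image[OF lebesgue_unit_cube(3), of "rmat W"] by (simp_all add: lebesgue_unit_cube)
  have S_iff: "y \<in> ?S \<longleftrightarrow> floorv (?V *v y) = 0" for y
  proof
    assume "y \<in> ?S"
    then show "floorv (?V *v y) = 0" unfolding floorv_eq_0_iff by (auto simp: inv)
  next
    assume "floorv (?V *v y) = 0"
    then show "y \<in> ?S" unfolding floorv_eq_0_iff by (intro image_eqI[of _ _ "?V *v y"]) (simp_all add: inv)
  qed
  have S_shift: "y + lat (W *v k) \<in> ?S \<longleftrightarrow> floorv (?V *v y) = - k" for y k
  proof -
    have "?V *v (y + lat (W *v k)) = ?V *v y + lat k"
      by (simp add: matrix_vector_right_distrib rmat_mult_lat[symmetric] inv)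
    then show ?thesis unfolding S_iff by (simp add: floorv_add_lat eq_neg_iff_add_eq_0)
  qed
  \<comment> \<open>\<open>E n\<close> is the part of the parallelepiped whose integer parts are
    congruent to \<open>n\<close> modulo the lattice of \<open>W\<close>.\<close>
  define E where "E n = (\<Union>k. ?S \<inter> floorv -` {n + W *v k})" for n
  have meas: "?S \<inter> floorv -` {m} \<in> sets lebesgue" for m
    using S_lm by (auto simp: fmeasurable_def)
  have E_sets: "E n \<in> sets lebesgue" for n
    unfolding E_def by (intro sets.countable_UN'' meas) auto
  have E_emeasure: "emeasure lebesgue (E n) = 1" for n
  proof -
    have disj1: "disjoint_family (\<lambda>k. ?S \<inter> floorv -` {n + W *v k})"
    proof (clarsimp simp: disjoint_family_on_def)
      fix j k :: "int ^ 'd" assume "j \<noteq> k"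
      moreover have "j = k" if "W *v j = W *v k"
      proof -
        have "rmat W *v lat j = rmat W *v lat k" by (simp only: rmat_mult_lat that)
        then have "?V *v (rmat W *v lat j) = ?V *v (rmat W *v lat k)" by (simp only:)
        then show ?thesis by (simp only: inv lat_eq_iff)
      qed
      ultimately show "?S \<inter> floorv -` {n + W *v j} \<inter> (?S \<inter> floorv -` {n + W *v k}) = {}" by auto
    qed
    \<comment> \<open>\<open>?R k\<close> is the piece with integer part \<open>n + W *v k\<close>,
      moved back into the cell of \<open>n\<close>. Every point of the cell lies in exactly one of
      these sets, because its translates by the lattice of \<open>W\<close> meet the parallelepiped
      exactly once.\<close>
    let ?R = "\<lambda>k. floorv -` {n} \<inter> {y. floorv (?V *v y) = - k}"
    have eq: "?S \<inter> floorv -` {n + W *v k} = (\<lambda>y. y - lat (W *v k)) -` ?R k" for k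
    proof (intro set_eqI)
      fix y
      have "y \<in> ?S \<longleftrightarrow> floorv (?V *v (y - lat (W *v k))) = - k"
        using S_shift[of "y - lat (W *v k)" k] by simp
      then show "y \<in> ?S \<inter> floorv -` {n + W *v k} \<longleftrightarrow> y \<in> (\<lambda>y. y - lat (W *v k)) -` ?R k"
        by (auto simp: floorv_diff_lat algebra_simps)
    qed
    have R_sets: "?R k \<in> sets lebesgue" for k
    proof -
      have R: "?R k = (\<lambda>y. y - (- lat (W *v k))) -` (?S \<inter> floorv -` {n + W *v k})"
        unfolding eq by auto
      show ?thesis
        using measurable_sets[OF lebesgue_shift(1)[of "- lat (W *v k)"] meas[of "n + W *v k"]]
        unfolding R by (simp only: space_completion space_lborel space_borel Int_UNIV_right)
    qed
    have "emeasure lebesgue (E n) = (\<integral>\<^sup>+k. emeasure lebesgue (?S \<inter> floorv -` {n + W *v k}) \<partial>count_space UNIV)"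
      unfolding E_def by (intro emeasure_UN_countable meas disj1 countableI_type)
    also have "\<dots> = (\<integral>\<^sup>+k. emeasure lebesgue (?R k) \<partial>count_space UNIV)"
      unfolding eq by (simp only: emeasure_shift[OF R_sets])
    also have "\<dots> = emeasure lebesgue (\<Union>k. ?R k)"
      by (intro emeasure_UN_countable[symmetric] R_sets countableI_type) (auto simp: disjoint_family_on_def)
    also have "(\<Union>k. ?R k) = floorv -` {n}"
    proof (intro set_eqI iffI)
      fix y assume "y \<in> floorv -` {n}"
      then have "y \<in> ?R (- floorv (?V *v y))" by simp
      then show "y \<in> (\<Union>k. ?R k)" by blast
    qed auto
    finally show ?thesis by (simp only: emeasure_floorv)
  qed
  have S_eq: "?S = (\<Union>n\<in>N. E n)"
  proof (intro set_eqI iffI)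
    fix y assume y: "y \<in> ?S"
    \<comment> \<open>This \<open>k\<close> reduces the integer part of \<open>y\<close> modulo the
      lattice of \<open>W\<close> to its representative in \<open>N\<close>.\<close>
    define k where "k = floorv (?V *v lat (floorv y))"
    have "lat (floorv y - W *v k) = rmat W *v fracv (?V *v lat (floorv y))"
      by (simp add: fracv_def k_def lat_diff matrix_vector_mult_diff_distrib rmat_mult_lat inv)
    then have "floorv y - W *v k \<in> N" unfolding N_def using fracv_in_unit_cube by auto
    moreover have "y \<in> E (floorv y - W *v k)" unfolding E_def using y by (auto intro!: exI[of _ k])
    ultimately show "y \<in> (\<Union>n\<in>N. E n)" by blast
  qed (auto simp: E_def)
  have E_disj: "disjoint_family_on E N"
  proof (unfold disjoint_family_on_def, intro ballI impI)
    fix m n assume mn: "m \<in> N" "n \<in> N" "m \<noteq> n"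
    have fl: "floorv (?V *v lat (l + W *v k)) = k" if "l \<in> N" for l k
    proof -
      have "?V *v lat (l + W *v k) = ?V *v lat l + lat k"
        by (simp add: lat_add matrix_vector_right_distrib rmat_mult_lat[symmetric] inv)
      moreover have "floorv (?V *v lat l) = 0" using that unfolding N_def S_iff by simp
      ultimately show ?thesis by (simp add: floorv_add_lat)
    qed
    { fix y assume "y \<in> E m" "y \<in> E n"
      then have "\<exists>j. floorv y = m + W *v j" "\<exists>k. floorv y = n + W *v k" by (auto simp: E_def)
      then obtain j k where "floorv y = m + W *v j" "floorv y = n + W *v k" by blast
      with fl[OF mn(1), of j] fl[OF mn(2), of k] have "j = k" "m + W *v j = n + W *v k" by auto
      with mn have False by simp }
    then show "E m \<inter> E n = {}" by blast
  qed
  have "emeasure lebesgue ?S = (\<Sum>n\<in>N. emeasure lebesgue (E n))"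
    unfolding S_eq by (rule sum_emeasure[symmetric]) (use E_sets E_disj fin in auto)
  also have "\<dots> = of_nat (card N)" by (simp only: E_emeasure) simp
  finally have "measure lebesgue ?S = real (card N)"
    by (simp add: measure_def del: emeasure_completion)
  then show "real (card N) = \<bar>det (rmat W)\<bar>" using S_m by simp
qed

lemma rmat_transpose: "rmat (transpose M) = transpose (rmat M)"
  by (simp add: map_matrix_def transpose_def vec_eq_iff)

lemma inv_transpose_eq:
  assumes "det (rmat M) \<noteq> 0"
  shows "inv_transpose M = matrix_inv (rmat (transpose M))"
proof -
  note inv = matrix_inv_cancel[OF assms]
  have det: "det (rmat (transpose M)) \<noteq> 0" using assms by (simp add: rmat_transpose det_transpose)
  have "rmat (transpose M) ** inv_transpose M = mat 1"
    unfolding inv_transpose_def rmat_transpose matrix_transpose_mul[symmetric] inv by simp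
  then have "matrix_inv (rmat (transpose M)) ** (rmat (transpose M) ** inv_transpose M) = matrix_inv (rmat (transpose M))"
    by simp
  then show ?thesis unfolding matrix_mul_assoc matrix_inv_cancel(2)[OF det] by simp
qed

lemma inv_transpose_cancel:
  assumes "det (rmat M) \<noteq> 0"
  shows "transpose (rmat M) *v (inv_transpose M *v x) = x" "inv_transpose M *v (transpose (rmat M) *v x) = x"
    "(inv_transpose M *v x) v* rmat M = x" "inv_transpose M *v (x v* rmat M) = x"
  using matrix_inv_cancel(3,4)[of "rmat (transpose M)"] assms
  by (simp_all add: inv_transpose_eq rmat_transpose det_transpose)

lemma inv_transpose_lat:
  assumes "det (rmat M) \<noteq> 0"
  shows "inv_transpose M *v lat (k v* M) = lat k"
proof -
  have "lat (k v* M) = lat k v* rmat M"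
    using rmat_mult_lat[of "transpose M" k] by (simp add: rmat_transpose)
  then show ?thesis by (simp add: inv_transpose_cancel[OF assms])
qed

lemma Omega_iff: "\<omega> \<in> Omega M \<longleftrightarrow> \<omega> \<in> unit_cube \<and> (\<exists>n. \<omega> = inv_transpose M *v lat n)"
  by (auto simp: Omega_def unit_cube_def lat_def[symmetric])

text \<open>The transpose of \<open>M\<close> maps \<open>Omega M\<close> bijectively onto the
  lattice points of its own parallelepiped, which \<open>card_lattice_points\<close> counts.\<close>

lemma card_Omega:
  fixes M :: "int ^ 'd ^ 'd"
  assumes det: "det (rmat M) \<noteq> 0"
  shows "finite (Omega M)" "real (card (Omega M)) = \<bar>det (rmat M)\<bar>"
proof -
  have detT: "det (rmat (transpose M)) \<noteq> 0" using det by (simp add: rmat_transpose det_transpose)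
  note inv = inv_transpose_cancel[OF det]
  let ?N = "{n. lat n \<in> (*v) (rmat (transpose M)) ` unit_cube}"
  have eq: "Omega M = (\<lambda>n. inv_transpose M *v lat n) ` ?N"
  proof (intro set_eqI iffI)
    fix \<omega> assume "\<omega> \<in> Omega M"
    then obtain n where n: "\<omega> \<in> unit_cube" "\<omega> = inv_transpose M *v lat n" unfolding Omega_iff by blast
    then have "lat n = rmat (transpose M) *v \<omega>" by (simp add: rmat_transpose inv)
    with n show "\<omega> \<in> (\<lambda>n. inv_transpose M *v lat n) ` ?N" by blast
  next
    fix \<omega> assume "\<omega> \<in> (\<lambda>n. inv_transpose M *v lat n) ` ?N"
    then obtain n x where n: "\<omega> = inv_transpose M *v lat n" "lat n = rmat (transpose M) *v x" "x \<in> unit_cube" by blast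
    then have "\<omega> = x" by (simp add: rmat_transpose inv)
    with n show "\<omega> \<in> Omega M" unfolding Omega_iff by blast
  qed
  have inj: "inj_on (\<lambda>n. inv_transpose M *v lat n) ?N"
    by (rule inj_onI) (metis inv(1) lat_eq_iff)
  show "finite (Omega M)" unfolding eq by (intro finite_imageI card_lattice_points detT)
  show "real (card (Omega M)) = \<bar>det (rmat M)\<bar>"
    unfolding eq card_image[OF inj] card_lattice_points(2)[OF detT] by (simp add: rmat_transpose det_transpose)
qed

lemma zero_in_Omega: "0 \<in> Omega M"
  unfolding Omega_iff unit_cube_def by (auto intro!: exI[of _ 0])

text \<open>Orthogonality of characters: \<open>Omega M\<close> represents the dual group of the
  integer lattice modulo \<open>M\<close>. If \<open>n\<close> is not in the image of
  \<open>M\<close>, some translation of \<open>Omega M\<close> modulo the integer lattice multiplies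
  the sum by a factor different from 1.\<close>

lemma sum_Omega_ee:
  fixes M :: "int ^ 'd ^ 'd"
  assumes det: "det (rmat M) \<noteq> 0"
  shows "(\<Sum>\<omega>\<in>Omega M. ee (\<omega> \<bullet> lat n)) = (if n \<in> range ((*v) M) then of_real \<bar>det (rmat M)\<bar> else 0)"
proof (cases "n \<in> range ((*v) M)")
  case True
  then obtain k where n: "n = M *v k" by auto
  have "ee (\<omega> \<bullet> lat n) = 1" if \<omega>: "\<omega> \<in> Omega M" for \<omega>
  proof -
    obtain m where "\<omega> = inv_transpose M *v lat m" using \<omega> unfolding Omega_iff by blast
    then have "\<omega> v* rmat M = lat m" using inv_transpose_cancel[OF det] by simp
    then have "\<omega> \<bullet> lat n = lat m \<bullet> lat k"
      unfolding n rmat_mult_lat[symmetric] by (simp add: dot_lmul_matrix[symmetric])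
    then show ?thesis by simp
  qed
  then have "(\<Sum>\<omega>\<in>Omega M. ee (\<omega> \<bullet> lat n)) = of_real (real (card (Omega M)))" by simp
  also have "\<dots> = of_real \<bar>det (rmat M)\<bar>" by (simp only: card_Omega[OF det])
  finally show ?thesis using True by simp
next
  case False
  define y where "y = matrix_inv (rmat M) *v lat n"
  have "\<exists>i. y $ i \<notin> \<int>"
  proof (rule ccontr)
    assume "\<not> (\<exists>i. y $ i \<notin> \<int>)"
    then have "y = lat (floorv y)" by (auto simp: floorv_def vec_eq_iff elim!: Ints_cases)
    then have "lat n = lat (M *v floorv y)"
      unfolding rmat_mult_lat[symmetric] by (metis matrix_inv_cancel(3)[OF det] y_def)
    then show False using False by (auto simp: lat_eq_iff)
  qed
  then obtain i where i: "y $ i \<notin> \<int>" by blast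
  \<comment> \<open>A dual lattice vector with \<open>t \<bullet> lat n = y $ i\<close>, which is
    not an integer. Adding it modulo the integer lattice permutes \<open>Omega M\<close>.\<close>
  define t where "t = inv_transpose M *v axis i 1"
  have t_n: "t \<bullet> lat n = y $ i"
    unfolding t_def y_def inv_transpose_def
    by (simp add: dot_lmul_matrix inner_axis')
  have axis_lat: "axis i 1 = lat (axis i 1)" by (simp add: axis_def vec_eq_iff)
  let ?\<phi> = "\<lambda>\<omega>. fracv (\<omega> + t)"
  have maps: "?\<phi> \<omega> \<in> Omega M" if \<omega>: "\<omega> \<in> Omega M" for \<omega>
  proof -
    obtain m where m: "\<omega> = inv_transpose M *v lat m" using \<omega> unfolding Omega_iff by blast
    have "?\<phi> \<omega> = inv_transpose M *v lat (m + axis i 1 - transpose M *v floorv (\<omega> + t))"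
      by (simp add: fracv_def m t_def axis_lat lat_add lat_diff matrix_vector_mult_diff_distrib
          matrix_vector_right_distrib inv_transpose_lat[OF det])
    then show ?thesis unfolding Omega_iff using fracv_in_unit_cube by blast
  qed
  have inj: "inj_on ?\<phi> (Omega M)"
  proof (rule inj_onI)
    fix a b assume ab: "a \<in> Omega M" "b \<in> Omega M" "?\<phi> a = ?\<phi> b"
    then have "a = b + lat (floorv (a + t) - floorv (b + t))"
      by (simp add: fracv_def lat_diff algebra_simps)
    moreover have "floorv a = 0" "floorv b = 0"
      using ab by (auto simp: Omega_iff floorv_eq_0_iff)
    ultimately show "a = b" by (metis add.right_neutral add_0 floorv_add_lat lat_0)
  qed
  have "?\<phi> ` Omega M = Omega M"
    by (rule endo_inj_surj[OF card_Omega(1)[OF det]]) (use maps inj in auto)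
  then have "(\<Sum>\<omega>\<in>Omega M. ee (\<omega> \<bullet> lat n)) = (\<Sum>\<omega>\<in>Omega M. ee (?\<phi> \<omega> \<bullet> lat n))"
    using sum.reindex[OF inj, of "\<lambda>\<omega>. ee (\<omega> \<bullet> lat n)"] by (simp add: o_def)
  also have "\<dots> = (\<Sum>\<omega>\<in>Omega M. ee (y $ i) * ee (\<omega> \<bullet> lat n))"
    by (simp add: fracv_def inner_diff_left inner_add_left ee_diff ee_add t_n mult.commute)
  finally have "(\<Sum>\<omega>\<in>Omega M. ee (\<omega> \<bullet> lat n)) * (1 - ee (y $ i)) = 0"
    by (simp add: sum_distrib_left[symmetric] algebra_simps)
  moreover have "ee (y $ i) \<noteq> 1" using ee_eq_1_imp_Ints i by blast
  ultimately show ?thesis using False by simp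
qed

text \<open>Artin's argument: subtracting \<open>ch x g\<close> times the relation at
  \<open>h\<close> from the relation at \<open>g + h\<close> removes the character \<open>x\<close>.
  The general domain lets the same lemma serve for the integer lattice and for the real
  space.\<close>

lemma characters_independent:
  fixes ch :: "'a \<Rightarrow> 'g::monoid_add \<Rightarrow> complex"
  assumes "finite F"
    and mult: "\<And>a g h. a \<in> F \<Longrightarrow> ch a (g + h) = ch a g * ch a h"
    and one: "\<And>a. a \<in> F \<Longrightarrow> ch a 0 = 1"
    and dist: "\<And>a b. a \<in> F \<Longrightarrow> b \<in> F \<Longrightarrow> a \<noteq> b \<Longrightarrow> \<exists>g. ch a g \<noteq> ch b g"
    and zero: "\<And>g. (\<Sum>a\<in>F. c a * ch a g) = 0"
    and a: "a \<in> F"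
  shows "c a = 0"
  using assms
proof (induction F arbitrary: c a rule: finite_induct)
  case (insert x F)
  have c0: "c b = 0" if b: "b \<in> F" for b
  proof -
    have "c b * (ch b g - ch x g) = 0" for g
    proof (rule insert.IH[where c = "\<lambda>b. c b * (ch b g - ch x g)"])
      fix h
      have 1: "(\<Sum>b\<in>insert x F. c b * ch b (g + h)) - ch x g * (\<Sum>b\<in>insert x F. c b * ch b h) = 0"
        using insert.prems(4) by simp
      have 2: "(\<Sum>b\<in>F. c b * ch b (g + h)) = (\<Sum>b\<in>F. c b * ch b g * ch b h)"
        using insert.prems(1) by (intro sum.cong) auto
      show "(\<Sum>b\<in>F. c b * (ch b g - ch x g) * ch b h) = 0"
        using 1 insert.hyps insert.prems(1)[of x g h] 2
        by (simp add: algebra_simps sum_subtractf sum_distrib_left)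
    qed (use insert.prems b in auto)
    moreover obtain g where "ch b g \<noteq> ch x g"
      using insert.prems(3)[of b x] b insert.hyps by auto
    ultimately show ?thesis by (metis eq_iff_diff_eq_0 mult_eq_0_iff)
  qed
  have "c x = 0"
    using insert.prems(4)[of 0] insert.prems(2) insert.hyps c0 by simp
  with c0 insert.prems(5) show ?case by auto
qed simp

section \<open>Fourier coefficients on the unit cube\<close>

text \<open>Lebesgue measure is the image of the product measure indexed by \<open>Basis\<close>;
  identifying \<open>Basis\<close> with the coordinates through \<open>axis\<close> reduces the
  claim to Fubini for product functions.\<close>

lemma lborel_integral_prod_vec:
  fixes f :: "'d::finite \<Rightarrow> real \<Rightarrow> complex"
  assumes int: "\<And>i. integrable lborel (f i)"
  shows "integrable lborel (\<lambda>x::real ^ 'd. \<Prod>i\<in>UNIV. f i (x $ i))"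
    and "(LINT x|lborel. (\<Prod>i\<in>UNIV. f i ((x::real ^ 'd) $ i))) = (\<Prod>i\<in>UNIV. LINT t|lborel. f i t)"
proof -
  let ?B = "Basis :: (real ^ 'd) set"
  let ?ax = "\<lambda>i::'d. axis i (1::real)"
  interpret product_sigma_finite "\<lambda>_::real ^ 'd. lborel :: real measure" ..
  have inj: "inj ?ax" by (auto simp: inj_def axis_eq_axis)
  have B: "?B = range ?ax" by (auto simp: Basis_vec_def)
  define F where "F b = f (THE i. b = ?ax i)" for b
  have F_ax: "F (?ax i) = f i" for i
    unfolding F_def by (rule arg_cong[of _ _ f]) (use inj in \<open>auto simp: inj_def\<close>)
  let ?T = "\<lambda>g. \<Sum>b\<in>?B. g b *\<^sub>R b"
  have comp: "?T g $ i = g (?ax i)" for g i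
  proof -
    have "?T g $ i = ?T g \<bullet> ?ax i" by (simp add: inner_axis)
    also have "\<dots> = g (?ax i)" by (simp add: inner_sum_left inner_Basis B if_distrib cong: if_cong)
    finally show ?thesis .
  qed
  have prod: "(\<Prod>i\<in>UNIV. f i (?T g $ i)) = (\<Prod>b\<in>?B. F b (g b))" for g
  proof -
    have "(\<Prod>b\<in>?B. F b (g b)) = (\<Prod>i\<in>UNIV. F (?ax i) (g (?ax i)))"
      unfolding B prod.reindex[OF inj] by (simp add: o_def)
    then show ?thesis unfolding F_ax comp by simp
  qed
  have F_int: "integrable lborel (F b)" if "b \<in> ?B" for b
    using that int F_ax unfolding B by auto
  have meas: "(\<lambda>x::real ^ 'd. \<Prod>i\<in>UNIV. f i (x $ i)) \<in> borel_measurable borel"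
    using int[THEN borel_measurable_integrable] by measurable
  have T_meas: "?T \<in> measurable (\<Pi>\<^sub>M b\<in>?B. lborel) borel" by measurable
  show "integrable lborel (\<lambda>x::real ^ 'd. \<Prod>i\<in>UNIV. f i (x $ i))"
    unfolding lborel_eq[where 'a = "real ^ 'd"] integrable_distr_eq[OF T_meas meas] prod
    by (rule product_integrable_prod) (use F_int in auto)
  have "(LINT x|lborel. (\<Prod>i\<in>UNIV. f i ((x::real ^ 'd) $ i))) = (\<Prod>b\<in>?B. integral\<^sup>L lborel (F b))"
    unfolding lborel_eq[where 'a = "real ^ 'd"] integral_distr[OF T_meas meas] prod
    by (rule product_integral_prod) (use F_int in auto)
  also have "\<dots> = (\<Prod>i\<in>UNIV. LINT t|lborel. f i t)"
    unfolding B prod.reindex[OF inj] by (simp add: F_ax o_def)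
  finally show "(LINT x|lborel. (\<Prod>i\<in>UNIV. f i ((x::real ^ 'd) $ i))) = (\<Prod>i\<in>UNIV. LINT t|lborel. f i t)" .
qed

lemma has_integral_ee:
  fixes k :: int
  shows "has_bochner_integral lborel (\<lambda>t. indicator {0..<1} t *\<^sub>R ee (of_int k * t)) (if k = 0 then 1 else 0)"
proof -
  have "has_bochner_integral lborel (\<lambda>t. indicator {0..1} t *\<^sub>R ee (of_int k * t)) (if k = 0 then 1 else 0)"
  proof (cases "k = 0")
    case True
    then show ?thesis
      using has_bochner_integral_indicator[of "{0..1::real}" lborel "1::complex"] by simp
  next
    case False
    let ?F = "\<lambda>t. ee (of_int k * t) / (\<i> * of_real (2 * pi * of_int k))"
    have "has_bochner_integral lborel (\<lambda>t. indicator {0..1} t *\<^sub>R ee (of_int k * t)) (?F 1 - ?F 0)"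
    proof (rule has_bochner_integral_FTC_Icc)
      fix t :: real
      let ?c = "\<i> * of_real (2 * pi * of_int k)"
      have e: "ee (of_int k * t) = exp (?c * of_real t)" for t
        by (simp add: ee_def cis_conv_exp mult_ac)
      have "((\<lambda>z. exp (?c * z)) has_field_derivative ?c * exp (?c * of_real t)) (at (of_real t))"
        by (auto intro!: derivative_eq_intros)
      from DERIV_cdivide[OF this, of ?c]
      have "((\<lambda>z. exp (?c * z) / ?c) has_field_derivative exp (?c * of_real t)) (at (of_real t))"
        using False by simp
      then show "(?F has_vector_derivative ee (of_int k * t)) (at t within {0..1})"
        unfolding e by (rule has_vector_derivative_real_field)
    qed (auto intro!: continuous_intros)
    then show ?thesis using False by simp
  qed
  moreover have "AE t::real in lborel. t \<noteq> 1" by (rule AE_lborel_singleton)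
  ultimately show ?thesis
    by (subst has_bochner_integral_cong_AE[of _ _ "\<lambda>t. indicator {0..1} t *\<^sub>R ee (of_int k * t)"])
      (measurable, auto elim!: eventually_mono simp: indicator_def)
qed

lemma ee_sum: "ee (sum f S) = (\<Prod>i\<in>S. ee (f i))" if "finite S"
  using that by (induction S rule: finite_induct) (auto simp: ee_add)

abbreviation cube_measure :: "(real ^ 'd) measure"
  where "cube_measure \<equiv> lebesgue_on unit_cube"

lemma finite_measure_cube: "finite_measure (cube_measure :: (real ^ 'd) measure)"
  by (rule finite_measure_lebesgue_on[OF lebesgue_unit_cube(3)])

lemma integrable_cube:
  fixes f :: "real ^ 'd \<Rightarrow> 'b::{banach, second_countable_topology}"
  shows "integrable cube_measure f \<longleftrightarrow> integrable lebesgue (\<lambda>x. indicator unit_cube x *\<^sub>R f x)"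
  using integrable_restrict_space[of unit_cube lebesgue f] by (simp add: lebesgue_unit_cube)

lemma integral_cube:
  fixes f :: "real ^ 'd \<Rightarrow> 'b::{banach, second_countable_topology}"
  shows "(LINT x|cube_measure. f x) = (LINT x|lebesgue. indicator unit_cube x *\<^sub>R f x)"
  using integral_restrict_space[of unit_cube lebesgue f] by (simp add: lebesgue_unit_cube)

lemma cube_ee:
  fixes k :: "int ^ 'd"
  shows "integrable cube_measure (\<lambda>x. ee (lat k \<bullet> x))"
    and "(LINT x|cube_measure. ee (lat k \<bullet> x)) = (if k = 0 then 1 else 0)"
proof -
  let ?f = "\<lambda>i t. indicator {0..<1} t *\<^sub>R ee (of_int (k $ i) * t)"
  have eq: "indicator unit_cube x *\<^sub>R ee (lat k \<bullet> x) = (\<Prod>i\<in>UNIV. ?f i (x $ i))" for x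
  proof (cases "x \<in> unit_cube")
    case True
    then show ?thesis by (auto simp: inner_vec_def ee_sum unit_cube_def indicator_def)
  next
    case False
    then obtain i where "\<not> (0 \<le> x $ i \<and> x $ i < 1)" by (auto simp: unit_cube_def)
    then show ?thesis using False by (auto simp: indicator_def intro!: prod_zero[symmetric] bexI[of _ i])
  qed
  have int: "integrable lborel (?f i)" "(LINT t|lborel. ?f i t) = (if k $ i = 0 then 1 else 0)" for i
    using has_integral_ee[of "k $ i"] by (simp_all add: has_bochner_integral_iff)
  have meas: "(\<lambda>x::real ^ 'd. \<Prod>i\<in>UNIV. ?f i (x $ i)) \<in> borel_measurable lborel"
    using lborel_integral_prod_vec(1)[OF int(1)] by (rule borel_measurable_integrable)
  show "integrable cube_measure (\<lambda>x. ee (lat k \<bullet> x))"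
    unfolding integrable_cube eq integrable_completion[OF meas] by (rule lborel_integral_prod_vec(1)[OF int(1)])
  show "(LINT x|cube_measure. ee (lat k \<bullet> x)) = (if k = 0 then 1 else 0)"
    unfolding integral_cube eq integral_completion[OF meas] lborel_integral_prod_vec(2)[OF int(1)] int(2)
    by (auto simp: vec_eq_iff prod_eq_1_iff intro!: prod_zero)
qed

lemma cube_trig_polynomial:
  fixes N :: "(int ^ 'd) set"
  assumes fin: "finite N"
  shows "integrable cube_measure (\<lambda>x. (cmod (\<Sum>n\<in>N. a n * ee (lat n \<bullet> x)))\<^sup>2)"
    and "(LINT x|cube_measure. (cmod (\<Sum>n\<in>N. a n * ee (lat n \<bullet> x)))\<^sup>2) = (\<Sum>n\<in>N. (cmod (a n))\<^sup>2)"
proof -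
  have eq: "complex_of_real ((cmod (\<Sum>n\<in>N. a n * ee (lat n \<bullet> x)))\<^sup>2)
      = (\<Sum>n\<in>N. \<Sum>m\<in>N. a n * cnj (a m) * ee (lat (n - m) \<bullet> x))" for x
    unfolding complex_norm_square by (simp add: sum_product lat_diff inner_diff_left ee_diff mult_ac)
  have int: "integrable cube_measure (\<lambda>x. complex_of_real ((cmod (\<Sum>n\<in>N. a n * ee (lat n \<bullet> x)))\<^sup>2))"
    unfolding eq by (intro Bochner_Integration.integrable_sum integrable_mult_right cube_ee)
  then show "integrable cube_measure (\<lambda>x. (cmod (\<Sum>n\<in>N. a n * ee (lat n \<bullet> x)))\<^sup>2)"
    by (simp only: complex_of_real_integrable_eq)
  have "complex_of_real (LINT x|cube_measure. (cmod (\<Sum>n\<in>N. a n * ee (lat n \<bullet> x)))\<^sup>2)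
      = (LINT x|cube_measure. (\<Sum>n\<in>N. \<Sum>m\<in>N. a n * cnj (a m) * ee (lat (n - m) \<bullet> x)))"
    unfolding integral_complex_of_real[symmetric] eq ..
  also have "\<dots> = (\<Sum>n\<in>N. \<Sum>m\<in>N. a n * cnj (a m) * (LINT x|cube_measure. ee (lat (n - m) \<bullet> x)))"
    by (simp add: cube_ee(1))
  also have "\<dots> = (\<Sum>n\<in>N. \<Sum>m\<in>N. if n = m then a n * cnj (a m) else 0)"
    by (intro sum.cong refl) (simp add: cube_ee(2))
  also have "\<dots> = complex_of_real (\<Sum>n\<in>N. (cmod (a n))\<^sup>2)"
    unfolding of_real_sum complex_norm_square by (simp add: fin)
  finally show "(LINT x|cube_measure. (cmod (\<Sum>n\<in>N. a n * ee (lat n \<bullet> x)))\<^sup>2) = (\<Sum>n\<in>N. (cmod (a n))\<^sup>2)"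
    by (simp only: of_real_eq_iff)
qed

text \<open>With \<open>P\<close> the Fourier sum of \<open>f\<close> over \<open>A\<close>, both
  the inner product of \<open>f\<close> with \<open>P\<close> and the squared norm of
  \<open>P\<close> equal the sum of the squared coefficients. Expanding the integral of the squared
  modulus of \<open>f - P\<close> then leaves the claimed difference.\<close>

lemma cube_Bessel:
  fixes f :: "real ^ 'd \<Rightarrow> complex"
  assumes fin: "finite A" and f: "f \<in> borel_measurable cube_measure"
    and f2: "integrable cube_measure (\<lambda>x. (cmod (f x))\<^sup>2)"
  shows "(\<Sum>k\<in>A. (cmod (LINT x|cube_measure. f x * ee (- (lat k \<bullet> x))))\<^sup>2) \<le> (LINT x|cube_measure. (cmod (f x))\<^sup>2)"
proof -
  interpret finite_measure "cube_measure :: (real ^ 'd) measure" by (rule finite_measure_cube)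
  have ee_meas: "(\<lambda>x. ee (lat k \<bullet> x)) \<in> borel_measurable cube_measure" for k :: "int ^ 'd"
    using cube_ee(1) by (rule borel_measurable_integrable)
  have ee_meas': "(\<lambda>x. ee (- (lat k \<bullet> x))) \<in> borel_measurable cube_measure" for k :: "int ^ 'd"
    using ee_meas[of "- k"] by (simp add: lat_minus)
  have f1: "integrable cube_measure f"
  proof (rule Bochner_Integration.integrable_bound)
    show "integrable cube_measure (\<lambda>x. 1 + (cmod (f x))\<^sup>2)" using f2 by simp
    have "t \<le> 1 + t\<^sup>2" for t :: real
      using zero_le_power2[of "t - 1/2"] by (simp add: power2_eq_square algebra_simps)
    then show "AE x in cube_measure. norm (f x) \<le> norm (1 + (cmod (f x))\<^sup>2)"
      by (intro AE_I2) (smt (verit) real_norm_def zero_le_power2)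
  qed (rule f)
  have fe: "integrable cube_measure (\<lambda>x. f x * ee (- (lat k \<bullet> x)))" for k
    by (intro Bochner_Integration.integrable_bound[OF f1] borel_measurable_times ee_meas' f) (auto simp: norm_mult)
  define c where "c k = (LINT x|cube_measure. f x * ee (- (lat k \<bullet> x)))" for k
  let ?P = "\<lambda>x. \<Sum>k\<in>A. c k * ee (lat k \<bullet> x)"
  have fP: "integrable cube_measure (\<lambda>x. f x * cnj (?P x))"
    and fPc: "(LINT x|cube_measure. f x * cnj (?P x)) = of_real (\<Sum>k\<in>A. (cmod (c k))\<^sup>2)"
  proof -
    have eq: "f x * cnj (?P x) = (\<Sum>k\<in>A. cnj (c k) * (f x * ee (- (lat k \<bullet> x))))" for x
      by (simp add: sum_distrib_left ee_minus mult_ac)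
    show "integrable cube_measure (\<lambda>x. f x * cnj (?P x))"
      unfolding eq by (intro Bochner_Integration.integrable_sum integrable_mult_right fe)
    show "(LINT x|cube_measure. f x * cnj (?P x)) = of_real (\<Sum>k\<in>A. (cmod (c k))\<^sup>2)"
      unfolding eq of_real_sum complex_norm_square using fe by (simp add: c_def[symmetric] mult.commute)
  qed
  have expand: "(cmod (f x - ?P x))\<^sup>2 = (cmod (f x))\<^sup>2 - 2 * Re (f x * cnj (?P x)) + (cmod (?P x))\<^sup>2" for x
  proof -
    have "(cmod (a - b))\<^sup>2 = (cmod a)\<^sup>2 - 2 * Re (a * cnj b) + (cmod b)\<^sup>2" for a b :: complex
      by (simp only: cmod_power2) (simp add: power2_eq_square algebra_simps)
    then show ?thesis .
  qed
  define g where "g x = Re (f x * cnj (?P x))" for x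
  have g: "integrable cube_measure g" "(LINT x|cube_measure. g x) = (\<Sum>k\<in>A. (cmod (c k))\<^sup>2)"
    using integrable_Re[OF fP] integral_Re[OF fP] unfolding fPc g_def[symmetric] by simp_all
  have "0 \<le> (LINT x|cube_measure. (cmod (f x - ?P x))\<^sup>2)" by simp
  also have "\<dots> = (LINT x|cube_measure. (cmod (f x))\<^sup>2) - 2 * (\<Sum>k\<in>A. (cmod (c k))\<^sup>2) + (\<Sum>k\<in>A. (cmod (c k))\<^sup>2)"
    unfolding expand g_def[symmetric]
    using f2 g cube_trig_polynomial[OF fin, of c] by simp
  finally show ?thesis unfolding c_def by simp
qed

text \<open>Optimising the weight, \<open>t = b / a\<close>, turns a weighted arithmetic-geometric
  mean inequality into Cauchy-Schwarz; for \<open>a = 0\<close> a large weight forces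
  \<open>b = 0\<close>. The same weighted inequalities later compare the energies of a system and
  its dual.\<close>

lemma amgm_imp_square_le:
  fixes a b c :: real
  assumes "0 \<le> a" "0 \<le> b" "0 \<le> c" and le: "\<And>t. t > 0 \<Longrightarrow> 2 * b \<le> t * a + c / t"
  shows "b\<^sup>2 \<le> a * c"
proof (cases "b = 0")
  case False
  then have b: "b > 0" using assms by simp
  show ?thesis
  proof (cases "a = 0")
    case True
    have "2 * b \<le> c * b / (c + 1)"
      using le[of "(c + 1) / b"] b assms True by simp
    also have "\<dots> \<le> b" using b assms by (simp add: field_simps)
    finally show ?thesis using b by simp
  next
    case False
    then have a: "a > 0" using assms by simp
    have "2 * b \<le> b + c * a / b" using le[of "b / a"] a b by simp
    then have "b \<le> c * a / b" by simp
    then show ?thesis using b by (simp add: field_simps power2_eq_square)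
  qed
qed (use assms in simp)

lemma two_mult_le_weighted: "2 * (x * y) \<le> t * x\<^sup>2 + y\<^sup>2 / t" if "t > 0" for t x y :: real
proof -
  have "0 \<le> (t * x - y)\<^sup>2 / t" using that by simp
  also have "\<dots> = t * x\<^sup>2 + y\<^sup>2 / t - 2 * (x * y)"
    using that by (simp add: power2_eq_square field_simps)
  finally show ?thesis by simp
qed

lemma norm_add_square_le: "(norm (x + y))\<^sup>2 \<le> 2 * (norm x)\<^sup>2 + 2 * (norm y)\<^sup>2" for x y :: "'a::real_normed_vector"
proof -
  have "(norm (x + y))\<^sup>2 \<le> (norm x + norm y)\<^sup>2"
    by (intro power_mono norm_triangle_ineq) auto
  also have "\<dots> \<le> 2 * (norm x)\<^sup>2 + 2 * (norm y)\<^sup>2"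
    using zero_le_power2[of "norm x - norm y"] by (simp add: power2_eq_square algebra_simps)
  finally show ?thesis .
qed

lemma norm_diff_square_le: "(norm (x - y))\<^sup>2 \<le> 2 * (norm x)\<^sup>2 + 2 * (norm y)\<^sup>2" for x y :: "'a::real_normed_vector"
  using norm_add_square_le[of x "- y"] by simp

section \<open>Square integrable functions\<close>

lemma L2_measurable: "f \<in> L2 \<Longrightarrow> f \<in> borel_measurable lebesgue"
  and L2_square_integrable: "f \<in> L2 \<Longrightarrow> integrable lebesgue (\<lambda>x. (cmod (f x))\<^sup>2)"
  by (auto simp: L2_def)

lemma L2I: "f \<in> borel_measurable lebesgue \<Longrightarrow> integrable lebesgue (\<lambda>x. (cmod (f x))\<^sup>2) \<Longrightarrow> f \<in> L2"
  by (simp add: L2_def)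

lemma L2_bound:
  assumes "g \<in> borel_measurable lebesgue" "integrable lebesgue h" "AE x in lebesgue. (cmod (g x))\<^sup>2 \<le> h x"
  shows "g \<in> L2"
proof (rule L2I)
  show "integrable lebesgue (\<lambda>x. (cmod (g x))\<^sup>2)"
    by (rule Bochner_Integration.integrable_bound[OF assms(2)]) (use assms in \<open>auto elim!: eventually_mono\<close>)
qed fact

lemma L2_add: "f \<in> L2 \<Longrightarrow> g \<in> L2 \<Longrightarrow> (\<lambda>x. f x + g x) \<in> L2"
  by (rule L2_bound[of _ "\<lambda>x. 2 * (cmod (f x))\<^sup>2 + 2 * (cmod (g x))\<^sup>2"])
    (auto simp: L2_def norm_add_square_le)

lemma L2_diff: "f \<in> L2 \<Longrightarrow> g \<in> L2 \<Longrightarrow> (\<lambda>x. f x - g x) \<in> L2"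
  by (rule L2_bound[of _ "\<lambda>x. 2 * (cmod (f x))\<^sup>2 + 2 * (cmod (g x))\<^sup>2"])
    (auto simp: L2_def norm_diff_square_le)

lemma L2_cmult: "f \<in> L2 \<Longrightarrow> (\<lambda>x. c * f x) \<in> L2"
  by (auto simp: L2_def norm_mult power_mult_distrib)

lemma L2_zero: "(\<lambda>x. 0) \<in> L2"
  by (simp add: L2_def)

lemma L2_sum: "(\<And>i. i \<in> S \<Longrightarrow> f i \<in> L2) \<Longrightarrow> (\<lambda>x. \<Sum>i\<in>S. f i x) \<in> L2"
  by (induction S rule: infinite_finite_induct) (auto simp: L2_zero intro: L2_add)

lemma cnj_borel_measurable [measurable]: "cnj \<in> borel_measurable borel"
  by (intro borel_measurable_continuous_onI continuous_on_cnj continuous_on_id)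

lemma L2_cnj: "f \<in> L2 \<Longrightarrow> (\<lambda>x. cnj (f x)) \<in> L2"
  unfolding L2_def by auto

lemma L2_inner_integrable:
  assumes "f \<in> L2" "g \<in> L2"
  shows "integrable lebesgue (\<lambda>x. f x * cnj (g x))"
proof (rule Bochner_Integration.integrable_bound)
  show "integrable lebesgue (\<lambda>x. (cmod (f x))\<^sup>2 + (cmod (g x))\<^sup>2)"
    using assms by (auto simp: L2_def)
  show "(\<lambda>x. f x * cnj (g x)) \<in> borel_measurable lebesgue"
    using assms[THEN L2_measurable] by measurable
  have "cmod a * cmod b \<le> (cmod a)\<^sup>2 + (cmod b)\<^sup>2" for a b
    using two_mult_le_weighted[of 1 "cmod a" "cmod b"] by (simp add: sum_power2_ge_zero) (smt (verit) zero_le_power2 mult_nonneg_nonneg norm_ge_zero)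
  then show "AE x in lebesgue. norm (f x * cnj (g x)) \<le> norm ((cmod (f x))\<^sup>2 + (cmod (g x))\<^sup>2)"
    by (intro AE_I2) (simp add: norm_mult)
qed

lemma L2_inner_add_left: "f \<in> L2 \<Longrightarrow> g \<in> L2 \<Longrightarrow> h \<in> L2 \<Longrightarrow> L2_inner (\<lambda>x. f x + g x) h = L2_inner f h + L2_inner g h"
  by (simp add: L2_inner_def ring_distribs L2_inner_integrable)

lemma L2_inner_diff_left: "f \<in> L2 \<Longrightarrow> g \<in> L2 \<Longrightarrow> h \<in> L2 \<Longrightarrow> L2_inner (\<lambda>x. f x - g x) h = L2_inner f h - L2_inner g h"
  by (simp add: L2_inner_def ring_distribs L2_inner_integrable)

lemma L2_inner_diff_right: "f \<in> L2 \<Longrightarrow> g \<in> L2 \<Longrightarrow> h \<in> L2 \<Longrightarrow> L2_inner h (\<lambda>x. f x - g x) = L2_inner h f - L2_inner h g"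
  by (simp add: L2_inner_def ring_distribs L2_inner_integrable)

lemma L2_inner_cmult_left: "L2_inner (\<lambda>x. c * f x) g = c * L2_inner f g"
  by (simp add: L2_inner_def mult.assoc)

lemma L2_inner_cmult_right: "L2_inner f (\<lambda>x. c * g x) = cnj c * L2_inner f g"
proof -
  have "L2_inner f (\<lambda>x. c * g x) = (LINT x|lebesgue. cnj c * (f x * cnj (g x)))"
    by (simp add: L2_inner_def mult_ac)
  then show ?thesis by (simp add: L2_inner_def)
qed

lemma L2_inner_sum_right:
  assumes "finite S" "f \<in> L2" "\<And>i. i \<in> S \<Longrightarrow> g i \<in> L2"
  shows "L2_inner f (\<lambda>x. \<Sum>i\<in>S. g i x) = (\<Sum>i\<in>S. L2_inner f (g i))"
  using assms by (simp add: L2_inner_def sum_distrib_left L2_inner_integrable)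

lemma L2_inner_cnj: "cnj (L2_inner f g) = L2_inner g f"
proof -
  have "L2_inner g f = (LINT x|lebesgue. cnj (f x * cnj (g x)))"
    by (simp add: L2_inner_def mult.commute del: integral_cnj)
  also have "\<dots> = cnj (L2_inner f g)"
    unfolding L2_inner_def by (rule integral_bounded_linear'[OF bounded_linear_cnj bounded_linear_cnj]) auto
  finally show ?thesis ..
qed

lemma L2_inner_cong_AE:
  assumes "f \<in> L2" "g \<in> L2" "g' \<in> L2" "AE x in lebesgue. g x = g' x"
  shows "L2_inner f g = L2_inner f g'"
  unfolding L2_inner_def
  by (rule integral_cong_AE) (use assms L2_inner_integrable[THEN borel_measurable_integrable] in \<open>auto elim!: eventually_mono\<close>)

lemma L2_normsq_nonneg: "0 \<le> L2_normsq f"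
  by (simp add: L2_normsq_def)

lemma L2_inner_self: "L2_inner f f = of_real (L2_normsq f)"
  by (simp add: L2_inner_def L2_normsq_def integral_complex_of_real[symmetric] complex_norm_square[symmetric] del: integral_complex_of_real)

lemma L2_normsq_add_le: "f \<in> L2 \<Longrightarrow> g \<in> L2 \<Longrightarrow> L2_normsq (\<lambda>x. f x + g x) \<le> 2 * L2_normsq f + 2 * L2_normsq g"
proof -
  assume fg: "f \<in> L2" "g \<in> L2"
  have "L2_normsq (\<lambda>x. f x + g x) \<le> (LINT x|lebesgue. 2 * (cmod (f x))\<^sup>2 + 2 * (cmod (g x))\<^sup>2)"
    unfolding L2_normsq_def using L2_add[OF fg] fg
    by (intro integral_mono norm_add_square_le) (auto simp: L2_def)
  also have "\<dots> = 2 * L2_normsq f + 2 * L2_normsq g"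
    using fg by (simp add: L2_normsq_def L2_def)
  finally show ?thesis .
qed

lemma L2_Cauchy_Schwarz:
  assumes f: "f \<in> L2" and g: "g \<in> L2"
  shows "(cmod (L2_inner f g))\<^sup>2 \<le> L2_normsq f * L2_normsq g"
proof (rule amgm_imp_square_le)
  fix t :: real assume t: "t > 0"
  have "2 * cmod (L2_inner f g) \<le> 2 * (LINT x|lebesgue. cmod (f x) * cmod (g x))"
    unfolding L2_inner_def using integral_norm_bound[of lebesgue "\<lambda>x. f x * cnj (g x)"]
    by (simp add: norm_mult)
  also have "\<dots> = (LINT x|lebesgue. 2 * (cmod (f x) * cmod (g x)))" by simp
  also have "\<dots> \<le> (LINT x|lebesgue. t * (cmod (f x))\<^sup>2 + (cmod (g x))\<^sup>2 / t)"
  proof (rule integral_mono)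
    show "integrable lebesgue (\<lambda>x. 2 * (cmod (f x) * cmod (g x)))"
      using integrable_norm[OF L2_inner_integrable[OF f g]] by (simp add: norm_mult)
    show "integrable lebesgue (\<lambda>x. t * (cmod (f x))\<^sup>2 + (cmod (g x))\<^sup>2 / t)"
      using f g by (auto simp: L2_def)
  qed (rule two_mult_le_weighted[OF t])
  also have "\<dots> = t * L2_normsq f + L2_normsq g / t"
    using f g by (simp add: L2_normsq_def L2_def)
  finally show "2 * cmod (L2_inner f g) \<le> t * L2_normsq f + L2_normsq g / t" .
qed (auto simp: L2_normsq_nonneg)

subsection \<open>Approximation by continuous functions of compact support\<close>

text \<open>Test functions for the sampling limits: continuity makes samples converge at every
  point, and the bounded support provides a dominating function.\<close>

definition Cc :: "(real ^ 'd \<Rightarrow> complex) set"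
  where "Cc = {g. continuous_on UNIV g \<and> (\<exists>R. \<forall>x. norm x > R \<longrightarrow> g x = 0)}"

lemma Cc_bounded:
  assumes "g \<in> Cc"
  shows "\<exists>B R. \<forall>x. cmod (g x) \<le> B * indicator (cball 0 R) x"
proof -
  obtain R where g: "continuous_on UNIV g" and R: "\<And>x. norm x > R \<Longrightarrow> g x = 0"
    using assms by (auto simp: Cc_def)
  have "compact (g ` cball 0 R)"
    by (intro compact_continuous_image continuous_on_subset[OF g]) auto
  then obtain B where "\<forall>y\<in>g ` cball 0 R. cmod y \<le> B"
    using bounded_iff compact_imp_bounded by metis
  then have B: "\<And>x. x \<in> cball 0 R \<Longrightarrow> cmod (g x) \<le> B" by blast
  have "cmod (g x) \<le> B * indicator (cball 0 R) x" for x
    using B[of x] R[of x] by (cases "norm x \<le> R") (auto simp: indicator_def)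
  then show ?thesis by blast
qed

lemma Cc_measurable: "g \<in> Cc \<Longrightarrow> g \<in> borel_measurable borel" "g \<in> Cc \<Longrightarrow> g \<in> borel_measurable lebesgue"
  by (auto simp: Cc_def intro!: borel_measurable_continuous_onI measurable_completion)

lemma integrable_indicator_cball: "integrable lebesgue (\<lambda>x::real ^ 'd. B * indicator (cball 0 R) x :: real)"
proof -
  have "cball 0 R \<in> (lmeasurable :: (real ^ 'd) set set)" by simp
  then show ?thesis by (intro integrable_mult_right) (simp add: lmeasurable_iff_integrable)
qed

lemma Cc_integrable: "g \<in> Cc \<Longrightarrow> integrable lebesgue g"
proof -
  assume g: "g \<in> Cc"
  then obtain B R where B: "\<And>x. cmod (g x) \<le> B * indicator (cball 0 R) x" using Cc_bounded by blast
  show ?thesis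
    by (rule Bochner_Integration.integrable_bound[OF integrable_indicator_cball[of B R] Cc_measurable(2)[OF g]])
      (use B in \<open>auto intro!: AE_I2 order_trans[OF _ abs_ge_self]\<close>)
qed

lemma Cc_L2: "g \<in> Cc \<Longrightarrow> g \<in> L2"
proof -
  assume g: "g \<in> Cc"
  then obtain B R where B: "\<And>x. cmod (g x) \<le> B * indicator (cball 0 R) x" using Cc_bounded by blast
  have "(cmod (g x))\<^sup>2 \<le> B\<^sup>2 * indicator (cball 0 R) x" for x
    using power_mono[OF B[of x], of 2] by (auto simp: indicator_def)
  then show ?thesis
    by (intro L2_bound[OF Cc_measurable(2)[OF g] integrable_indicator_cball]) auto
qed

definition cutoff :: "nat \<Rightarrow> real ^ 'd \<Rightarrow> real"
  where "cutoff n x = max 0 (min 1 (real n + 1 - norm x))"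

lemma cutoff_props:
  "0 \<le> cutoff n x" "cutoff n x \<le> 1" "norm x \<le> real n \<Longrightarrow> cutoff n x = 1"
  "cutoff n x \<le> indicator (cball 0 (real n + 1)) x" "continuous_on S (cutoff n)"
  unfolding cutoff_def by (auto simp: indicator_def intro!: continuous_intros)

lemma cutoff_tendsto: "(\<lambda>n. cutoff n x) \<longlonglongrightarrow> 1"
proof (rule tendsto_eventually)
  obtain N :: nat where "norm x \<le> real N" using real_arch_simple by blast
  then show "\<forall>\<^sub>F n in sequentially. cutoff n x = 1"
    by (intro eventually_sequentiallyI[of N] cutoff_props) auto
qed

lemma cutoff_borel [measurable]: "cutoff n \<in> borel_measurable borel"
  by (intro borel_measurable_continuous_onI cutoff_props)

text \<open>A measurable function is almost everywhere a limit of continuous ones. Clipping their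
  values to the ball of radius \<open>B\<close> does not disturb the limit, as \<open>s\<close>
  stays in that ball, and together with \<open>cutoff\<close> it supplies one dominating function
  for all \<open>n\<close>.\<close>

lemma Cc_approx:
  fixes s :: "real ^ 'd \<Rightarrow> complex"
  assumes s: "s \<in> borel_measurable lebesgue" and B: "\<And>x. cmod (s x) \<le> B"
  obtains h where "\<And>n::nat. h n \<in> Cc" "\<And>n x. cmod (h n x) \<le> B * indicator (cball 0 (real N + 1)) x"
    "AE x in lebesgue. (\<lambda>n. h n x) \<longlonglongrightarrow> of_real (cutoff N x) * s x"
proof -
  have B0: "B \<ge> 0" using B[of 0] norm_ge_zero order_trans by blast
  have "s measurable_on UNIV"
    using lebesgue_measurable_imp_measurable_on[OF s] by simp
  then obtain Z g where Z: "negligible Z" and g: "\<And>n. continuous_on UNIV (g n)"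
    and lim: "\<And>x. x \<notin> Z \<Longrightarrow> (\<lambda>n. g n x) \<longlonglongrightarrow> s x"
    unfolding measurable_on_def by auto
  let ?clip = "closest_point (cball 0 B) :: complex \<Rightarrow> complex"
  have clip_cont: "continuous_on UNIV ?clip"
    using B0 by (intro continuous_on_closest_point) auto
  have clip_norm: "cmod (?clip z) \<le> B" for z
    using closest_point_in_set[of "cball 0 B" z] B0 by auto
  define h where "h n x = of_real (cutoff N x) * ?clip (g n x)" for n x
  show thesis
  proof
    fix n
    show bd: "cmod (h n x) \<le> B * indicator (cball 0 (real N + 1)) x" for x
      using mult_mono[OF cutoff_props(4)[of N x] clip_norm[of "g n x"]] B0 cutoff_props(1)[of N x]
      by (simp add: h_def norm_mult mult.commute)
    have "continuous_on UNIV (h n)"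
      unfolding h_def by (intro continuous_intros cutoff_props continuous_on_compose2[OF clip_cont g]) auto
    moreover have "\<forall>x. norm x > real N + 1 \<longrightarrow> h n x = 0"
      unfolding h_def cutoff_def by auto
    ultimately show "h n \<in> Cc" unfolding Cc_def by blast
  next
    have "(\<lambda>n. h n x) \<longlonglongrightarrow> of_real (cutoff N x) * s x" if "x \<notin> Z" for x
    proof -
      have "(\<lambda>n. ?clip (g n x)) \<longlonglongrightarrow> ?clip (s x)"
        using continuous_on_tendsto_compose[OF clip_cont lim[OF that]] by simp
      also have "?clip (s x) = s x" using B by (intro closest_point_self) auto
      finally show ?thesis unfolding h_def by (intro tendsto_intros)
    qed
    then show "AE x in lebesgue. (\<lambda>n. h n x) \<longlonglongrightarrow> of_real (cutoff N x) * s x"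
      using Z by (intro AE_I'[of Z]) (auto simp: negligible_iff_null_sets)
  qed
qed

text \<open>Two rounds of dominated convergence: truncating the domain and the values of
  \<open>f\<close> at \<open>N\<close> gives a bounded function with bounded support, which is the
  situation of \<open>Cc_approx\<close>.\<close>

lemma L2_Cc_dense:
  fixes f :: "real ^ 'd \<Rightarrow> complex"
  assumes f: "f \<in> L2" and e: "e > 0"
  obtains g where "g \<in> Cc" "L2_normsq (\<lambda>x. f x - g x) < e"
proof -
  have fm: "f \<in> borel_measurable lebesgue" by (rule L2_measurable[OF f])
  let ?clip = "\<lambda>N. closest_point (cball 0 (real N)) :: complex \<Rightarrow> complex"
  have clip_cont: "continuous_on UNIV (?clip N)" for N
    by (intro continuous_on_closest_point) auto
  have clip_norm: "cmod (?clip N z) \<le> real N" for N z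
    using closest_point_in_set[of "cball 0 (real N)" z] by auto
  \<comment> \<open>The crude factor 2 is a triangle inequality: the distance from \<open>z\<close>
    to its clipping is at most the distance from \<open>z\<close> to 0.\<close>
  have clip_le: "cmod (?clip N z) \<le> 2 * cmod z" for N z
  proof -
    have "dist z (?clip N z) \<le> dist z 0"
      by (intro closest_point_le) auto
    then show ?thesis using norm_triangle_ineq4[of z "z - ?clip N z"] by (simp add: dist_norm)
  qed
  define h where "h N x = of_real (cutoff N x) * ?clip N (f x)" for N x
  have clip_meas: "(\<lambda>x. ?clip N (f x)) \<in> borel_measurable lebesgue" for N
    using measurable_compose[OF fm borel_measurable_continuous_onI[OF clip_cont]] .
  have cut_meas: "cutoff N \<in> borel_measurable lebesgue" for N
    by (rule measurable_completion) simp
  have h_meas: "h N \<in> borel_measurable lebesgue" for N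
    unfolding h_def using clip_meas cut_meas by measurable
  have h_le: "cmod (h N x) \<le> 2 * cmod (f x)" for N x
    using mult_mono[OF cutoff_props(2)[of N x] clip_le[of N "f x"]] cutoff_props(1)[of N x]
    by (simp add: h_def norm_mult)
  have h_le2: "(cmod (h N x))\<^sup>2 \<le> 4 * (cmod (f x))\<^sup>2" for N x
    using power_mono[OF h_le[of N x], of 2] by (simp add: power_mult_distrib)
  have h_L2: "h N \<in> L2" for N
    using f by (intro L2_bound[where h = "\<lambda>x. 4 * (cmod (f x))\<^sup>2"] h_meas AE_I2 h_le2) (auto simp: L2_def)
  have "(\<lambda>N. LINT x|lebesgue. (cmod (f x - h N x))\<^sup>2) \<longlonglongrightarrow> (LINT x::real ^ 'd|lebesgue. (0::real))"
  proof (rule integral_dominated_convergence[where w = "\<lambda>x. 9 * (cmod (f x))\<^sup>2"])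
    show "integrable lebesgue (\<lambda>x. 9 * (cmod (f x))\<^sup>2)" using f by (simp add: L2_def)
    show "(\<lambda>x. (cmod (f x - h N x))\<^sup>2) \<in> borel_measurable lebesgue" for N
      using h_meas[of N] fm by measurable
    have "cmod (f x - h N x) \<le> 3 * cmod (f x)" for N x
      using norm_triangle_ineq4[of "f x" "h N x"] h_le[of N x] by linarith
    then have "(cmod (f x - h N x))\<^sup>2 \<le> (3 * cmod (f x))\<^sup>2" for N x
      by (intro power_mono) auto
    then show "AE x in lebesgue. norm ((cmod (f x - h N x))\<^sup>2) \<le> 9 * (cmod (f x))\<^sup>2" for N
      by (simp add: power_mult_distrib)
    have "(\<lambda>N. (cmod (f x - h N x))\<^sup>2) \<longlonglongrightarrow> 0" for x
    proof -
      have "(\<lambda>N. ?clip N (f x)) \<longlonglongrightarrow> f x"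
      proof (rule tendsto_eventually)
        obtain K :: nat where "cmod (f x) \<le> real K" using real_arch_simple by blast
        then show "\<forall>\<^sub>F N in sequentially. ?clip N (f x) = f x"
          by (intro eventually_sequentiallyI[of K] closest_point_self) auto
      qed
      then have "(\<lambda>N. h N x) \<longlonglongrightarrow> of_real 1 * f x"
        unfolding h_def by (intro tendsto_mult tendsto_of_real cutoff_tendsto)
      then have "(\<lambda>N. (cmod (f x - h N x))\<^sup>2) \<longlonglongrightarrow> (cmod (f x - of_real 1 * f x))\<^sup>2"
        by (intro tendsto_intros)
      then show ?thesis by simp
    qed
    then show "AE x in lebesgue. (\<lambda>N. (cmod (f x - h N x))\<^sup>2) \<longlonglongrightarrow> 0" by simp
  qed simp
  then have "(\<lambda>N. L2_normsq (\<lambda>x. f x - h N x)) \<longlonglongrightarrow> 0" by (simp add: L2_normsq_def)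
  \<comment> \<open>Both errors are kept below \<open>e / 4\<close>, since
    \<open>L2_normsq_add_le\<close> costs a factor 2 on each.\<close>
  from order_tendstoD(2)[OF this, of "e / 4"] e obtain N where N: "L2_normsq (\<lambda>x. f x - h N x) < e / 4"
    by (auto simp: eventually_sequentially)
  obtain g where g: "\<And>n::nat. g n \<in> Cc" "\<And>n x. cmod (g n x) \<le> real N * indicator (cball 0 (real N + 1)) x"
    and lim: "AE x in lebesgue. (\<lambda>n. g n x) \<longlonglongrightarrow> of_real (cutoff N x) * ?clip N (f x)"
    using Cc_approx[OF clip_meas clip_norm] by blast
  have h_bd: "cmod (h N x) \<le> real N * indicator (cball 0 (real N + 1)) x" for x
    using mult_mono[OF cutoff_props(4)[of N x] clip_norm[of N "f x"]] cutoff_props(1)[of N x]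
    by (simp add: h_def norm_mult mult.commute)
  have "(\<lambda>n. LINT x|lebesgue. (cmod (h N x - g n x))\<^sup>2) \<longlonglongrightarrow> (LINT x::real ^ 'd|lebesgue. (0::real))"
  proof (rule integral_dominated_convergence[where w = "\<lambda>x. (2 * real N)\<^sup>2 * indicator (cball 0 (real N + 1)) x"])
    show "(\<lambda>x. (cmod (h N x - g n x))\<^sup>2) \<in> borel_measurable lebesgue" for n
      using h_meas[of N] Cc_measurable(2)[OF g(1)[of n]] by measurable
    have "cmod (h N x - g n x) \<le> 2 * real N * indicator (cball 0 (real N + 1)) x" for n x
      using norm_triangle_ineq4[of "h N x" "g n x"] h_bd[of x] g(2)[of n x] by linarith
    then have "(cmod (h N x - g n x))\<^sup>2 \<le> (2 * real N * indicator (cball 0 (real N + 1)) x)\<^sup>2" for n x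
      by (intro power_mono) auto
    moreover have "(2 * real N * indicator (cball 0 (real N + 1)) x)\<^sup>2 = (2 * real N)\<^sup>2 * indicator (cball 0 (real N + 1)) x" for x :: "real ^ 'd"
      by (simp add: indicator_def)
    ultimately have "(cmod (h N x - g n x))\<^sup>2 \<le> (2 * real N)\<^sup>2 * indicator (cball 0 (real N + 1)) x" for n x
      by metis
    then show "AE x in lebesgue. norm ((cmod (h N x - g n x))\<^sup>2) \<le> (2 * real N)\<^sup>2 * indicator (cball 0 (real N + 1)) x" for n
      by (intro AE_I2) simp
    show "AE x in lebesgue. (\<lambda>n. (cmod (h N x - g n x))\<^sup>2) \<longlonglongrightarrow> 0"
      using lim
    proof eventually_elim
      fix x assume "(\<lambda>n. g n x) \<longlonglongrightarrow> of_real (cutoff N x) * ?clip N (f x)"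
      then have "(\<lambda>n. (cmod (h N x - g n x))\<^sup>2) \<longlonglongrightarrow> (cmod (h N x - of_real (cutoff N x) * ?clip N (f x)))\<^sup>2"
        by (intro tendsto_intros)
      then show "(\<lambda>n. (cmod (h N x - g n x))\<^sup>2) \<longlonglongrightarrow> 0" by (simp add: h_def)
    qed
    show "integrable lebesgue (\<lambda>x::real ^ 'd. (2 * real N)\<^sup>2 * indicator (cball 0 (real N + 1)) x)"
      by (rule integrable_indicator_cball)
  qed simp
  then have "(\<lambda>n. L2_normsq (\<lambda>x. h N x - g n x)) \<longlonglongrightarrow> 0" by (simp add: L2_normsq_def)
  from order_tendstoD(2)[OF this, of "e / 4"] e obtain n where n: "L2_normsq (\<lambda>x. h N x - g n x) < e / 4"
    by (auto simp: eventually_sequentially)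
  have "L2_normsq (\<lambda>x. f x - g n x) = L2_normsq (\<lambda>x. (f x - h N x) + (h N x - g n x))" by simp
  also have "\<dots> \<le> 2 * L2_normsq (\<lambda>x. f x - h N x) + 2 * L2_normsq (\<lambda>x. h N x - g n x)"
    by (intro L2_normsq_add_le L2_diff f h_L2 Cc_L2 g)
  also have "\<dots> < e" using N n by simp
  finally show thesis using that g(1) by blast
qed

text \<open>Test functions approximate the conjugate sign of \<open>w\<close> times a cutoff, so
  orthogonality passes in the limit to a vanishing integral of \<open>cutoff N\<close> times the
  modulus of \<open>w\<close>.\<close>

lemma AE_0_if_orthogonal_Cc:
  fixes w :: "real ^ 'd \<Rightarrow> complex"
  assumes w: "integrable lebesgue w" and orth: "\<And>g. g \<in> Cc \<Longrightarrow> (LINT x|lebesgue. w x * g x) = 0"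
  shows "AE x in lebesgue. w x = 0"
proof -
  have wm: "w \<in> borel_measurable lebesgue" using w by (rule borel_measurable_integrable)
  define s where "s x = cnj (sgn (w x))" for x
  have ws: "w x * s x = of_real (cmod (w x))" for x
    by (cases "w x = 0")
      (simp_all add: s_def sgn_div_norm scaleR_conv_of_real complex_norm_square[symmetric] power2_eq_square field_simps flip: complex_norm_square)
  have "(\<lambda>x. sgn (w x)) \<in> borel_measurable lebesgue" using wm by measurable
  then have s: "s \<in> borel_measurable lebesgue"
    unfolding s_def by (rule measurable_compose) (intro borel_measurable_continuous_onI continuous_intros)
  have s1: "cmod (s x) \<le> 1" for x by (simp add: s_def norm_sgn)
  have "AE x in lebesgue. cutoff N x * cmod (w x) = 0" for N
  proof -
    obtain g where g: "\<And>n::nat. g n \<in> Cc" "\<And>n x. cmod (g n x) \<le> 1 * indicator (cball 0 (real N + 1)) x"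
      and lim: "AE x in lebesgue. (\<lambda>n. g n x) \<longlonglongrightarrow> of_real (cutoff N x) * s x"
      using Cc_approx[OF s s1] by blast
    have cut_meas: "cutoff N \<in> borel_measurable lebesgue"
      by (rule measurable_completion) simp
    have "(\<lambda>n. LINT x|lebesgue. w x * g n x) \<longlonglongrightarrow> (LINT x|lebesgue. complex_of_real (cutoff N x * cmod (w x)))"
    proof (rule integral_dominated_convergence[where w = "\<lambda>x. cmod (w x)"])
      show "(\<lambda>x. complex_of_real (cutoff N x * cmod (w x))) \<in> borel_measurable lebesgue"
        using cut_meas wm by measurable
      show "(\<lambda>x. w x * g n x) \<in> borel_measurable lebesgue" for n
        using wm Cc_measurable(2)[OF g(1)[of n]] by measurable
      show "AE x in lebesgue. (\<lambda>n. w x * g n x) \<longlonglongrightarrow> complex_of_real (cutoff N x * cmod (w x))"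
        using lim
      proof eventually_elim
        fix x assume "(\<lambda>n. g n x) \<longlonglongrightarrow> of_real (cutoff N x) * s x"
        then have "(\<lambda>n. w x * g n x) \<longlonglongrightarrow> w x * (of_real (cutoff N x) * s x)" by (intro tendsto_intros)
        also have "w x * (of_real (cutoff N x) * s x) = complex_of_real (cutoff N x * cmod (w x))"
          using ws[of x] by (simp add: mult_ac)
        finally show "(\<lambda>n. w x * g n x) \<longlonglongrightarrow> complex_of_real (cutoff N x * cmod (w x))" .
      qed
      have "cmod (g n x) \<le> 1" for n x using g(2)[of n x] by (cases "x \<in> cball 0 (real N + 1)") auto
      then show "AE x in lebesgue. norm (w x * g n x) \<le> cmod (w x)" for n
        by (intro AE_I2) (simp add: norm_mult mult_left_le)
    qed (use w in auto)
    then have "(LINT x|lebesgue. complex_of_real (cutoff N x * cmod (w x))) = 0"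
      using orth[OF g(1)] LIMSEQ_unique[OF _ tendsto_const] by simp
    then have 0: "(LINT x|lebesgue. cutoff N x * cmod (w x)) = 0"
      by (simp only: integral_complex_of_real of_real_eq_0_iff)
    have "integrable lebesgue (\<lambda>x. cutoff N x * cmod (w x))"
    proof (rule Bochner_Integration.integrable_bound[OF integrable_norm[OF w]])
      show "(\<lambda>x. cutoff N x * cmod (w x)) \<in> borel_measurable lebesgue" using cut_meas wm by measurable
      show "AE x in lebesgue. norm (cutoff N x * cmod (w x)) \<le> norm (cmod (w x))"
        using cutoff_props(1,2)[of N] by (intro AE_I2) (simp add: abs_mult mult_left_le_one_le cutoff_def)
    qed
    then show ?thesis
      using integral_nonneg_eq_0_iff_AE[of lebesgue "\<lambda>x. cutoff N x * cmod (w x)"] 0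
      by (simp add: cutoff_props(1))
  qed
  then have "AE x in lebesgue. \<forall>N. cutoff N x * cmod (w x) = 0"
    by (intro AE_all_countable[THEN iffD2] allI)
  then show ?thesis
  proof eventually_elim
    fix x assume *: "\<forall>N. cutoff N x * cmod (w x) = 0"
    obtain N :: nat where "norm x \<le> real N" using real_arch_simple by blast
    then show "w x = 0" using * cutoff_props(3)[of x N] by (metis mult_1 norm_eq_zero)
  qed
qed

section \<open>Uniqueness of Fourier transforms\<close>

text \<open>The characteristic function of the standard normal law with density
  \<open>gauss_density\<close>, and a constant multiple of that density. The first fact writes it as
  a superposition of characters, the second makes it integrable.\<close>

definition gauss :: "real ^ 'd \<Rightarrow> real"
  where "gauss y = (\<Prod>i\<in>UNIV. exp (- (y $ i)\<^sup>2 / 2))"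

definition gauss_density :: "real ^ 'd \<Rightarrow> real"
  where "gauss_density y = (\<Prod>i\<in>UNIV. std_normal_density (y $ i))"

lemma cis_sum: "finite S \<Longrightarrow> cis (sum f S) = (\<Prod>i\<in>S. cis (f i))"
  by (induction S rule: finite_induct) (auto simp: cis_mult[symmetric])

lemma std_normal_cis:
  "integrable lborel (\<lambda>x. std_normal_density x *\<^sub>R cis (t * x))"
  "(LINT x|lborel. std_normal_density x *\<^sub>R cis (t * x)) = of_real (exp (- t\<^sup>2 / 2))"
proof -
  have cis_meas: "(\<lambda>x. cis (t * x)) \<in> borel_measurable borel"
    unfolding cis_conv_exp by (intro borel_measurable_continuous_onI continuous_intros)
  show "integrable lborel (\<lambda>x. std_normal_density x *\<^sub>R cis (t * x))"
    by (rule Bochner_Integration.integrable_bound[OF integrable_normal_density[of 1 0]])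
      (use cis_meas in \<open>auto simp: normal_density_nonneg\<close>)
  have "of_real (exp (- t\<^sup>2 / 2)) = char std_normal_distribution t"
    by (simp add: char_std_normal_distribution)
  also have "\<dots> = (LINT x|lborel. std_normal_density x *\<^sub>R cis (t * x))"
    unfolding char_def cis_conv_exp by (subst integral_density) (auto simp: normal_density_nonneg)
  finally show "(LINT x|lborel. std_normal_density x *\<^sub>R cis (t * x)) = of_real (exp (- t\<^sup>2 / 2))" ..
qed

lemma gauss_fourier:
  fixes y :: "real ^ 'd"
  shows "(LINT z|lborel. of_real (gauss_density z) * cis (z \<bullet> y)) = of_real (gauss y)"
proof -
  have eq: "of_real (gauss_density z) * cis (z \<bullet> y) = (\<Prod>i\<in>UNIV. std_normal_density (z $ i) *\<^sub>R cis (y $ i * z $ i))" for z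
    by (simp add: gauss_density_def inner_vec_def cis_sum scaleR_conv_of_real prod.distrib mult.commute)
  show ?thesis
    unfolding eq
    by (subst lborel_integral_prod_vec(2)[where f = "\<lambda>i t. std_normal_density t *\<^sub>R cis (y $ i * t)"])
      (simp_all add: std_normal_cis gauss_def)
qed

lemma gauss_density_integrable: "integrable lborel (gauss_density :: real ^ 'd \<Rightarrow> real)"
proof -
  have "integrable lborel (\<lambda>x::real ^ 'd. \<Prod>i\<in>UNIV. complex_of_real (std_normal_density (x $ i)))"
    by (rule lborel_integral_prod_vec(1)) simp
  then have "integrable lborel (\<lambda>x::real ^ 'd. complex_of_real (gauss_density x))"
    by (simp add: gauss_density_def)
  then show ?thesis by (simp only: complex_of_real_integrable_eq)
qed

lemma gauss_density_nonneg: "0 \<le> gauss_density x"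
  unfolding gauss_density_def by (intro prod_nonneg) (simp add: normal_density_nonneg)

lemma gauss_eq: "gauss x = sqrt (2 * pi) ^ CARD('d) * gauss_density x" for x :: "real ^ 'd"
  by (simp add: gauss_def gauss_density_def std_normal_density_def prod.distrib prod_dividef power_divide)

lemma gauss_pos: "0 < gauss x" and gauss_le_1: "gauss x \<le> 1"
  unfolding gauss_def by (auto intro!: prod_pos prod_le_1)

lemma gauss_borel [measurable]: "gauss \<in> borel_measurable borel"
  and gauss_density_borel [measurable]: "gauss_density \<in> borel_measurable borel"
  unfolding gauss_def gauss_density_def by measurable

lemma gauss_integrable: "integrable lborel (gauss :: real ^ 'd \<Rightarrow> real)"
  unfolding gauss_eq by (intro integrable_mult_right gauss_density_integrable)

lemma gauss_uminus: "gauss (- x) = gauss x"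
  by (simp add: gauss_def)

lemma gauss_integral_pos: "0 < (LINT x|lborel. gauss (x :: real ^ 'd))"
proof -
  have "(LINT z|lborel. of_real (gauss_density z) * cis (z \<bullet> (0 :: real ^ 'd))) = of_real (gauss (0 :: real ^ 'd))"
    by (rule gauss_fourier)
  then have "(LINT z|lborel. complex_of_real (gauss_density (z :: real ^ 'd))) = 1"
    by (simp add: gauss_def)
  then have "(LINT z|lborel. gauss_density (z :: real ^ 'd)) = 1"
    by (simp only: integral_complex_of_real of_real_eq_1_iff)
  then show ?thesis unfolding gauss_eq by simp
qed

lemma cis_borel [measurable]: "cis \<in> borel_measurable borel"
  unfolding cis_conv_exp by (intro borel_measurable_continuous_onI continuous_intros)

text \<open>Fubini's theorem is applied over \<open>lborel\<close>, where functions have to be Borel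
  measurable; Lebesgue integrals are first rewritten with such a representative.\<close>

lemma borel_version:
  fixes f :: "'a::euclidean_space \<Rightarrow> complex"
  assumes "f \<in> borel_measurable lebesgue"
  obtains f' where "f' \<in> borel_measurable borel" "AE x in lebesgue. f x = f' x"
proof -
  have "(\<lambda>x. Re (f x)) \<in> borel_measurable lebesgue" "(\<lambda>x. Im (f x)) \<in> borel_measurable lebesgue"
    using assms by auto
  then obtain u v where uv: "u \<in> borel_measurable lborel" "v \<in> borel_measurable lborel"
    "AE x in lborel. Re (f x) = u x" "AE x in lborel. Im (f x) = v x"
    by (metis completion_ex_borel_measurable_real)
  have "(\<lambda>x. of_real (u x) + \<i> * of_real (v x)) \<in> borel_measurable borel"
    using uv by measurable
  moreover have "AE x in lebesgue. f x = of_real (u x) + \<i> * of_real (v x)"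
    using AE_completion[OF uv(3)] AE_completion[OF uv(4)] by eventually_elim (simp add: complex_eq_iff)
  ultimately show thesis using that by blast
qed

lemma borel_version_integral:
  fixes f f' :: "'a::euclidean_space \<Rightarrow> complex"
  assumes f: "integrable lebesgue f" and f': "f' \<in> borel_measurable borel" and eq: "AE x in lebesgue. f x = f' x"
    and k: "k \<in> borel_measurable borel"
  shows "integrable lborel f'" "(LINT x|lebesgue. f x * k x) = (LINT x|lborel. f' x * k x)"
proof -
  have "integrable lebesgue f'"
    using integrable_cong_AE[of f lebesgue f'] f f' eq borel_measurable_integrable[OF f] by (simp add: measurable_completion)
  then show "integrable lborel f'" using f' by (simp add: integrable_completion)
  have k': "k \<in> borel_measurable lebesgue" "f' \<in> borel_measurable lebesgue"
    using k f' by (auto intro!: measurable_completion)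
  have "(LINT x|lebesgue. f x * k x) = (LINT x|lebesgue. f' x * k x)"
  proof (rule integral_cong_AE)
    show "(\<lambda>x. f x * k x) \<in> borel_measurable lebesgue" "(\<lambda>x. f' x * k x) \<in> borel_measurable lebesgue"
      using k' borel_measurable_integrable[OF f] by measurable
    show "AE x in lebesgue. f x * k x = f' x * k x"
      using eq by eventually_elim simp
  qed
  also have "\<dots> = (LINT x|lborel. f' x * k x)"
    by (rule integral_completion) (use f' k in auto)
  finally show "(LINT x|lebesgue. f x * k x) = (LINT x|lborel. f' x * k x)" .
qed

text \<open>A bounded kernel keeps \<open>u x * v y * k x y\<close> absolutely integrable on the
  product, so the order of integration may be exchanged.\<close>

lemma Fubini_kernel:
  fixes u v :: "'a::euclidean_space \<Rightarrow> complex"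
  assumes u: "integrable lborel u" and v: "integrable lborel v"
    and k [measurable]: "(\<lambda>(x, y). k x y) \<in> borel_measurable (borel \<Otimes>\<^sub>M borel)"
    and k1: "\<And>x y. cmod (k x y) \<le> 1"
  shows "(LINT x|lborel. u x * (LINT y|lborel. v y * k x y)) = (LINT y|lborel. v y * (LINT x|lborel. u x * k x y))"
proof -
  have [measurable]: "u \<in> borel_measurable borel" "v \<in> borel_measurable borel"
    using u v by auto
  have meas: "(\<lambda>(x, y). u x * v y * k x y) \<in> borel_measurable (lborel \<Otimes>\<^sub>M lborel)" by measurable
  have vk: "integrable lborel (\<lambda>y. u x * v y * k x y)" for x
  proof (rule Bochner_Integration.integrable_bound)
    show "integrable lborel (\<lambda>y. u x * v y)" using v by simp
    show "AE y in lborel. norm (u x * v y * k x y) \<le> norm (u x * v y)"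
      using k1 by (auto simp: norm_mult mult_left_le)
  qed measurable
  have "integrable (lborel \<Otimes>\<^sub>M lborel) (\<lambda>(x, y). u x * v y * k x y)"
  proof (rule lborel_pair.Fubini_integrable[OF meas])
    show "integrable lborel (\<lambda>x. LINT y|lborel. norm (case (x, y) of (x, y) \<Rightarrow> u x * v y * k x y))"
    proof (rule Bochner_Integration.integrable_bound)
      show "integrable lborel (\<lambda>x. cmod (u x) * (LINT y|lborel. cmod (v y)))" using u by simp
      show "(\<lambda>x. LINT y|lborel. norm (case (x, y) of (x, y) \<Rightarrow> u x * v y * k x y)) \<in> borel_measurable lborel"
        by measurable
      have "(LINT y|lborel. cmod (u x * v y * k x y)) \<le> (LINT y|lborel. cmod (u x) * cmod (v y))" for x
      proof (rule integral_mono)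
        show "integrable lborel (\<lambda>y. cmod (u x * v y * k x y))" by (rule integrable_norm[OF vk])
        show "integrable lborel (\<lambda>y. cmod (u x) * cmod (v y))" using v by simp
        show "cmod (u x * v y * k x y) \<le> cmod (u x) * cmod (v y)" for y
          using k1[of x y] by (simp add: norm_mult mult_left_le)
      qed
      then show "AE x in lborel. norm (LINT y|lborel. norm (case (x, y) of (x, y) \<Rightarrow> u x * v y * k x y))
          \<le> norm (cmod (u x) * (LINT y|lborel. cmod (v y)))"
        by (auto simp: abs_mult)
    qed
    show "AE x in lborel. integrable lborel (\<lambda>y. case (x, y) of (x, y) \<Rightarrow> u x * v y * k x y)"
      using vk by simp
  qed
  from lborel_pair.Fubini_integral[OF this]
  have "(LINT x|lborel. LINT y|lborel. u x * (v y * k x y)) = (LINT y|lborel. LINT x|lborel. v y * (u x * k x y))"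
    by (simp add: mult_ac)
  then show ?thesis by simp
qed

text \<open>Scaled and translated Gaussians are superpositions of characters, so \<open>w\<close>
  annihilates them. Superposing their translates with weight \<open>g\<close> gives an approximate
  identity applied to \<open>g\<close>; in the limit \<open>w\<close> annihilates \<open>g\<close>
  itself, and test functions determine \<open>w\<close>.\<close>

lemma AE_0_if_fourier_0:
  fixes w :: "real ^ 'd \<Rightarrow> complex"
  assumes w: "integrable lebesgue w" and zero: "\<And>b. (LINT x|lebesgue. w x * cis (b \<bullet> x)) = 0"
  shows "AE x in lebesgue. w x = 0"
proof (rule AE_0_if_orthogonal_Cc[OF w])
  fix g :: "real ^ 'd \<Rightarrow> complex" assume g: "g \<in> Cc"
  obtain w' where w': "w' \<in> borel_measurable borel" "AE x in lebesgue. w x = w' x"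
    using borel_version borel_measurable_integrable[OF w] by blast
  note [measurable] = w'(1) Cc_measurable(1)[OF g]
  note wi = borel_version_integral[OF w w']
  have w'i: "integrable lborel w'" using wi(1)[of "\<lambda>_. 1"] by simp
  have zero': "(LINT x|lborel. w' x * cis (b \<bullet> x)) = 0" for b
    using zero[of b] wi(2)[of "\<lambda>x. cis (b \<bullet> x)"] by simp
  have gi: "integrable lborel g"
    using Cc_integrable[OF g] Cc_measurable(1)[OF g] by (simp add: integrable_completion)
  obtain B R where "\<And>x. cmod (g x) \<le> B * indicator (cball 0 R) x" using Cc_bounded[OF g] by blast
  then have B: "cmod (g x) \<le> \<bar>B\<bar>" for x
    by (rule order_trans) (auto simp: indicator_def)
  have A: "(LINT x|lborel. w' x * of_real (gauss (real n *\<^sub>R (x - a)))) = 0" for n a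
  proof -
    have "(LINT x|lborel. w' x * of_real (gauss (real n *\<^sub>R (x - a))))
        = (LINT x|lborel. w' x * (LINT z|lborel. of_real (gauss_density z) * cis (z \<bullet> (real n *\<^sub>R (x - a)))))"
      by (simp only: gauss_fourier)
    also have "\<dots> = (LINT z|lborel. of_real (gauss_density z) * (LINT x|lborel. w' x * cis (z \<bullet> (real n *\<^sub>R (x - a)))))"
      by (rule Fubini_kernel[OF w'i]) (auto simp: gauss_density_integrable)
    also have "(\<lambda>z. LINT x|lborel. w' x * cis (z \<bullet> (real n *\<^sub>R (x - a)))) = (\<lambda>z. 0)"
    proof
      fix z
      have "cis (z \<bullet> (real n *\<^sub>R (x - a))) = cis ((real n *\<^sub>R z) \<bullet> x) * cis (- (real n * (z \<bullet> a)))" for x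
        by (simp add: cis_mult inner_diff_right algebra_simps)
      then show "(LINT x|lborel. w' x * cis (z \<bullet> (real n *\<^sub>R (x - a)))) = 0"
        using zero'[of "real n *\<^sub>R z"] by (simp add: mult.assoc[symmetric])
    qed
    finally show ?thesis by simp
  qed
  \<comment> \<open>The convolution of \<open>g\<close> with a narrow Gaussian after the
    substitution \<open>u = n (x - a)\<close>, in which the integrand converges pointwise and the
    total mass of \<open>gauss\<close> remains as a factor.\<close>
  define K where "K n x = (LINT u|lborel. of_real (gauss u) * g (x - (1 / real n) *\<^sub>R u))" for n x
  have K_eq: "(LINT x|lborel. w' x * K n x) = 0" if n: "n > 0" for n
  proof -
    let ?A = "mat (- real n) :: real ^ 'd ^ 'd"
    have Av: "?A *v x = - real n *\<^sub>R x" for x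
      by (simp add: vec_eq_iff matrix_vector_mult_def mat_def if_distrib if_distribR cong: if_cong)
    have "det ?A = (\<Prod>i::'d\<in>UNIV. ?A $ i $ i)" by (rule det_diagonal) (simp add: mat_def)
    then have det: "det ?A \<noteq> 0" using n by (simp add: mat_def)
    have K2: "K n x = of_real \<bar>det ?A\<bar> * (LINT a|lborel. g a * of_real (gauss (real n *\<^sub>R (x - a))))" for x
    proof -
      let ?F = "\<lambda>u. of_real (gauss u) * g (x - (1 / real n) *\<^sub>R u)"
      have F: "?F \<in> borel_measurable borel" by measurable
      have "(LINT a|lebesgue. ?F (?A *v a - (- real n *\<^sub>R x))) = (1 / \<bar>det ?A\<bar>) *\<^sub>R (LINT u|lebesgue. ?F u)"
        by (rule lebesgue_integral_affine[OF det]) (rule measurable_completion, simp add: F)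
      also have "(LINT u|lebesgue. ?F u) = K n x"
        unfolding K_def by (rule integral_completion) (simp add: F)
      also have "(\<lambda>a. ?F (?A *v a - (- real n *\<^sub>R x))) = (\<lambda>a. g a * of_real (gauss (real n *\<^sub>R (x - a))))"
        using n by (simp add: Av algebra_simps fun_eq_iff)
      also have "(LINT a|lebesgue. g a * of_real (gauss (real n *\<^sub>R (x - a)))) = (LINT a|lborel. g a * of_real (gauss (real n *\<^sub>R (x - a))))"
        by (rule integral_completion) measurable
      finally show ?thesis using det by (simp add: scaleR_conv_of_real)
    qed
    have wK: "(\<lambda>x. w' x * K n x)
        = (\<lambda>x. of_real \<bar>det ?A\<bar> * (w' x * (LINT a|lborel. g a * of_real (gauss (real n *\<^sub>R (x - a))))))"
      unfolding K2 by (intro ext) (rule mult.left_commute)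
    have "(LINT x|lborel. w' x * K n x)
        = of_real \<bar>det ?A\<bar> * (LINT x|lborel. w' x * (LINT a|lborel. g a * of_real (gauss (real n *\<^sub>R (x - a)))))"
      unfolding wK by (rule integral_mult_right_zero)
    also have "(LINT x|lborel. w' x * (LINT a|lborel. g a * of_real (gauss (real n *\<^sub>R (x - a)))))
        = (LINT a|lborel. g a * (LINT x|lborel. w' x * of_real (gauss (real n *\<^sub>R (x - a)))))"
      by (rule Fubini_kernel[OF w'i gi]) (auto simp: gauss_le_1 gauss_pos less_imp_le)
    also have "\<dots> = 0" by (simp add: A)
    finally show ?thesis by simp
  qed
  have gai: "integrable lborel (\<lambda>u::real ^ 'd. \<bar>B\<bar> * gauss u)"
    by (intro integrable_mult_right gauss_integrable)
  have gB: "norm (of_real (gauss u) * g y) \<le> \<bar>B\<bar> * gauss u" for u y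
    using mult_right_mono[OF B[of y] less_imp_le[OF gauss_pos[of u]]] gauss_pos[of u]
    by (simp add: norm_mult mult.commute)
  have K_lim: "(\<lambda>n. K n x) \<longlonglongrightarrow> (LINT u|lborel. of_real (gauss (u :: real ^ 'd)) * g x)" for x
    unfolding K_def
  proof (rule integral_dominated_convergence[where w = "\<lambda>u. \<bar>B\<bar> * gauss u"])
    show "integrable lborel (\<lambda>u::real ^ 'd. \<bar>B\<bar> * gauss u)" by (rule gai)
    have "(\<lambda>n. x - (1 / real n) *\<^sub>R u) \<longlonglongrightarrow> x - 0 *\<^sub>R u" for u
      by (intro tendsto_intros lim_1_over_n)
    then have "(\<lambda>n. g (x - (1 / real n) *\<^sub>R u)) \<longlonglongrightarrow> g x" for u
      using g continuous_on_tendsto_compose[of UNIV g] by (auto simp: Cc_def)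
    then show "AE u in lborel. (\<lambda>n. of_real (gauss u) * g (x - (1 / real n) *\<^sub>R u)) \<longlonglongrightarrow> of_real (gauss u) * g x"
      by (intro AE_I2 tendsto_intros)
    show "AE u in lborel. norm (of_real (gauss u) * g (x - (1 / real n) *\<^sub>R u)) \<le> \<bar>B\<bar> * gauss u" for n
      by (intro AE_I2 gB)
  qed measurable
  have K_bd: "cmod (K n x) \<le> \<bar>B\<bar> * (LINT u|lborel. gauss (u :: real ^ 'd))" for n x
  proof -
    have "cmod (K n x) \<le> (LINT u|lborel. cmod (of_real (gauss u) * g (x - (1 / real n) *\<^sub>R u)))"
      unfolding K_def by (rule integral_norm_bound)
    also have "\<dots> \<le> (LINT u|lborel. \<bar>B\<bar> * gauss (u :: real ^ 'd))"
    proof (rule integral_mono_AE')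
      show "AE u in lborel. cmod (of_real (gauss u) * g (x - (1 / real n) *\<^sub>R u)) \<le> \<bar>B\<bar> * gauss u"
        by (intro AE_I2 gB)
      show "AE u in lborel. 0 \<le> \<bar>B\<bar> * gauss u"
        by (intro AE_I2 mult_nonneg_nonneg less_imp_le[OF gauss_pos]) simp
    qed (rule gai)
    finally show ?thesis by simp
  qed
  have "(\<lambda>n. LINT x|lborel. w' x * K n x) \<longlonglongrightarrow> (LINT x|lborel. w' x * (LINT u|lborel. of_real (gauss (u :: real ^ 'd)) * g x))"
  proof (rule integral_dominated_convergence[where w = "\<lambda>x. cmod (w' x) * (\<bar>B\<bar> * (LINT u|lborel. gauss (u :: real ^ 'd)))"])
    show "(\<lambda>x. w' x * K n x) \<in> borel_measurable lborel" for n unfolding K_def by measurable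
    show "integrable lborel (\<lambda>x. cmod (w' x) * (\<bar>B\<bar> * (LINT u|lborel. gauss (u :: real ^ 'd))))"
      using w'i by simp
    show "AE x in lborel. (\<lambda>n. w' x * K n x) \<longlonglongrightarrow> w' x * (LINT u|lborel. of_real (gauss (u :: real ^ 'd)) * g x)"
      by (intro AE_I2 tendsto_intros K_lim)
    show "AE x in lborel. norm (w' x * K n x) \<le> cmod (w' x) * (\<bar>B\<bar> * (LINT u|lborel. gauss (u :: real ^ 'd)))" for n
      using K_bd by (auto simp: norm_mult intro!: mult_left_mono)
  qed measurable
  \<comment> \<open>The scale \<open>n = 0\<close> is degenerate, so the identity is used from 1
    on.\<close>
  moreover have "\<forall>\<^sub>F n in sequentially. (LINT x|lborel. w' x * K n x) = 0"
    by (intro eventually_sequentiallyI[of 1] K_eq) auto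
  then have "(\<lambda>n. LINT x|lborel. w' x * K n x) \<longlonglongrightarrow> 0" by (rule tendsto_eventually)
  ultimately have "(LINT x|lborel. w' x * (LINT u|lborel. of_real (gauss (u :: real ^ 'd)) * g x)) = 0"
    by (rule LIMSEQ_unique)
  moreover have "(LINT u|lborel. complex_of_real (gauss (u :: real ^ 'd)) * g x) = of_real (LINT u|lborel. gauss (u :: real ^ 'd)) * g x" for x
    by simp
  ultimately have "(LINT x|lborel. of_real (LINT u|lborel. gauss (u :: real ^ 'd)) * (w' x * g x)) = 0"
    by (simp only: mult.left_commute)
  then have "of_real (LINT u|lborel. gauss (u :: real ^ 'd)) * (LINT x|lborel. w' x * g x) = 0"
    by (simp only: integral_mult_right_zero)
  then have "(LINT x|lborel. w' x * g x) = 0"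
    using gauss_integral_pos[where 'd = 'd] by simp
  then show "(LINT x|lebesgue. w x * g x) = 0"
    using wi(2)[of g] by simp
qed

section \<open>Fourier transforms of integrable and of square integrable functions\<close>

lemma fourier_eq_cis: "fourier f \<xi> = (LINT x|lebesgue. f x * cis (- (x \<bullet> \<xi>)))"
  by (simp add: fourier_def cis_conv_exp)

lemma fourier_L1_unique:
  fixes f h :: "real ^ 'd \<Rightarrow> complex"
  assumes f: "integrable lebesgue f" and h: "integrable lebesgue h" and eq: "\<And>\<xi>. fourier f \<xi> = fourier h \<xi>"
  shows "AE x in lebesgue. f x = h x"
proof -
  have ci: "integrable lebesgue (\<lambda>x. g x * cis (b \<bullet> x))" if "integrable lebesgue g" for g :: "real ^ 'd \<Rightarrow> complex" and b
  proof (rule Bochner_Integration.integrable_bound[OF that])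
    have "(\<lambda>x. cis (b \<bullet> x)) \<in> borel_measurable lebesgue" by (rule measurable_completion) measurable
    then show "(\<lambda>x. g x * cis (b \<bullet> x)) \<in> borel_measurable lebesgue"
      using borel_measurable_integrable[OF that] by measurable
  qed (simp add: norm_mult)
  have "AE x in lebesgue. f x - h x = 0"
  proof (rule AE_0_if_fourier_0)
    fix b
    have "fourier g (- b) = (LINT x|lebesgue. g x * cis (b \<bullet> x))" for g :: "real ^ 'd \<Rightarrow> complex"
      by (simp add: fourier_eq_cis inner_commute)
    then have "(LINT x|lebesgue. (f x - h x) * cis (b \<bullet> x)) = fourier f (- b) - fourier h (- b)"
      using ci[OF f] ci[OF h] by (simp add: left_diff_distrib)
    then show "(LINT x|lebesgue. (f x - h x) * cis (b \<bullet> x)) = 0" using eq by simp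
  qed (use f h in simp)
  then show ?thesis by eventually_elim simp
qed

lemma fourier_borel: "integrable lebesgue f \<Longrightarrow> fourier f \<in> borel_measurable borel" for f :: "real ^ 'd \<Rightarrow> complex"
proof -
  assume f: "integrable lebesgue f"
  obtain f' where f': "f' \<in> borel_measurable borel" "AE x in lebesgue. f x = f' x"
    using borel_version borel_measurable_integrable[OF f] by blast
  note [measurable] = f'(1)
  have "fourier f = (\<lambda>\<xi>. LINT x|lborel. f' x * cis (- (x \<bullet> \<xi>)))"
    unfolding fourier_eq_cis by (intro ext borel_version_integral(2)[OF f f']) measurable
  also have "\<dots> \<in> borel_measurable borel" by measurable
  finally show ?thesis .
qed

lemma fourier_bound: "cmod (fourier f \<xi>) \<le> (LINT x|lebesgue. cmod (f x))"
proof -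
  have "cmod (fourier f \<xi>) \<le> (LINT x|lebesgue. cmod (f x * cis (- (x \<bullet> \<xi>))))"
    unfolding fourier_eq_cis by (rule integral_norm_bound)
  then show ?thesis by (simp add: norm_mult)
qed

text \<open>Multiplication formula for a translated Gaussian: the transform moves from
  \<open>g\<close> to the Gaussian. The weights on both sides are square integrable, so the identity
  survives \<open>L2\<close> limits of \<open>g\<close> and of its transform.\<close>

lemma fourier_gauss_pairing:
  fixes g :: "real ^ 'd \<Rightarrow> complex"
  assumes g: "integrable lebesgue g"
  shows "(LINT \<xi>|lebesgue. fourier g \<xi> * of_real (gauss_density (\<xi> - b))) = (LINT x|lebesgue. g x * (cis (- (x \<bullet> b)) * of_real (gauss x)))"
proof -
  obtain f' where f': "f' \<in> borel_measurable borel" "AE x in lebesgue. g x = f' x"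
    using borel_version borel_measurable_integrable[OF g] by blast
  note [measurable] = f'(1)
  note gi = borel_version_integral[OF g f']
  have f'i: "integrable lborel f'" using gi(1)[of "\<lambda>_. 1"] by simp
  have F: "fourier g \<xi> = (LINT x|lborel. f' x * cis (- (x \<bullet> \<xi>)))" for \<xi>
    unfolding fourier_eq_cis by (intro gi(2)) measurable
  have di: "integrable lborel (\<lambda>\<xi>. complex_of_real (gauss_density (\<xi> - b)))"
  proof -
    have "integrable lebesgue (\<lambda>\<xi>. gauss_density (mat 1 *v \<xi> - b))"
      by (subst lebesgue_integral_affine(1)) (auto simp: gauss_density_integrable integrable_completion intro!: measurable_completion)
    then have "integrable lebesgue (\<lambda>\<xi>. gauss_density (\<xi> - b))" by simp
    then have "integrable lborel (\<lambda>\<xi>. gauss_density (\<xi> - b))" by (subst (asm) integrable_completion) auto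
    then show ?thesis by simp
  qed
  have inner: "(LINT \<xi>|lborel. of_real (gauss_density (\<xi> - b)) * cis (- (x \<bullet> \<xi>))) = cis (- (x \<bullet> b)) * of_real (gauss x)" for x
  proof -
    let ?G = "\<lambda>z. complex_of_real (gauss_density z) * cis (z \<bullet> (- x)) * cis (- (x \<bullet> b))"
    have "(LINT \<xi>|lborel. of_real (gauss_density (\<xi> - b)) * cis (- (x \<bullet> \<xi>))) = (LINT \<xi>|lborel. ?G (\<xi> - b))"
      by (intro Bochner_Integration.integral_cong refl)
        (simp add: mult.assoc cis_mult inner_diff_left inner_diff_right inner_commute)
    also have "\<dots> = (LINT \<xi>|lebesgue. ?G (mat 1 *v \<xi> - b))"
      by (subst integral_completion) (auto, measurable)
    also have "\<dots> = (LINT z|lebesgue. ?G z)"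
      by (subst lebesgue_integral_affine(2)) (auto intro!: measurable_completion)
    also have "\<dots> = (LINT z|lborel. ?G z)" by (rule integral_completion) measurable
    also have "\<dots> = (LINT z|lborel. of_real (gauss_density z) * cis (z \<bullet> (- x))) * cis (- (x \<bullet> b))" by simp
    also have "\<dots> = of_real (gauss (- x)) * cis (- (x \<bullet> b))" by (simp only: gauss_fourier)
    finally show ?thesis by (simp add: gauss_uminus mult.commute)
  qed
  have "(LINT \<xi>|lebesgue. fourier g \<xi> * of_real (gauss_density (\<xi> - b)))
      = (LINT \<xi>|lborel. fourier g \<xi> * of_real (gauss_density (\<xi> - b)))"
    by (rule integral_completion) (use fourier_borel[OF g] in measurable)
  also have "\<dots> = (LINT \<xi>|lborel. of_real (gauss_density (\<xi> - b)) * (LINT x|lborel. f' x * cis (- (x \<bullet> \<xi>))))"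
    unfolding F by (simp add: mult.commute)
  also have "\<dots> = (LINT x|lborel. f' x * (LINT \<xi>|lborel. of_real (gauss_density (\<xi> - b)) * cis (- (x \<bullet> \<xi>))))"
    by (rule Fubini_kernel[OF di f'i, where k = "\<lambda>\<xi> x. cis (- (x \<bullet> \<xi>))"]) auto
  also have "\<dots> = (LINT x|lborel. f' x * (cis (- (x \<bullet> b)) * of_real (gauss x)))"
    by (simp only: inner)
  also have "\<dots> = (LINT x|lebesgue. g x * (cis (- (x \<bullet> b)) * of_real (gauss x)))"
    by (rule gi(2)[symmetric]) measurable
  finally show ?thesis .
qed

text \<open>Cauchy-Schwarz with values in \<open>[0, \<infinity>]\<close>, the form in which
  \<open>has_L2_fourier\<close> measures distances, so that individual norms of \<open>D n\<close>
  may be infinite.\<close>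

lemma pairing_tendsto_0:
  fixes D :: "nat \<Rightarrow> 'a \<Rightarrow> complex"
  assumes D: "\<And>n. D n \<in> borel_measurable M" and e: "e \<in> borel_measurable M"
    and e2: "(\<integral>\<^sup>+x. ennreal ((cmod (e x))\<^sup>2) \<partial>M) < \<infinity>"
    and lim: "(\<lambda>n. \<integral>\<^sup>+x. ennreal ((cmod (D n x))\<^sup>2) \<partial>M) \<longlonglongrightarrow> 0"
  shows "(\<lambda>n. LINT x|M. D n x * e x) \<longlonglongrightarrow> 0"
proof -
  let ?C = "\<integral>\<^sup>+x. ennreal ((cmod (e x))\<^sup>2) \<partial>M"
  have bd: "ennreal ((cmod (LINT x|M. D n x * e x))\<^sup>2) \<le> (\<integral>\<^sup>+x. ennreal ((cmod (D n x))\<^sup>2) \<partial>M) * ?C" for n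
  proof (cases "integrable M (\<lambda>x. D n x * e x)")
    case True
    have "ennreal ((cmod (LINT x|M. D n x * e x))\<^sup>2) = (ennreal (cmod (LINT x|M. D n x * e x)))\<^sup>2"
      by (simp add: ennreal_power)
    also have "\<dots> \<le> (\<integral>\<^sup>+x. ennreal (cmod (D n x * e x)) \<partial>M)\<^sup>2"
      by (intro power_mono integral_norm_bound_ennreal True) auto
    also have "\<dots> = (\<integral>\<^sup>+x. ennreal (cmod (D n x)) * ennreal (cmod (e x)) \<partial>M)\<^sup>2"
      by (simp add: norm_mult ennreal_mult)
    also have "\<dots> \<le> (\<integral>\<^sup>+x. (ennreal (cmod (D n x)))\<^sup>2 \<partial>M) * (\<integral>\<^sup>+x. (ennreal (cmod (e x)))\<^sup>2 \<partial>M)"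
      by (rule Cauchy_Schwarz_nn_integral) (use D e in auto)
    finally show ?thesis by (simp add: ennreal_power)
  \<comment> \<open>A Bochner integral that does not exist has the value 0, for which the bound is
    trivial.\<close>
  qed (simp add: not_integrable_integral_eq)
  have L: "(\<lambda>n. (\<integral>\<^sup>+x. ennreal ((cmod (D n x))\<^sup>2) \<partial>M) * ?C) \<longlonglongrightarrow> 0 * ?C"
    using e2 by (intro tendsto_mult_ennreal lim tendsto_const) auto
  have "(\<lambda>n. ennreal ((cmod (LINT x|M. D n x * e x))\<^sup>2)) \<longlonglongrightarrow> 0"
  proof (rule tendsto_sandwich)
    show "\<forall>\<^sub>F n in sequentially. 0 \<le> ennreal ((cmod (LINT x|M. D n x * e x))\<^sup>2)" by simp
    show "\<forall>\<^sub>F n in sequentially. ennreal ((cmod (LINT x|M. D n x * e x))\<^sup>2) \<le> (\<integral>\<^sup>+x. ennreal ((cmod (D n x))\<^sup>2) \<partial>M) * ?C"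
      by (intro always_eventually allI bd)
    show "(\<lambda>n. (\<integral>\<^sup>+x. ennreal ((cmod (D n x))\<^sup>2) \<partial>M) * ?C) \<longlonglongrightarrow> 0" using L by simp
  qed (rule tendsto_const)
  then have "(\<lambda>n. (cmod (LINT x|M. D n x * e x))\<^sup>2) \<longlonglongrightarrow> 0"
    by (subst (asm) ennreal_tendsto_0_iff) auto
  then have "(\<lambda>n. sqrt ((cmod (LINT x|M. D n x * e x))\<^sup>2)) \<longlonglongrightarrow> sqrt 0"
    by (rule tendsto_real_sqrt)
  then show ?thesis by (simp add: tendsto_norm_zero_iff)
qed

text \<open>Both limits in \<open>has_L2_fourier\<close> are tested with Gaussians,
  \<open>E b\<close> in time and \<open>\<phi> b\<close> in frequency, which the multiplication
  formula exchanges. Since \<open>f - h\<close> need not be integrable, uniqueness is applied to its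
  product with the positive function \<open>gauss\<close>.\<close>

lemma fourier_L2_unique:
  fixes f F h :: "real ^ 'd \<Rightarrow> complex"
  assumes hf: "has_L2_fourier f F" and h: "h \<in> L2" and h1: "integrable lebesgue h"
    and eq: "\<And>\<xi>. F \<xi> = fourier h \<xi>"
  shows "AE x in lebesgue. f x = h x"
proof -
  obtain g where f: "f \<in> L2" and F: "F \<in> L2" and g: "\<And>n::nat. g n \<in> L2" "\<And>n. integrable lebesgue (g n)"
    and lim: "(\<lambda>n. \<integral>\<^sup>+x. ennreal ((cmod (g n x - f x))\<^sup>2) \<partial>lebesgue) \<longlonglongrightarrow> 0"
      "(\<lambda>n. \<integral>\<^sup>+\<xi>. ennreal ((cmod (fourier (g n) \<xi> - F \<xi>))\<^sup>2) \<partial>lebesgue) \<longlonglongrightarrow> 0"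
    using hf unfolding has_L2_fourier_def by blast
  define E where "E b x = cis (- (x \<bullet> b)) * complex_of_real (gauss x)" for b x :: "real ^ 'd"
  define \<phi> where "\<phi> b \<xi> = complex_of_real (gauss_density (\<xi> - b))" for b \<xi> :: "real ^ 'd"
  have E_eq: "E b = (\<lambda>x. cis (- (x \<bullet> b)) * complex_of_real (gauss x))"
    and \<phi>_eq: "\<phi> b = (\<lambda>\<xi>. complex_of_real (gauss_density (\<xi> - b)))" for b
    by (simp_all add: E_def \<phi>_def fun_eq_iff)
  have E_norm: "cmod (E b x) = gauss x" for b x
    using gauss_pos[of x] by (simp add: E_def norm_mult)
  have E_meas: "E b \<in> borel_measurable borel" for b
    unfolding E_eq by measurable
  have gsq: "(gauss x)\<^sup>2 \<le> gauss x" for x :: "real ^ 'd"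
    using gauss_pos[of x] gauss_le_1[of x] by (simp add: power2_eq_square mult_left_le)
  have gi: "integrable lebesgue (gauss :: real ^ 'd \<Rightarrow> real)"
    using gauss_integrable by (subst integrable_completion) auto
  have E_L2: "E b \<in> L2" for b
    by (rule L2_bound[OF _ gi]) (use E_meas E_norm gsq in \<open>auto intro!: measurable_completion\<close>)
  have \<phi>_norm: "cmod (\<phi> b \<xi>) = gauss_density (\<xi> - b)" for b \<xi>
    by (simp add: \<phi>_def gauss_density_nonneg)
  have \<phi>_meas: "\<phi> b \<in> borel_measurable borel" for b
    unfolding \<phi>_eq by measurable
  have \<phi>_int: "integrable lebesgue (\<phi> b)" for b
  proof -
    have "integrable lebesgue (\<lambda>\<xi>. complex_of_real (gauss_density (mat 1 *v \<xi> - b)))"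
      by (subst lebesgue_integral_affine(1)[where f = "\<lambda>z. complex_of_real (gauss_density z)"])
        (auto simp: gauss_density_integrable integrable_completion intro!: measurable_completion)
    then show ?thesis by (simp add: \<phi>_eq)
  qed
  have \<phi>_L2: "\<phi> b \<in> L2" for b
  proof -
    let ?c = "1 / sqrt (2 * pi) ^ CARD('d)"
    have "gauss_density x \<le> ?c" for x :: "real ^ 'd"
      using gauss_le_1[of x] unfolding gauss_eq by (simp add: field_simps)
    then have "(cmod (\<phi> b \<xi>))\<^sup>2 \<le> ?c * cmod (\<phi> b \<xi>)" for \<xi>
      unfolding \<phi>_norm power2_eq_square by (intro mult_right_mono gauss_density_nonneg) auto
    then show ?thesis
      by (intro L2_bound[where h = "\<lambda>\<xi>. ?c * cmod (\<phi> b \<xi>)"])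
        (use \<phi>_meas \<phi>_int in \<open>auto intro!: measurable_completion integrable_mult_right integrable_norm simp del: integrable_mult_right_iff\<close>)
  qed
  have prod_int: "integrable lebesgue (\<lambda>x. u x * v x)" if "u \<in> L2" "v \<in> L2" for u v :: "real ^ 'd \<Rightarrow> complex"
    using L2_inner_integrable[OF that(1) L2_cnj[OF that(2)]] by simp
  have fin: "(\<integral>\<^sup>+x. ennreal ((cmod (e x))\<^sup>2) \<partial>lebesgue) < \<infinity>" if "e \<in> L2" for e :: "real ^ 'd \<Rightarrow> complex"
    using L2_square_integrable[OF that] by (simp add: integrable_iff_bounded)
  have key: "(LINT x|lebesgue. f x * E b x) = (LINT x|lebesgue. h x * E b x)" for b
  proof -
    have "(\<lambda>n. LINT x|lebesgue. (g n x - f x) * E b x) \<longlonglongrightarrow> 0"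
      by (rule pairing_tendsto_0[OF _ _ fin[OF E_L2] lim(1)])
        (intro borel_measurable_diff L2_measurable f g E_L2)+
    moreover have "(LINT x|lebesgue. (g n x - f x) * E b x) = (LINT x|lebesgue. g n x * E b x) - (LINT x|lebesgue. f x * E b x)" for n
      using prod_int[OF g(1) E_L2] prod_int[OF f E_L2] by (simp add: left_diff_distrib)
    ultimately have "(\<lambda>n. (LINT x|lebesgue. g n x * E b x) - (LINT x|lebesgue. f x * E b x)) \<longlonglongrightarrow> 0" by simp
    then have 1: "(\<lambda>n. LINT x|lebesgue. g n x * E b x) \<longlonglongrightarrow> (LINT x|lebesgue. f x * E b x)"
      by (simp add: LIM_zero_iff)
    have four_int: "integrable lebesgue (\<lambda>\<xi>. fourier (g n) \<xi> * \<phi> b \<xi>)" for n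
    proof (rule Bochner_Integration.integrable_bound)
      show "integrable lebesgue (\<lambda>\<xi>. (LINT x|lebesgue. cmod (g n x)) * cmod (\<phi> b \<xi>))"
        by (intro integrable_mult_right integrable_norm \<phi>_int)
      show "(\<lambda>\<xi>. fourier (g n) \<xi> * \<phi> b \<xi>) \<in> borel_measurable lebesgue"
        using fourier_borel[OF g(2)] \<phi>_meas by (intro measurable_completion borel_measurable_times) auto
      show "AE \<xi> in lebesgue. norm (fourier (g n) \<xi> * \<phi> b \<xi>) \<le> norm ((LINT x|lebesgue. cmod (g n x)) * cmod (\<phi> b \<xi>))"
        by (intro AE_I2) (simp add: norm_mult abs_mult mult_right_mono fourier_bound)
    qed
    have "(\<lambda>n. LINT \<xi>|lebesgue. (fourier (g n) \<xi> - F \<xi>) * \<phi> b \<xi>) \<longlonglongrightarrow> 0"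
      by (rule pairing_tendsto_0[OF _ _ fin[OF \<phi>_L2] lim(2)])
        (intro borel_measurable_diff L2_measurable F \<phi>_L2 measurable_completion[of "fourier _"], simp add: fourier_borel[OF g(2)],
         intro L2_measurable \<phi>_L2)
    moreover have "(LINT \<xi>|lebesgue. (fourier (g n) \<xi> - F \<xi>) * \<phi> b \<xi>)
        = (LINT \<xi>|lebesgue. fourier (g n) \<xi> * \<phi> b \<xi>) - (LINT \<xi>|lebesgue. F \<xi> * \<phi> b \<xi>)" for n
      using four_int prod_int[OF F \<phi>_L2] by (simp add: left_diff_distrib)
    ultimately have "(\<lambda>n. (LINT \<xi>|lebesgue. fourier (g n) \<xi> * \<phi> b \<xi>) - (LINT \<xi>|lebesgue. F \<xi> * \<phi> b \<xi>)) \<longlonglongrightarrow> 0" by simp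
    then have 2: "(\<lambda>n. LINT \<xi>|lebesgue. fourier (g n) \<xi> * \<phi> b \<xi>) \<longlonglongrightarrow> (LINT \<xi>|lebesgue. F \<xi> * \<phi> b \<xi>)"
      by (simp add: LIM_zero_iff)
    have "(LINT x|lebesgue. f x * E b x) = (LINT \<xi>|lebesgue. F \<xi> * \<phi> b \<xi>)"
      using 1 2 unfolding E_def \<phi>_def fourier_gauss_pairing[OF g(2)] by (rule LIMSEQ_unique)
    also have "\<dots> = (LINT x|lebesgue. h x * E b x)"
      unfolding eq E_def \<phi>_def by (rule fourier_gauss_pairing[OF h1])
    finally show ?thesis .
  qed
  let ?w = "\<lambda>x. (f x - h x) * of_real (gauss x)"
  have E0: "E 0 x = of_real (gauss x)" for x by (simp add: E_def)
  have "AE x in lebesgue. ?w x = 0"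
  proof (rule AE_0_if_fourier_0)
    show "integrable lebesgue ?w"
      using prod_int[OF L2_diff[OF f h] E_L2[of 0]] by (simp add: E0)
    fix b
    have "?w x * cis (b \<bullet> x) = f x * E (- b) x - h x * E (- b) x" for x
      by (simp add: E_def inner_commute algebra_simps)
    then show "(LINT x|lebesgue. ?w x * cis (b \<bullet> x)) = 0"
      using prod_int[OF f E_L2] prod_int[OF h E_L2] key[of "- b"] by simp
  qed
  then show ?thesis
  proof eventually_elim
    fix x assume "?w x = 0"
    then show "f x = h x" using gauss_pos[of x] by simp
  qed
qed

section \<open>Square summable sequences\<close>

lemma norm_vec_square: "(norm x)\<^sup>2 = (\<Sum>i\<in>UNIV. (cmod (x $ i))\<^sup>2)" for x :: "complex ^ 'p"
  by (simp add: norm_vec_def L2_set_def sum_nonneg)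

lemma has_sum_finite_sum:
  fixes f :: "'a \<Rightarrow> 'b \<Rightarrow> 'c::topological_comm_monoid_add"
  shows "(\<And>p. p \<in> P \<Longrightarrow> (f p has_sum s p) A) \<Longrightarrow> ((\<lambda>n. \<Sum>p\<in>P. f p n) has_sum (\<Sum>p\<in>P. s p)) A"
  by (induction P rule: infinite_finite_induct) (auto intro: has_sum_add)

definition l2_inner :: "(int ^ 'd \<Rightarrow> complex ^ 'p) \<Rightarrow> (int ^ 'd \<Rightarrow> complex ^ 'p) \<Rightarrow> complex"
  where "l2_inner v w = (\<Sum>\<^sub>\<infinity>k. \<Sum>i\<in>UNIV. v k $ i * cnj (w k $ i))"

lemma l2_summable: "v \<in> l2 \<Longrightarrow> (\<lambda>k. (norm (v k))\<^sup>2) summable_on UNIV"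
  by (simp add: l2_def)

lemma l2_bound:
  assumes "h summable_on UNIV" "\<And>k. (norm (v k))\<^sup>2 \<le> h k"
  shows "v \<in> l2"
  unfolding l2_def by (auto intro: summable_on_comparison_test[OF assms(1)] assms(2))

lemma l2_add: "v \<in> l2 \<Longrightarrow> w \<in> l2 \<Longrightarrow> (\<lambda>k. v k + w k) \<in> l2"
  by (rule l2_bound[OF summable_on_add[OF summable_on_cmult_right[of _ _ 2] summable_on_cmult_right[of _ _ 2]] norm_add_square_le])
    (auto simp: l2_def)

lemma l2_diff: "v \<in> l2 \<Longrightarrow> w \<in> l2 \<Longrightarrow> (\<lambda>k. v k - w k) \<in> l2"
  by (rule l2_bound[OF summable_on_add[OF summable_on_cmult_right[of _ _ 2] summable_on_cmult_right[of _ _ 2]] norm_diff_square_le])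
    (auto simp: l2_def)

lemma l2_finite_support: "finite {k. v k \<noteq> 0} \<Longrightarrow> v \<in> l2"
  unfolding l2_def by (auto intro!: finite_nonzero_values_imp_summable_on elim: rev_finite_subset)

lemma l2_normsq_nonneg: "0 \<le> l2_normsq v"
  unfolding l2_normsq_def by (rule infsum_nonneg) simp

lemma l2_normsq_add_le: "v \<in> l2 \<Longrightarrow> w \<in> l2 \<Longrightarrow> l2_normsq (\<lambda>k. v k + w k) \<le> 2 * l2_normsq v + 2 * l2_normsq w"
proof -
  assume vw: "v \<in> l2" "w \<in> l2"
  have s: "(\<lambda>k. 2 * (norm (v k))\<^sup>2) summable_on UNIV" "(\<lambda>k. 2 * (norm (w k))\<^sup>2) summable_on UNIV"
    using vw by (auto intro!: summable_on_cmult_right simp: l2_def)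
  have "l2_normsq (\<lambda>k. v k + w k) \<le> (\<Sum>\<^sub>\<infinity>k. 2 * (norm (v k))\<^sup>2 + 2 * (norm (w k))\<^sup>2)"
    unfolding l2_normsq_def
    by (intro infsum_mono norm_add_square_le summable_on_add s l2_summable l2_add vw)
  also have "\<dots> = 2 * l2_normsq v + 2 * l2_normsq w"
    unfolding l2_normsq_def infsum_add[OF s] by (simp add: infsum_cmult_right')
  finally show ?thesis .
qed

lemma l2_normsq_minus: "l2_normsq (\<lambda>k. - v k) = l2_normsq v" "l2_normsq (\<lambda>k. v k - w k) = l2_normsq (\<lambda>k. w k - v k)"
  by (simp_all add: l2_normsq_def norm_minus_commute)

lemma l2_normsq_diff_le: "v \<in> l2 \<Longrightarrow> w \<in> l2 \<Longrightarrow> l2_normsq (\<lambda>k. v k - w k) \<le> 2 * l2_normsq v + 2 * l2_normsq w"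
  using l2_normsq_add_le[of v "\<lambda>k. - w k"] by (simp add: l2_normsq_minus l2_def)

lemma l2_component: "v \<in> l2 \<Longrightarrow> (\<lambda>k. (cmod (v k $ i))\<^sup>2) summable_on UNIV"
  by (rule summable_on_comparison_test[OF l2_summable])
    (auto simp: component_le_norm_cart intro!: power_mono Finite_Cartesian_Product.norm_nth_le)

lemma norm_inner_le:
  fixes x y :: "complex ^ 'p"
  assumes "t > 0"
  shows "2 * cmod (\<Sum>i\<in>UNIV. x $ i * cnj (y $ i)) \<le> t * (norm x)\<^sup>2 + (norm y)\<^sup>2 / t"
proof -
  have "2 * cmod (\<Sum>i\<in>UNIV. x $ i * cnj (y $ i)) \<le> 2 * (\<Sum>i\<in>UNIV. cmod (x $ i) * cmod (y $ i))"
    using norm_sum[of "\<lambda>i. x $ i * cnj (y $ i)" UNIV] by (simp add: norm_mult)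
  also have "\<dots> = (\<Sum>i\<in>UNIV. 2 * (cmod (x $ i) * cmod (y $ i)))" by (simp add: sum_distrib_left)
  also have "\<dots> \<le> (\<Sum>i\<in>UNIV. t * (cmod (x $ i))\<^sup>2 + (cmod (y $ i))\<^sup>2 / t)"
    by (intro sum_mono two_mult_le_weighted assms)
  also have "\<dots> = t * (norm x)\<^sup>2 + (norm y)\<^sup>2 / t"
    by (simp add: norm_vec_square sum.distrib sum_distrib_left sum_divide_distrib)
  finally show ?thesis .
qed

lemma l2_inner_abs_summable:
  assumes "v \<in> l2" "w \<in> l2"
  shows "(\<lambda>k. cmod (\<Sum>i\<in>UNIV. v k $ i * cnj (w k $ i))) summable_on UNIV"
proof (rule summable_on_comparison_test)
  show "(\<lambda>k. (norm (v k))\<^sup>2 + (norm (w k))\<^sup>2) summable_on UNIV"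
    using assms by (intro summable_on_add) (auto simp: l2_def)
  show "cmod (\<Sum>i\<in>UNIV. v k $ i * cnj (w k $ i)) \<le> (norm (v k))\<^sup>2 + (norm (w k))\<^sup>2" for k
    using norm_inner_le[of 1 "v k" "w k"] norm_ge_zero[of "\<Sum>i\<in>UNIV. v k $ i * cnj (w k $ i)"] by linarith
qed auto

lemma l2_inner_summable:
  "v \<in> l2 \<Longrightarrow> w \<in> l2 \<Longrightarrow> (\<lambda>k. \<Sum>i\<in>UNIV. v k $ i * cnj (w k $ i)) summable_on UNIV"
  by (rule abs_summable_summable[OF l2_inner_abs_summable])

lemma l2_inner_amgm:
  assumes v: "v \<in> l2" and w: "w \<in> l2" and t: "t > 0"
  shows "2 * cmod (l2_inner v w) \<le> t * l2_normsq v + l2_normsq w / t"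
proof -
  note s = l2_summable[OF v] l2_summable[OF w]
  have s': "(\<lambda>k. t * (norm (v k))\<^sup>2) summable_on UNIV" "(\<lambda>k. (norm (w k))\<^sup>2 / t) summable_on UNIV"
    using summable_on_cmult_right[OF s(1), of t] summable_on_cmult_left[OF s(2), of "1 / t"] by simp_all
  have "2 * cmod (l2_inner v w) \<le> 2 * (\<Sum>\<^sub>\<infinity>k. cmod (\<Sum>i\<in>UNIV. v k $ i * cnj (w k $ i)))"
    unfolding l2_inner_def using norm_infsum_bound[OF l2_inner_abs_summable[OF v w]] by simp
  also have "\<dots> = (\<Sum>\<^sub>\<infinity>k. 2 * cmod (\<Sum>i\<in>UNIV. v k $ i * cnj (w k $ i)))"
    by (simp add: infsum_cmult_right')
  also have "\<dots> \<le> (\<Sum>\<^sub>\<infinity>k. t * (norm (v k))\<^sup>2 + (norm (w k))\<^sup>2 / t)"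
    by (intro infsum_mono norm_inner_le t summable_on_add s' summable_on_cmult_right l2_inner_abs_summable v w)
  also have "\<dots> = t * l2_normsq v + l2_normsq w / t"
    unfolding infsum_add[OF s'] l2_normsq_def
    using infsum_cmult_left'[of "\<lambda>k. (norm (w k))\<^sup>2" "1 / t" UNIV] by (simp add: infsum_cmult_right')
  finally show ?thesis .
qed

lemma l2_Cauchy_Schwarz:
  assumes "v \<in> l2" "w \<in> l2"
  shows "(cmod (l2_inner v w))\<^sup>2 \<le> l2_normsq v * l2_normsq w"
  by (rule amgm_imp_square_le) (use assms in \<open>auto simp: l2_normsq_nonneg l2_inner_amgm\<close>)

lemma l2_inner_diff_left:
  assumes "v \<in> l2" "v' \<in> l2" "w \<in> l2"
  shows "l2_inner (\<lambda>k. v k - v' k) w = l2_inner v w - l2_inner v' w"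
proof -
  have "l2_inner (\<lambda>k. v k - v' k) w
      = (\<Sum>\<^sub>\<infinity>k. (\<Sum>i\<in>UNIV. v k $ i * cnj (w k $ i)) + - (\<Sum>i\<in>UNIV. v' k $ i * cnj (w k $ i)))"
    by (simp add: l2_inner_def left_diff_distrib sum_subtractf)
  also have "\<dots> = l2_inner v w + - l2_inner v' w"
    unfolding l2_inner_def infsum_uminus[symmetric]
    by (intro infsum_add l2_inner_summable assms summable_on_uminus[THEN iffD2])
  finally show ?thesis by simp
qed

lemma l2_inner_cnj: "cnj (l2_inner v w) = l2_inner w v"
  unfolding l2_inner_def infsum_cnj[symmetric] by (simp add: mult.commute)

lemma l2_inner_diff_right:
  assumes "v \<in> l2" "w \<in> l2" "w' \<in> l2"
  shows "l2_inner v (\<lambda>k. w k - w' k) = l2_inner v w - l2_inner v w'"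
  using arg_cong[OF l2_inner_diff_left[OF assms(2,3,1)], of cnj] by (simp add: l2_inner_cnj)

lemma l2_inner_self: "v \<in> l2 \<Longrightarrow> l2_inner v v = of_real (l2_normsq v)"
proof -
  assume "v \<in> l2"
  have "l2_inner v v = (\<Sum>\<^sub>\<infinity>k. of_real ((norm (v k))\<^sup>2))"
    unfolding l2_inner_def norm_vec_square of_real_sum complex_norm_square ..
  also have "\<dots> = of_real (l2_normsq v)"
    unfolding l2_normsq_def by (rule infsumI[OF has_sum_of_real[OF has_sum_infsum[OF l2_summable]]]) fact
  finally show ?thesis .
qed

section \<open>Truncation, and functionals vanishing on dense sets\<close>

definition restrict_seq :: "(int ^ 'd) set \<Rightarrow> (int ^ 'd \<Rightarrow> complex ^ 'p) \<Rightarrow> int ^ 'd \<Rightarrow> complex ^ 'p"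
  where "restrict_seq A v k = (if k \<in> A then v k else 0)"

lemma restrict_seq_l2: "finite A \<Longrightarrow> restrict_seq A v \<in> l2"
  by (rule l2_finite_support) (rule finite_subset[of _ A], auto simp: restrict_seq_def)

lemma restrict_seq_normsq_le: "v \<in> l2 \<Longrightarrow> finite A \<Longrightarrow> l2_normsq (restrict_seq A v) \<le> l2_normsq v"
  unfolding l2_normsq_def
  by (intro infsum_mono l2_summable restrict_seq_l2) (auto simp: restrict_seq_def)

lemma l2_truncate:
  assumes v: "v \<in> l2" and e: "e > 0"
  obtains A where "finite A" "l2_normsq (\<lambda>k. v k - restrict_seq A v k) < e"
proof -
  have hs: "((\<lambda>k. (norm (v k))\<^sup>2) has_sum l2_normsq v) UNIV"
    unfolding l2_normsq_def by (rule has_sum_infsum[OF l2_summable[OF v]])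
  have "((\<lambda>A. \<Sum>k\<in>A. (norm (v k))\<^sup>2) \<longlongrightarrow> l2_normsq v) (finite_subsets_at_top UNIV)"
    using hs by (simp add: has_sum_def)
  from order_tendstoD(1)[OF this, of "l2_normsq v - e"] e
  have "\<forall>\<^sub>F A in finite_subsets_at_top UNIV. l2_normsq v - e < (\<Sum>k\<in>A. (norm (v k))\<^sup>2)" by simp
  then obtain A where A: "finite A" "l2_normsq v - e < (\<Sum>k\<in>A. (norm (v k))\<^sup>2)"
    by (auto simp: eventually_finite_subsets_at_top)
  have s: "(\<lambda>k. (norm (v k))\<^sup>2) summable_on S" for S
    using summable_on_subset_banach[OF l2_summable[OF v]] by blast
  have "l2_normsq (\<lambda>k. v k - restrict_seq A v k) = (\<Sum>\<^sub>\<infinity>k\<in>-A. (norm (v k))\<^sup>2)"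
    unfolding l2_normsq_def by (rule infsum_cong_neutral) (auto simp: restrict_seq_def)
  moreover have "l2_normsq v = (\<Sum>\<^sub>\<infinity>k\<in>A. (norm (v k))\<^sup>2) + (\<Sum>\<^sub>\<infinity>k\<in>-A. (norm (v k))\<^sup>2)"
    unfolding l2_normsq_def using infsum_Un_disjoint[OF s s, of A "-A"] by simp
  ultimately show thesis using that A by simp
qed

text \<open>Continuity is expressed by compatibility with differences and a quadratic bound, which
  covers linear and conjugate-linear functionals at once. Both occur, as the two arguments of a
  sesquilinear form.\<close>

lemma l2_functional_zero_dense:
  fixes F :: "(int ^ 'd \<Rightarrow> complex ^ 'p) \<Rightarrow> complex"
  assumes diff: "\<And>v w. v \<in> l2 \<Longrightarrow> w \<in> l2 \<Longrightarrow> F (\<lambda>k. v k - w k) = F v - F w"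
    and bound: "\<And>v. v \<in> l2 \<Longrightarrow> (cmod (F v))\<^sup>2 \<le> K * l2_normsq v"
    and dense: "\<And>e. e > 0 \<Longrightarrow> \<exists>u\<in>l2. F u = 0 \<and> l2_normsq (\<lambda>k. v k - u k) < e"
    and v: "v \<in> l2"
  shows "F v = 0"
proof -
  have "(cmod (F v))\<^sup>2 \<le> 0 + e" if "e > 0" for e
  proof -
    \<comment> \<open>The sign of \<open>K\<close> is unknown, so \<open>\<bar>K\<bar> + 1\<close>
      serves as a positive substitute.\<close>
    have "0 < e / (\<bar>K\<bar> + 1)" using that by simp
    then obtain u where u: "u \<in> l2" "F u = 0" "l2_normsq (\<lambda>k. v k - u k) < e / (\<bar>K\<bar> + 1)"
      using dense by blast
    have "(cmod (F v))\<^sup>2 \<le> K * l2_normsq (\<lambda>k. v k - u k)"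
      using bound[OF l2_diff[OF v u(1)]] diff[OF v u(1)] u(2) by simp
    also have "\<dots> \<le> (\<bar>K\<bar> + 1) * l2_normsq (\<lambda>k. v k - u k)"
      by (intro mult_right_mono l2_normsq_nonneg) auto
    also have "\<dots> \<le> (\<bar>K\<bar> + 1) * (e / (\<bar>K\<bar> + 1))"
      using u(3) by (intro mult_left_mono) auto
    finally show ?thesis by simp
  qed
  then have "(cmod (F v))\<^sup>2 \<le> 0" by (rule field_le_epsilon)
  then show ?thesis by simp
qed

text \<open>Truncations are dense in \<open>l2\<close> and are built up one site at a time.\<close>

lemma l2_functional_zero:
  fixes F :: "(int ^ 'd \<Rightarrow> complex ^ 'p) \<Rightarrow> complex"
  assumes diff: "\<And>v w. v \<in> l2 \<Longrightarrow> w \<in> l2 \<Longrightarrow> F (\<lambda>k. v k - w k) = F v - F w"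
    and bound: "\<And>v. v \<in> l2 \<Longrightarrow> (cmod (F v))\<^sup>2 \<le> K * l2_normsq v"
    and site: "\<And>k x. F (\<lambda>m. if m = k then x else 0) = 0"
    and v: "v \<in> l2"
  shows "F v = 0"
proof -
  have fin: "F (restrict_seq A v) = 0" if "finite A" for A
    using that
  proof (induction A rule: finite_induct)
    case empty
    have "restrict_seq {} v = (\<lambda>m. if m = 0 then 0 else 0)" by (auto simp: restrict_seq_def)
    then show ?case using site[of 0 0] by simp
  next
    case (insert k A)
    let ?d = "\<lambda>m. if m = k then v k else 0"
    have d: "?d \<in> l2" by (rule l2_finite_support) (rule finite_subset[of _ "{k}"], auto)
    have "restrict_seq A v = (\<lambda>m. restrict_seq (insert k A) v m - ?d m)"
      using insert.hyps by (auto simp: restrict_seq_def)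
    then have "F (restrict_seq A v) = F (restrict_seq (insert k A) v) - F ?d"
      using diff[OF restrict_seq_l2 d, of "insert k A"] insert.hyps by simp
    then show ?case using insert.IH site by simp
  qed
  show ?thesis
  proof (rule l2_functional_zero_dense[OF diff bound _ v])
    fix e :: real assume "e > 0"
    then obtain A where A: "finite A" "l2_normsq (\<lambda>k. v k - restrict_seq A v k) < e"
      using l2_truncate[OF v] by blast
    then show "\<exists>u\<in>l2. F u = 0 \<and> l2_normsq (\<lambda>k. v k - u k) < e"
      using fin[OF A(1)] restrict_seq_l2[OF A(1)] by blast
  qed
qed

section \<open>Transition operators\<close>

lemma matrix_int_inj:
  assumes "det (rmat M) \<noteq> 0" "M *v m = M *v n"
  shows "m = n"
proof -
  have "rmat M *v lat m = rmat M *v lat n" by (simp only: rmat_mult_lat assms)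
  then have "matrix_inv (rmat M) *v (rmat M *v lat m) = matrix_inv (rmat M) *v (rmat M *v lat n)" by (simp only:)
  then show ?thesis by (simp only: matrix_inv_cancel[OF assms(1)] lat_eq_iff)
qed

text \<open>The substitution \<open>p = k - M *v n\<close> replaces the infinite sum by one over the
  support of \<open>b\<close>, the same for every \<open>n\<close>.\<close>

lemma transition_eq:
  assumes "finitely_supported b"
  shows "transition b M u n = sqrt \<bar>det (rmat M)\<bar> *\<^sub>R (\<Sum>p | b p \<noteq> 0. u (p + M *v n) v* herm (b p))"
proof -
  have fin: "finite {p. b p \<noteq> 0}" using assms by (simp add: finitely_supported_def)
  have herm0: "herm 0 = 0" by (simp add: herm_def vec_eq_iff)
  have "(\<Sum>\<^sub>\<infinity>k. u k v* herm (b (k - M *v n))) = (\<Sum>\<^sub>\<infinity>k\<in>(\<lambda>p. p + M *v n) ` {p. b p \<noteq> 0}. u k v* herm (b (k - M *v n)))"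
  proof (rule infsum_cong_neutral)
    fix k assume "k \<in> UNIV - (\<lambda>p. p + M *v n) ` {p. b p \<noteq> 0}"
    then have "b (k - M *v n) = 0" by (metis (mono_tags, lifting) DiffE diff_add_cancel image_eqI mem_Collect_eq)
    then show "u k v* herm (b (k - M *v n)) = 0" by (simp add: herm0)
  qed auto
  also have "\<dots> = (\<Sum>k\<in>(\<lambda>p. p + M *v n) ` {p. b p \<noteq> 0}. u k v* herm (b (k - M *v n)))"
    using fin by simp
  also have "\<dots> = (\<Sum>p | b p \<noteq> 0. u (p + M *v n) v* herm (b p))"
    by (subst sum.reindex) (auto simp: inj_on_def)
  finally show ?thesis by (simp add: transition_def)
qed

lemma norm_row_mult_le:
  fixes B :: "complex ^ 'q ^ 'p"
  obtains C where "C > 0" "\<And>x. norm (x v* B) \<le> C * norm x"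
proof -
  have "bounded_linear (\<lambda>x. x v* B)"
  proof (rule linear_conv_bounded_linear[THEN iffD1], rule linearI)
    show "(x + y) v* B = x v* B + y v* B" for x y
      by (simp add: vec_eq_iff vector_matrix_mult_def ring_distribs sum.distrib)
    show "(c *\<^sub>R x) v* B = c *\<^sub>R (x v* B)" for c x
      by (simp add: vec_eq_iff vector_matrix_mult_def scaleR_sum_right)
  qed
  then show thesis using that bounded_linear.pos_bounded by (metis mult.commute)
qed

text \<open>Cauchy-Schwarz over the support of \<open>b\<close> leaves finitely many terms
  \<open>v (p + M *v n)\<close>. For fixed \<open>p\<close> the index is injective in
  \<open>n\<close>, so each term samples \<open>v\<close> without repetition and has at most its
  norm.\<close>

lemma transition_bounded_aux:
  fixes b :: "int ^ 'd \<Rightarrow> complex ^ 'r ^ 'q"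
  assumes b: "finitely_supported b" and det: "det (rmat M) \<noteq> 0"
  obtains K where "K \<ge> 0" "\<And>v. v \<in> l2 \<Longrightarrow> transition b M v \<in> l2 \<and> l2_normsq (transition b M v) \<le> K * l2_normsq v"
proof -
  let ?P = "{p. b p \<noteq> 0}"
  have fin: "finite ?P" using b by (simp add: finitely_supported_def)
  have "\<forall>p. \<exists>C. C > 0 \<and> (\<forall>x. norm (x v* herm (b p)) \<le> C * norm x)"
    using norm_row_mult_le by metis
  then obtain C where C: "\<And>p. C p > 0" "\<And>p x. norm (x v* herm (b p)) \<le> C p * norm x" by metis
  let ?c = "\<lambda>p. \<bar>det (rmat M)\<bar> * real (card ?P) * (C p)\<^sup>2"
  have pt: "(norm (transition b M v n))\<^sup>2 \<le> (\<Sum>p\<in>?P. ?c p * (norm (v (p + M *v n)))\<^sup>2)" for v n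
  proof -
    have "(norm (\<Sum>p\<in>?P. v (p + M *v n) v* herm (b p)))\<^sup>2 \<le> (\<Sum>p\<in>?P. C p * norm (v (p + M *v n)))\<^sup>2"
      by (intro power_mono norm_sum[THEN order_trans] sum_mono C) auto
    also have "\<dots> \<le> real (card ?P) * (\<Sum>p\<in>?P. (C p * norm (v (p + M *v n)))\<^sup>2)"
      using Cauchy_Schwarz_ineq_sum[of "\<lambda>_. 1" "\<lambda>p. C p * norm (v (p + M *v n))" ?P] by simp
    finally have "\<bar>det (rmat M)\<bar> * (norm (\<Sum>p\<in>?P. v (p + M *v n) v* herm (b p)))\<^sup>2
        \<le> \<bar>det (rmat M)\<bar> * (real (card ?P) * (\<Sum>p\<in>?P. (C p * norm (v (p + M *v n)))\<^sup>2))"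
      by (intro mult_left_mono) auto
    then show ?thesis
      unfolding transition_eq[OF b] by (simp add: power_mult_distrib sum_distrib_left mult_ac)
  qed
  have shift: "(\<lambda>n. (norm (v (p + M *v n)))\<^sup>2) summable_on UNIV"
    "(\<Sum>\<^sub>\<infinity>n. (norm (v (p + M *v n)))\<^sup>2) \<le> l2_normsq v" if v: "v \<in> l2" for v :: "int ^ 'd \<Rightarrow> complex ^ 'r" and p
  proof -
    let ?R = "range (\<lambda>n. p + M *v n)"
    have inj: "inj (\<lambda>n. p + M *v n)" using matrix_int_inj[OF det] by (auto simp: inj_def)
    have s: "(\<lambda>k. (norm (v k))\<^sup>2) summable_on ?R"
      using summable_on_subset_banach[OF l2_summable[OF v]] by blast
    show "(\<lambda>n. (norm (v (p + M *v n)))\<^sup>2) summable_on UNIV"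
      using s summable_on_reindex[OF inj, of "\<lambda>k. (norm (v k))\<^sup>2"] by (simp add: o_def)
    have "(\<Sum>\<^sub>\<infinity>n. (norm (v (p + M *v n)))\<^sup>2) = (\<Sum>\<^sub>\<infinity>k\<in>?R. (norm (v k))\<^sup>2)"
      using infsum_reindex[OF inj, of "\<lambda>k. (norm (v k))\<^sup>2"] by (simp add: o_def)
    also have "\<dots> \<le> l2_normsq v"
      unfolding l2_normsq_def by (rule infsum_mono_neutral) (use s l2_summable[OF v] in auto)
    finally show "(\<Sum>\<^sub>\<infinity>n. (norm (v (p + M *v n)))\<^sup>2) \<le> l2_normsq v" .
  qed
  show thesis
  proof (rule that[of "\<Sum>p\<in>?P. ?c p"])
    show "0 \<le> (\<Sum>p\<in>?P. ?c p)" by (intro sum_nonneg) auto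
    fix v :: "int ^ 'd \<Rightarrow> complex ^ 'r" assume v: "v \<in> l2"
    have cs: "(\<lambda>n. ?c p * (norm (v (p + M *v n)))\<^sup>2) summable_on UNIV" for p
      by (intro summable_on_cmult_right shift v)
    have hs: "((\<lambda>n. \<Sum>p\<in>?P. ?c p * (norm (v (p + M *v n)))\<^sup>2) has_sum (\<Sum>p\<in>?P. \<Sum>\<^sub>\<infinity>n. ?c p * (norm (v (p + M *v n)))\<^sup>2)) UNIV"
      by (intro has_sum_finite_sum has_sum_infsum cs)
    then have s: "(\<lambda>n. \<Sum>p\<in>?P. ?c p * (norm (v (p + M *v n)))\<^sup>2) summable_on UNIV"
      by (rule has_sum_imp_summable)
    have T: "transition b M v \<in> l2" by (rule l2_bound[OF s pt])
    have "l2_normsq (transition b M v) \<le> (\<Sum>\<^sub>\<infinity>n. \<Sum>p\<in>?P. ?c p * (norm (v (p + M *v n)))\<^sup>2)"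
      unfolding l2_normsq_def by (intro infsum_mono pt s l2_summable T)
    also have "\<dots> = (\<Sum>p\<in>?P. \<Sum>\<^sub>\<infinity>n. ?c p * (norm (v (p + M *v n)))\<^sup>2)"
      by (rule infsumI[OF hs])
    also have "\<dots> = (\<Sum>p\<in>?P. ?c p * (\<Sum>\<^sub>\<infinity>n. (norm (v (p + M *v n)))\<^sup>2))"
      by (simp only: infsum_cmult_right')
    also have "\<dots> \<le> (\<Sum>p\<in>?P. ?c p * l2_normsq v)"
      by (intro sum_mono mult_left_mono shift v) auto
    finally show "transition b M v \<in> l2 \<and> l2_normsq (transition b M v) \<le> (\<Sum>p\<in>?P. ?c p) * l2_normsq v"
      using T by (simp only: sum_distrib_right)
  qed
qed

lemma transition_l2:
  "finitely_supported b \<Longrightarrow> det (rmat M) \<noteq> 0 \<Longrightarrow> v \<in> l2 \<Longrightarrow> transition b M v \<in> l2"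
  using transition_bounded_aux by metis

lemma row_mult_diff: "(x - y) v* B = x v* B - y v* B" for B :: "complex ^ 'q ^ 'p"
  by (simp add: vec_eq_iff vector_matrix_mult_def left_diff_distrib sum_subtractf)

lemma transition_diff:
  assumes "finitely_supported b"
  shows "transition b M (\<lambda>k. v k - w k) = (\<lambda>n. transition b M v n - transition b M w n)"
  by (simp add: fun_eq_iff transition_eq[OF assms] sum_subtractf scaleR_right_diff_distrib row_mult_diff)

section \<open>Refinement equations in the time domain\<close>

lemma seq_hat_eq:
  assumes "finite P" "\<And>k. k \<notin> P \<Longrightarrow> u k = 0"
  shows "seq_hat u \<xi> = (\<Sum>k\<in>P. u k * cis (- (lat k \<bullet> \<xi>)))"
proof -
  have "seq_hat u \<xi> = (\<Sum>\<^sub>\<infinity>k\<in>P. u k * cis (- (lat k \<bullet> \<xi>)))"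
    unfolding seq_hat_def lat_def[symmetric]
    by (rule infsum_cong_neutral) (auto simp: assms cis_conv_exp)
  then show ?thesis using assms by simp
qed

lemma compactly_supported_radius:
  assumes "compactly_supported \<psi>"
  obtains R where "R > 0" "AE x in lebesgue. norm x > R \<longrightarrow> \<psi> x = 0"
proof -
  obtain K where K: "compact K" "AE x in lebesgue. x \<notin> K \<longrightarrow> \<psi> x = 0"
    using assms by (auto simp: compactly_supported_def)
  obtain R where R: "R > 0" "\<And>x. x \<in> K \<Longrightarrow> norm x \<le> R"
    using compact_imp_bounded[OF K(1)] by (auto simp: bounded_pos)
  have "AE x in lebesgue. norm x > R \<longrightarrow> \<psi> x = 0"
    using K(2) by eventually_elim (use R in force)
  with R show thesis using that by blast
qed

lemma compact_L2_integrable: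
  fixes f :: "real ^ 'd \<Rightarrow> complex"
  assumes f: "f \<in> L2" and R: "AE x in lebesgue. norm x > R \<longrightarrow> f x = 0"
  shows "integrable lebesgue f"
proof (rule Bochner_Integration.integrable_bound)
  show "integrable lebesgue (\<lambda>x. 1 * indicator (cball 0 R) x + (cmod (f x))\<^sup>2)"
    by (intro Bochner_Integration.integrable_add integrable_indicator_cball L2_square_integrable f)
  have le: "t \<le> 1 + t\<^sup>2" for t :: real
    using zero_le_power2[of "t - 1/2"] by (simp add: power2_eq_square algebra_simps)
  show "AE x in lebesgue. norm (f x) \<le> norm (1 * indicator (cball 0 R) x + (cmod (f x))\<^sup>2)"
    using R
  proof eventually_elim
    fix x assume "norm x > R \<longrightarrow> f x = 0"
    then show "norm (f x) \<le> norm (1 * indicator (cball 0 R) x + (cmod (f x))\<^sup>2)"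
      using le[of "cmod (f x)"] by (cases "norm x > R") (auto simp: indicator_def)
  qed
qed (rule L2_measurable[OF f])

lemma L2_affine:
  assumes f: "f \<in> L2" and det: "det A \<noteq> 0"
  shows "(\<lambda>x. f (A *v x - a)) \<in> L2"
proof (rule L2I)
  note sq = L2_square_integrable[OF f]
  show "(\<lambda>x. f (A *v x - a)) \<in> borel_measurable lebesgue"
    by (rule lebesgue_integral_affine(3)[OF det L2_measurable[OF f]])
  show "integrable lebesgue (\<lambda>x. (cmod (f (A *v x - a)))\<^sup>2)"
    using lebesgue_integral_affine(1)[OF det borel_measurable_integrable[OF sq]] sq by blast
qed

lemma fourier_affine:
  fixes f :: "real ^ 'd \<Rightarrow> complex"
  assumes f: "f \<in> borel_measurable lebesgue" and det: "det (rmat M) \<noteq> 0"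
  shows "fourier (\<lambda>x. f (rmat M *v x - lat k)) \<xi>
    = (1 / \<bar>det (rmat M)\<bar>) *\<^sub>R (cis (- (lat k \<bullet> (inv_transpose M *v \<xi>))) * fourier f (inv_transpose M *v \<xi>))"
proof -
  let ?\<eta> = "inv_transpose M *v \<xi>"
  let ?G = "\<lambda>y. f y * cis (- (y \<bullet> ?\<eta>)) * cis (- (lat k \<bullet> ?\<eta>))"
  have "(\<lambda>y. cis (- (y \<bullet> ?\<eta>))) \<in> borel_measurable lebesgue" by (rule measurable_completion) measurable
  then have G: "?G \<in> borel_measurable lebesgue" using f by measurable
  have "x \<bullet> \<xi> = (rmat M *v x - lat k) \<bullet> ?\<eta> + lat k \<bullet> ?\<eta>" for x
  proof -
    have "x \<bullet> \<xi> = (?\<eta> v* rmat M) \<bullet> x" by (simp add: inv_transpose_cancel[OF det] inner_commute)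
    also have "\<dots> = ?\<eta> \<bullet> (rmat M *v x)" by (rule dot_lmul_matrix)
    finally have "x \<bullet> \<xi> = (rmat M *v x) \<bullet> ?\<eta>" by (simp only: inner_commute[of ?\<eta>])
    then show ?thesis by (simp add: inner_diff_left)
  qed
  then have "fourier (\<lambda>x. f (rmat M *v x - lat k)) \<xi> = (LINT x|lebesgue. ?G (rmat M *v x - lat k))"
    by (simp add: fourier_eq_cis cis_mult mult.assoc)
  also have "\<dots> = (1 / \<bar>det (rmat M)\<bar>) *\<^sub>R (LINT y|lebesgue. ?G y)"
    by (rule lebesgue_integral_affine(2)[OF det G])
  also have "(LINT y|lebesgue. ?G y) = cis (- (lat k \<bullet> ?\<eta>)) * fourier f ?\<eta>"
    by (simp add: fourier_eq_cis mult.commute)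
  finally show ?thesis .
qed

text \<open>The function whose transform is a mask times the transform of \<open>\<psi>\<close>,
  both taken at \<open>inv_transpose M *v \<xi>\<close>; see \<open>fourier_refine_sum\<close>. The
  determinant cancels the Jacobian of the dilation.\<close>

definition refine_sum ::
    "int ^ 'd ^ 'd \<Rightarrow> (int ^ 'd) set \<Rightarrow> ('r \<Rightarrow> int ^ 'd \<Rightarrow> complex) \<Rightarrow> (real ^ 'd \<Rightarrow> complex ^ 'r) \<Rightarrow> real ^ 'd \<Rightarrow> complex"
  where "refine_sum M P \<beta> \<psi> x =
    of_real \<bar>det (rmat M)\<bar> * (\<Sum>q\<in>UNIV. \<Sum>k\<in>P. \<beta> q k * \<psi> (rmat M *v x - lat k) $ q)"

context
  fixes M :: "int ^ 'd ^ 'd" and P :: "(int ^ 'd) set" and \<beta> :: "'r::finite \<Rightarrow> int ^ 'd \<Rightarrow> complex"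
    and \<psi> :: "real ^ 'd \<Rightarrow> complex ^ 'r"
  assumes det: "det (rmat M) \<noteq> 0" and finP: "finite P" and P: "\<And>q k. k \<notin> P \<Longrightarrow> \<beta> q k = 0"
    and \<psi>: "\<And>q. (\<lambda>x. \<psi> x $ q) \<in> L2" "\<And>q. integrable lebesgue (\<lambda>x. \<psi> x $ q)"
begin

lemma refine_sum_L2: "refine_sum M P \<beta> \<psi> \<in> L2"
  unfolding refine_sum_def[abs_def]
  by (intro L2_cmult L2_sum L2_affine[OF \<psi>(1) det])

lemma refine_sum_integrable: "integrable lebesgue (refine_sum M P \<beta> \<psi>)"
  unfolding refine_sum_def[abs_def]
  by (intro integrable_mult_right Bochner_Integration.integrable_sum
      lebesgue_integral_affine(1)[OF det L2_measurable[OF \<psi>(1)], THEN iffD2] \<psi>(2))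

lemma fourier_refine_sum:
  "fourier (refine_sum M P \<beta> \<psi>) \<xi>
    = (\<Sum>q\<in>UNIV. seq_hat (\<beta> q) (inv_transpose M *v \<xi>) * vfourier \<psi> (inv_transpose M *v \<xi>) $ q)"
proof -
  let ?\<eta> = "inv_transpose M *v \<xi>"
  have int: "integrable lebesgue (\<lambda>x. \<psi> (rmat M *v x - lat k) $ q * cis (- (x \<bullet> \<xi>)))" for q k
  proof (rule Bochner_Integration.integrable_bound)
    show "integrable lebesgue (\<lambda>x. \<psi> (rmat M *v x - lat k) $ q)"
      by (rule lebesgue_integral_affine(1)[OF det L2_measurable[OF \<psi>(1)], THEN iffD2, OF \<psi>(2)])
    have "(\<lambda>x. cis (- (x \<bullet> \<xi>))) \<in> borel_measurable lebesgue" by (rule measurable_completion) measurable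
    then show "(\<lambda>x. \<psi> (rmat M *v x - lat k) $ q * cis (- (x \<bullet> \<xi>))) \<in> borel_measurable lebesgue"
      using lebesgue_integral_affine(3)[OF det L2_measurable[OF \<psi>(1)], of "lat k" q] by measurable
  qed (simp add: norm_mult)
  have "fourier (refine_sum M P \<beta> \<psi>) \<xi>
      = (LINT x|lebesgue. of_real \<bar>det (rmat M)\<bar> * (\<Sum>q\<in>UNIV. \<Sum>k\<in>P. \<beta> q k * (\<psi> (rmat M *v x - lat k) $ q * cis (- (x \<bullet> \<xi>)))))"
    unfolding fourier_eq_cis refine_sum_def by (simp add: sum_distrib_right mult.assoc)
  also have "\<dots> = of_real \<bar>det (rmat M)\<bar> * (\<Sum>q\<in>UNIV. \<Sum>k\<in>P. \<beta> q k * fourier (\<lambda>x. \<psi> (rmat M *v x - lat k) $ q) \<xi>)"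
    using int by (simp add: fourier_eq_cis)
  also have "\<dots> = (\<Sum>q\<in>UNIV. \<Sum>k\<in>P. \<beta> q k * (cis (- (lat k \<bullet> ?\<eta>)) * fourier (\<lambda>x. \<psi> x $ q) ?\<eta>))"
    using det by (simp add: fourier_affine[OF L2_measurable[OF \<psi>(1)] det] sum_distrib_left scaleR_conv_of_real mult_ac)
  also have "\<dots> = (\<Sum>q\<in>UNIV. seq_hat (\<beta> q) ?\<eta> * vfourier \<psi> ?\<eta> $ q)"
    by (simp add: seq_hat_eq[OF finP P] vfourier_def sum_distrib_right mult.assoc)
  finally show ?thesis .
qed

end

section \<open>Coefficients of the affine system\<close>

lemma dilate_shift_L2: "f \<in> L2 \<Longrightarrow> det U \<noteq> 0 \<Longrightarrow> dilate_shift U k f \<in> L2"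
  unfolding dilate_shift_def[abs_def] by (intro L2_cmult L2_affine)

lemma L2_inner_dilate_shift:
  assumes f: "f \<in> L2" and g: "g \<in> L2" and UV: "det U \<noteq> 0" "V ** U = mat 1"
  shows "L2_inner f (dilate_shift U k g) = L2_inner (dilate_shift V 0 f) (\<lambda>x. g (x - k))"
proof -
  have "det V * det U = 1" using UV(2) by (metis det_I det_mul)
  then have detV: "det V = 1 / det U" using UV(1) by (simp add: field_simps)
  then have detV0: "det V \<noteq> 0" using UV(1) by simp
  have VU: "V *v (U *v x) = x" for x using UV(2) by (simp add: matrix_vector_mul_assoc)
  let ?c = "complex_of_real (sqrt \<bar>det U\<bar>)"
  let ?G = "\<lambda>y. ?c * (f (V *v y) * cnj (g (y - k)))"
  have "(\<lambda>y. f (V *v y - 0)) \<in> L2" "(\<lambda>y. g (mat 1 *v y - k)) \<in> L2"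
    by (intro L2_affine f g detV0; simp)+
  then have G: "?G \<in> borel_measurable lebesgue"
    using L2_measurable by (intro borel_measurable_times measurable_compose[OF _ cnj_borel_measurable]) auto
  have "L2_inner f (dilate_shift U k g) = (LINT x|lebesgue. ?G (U *v x - 0))"
    unfolding L2_inner_def dilate_shift_def by (simp add: VU mult_ac)
  also have "\<dots> = (1 / \<bar>det U\<bar>) *\<^sub>R (LINT y|lebesgue. ?G y)"
    by (rule lebesgue_integral_affine(2)[OF UV(1) G])
  also have "\<dots> = of_real (sqrt \<bar>det V\<bar>) * (LINT y|lebesgue. f (V *v y) * cnj (g (y - k)))"
  proof -
    have "(1 / \<bar>det U\<bar>) * sqrt \<bar>det U\<bar> = sqrt \<bar>det V\<bar>"
      using UV(1) unfolding detV by (simp add: real_sqrt_divide field_simps)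
    moreover have "(LINT y|lebesgue. ?G y) = ?c * (LINT y|lebesgue. f (V *v y) * cnj (g (y - k)))"
      by (rule integral_mult_right_zero)
    ultimately show ?thesis
      by (simp only: scaleR_conv_of_real mult.assoc[symmetric] of_real_mult[symmetric])
  qed
  also have "\<dots> = L2_inner (dilate_shift V 0 f) (\<lambda>x. g (x - k))"
    by (simp add: L2_inner_def dilate_shift_def mult.assoc)
  finally show ?thesis .
qed

lemma L2_inner_dilate:
  assumes f: "f \<in> L2" and g: "g \<in> L2" and U: "det U \<noteq> 0"
  shows "L2_inner (dilate_shift U 0 f) (dilate_shift U 0 g) = L2_inner f g"
proof -
  let ?G = "\<lambda>x. f x * cnj (g x)"
  have sq: "complex_of_real \<bar>det U\<bar> = of_real (sqrt \<bar>det U\<bar>) * of_real (sqrt \<bar>det U\<bar>)"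
    by (simp flip: of_real_mult)
  have "L2_inner (dilate_shift U 0 f) (dilate_shift U 0 g) = (LINT x|lebesgue. of_real \<bar>det U\<bar> * ?G (U *v x - 0))"
    unfolding L2_inner_def dilate_shift_def sq
    by (intro Bochner_Integration.integral_cong refl) simp
  also have "\<dots> = of_real \<bar>det U\<bar> * (LINT x|lebesgue. ?G (U *v x - 0))"
    by (rule integral_mult_right_zero)
  also have "(LINT x|lebesgue. ?G (U *v x - 0)) = (1 / \<bar>det U\<bar>) *\<^sub>R (LINT x|lebesgue. ?G x)"
    by (rule lebesgue_integral_affine(2)[OF U borel_measurable_integrable[OF L2_inner_integrable[OF f g]]])
  finally show ?thesis using U by (simp add: L2_inner_def scaleR_conv_of_real)
qed

lemma L2_normsq_dilate: "f \<in> L2 \<Longrightarrow> det U \<noteq> 0 \<Longrightarrow> L2_normsq (dilate_shift U 0 f) = L2_normsq f"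
  using L2_inner_dilate[of f f U] by (simp add: L2_inner_self)

text \<open>These are the sequences \<open>c\<^sub>j f\<close> of the overview. All generators share
  the index \<open>k\<close>, so that the filters act on the sequence through
  \<open>transition\<close>.\<close>

definition coef :: "int ^ 'd ^ 'd \<Rightarrow> (real ^ 'd \<Rightarrow> complex ^ 'r) \<Rightarrow> nat \<Rightarrow> (real ^ 'd \<Rightarrow> complex) \<Rightarrow> int ^ 'd \<Rightarrow> complex ^ 'r"
  where "coef M \<psi> j f k = (\<chi> q. L2_inner f (dilate_shift (matpow (rmat M) j) (lat k) (\<lambda>x. \<psi> x $ q)))"

text \<open>Dilations are unitary, so moving them onto \<open>f\<close> reduces every level to level
  0; bounds found there hold at all levels with the same constant.\<close>

lemma coef_dilate:
  assumes f: "f \<in> L2" and \<psi>: "\<And>q. (\<lambda>x. \<psi> x $ q) \<in> L2" and det: "det (rmat M) \<noteq> 0"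
  shows "coef M \<psi> j f = coef M \<psi> 0 (dilate_shift (matpow (matrix_inv (rmat M)) j) 0 f)"
proof -
  have 1: "det (matpow (rmat M) j) \<noteq> 0" using det by (simp add: det_matpow)
  have 2: "matpow (matrix_inv (rmat M)) j ** matpow (rmat M) j = mat 1"
    by (rule matpow_inverse[OF matrix_inv_cancel(2)[OF det]])
  show ?thesis
    unfolding coef_def by (simp add: fun_eq_iff vec_eq_iff L2_inner_dilate_shift[OF f \<psi> 1 2])
      (simp add: dilate_shift_def[abs_def])
qed

lemma coef_diff:
  assumes "f \<in> L2" "g \<in> L2" "\<And>q. (\<lambda>x. \<psi> x $ q) \<in> L2" "det (rmat M) \<noteq> 0"
  shows "coef M \<psi> j (\<lambda>x. f x - g x) = (\<lambda>k. coef M \<psi> j f k - coef M \<psi> j g k)"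
proof -
  have "det (matpow (rmat M) j) \<noteq> 0" using assms by (simp add: det_matpow)
  then show ?thesis
    using assms unfolding coef_def fun_eq_iff vec_eq_iff by (simp add: L2_inner_diff_left dilate_shift_L2)
qed

text \<open>Subtracting the integer part of \<open>x\<close> moves all lattice points in question
  into one ball around 0, of radius independent of \<open>x\<close>.\<close>

lemma card_lattice_ball:
  fixes R :: real
  obtains N :: nat where "\<And>x :: real ^ 'd. finite {k. norm (x - lat k) \<le> R}" "\<And>x :: real ^ 'd. card {k. norm (x - lat k) \<le> R} \<le> N"
proof -
  obtain Q where Q: "\<And>x :: real ^ 'd. x \<in> unit_cube \<Longrightarrow> norm x \<le> Q"
    using bounded_subset[OF bounded_cbox box_subset_unit_cube(2)] by (auto simp: bounded_iff)
  let ?B = "{m :: int ^ 'd. lat m \<in> cball 0 (R + Q)}"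
  have fin: "finite ?B" by (rule finite_bounded_lattice) simp
  have sub: "{k. norm (x - lat k) \<le> R} \<subseteq> (\<lambda>m. m + floorv x) ` ?B" for x :: "real ^ 'd"
  proof
    fix k assume "k \<in> {k. norm (x - lat k) \<le> R}"
    then have "norm (x - lat k) \<le> R" by simp
    moreover have eq: "lat (k - floorv x) = fracv x - (x - lat k)"
      by (simp add: fracv_def lat_diff)
    have "norm (lat (k - floorv x)) \<le> norm (fracv x) + norm (x - lat k)"
      unfolding eq by (rule norm_triangle_ineq4)
    ultimately have "norm (lat (k - floorv x)) \<le> R + Q"
      using Q[OF fracv_in_unit_cube, of x] by linarith
    then show "k \<in> (\<lambda>m. m + floorv x) ` ?B"
      by (intro image_eqI[of _ _ "k - floorv x"]) auto
  qed
  show thesis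
  proof (rule that[of "card ?B"])
    fix x :: "real ^ 'd"
    show "finite {k. norm (x - lat k) \<le> R}" by (rule finite_subset[OF sub]) (use fin in simp)
    show "card {k. norm (x - lat k) \<le> R} \<le> card ?B"
      by (rule order_trans[OF card_mono[OF finite_imageI[OF fin] sub] card_image_le[OF fin]])
  qed
qed

text \<open>
  A translate \<open>\<phi>(x - k)\<close> only sees \<open>f\<close> on a ball around \<open>k\<close>, and these balls have bounded overlap.
\<close>

lemma Bessel_shifts:
  fixes \<phi> :: "real ^ 'd \<Rightarrow> complex"
  assumes \<phi>: "\<phi> \<in> L2" and R: "AE x in lebesgue. norm x > R \<longrightarrow> \<phi> x = 0"
  obtains B where "B \<ge> 0"
    "\<And>f F. f \<in> L2 \<Longrightarrow> finite F \<Longrightarrow> (\<Sum>k\<in>F. (cmod (L2_inner f (\<lambda>x. \<phi> (x - lat k))))\<^sup>2) \<le> B * L2_normsq f"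
proof -
  obtain N :: nat where N: "\<And>x :: real ^ 'd. finite {k. norm (x - lat k) \<le> R}" "\<And>x :: real ^ 'd. card {k. norm (x - lat k) \<le> R} \<le> N"
    using card_lattice_ball by blast
  have one: "det (mat 1 :: real ^ 'd ^ 'd) \<noteq> 0" by simp
  have shift: "(\<lambda>x. \<phi> (x - lat k)) \<in> L2" for k
    using L2_affine[OF \<phi> one, of "lat k"] by simp
  have shift_norm: "L2_normsq (\<lambda>x. \<phi> (x - lat k)) = L2_normsq \<phi>" for k
    using lebesgue_integral_affine(2)[OF one borel_measurable_integrable[OF L2_square_integrable[OF \<phi>]], of "lat k"]
    by (simp add: L2_normsq_def)
  have shift_R: "AE x in lebesgue. norm (x - lat k) > R \<longrightarrow> \<phi> (x - lat k) = 0" for k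
    using AE_lebesgue_affine[OF one R, of "lat k"] by simp
  show thesis
  proof (rule that[of "real N * L2_normsq \<phi>"])
    show "0 \<le> real N * L2_normsq \<phi>" by (simp add: L2_normsq_nonneg)
    fix f :: "real ^ 'd \<Rightarrow> complex" and F :: "(int ^ 'd) set"
    assume f: "f \<in> L2" and F: "finite F"
    let ?c = "\<lambda>k x. indicator {x. norm (x - lat k) \<le> R} x :: real"
    have meas: "?c k \<in> borel_measurable lebesgue" for k
      by (rule measurable_completion) measurable
    \<comment> \<open>Localisation of \<open>f\<close> to the ball around \<open>lat k\<close> that
      the translate can see; the squared norms add up to at most \<open>N\<close> times that of
      \<open>f\<close>.\<close>
    define g where "g k x = of_real (?c k x) * f x" for k x
    have gsq: "(cmod (g k x))\<^sup>2 = ?c k x * (cmod (f x))\<^sup>2" for k x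
      by (simp add: g_def indicator_def)
    have "g k \<in> borel_measurable lebesgue" for k
      unfolding g_def[abs_def] using meas L2_measurable[OF f] by measurable
    then have g: "g k \<in> L2" for k
      by (rule L2_bound[OF _ L2_square_integrable[OF f]]) (simp add: gsq indicator_def)
    have inner: "L2_inner f (\<lambda>x. \<phi> (x - lat k)) = L2_inner (g k) (\<lambda>x. \<phi> (x - lat k))" for k
      unfolding L2_inner_def
    proof (rule integral_cong_AE)
      show "AE x in lebesgue. f x * cnj (\<phi> (x - lat k)) = g k x * cnj (\<phi> (x - lat k))"
        using shift_R by eventually_elim (auto simp: g_def indicator_def)
    qed (use L2_inner_integrable[OF f shift, THEN borel_measurable_integrable]
        L2_inner_integrable[OF g shift, THEN borel_measurable_integrable] in auto)
    have int: "integrable lebesgue (\<lambda>x. ?c k x * (cmod (f x))\<^sup>2)" for k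
      using L2_square_integrable[OF g, of k] unfolding gsq .
    have sum_c: "(\<Sum>k\<in>F. ?c k x) \<le> real N" for x
    proof -
      have "(\<Sum>k\<in>F. ?c k x) = real (card (F \<inter> {k. norm (x - lat k) \<le> R}))"
        using F by (simp add: indicator_def sum.If_cases)
      also have "\<dots> \<le> real (card {k. norm (x - lat k) \<le> R})"
        using N(1) by (intro of_nat_mono card_mono) auto
      finally show ?thesis using N(2)[of x] by linarith
    qed
    have "(\<Sum>k\<in>F. (cmod (L2_inner f (\<lambda>x. \<phi> (x - lat k))))\<^sup>2) \<le> (\<Sum>k\<in>F. L2_normsq (g k) * L2_normsq \<phi>)"
      unfolding inner using L2_Cauchy_Schwarz[OF g shift] by (intro sum_mono) (simp add: shift_norm)
    also have "\<dots> = L2_normsq \<phi> * (\<Sum>k\<in>F. LINT x|lebesgue. ?c k x * (cmod (f x))\<^sup>2)"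
      unfolding sum_distrib_left L2_normsq_def[of "g _"] gsq by (simp add: mult.commute)
    finally have *: "(\<Sum>k\<in>F. (cmod (L2_inner f (\<lambda>x. \<phi> (x - lat k))))\<^sup>2)
        \<le> L2_normsq \<phi> * (\<Sum>k\<in>F. LINT x|lebesgue. ?c k x * (cmod (f x))\<^sup>2)" .
    have "(\<Sum>k\<in>F. LINT x|lebesgue. ?c k x * (cmod (f x))\<^sup>2) = (LINT x|lebesgue. (\<Sum>k\<in>F. ?c k x) * (cmod (f x))\<^sup>2)"
      using int by (simp add: sum_distrib_right)
    also have "\<dots> \<le> (LINT x|lebesgue. real N * (cmod (f x))\<^sup>2)"
    proof (rule integral_mono)
      show "integrable lebesgue (\<lambda>x. (\<Sum>k\<in>F. ?c k x) * (cmod (f x))\<^sup>2)"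
        unfolding sum_distrib_right using int by simp
      show "integrable lebesgue (\<lambda>x. real N * (cmod (f x))\<^sup>2)" using L2_square_integrable[OF f] by simp
      show "(\<Sum>k\<in>F. ?c k x) * (cmod (f x))\<^sup>2 \<le> real N * (cmod (f x))\<^sup>2" for x
        by (intro mult_right_mono sum_c) simp
    qed
    also have "\<dots> = real N * L2_normsq f" by (simp add: L2_normsq_def)
    finally have "(\<Sum>k\<in>F. LINT x|lebesgue. ?c k x * (cmod (f x))\<^sup>2) \<le> real N * L2_normsq f" .
    from mult_left_mono[OF this L2_normsq_nonneg[of \<phi>]] *
    show "(\<Sum>k\<in>F. (cmod (L2_inner f (\<lambda>x. \<phi> (x - lat k))))\<^sup>2) \<le> real N * L2_normsq \<phi> * L2_normsq f"
      by (simp add: mult_ac)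
  qed
qed

text \<open>The standing assumptions for everything that concerns integer shifts and samples alone;
  the refinement equations join in \<open>affine_bank\<close>.\<close>

locale refinable_vector =
  fixes M :: "int ^ 'd ^ 'd" and \<psi> :: "real ^ 'd \<Rightarrow> complex ^ 'r"
  assumes dil: "dilation_matrix M" and \<psi>_L2: "\<And>q. (\<lambda>x. \<psi> x $ q) \<in> L2" and csupp: "compactly_supported \<psi>"
begin

lemma det: "det (rmat M) \<noteq> 0"
  by (rule dilation_det_nz[OF dil])

lemma radius: obtains R where "R > 0" "\<And>q. AE x in lebesgue. norm x > R \<longrightarrow> \<psi> x $ q = 0"
proof -
  obtain R where R: "R > 0" "AE x in lebesgue. norm x > R \<longrightarrow> \<psi> x = 0"
    using compactly_supported_radius[OF csupp] by blast
  have "AE x in lebesgue. norm x > R \<longrightarrow> \<psi> x $ q = 0" for q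
    using R(2) by eventually_elim auto
  with R(1) show thesis using that by blast
qed

lemma \<psi>_integrable: "integrable lebesgue (\<lambda>x. \<psi> x $ q)"
proof -
  obtain R where "AE x in lebesgue. norm x > R \<longrightarrow> \<psi> x $ q = 0" using radius by blast
  then show ?thesis by (rule compact_L2_integrable[OF \<psi>_L2])
qed

lemma coef_0: "coef M \<psi> 0 f k $ q = L2_inner f (\<lambda>x. \<psi> (x - lat k) $ q)"
  by (simp add: coef_def dilate_shift_def[abs_def])

lemma coef_bounded:
  obtains B where "B > 0" "\<And>f j. f \<in> L2 \<Longrightarrow> coef M \<psi> j f \<in> l2 \<and> l2_normsq (coef M \<psi> j f) \<le> B * L2_normsq f"
proof -
  obtain R where R: "\<And>q. AE x in lebesgue. norm x > R \<longrightarrow> \<psi> x $ q = 0" using radius by blast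
  have "\<forall>q. \<exists>B\<ge>0. \<forall>f F. f \<in> L2 \<longrightarrow> finite F \<longrightarrow> (\<Sum>k\<in>F. (cmod (L2_inner f (\<lambda>x. \<psi> (x - lat k) $ q)))\<^sup>2) \<le> B * L2_normsq f"
    using Bessel_shifts[OF \<psi>_L2 R] by metis
  then obtain B where B: "\<And>q. B q \<ge> 0"
    "\<And>q f F. f \<in> L2 \<Longrightarrow> finite F \<Longrightarrow> (\<Sum>k\<in>F. (cmod (L2_inner f (\<lambda>x. \<psi> (x - lat k) $ q)))\<^sup>2) \<le> B q * L2_normsq f"
    by metis
  \<comment> \<open>The summand 1 makes the constant positive.\<close>
  let ?B = "1 + (\<Sum>q\<in>UNIV. B q)"
  have fin: "(\<Sum>k\<in>F. (norm (coef M \<psi> 0 f k))\<^sup>2) \<le> ?B * L2_normsq f" if "f \<in> L2" "finite F" for f F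
  proof -
    have "(\<Sum>k\<in>F. (norm (coef M \<psi> 0 f k))\<^sup>2) = (\<Sum>q\<in>UNIV. \<Sum>k\<in>F. (cmod (L2_inner f (\<lambda>x. \<psi> (x - lat k) $ q)))\<^sup>2)"
      unfolding norm_vec_square coef_0 by (rule sum.swap)
    also have "\<dots> \<le> (\<Sum>q\<in>UNIV. B q * L2_normsq f)" by (intro sum_mono B that)
    also have "\<dots> \<le> ?B * L2_normsq f"
      using L2_normsq_nonneg[of f] by (simp add: sum_distrib_right[symmetric] ring_distribs)
    finally show ?thesis .
  qed
  have level0: "coef M \<psi> 0 f \<in> l2 \<and> l2_normsq (coef M \<psi> 0 f) \<le> ?B * L2_normsq f" if f: "f \<in> L2" for f
  proof -
    have s: "(\<lambda>k. (norm (coef M \<psi> 0 f k))\<^sup>2) summable_on UNIV"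
      by (rule nonneg_bdd_above_summable_on) (auto intro!: bdd_aboveI2[where M = "?B * L2_normsq f"] fin f)
    then show ?thesis
      unfolding l2_def l2_normsq_def using infsum_le_finite_sums[OF s, of "?B * L2_normsq f"] fin[OF f] by simp
  qed
  show thesis
  proof (rule that[of ?B])
    show "?B > 0" using B(1) by (simp add: add_pos_nonneg sum_nonneg)
    fix f :: "real ^ 'd \<Rightarrow> complex" and j assume f: "f \<in> L2"
    have d: "det (matpow (matrix_inv (rmat M)) j) \<noteq> 0"
      using det by (simp add: det_matpow matrix_inv_cancel(5)[OF det])
    show "coef M \<psi> j f \<in> l2 \<and> l2_normsq (coef M \<psi> j f) \<le> ?B * L2_normsq f"
      unfolding coef_dilate[OF f \<psi>_L2 det, of j]
      using level0[OF dilate_shift_L2[OF f d, of 0]] L2_normsq_dilate[OF f d] by simp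
  qed
qed

lemma coef_l2: "f \<in> L2 \<Longrightarrow> coef M \<psi> j f \<in> l2"
proof -
  obtain B where "\<And>f j. f \<in> L2 \<Longrightarrow> coef M \<psi> j f \<in> l2 \<and> l2_normsq (coef M \<psi> j f) \<le> B * L2_normsq f"
    using coef_bounded by blast
  then show "f \<in> L2 \<Longrightarrow> coef M \<psi> j f \<in> l2" by blast
qed

text \<open>Dilating \<open>f\<close> by \<open>i\<close> steps and sampling \<open>i\<close> levels
  finer cancel. Thus a level 0 sequence is at the same time the level \<open>J\<close> sequence of a
  function of equal norm, and levels can be shifted by one.\<close>

lemma coef_dilate_Suc:
  assumes f: "f \<in> L2"
  shows "coef M \<psi> (j + i) (dilate_shift (matpow (rmat M) i) 0 f) = coef M \<psi> j f"
proof -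
  have di: "det (matpow (rmat M) i) \<noteq> 0" and di': "det (matpow (matrix_inv (rmat M)) i) \<noteq> 0"
    and dj: "det (matpow (rmat M) j) \<noteq> 0"
    using det by (simp_all add: det_matpow matrix_inv_cancel(5)[OF det])
  have inv: "matpow (rmat M) i ** matpow (matrix_inv (rmat M)) i = mat 1"
    by (rule matpow_inverse[OF matrix_inv_cancel(1)[OF det]])
  have add: "matpow (rmat M) (j + i) = matpow (rmat M) j ** matpow (rmat M) i"
    by (induction i) (simp_all add: matpow_Suc2 matrix_mul_assoc)
  have eq: "dilate_shift (matpow (rmat M) (j + i)) (lat k) g = dilate_shift (matpow (rmat M) i) 0 (dilate_shift (matpow (rmat M) j) (lat k) g)" for k and g :: "real ^ 'd \<Rightarrow> complex"
    by (simp add: dilate_shift_def[abs_def] add det_mul abs_mult real_sqrt_mult matrix_vector_mul_assoc mult_ac)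
  show ?thesis
    unfolding coef_def eq by (simp add: fun_eq_iff vec_eq_iff L2_inner_dilate[OF f dilate_shift_L2[OF \<psi>_L2 dj] di])
qed

text \<open>Two-scale relation for a shift by \<open>M^{-1} N n\<close>: one level finer this
  becomes the shift by the integer point \<open>N n\<close>, whatever the dilation \<open>N\<close>
  of the filter.\<close>

lemma refined_inner:
  fixes N :: "int ^ 'd ^ 'd"
  assumes \<phi>: "\<phi> \<in> L2" and ref: "AE x in lebesgue. \<phi> x = refine_sum M P \<beta> \<psi> x" and P: "finite P" and f: "f \<in> L2"
  shows "L2_inner f (dilate_shift (matpow (rmat M) j) (matrix_inv (rmat M) *v lat (N *v n)) \<phi>)
    = of_real (sqrt \<bar>det (rmat M)\<bar>) * (\<Sum>q\<in>UNIV. \<Sum>p\<in>P. cnj (\<beta> q p) * coef M \<psi> (Suc j) f (p + N *v n) $ q)"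
proof -
  let ?a = "matrix_inv (rmat M) *v lat (N *v n)"
  have dj: "det (matpow (rmat M) j) \<noteq> 0" and dSj: "det (matpow (rmat M) (Suc j)) \<noteq> 0"
    using det by (simp_all add: det_matpow)
  let ?D = "\<lambda>q p. dilate_shift (matpow (rmat M) (Suc j)) (lat (p + N *v n)) (\<lambda>x. \<psi> x $ q)"
  let ?c = "complex_of_real (sqrt \<bar>det (rmat M)\<bar>)"
  let ?h = "\<lambda>x. ?c * (\<Sum>q\<in>UNIV. \<Sum>p\<in>P. \<beta> q p * ?D q p x)"
  have D: "?D q p \<in> L2" for q p by (intro dilate_shift_L2 \<psi>_L2 dSj)
  have h: "?h \<in> L2" by (intro L2_cmult L2_sum D)
  have eq: "AE x in lebesgue. dilate_shift (matpow (rmat M) j) ?a \<phi> x = ?h x"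
    using AE_lebesgue_affine[OF dj ref, of ?a]
  proof eventually_elim
    fix x assume *: "\<phi> (matpow (rmat M) j *v x - ?a) = refine_sum M P \<beta> \<psi> (matpow (rmat M) j *v x - ?a)"
    have arg: "rmat M *v (matpow (rmat M) j *v x - ?a) - lat p = matpow (rmat M) (Suc j) *v x - lat (p + N *v n)" for p
      by (simp add: matrix_vector_mult_diff_distrib matrix_inv_cancel[OF det] matpow_Suc matrix_vector_mul_assoc lat_add algebra_simps)
    have sq: "complex_of_real (sqrt \<bar>det (rmat M)\<bar>) * complex_of_real (sqrt \<bar>det (rmat M)\<bar>) = of_real \<bar>det (rmat M)\<bar>"
      by (simp flip: of_real_mult)
    show "dilate_shift (matpow (rmat M) j) ?a \<phi> x = ?h x"
      unfolding dilate_shift_def[of "matpow (rmat M) j"] * refine_sum_def arg sq[symmetric]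
      by (simp add: dilate_shift_def matpow_Suc det_mul abs_mult real_sqrt_mult sum_distrib_left mult_ac)
  qed
  have "L2_inner f (dilate_shift (matpow (rmat M) j) ?a \<phi>) = L2_inner f ?h"
    by (rule L2_inner_cong_AE[OF f dilate_shift_L2[OF \<phi> dj] h eq])
  also have "\<dots> = cnj ?c * (\<Sum>q\<in>UNIV. \<Sum>p\<in>P. cnj (\<beta> q p) * L2_inner f (?D q p))"
    unfolding L2_inner_cmult_right using P f D
    by (simp add: L2_inner_sum_right L2_inner_cmult_right L2_sum L2_cmult)
  finally show ?thesis by (simp add: coef_def)
qed

text \<open>Filtering and subsampling by \<open>N\<close> realises the two-scale relation. The two
  determinant factors are the normalisations of \<open>transition\<close> and of the dilation by
  \<open>M\<close>; \<open>N\<close> is \<open>M 0\<close> for the lowpass filter and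
  \<open>M l\<close> for the others.\<close>

lemma refined_inner_transition:
  fixes b :: "int ^ 'd \<Rightarrow> complex ^ 'r ^ 'q"
  assumes \<phi>: "\<phi> \<in> L2" and ref: "AE x in lebesgue. \<phi> x = refine_sum M {p. b p \<noteq> 0} (\<lambda>q p. b p $ i $ q) \<psi> x"
    and b: "finitely_supported b" and f: "f \<in> L2"
  shows "of_real (sqrt \<bar>det (rmat N)\<bar>) * L2_inner f (dilate_shift (matpow (rmat M) j) (matrix_inv (rmat M) *v lat (N *v n)) \<phi>)
    = of_real (sqrt \<bar>det (rmat M)\<bar>) * transition b N (coef M \<psi> (Suc j) f) n $ i"
proof -
  have "(\<Sum>p | b p \<noteq> 0. v (p + N *v n) v* herm (b p)) $ i = (\<Sum>q\<in>UNIV. \<Sum>p | b p \<noteq> 0. cnj (b p $ i $ q) * v (p + N *v n) $ q)" for v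
    by (simp add: vector_matrix_mult_def herm_def mult.commute) (rule sum.swap)
  then show ?thesis
    using refined_inner[OF \<phi> ref _ f, of j N n] b
    unfolding transition_eq[OF b] vector_scaleR_component
    by (simp add: finitely_supported_def scaleR_conv_of_real mult_ac)
qed

end

section \<open>Bracket products\<close>

lemma unit_cube_radius: obtains Q where "\<And>x :: real ^ 'd. x \<in> unit_cube \<Longrightarrow> norm x \<le> Q"
  using bounded_subset[OF bounded_cbox box_subset_unit_cube(2)] by (auto simp: bounded_iff)

lemma shift_lat:
  fixes g :: "real ^ 'd \<Rightarrow> 'b::{banach, second_countable_topology}"
  assumes g: "integrable lebesgue g"
  shows "integrable lebesgue (\<lambda>x. g (x + lat n))" "(LINT x|lebesgue. g (x + lat n)) = (LINT x|lebesgue. g x)"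
  using lebesgue_integral_affine(1,2)[of "mat 1" g "- lat n"] borel_measurable_integrable[OF g] g by simp_all

text \<open>The lattice cells that meet the ball of radius \<open>R\<close>. For functions supported
  in that ball the periodization is a finite sum over these cells.\<close>

definition tiles :: "real \<Rightarrow> (int ^ 'd) set"
  where "tiles R = {n. \<exists>x\<in>unit_cube. norm (x + lat n) \<le> R}"

lemma finite_tiles: "finite (tiles R :: (int ^ 'd) set)"
proof -
  obtain Q where Q: "\<And>x :: real ^ 'd. x \<in> unit_cube \<Longrightarrow> norm x \<le> Q" using unit_cube_radius by blast
  have "(tiles R :: (int ^ 'd) set) \<subseteq> {n :: int ^ 'd. lat n \<in> cball 0 (R + Q)}"
  proof
    fix n :: "int ^ 'd" assume "n \<in> tiles R"
    then obtain x :: "real ^ 'd" where x: "x \<in> unit_cube" "norm (x + lat n) \<le> R" by (auto simp: tiles_def)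
    have "norm (lat n) \<le> norm (x + lat n) + norm x"
      using norm_triangle_ineq4[of "x + lat n" x] by simp
    with x Q[OF x(1)] show "n \<in> {n. lat n \<in> cball 0 (R + Q)}" by simp
  qed
  then show ?thesis by (rule finite_subset) (rule finite_bounded_lattice, simp)
qed

text \<open>Every point lies in exactly one lattice cell, and outside the listed cells
  \<open>g\<close> vanishes almost everywhere.\<close>

lemma tile_integral:
  fixes g :: "real ^ 'd \<Rightarrow> complex"
  assumes g: "integrable lebesgue g" and R: "AE x in lebesgue. norm x > R \<longrightarrow> g x = 0"
  shows "integrable cube_measure (\<lambda>x. g (x + lat n))"
    and "(LINT x|lebesgue. g x) = (\<Sum>n\<in>tiles R. LINT x|cube_measure. g (x + lat n))"
proof -
  let ?N = "tiles R :: (int ^ 'd) set"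
  let ?h = "\<lambda>n x. indicator unit_cube (x - lat n) *\<^sub>R g x"
  have cube_int: "integrable lebesgue (\<lambda>x. indicator unit_cube x *\<^sub>R g (x + lat n))" for n
    by (rule integrable_mult_indicator[OF lebesgue_unit_cube(1) shift_lat(1)[OF g]])
  then show "integrable cube_measure (\<lambda>x. g (x + lat n))"
    unfolding integrable_cube .
  have h_int: "integrable lebesgue (?h n)" and h_eq: "(LINT x|lebesgue. ?h n x) = (LINT x|cube_measure. g (x + lat n))" for n
    using shift_lat[OF cube_int[of n], of "- n"] unfolding integral_cube by (simp_all add: lat_minus)
  have "AE x in lebesgue. g x = (\<Sum>n\<in>?N. ?h n x)"
    using R
  proof eventually_elim
    fix x assume x: "norm x > R \<longrightarrow> g x = 0"
    have ind: "indicator unit_cube (x - lat n) = (if n = floorv x then 1 else 0 :: real)" for n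
      using floorv_eq_iff[of x n] by (auto simp: indicator_def)
    have "(\<Sum>n\<in>?N. ?h n x) = (if floorv x \<in> ?N then g x else 0)"
      unfolding ind using finite_tiles[where 'd = 'd, of R] by (simp add: if_distrib if_distribR cong: if_cong)
    moreover have "floorv x \<in> ?N" if "norm x \<le> R"
      unfolding tiles_def using that fracv_in_unit_cube[of x] fracv_add[of x] by (auto intro!: bexI[of _ "fracv x"] simp: add.commute)
    ultimately show "g x = (\<Sum>n\<in>?N. ?h n x)" using x by (cases "norm x \<le> R") (auto split: if_splits)
  qed
  then have "(LINT x|lebesgue. g x) = (LINT x|lebesgue. (\<Sum>n\<in>?N. ?h n x))"
    by (intro integral_cong_AE borel_measurable_sum borel_measurable_integrable[OF h_int] borel_measurable_integrable[OF g])
  also have "\<dots> = (\<Sum>n\<in>?N. LINT x|cube_measure. g (x + lat n))"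
    using h_int by (simp add: h_eq)
  finally show "(LINT x|lebesgue. g x) = (\<Sum>n\<in>?N. LINT x|cube_measure. g (x + lat n))" .
qed

lemma L2_cube:
  fixes f :: "real ^ 'd \<Rightarrow> complex"
  assumes "f \<in> L2"
  shows "f \<in> borel_measurable cube_measure" "integrable cube_measure (\<lambda>x. (cmod (f x))\<^sup>2)"
proof -
  show "f \<in> borel_measurable cube_measure"
    by (rule measurable_restrict_space1[OF L2_measurable[OF assms]])
  show "integrable cube_measure (\<lambda>x. (cmod (f x))\<^sup>2)"
    unfolding integrable_cube
    by (rule integrable_mult_indicator[OF lebesgue_unit_cube(1) L2_square_integrable[OF assms]])
qed

text \<open>
  At every point the values \<open>f\<^sup>^(\<xi> + 2\<pi>k)\<close> are the Fourier coefficients of a periodization of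
  \<open>f\<close>, so Bessel's inequality on the cube applies.
\<close>

lemma periodization:
  fixes f :: "real ^ 'd \<Rightarrow> complex"
  assumes f: "f \<in> L2" and R: "AE x in lebesgue. norm x > R \<longrightarrow> f x = 0"
  shows "finite A \<Longrightarrow> (\<Sum>k\<in>A. (cmod (fourier f (\<xi> + (2 * pi) *\<^sub>R lat k)))\<^sup>2)
      \<le> (LINT x|cube_measure. (cmod (\<Sum>n\<in>tiles R. f (x + lat n) * cis (- (lat n \<bullet> \<xi>))))\<^sup>2)"
    and "(LINT x|cube_measure. (cmod (\<Sum>n\<in>tiles R. f (x + lat n) * cis (- (lat n \<bullet> \<xi>))))\<^sup>2)
      \<le> real (card (tiles R :: (int ^ 'd) set)) * L2_normsq f"
    and "integrable cube_measure (\<lambda>t. LINT x|cube_measure. (cmod (\<Sum>n\<in>tiles R. f (x + lat n) * cis (- (lat n \<bullet> ((2 * pi) *\<^sub>R t)))))\<^sup>2)"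
    and "(LINT t|cube_measure. LINT x|cube_measure. (cmod (\<Sum>n\<in>tiles R. f (x + lat n) * cis (- (lat n \<bullet> ((2 * pi) *\<^sub>R t)))))\<^sup>2) = L2_normsq f"
proof -
  let ?N = "tiles R :: (int ^ 'd) set"
  note N1 = finite_tiles[where 'd = 'd, of R]
  note f1 = compact_L2_integrable[OF f R]
  have fn: "(\<lambda>x. f (x + lat n)) \<in> L2" for n
    using L2_affine[OF f, of "mat 1" "- lat n"] by simp
  have Z_L2: "(\<lambda>x. \<Sum>n\<in>?N. f (x + lat n) * cis (- (lat n \<bullet> \<xi>))) \<in> L2" for \<xi>
    unfolding mult.commute[of "f _"] by (intro L2_sum L2_cmult fn)
  let ?Z = "\<lambda>\<xi> x. \<Sum>n\<in>?N. f (x + lat n) * cis (- (lat n \<bullet> \<xi>))"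
  have nsq: "L2_normsq f = (\<Sum>n\<in>?N. LINT x|cube_measure. (cmod (f (x + lat n)))\<^sup>2)"
  proof -
    have "integrable lebesgue (\<lambda>x. complex_of_real ((cmod (f x))\<^sup>2))"
      using L2_square_integrable[OF f] by (simp only: complex_of_real_integrable_eq)
    moreover have "AE x in lebesgue. norm x > R \<longrightarrow> complex_of_real ((cmod (f x))\<^sup>2) = 0"
      using R by eventually_elim auto
    ultimately have "(LINT x|lebesgue. complex_of_real ((cmod (f x))\<^sup>2))
        = (\<Sum>n\<in>?N. LINT x|cube_measure. complex_of_real ((cmod (f (x + lat n)))\<^sup>2))"
      using tile_integral(2)[of "\<lambda>x. complex_of_real ((cmod (f x))\<^sup>2)" R] by blast
    then have "complex_of_real (L2_normsq f) = of_real (\<Sum>n\<in>?N. LINT x|cube_measure. (cmod (f (x + lat n)))\<^sup>2)"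
      unfolding L2_normsq_def integral_complex_of_real of_real_sum .
    then show ?thesis by (simp only: of_real_eq_iff)
  qed
  show "finite A \<Longrightarrow> (\<Sum>k\<in>A. (cmod (fourier f (\<xi> + (2 * pi) *\<^sub>R lat k)))\<^sup>2) \<le> (LINT x|cube_measure. (cmod (?Z \<xi> x))\<^sup>2)"
  proof -
    assume A: "finite A"
    let ?F = "\<lambda>x. cis (- (x \<bullet> \<xi>)) * ?Z \<xi> x"
    have cis_meas: "(\<lambda>x. cis (- (x \<bullet> \<xi>))) \<in> borel_measurable lebesgue" for \<xi> :: "real ^ 'd"
      by (rule measurable_completion) measurable
    have four: "fourier f (\<xi> + (2 * pi) *\<^sub>R lat k) = (LINT x|cube_measure. ?F x * ee (- (lat k \<bullet> x)))" for k
    proof -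
      let ?\<eta> = "\<xi> + (2 * pi) *\<^sub>R lat k"
      let ?g = "\<lambda>x. f x * cis (- (x \<bullet> ?\<eta>))"
      have gi: "integrable lebesgue ?g"
      proof (rule Bochner_Integration.integrable_bound[OF f1])
        show "?g \<in> borel_measurable lebesgue" using L2_measurable[OF f] cis_meas by measurable
      qed (simp add: norm_mult)
      have gR: "AE x in lebesgue. norm x > R \<longrightarrow> ?g x = 0"
        using R by eventually_elim auto
      \<comment> \<open>The factor \<open>ee (lat n \<bullet> lat k)\<close> is 1, so all cells
        contribute with the same character in \<open>x\<close> and the transform is a Fourier
        coefficient on the cube.\<close>
      have shift: "?g (x + lat n) = cis (- (x \<bullet> \<xi>)) * (f (x + lat n) * cis (- (lat n \<bullet> \<xi>))) * ee (- (lat k \<bullet> x))" for x n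
      proof -
        have "cis (- (2 * pi * (lat n \<bullet> lat k))) = 1"
          using ee_lat_inner[of n k] ee_minus[of "lat n \<bullet> lat k"] by (simp add: ee_def)
        moreover have "cis (- ((x + lat n) \<bullet> ?\<eta>)) = cis (- (x \<bullet> \<xi>)) * cis (- (lat n \<bullet> \<xi>)) * ee (- (lat k \<bullet> x)) * cis (- (2 * pi * (lat n \<bullet> lat k)))"
          by (simp add: ee_def cis_mult inner_add_left inner_add_right inner_commute[of "lat k"] algebra_simps)
        ultimately show ?thesis by simp
      qed
      have "fourier f ?\<eta> = (\<Sum>n\<in>?N. LINT x|cube_measure. ?g (x + lat n))"
        unfolding fourier_eq_cis by (rule tile_integral(2)[OF gi gR])
      also have "\<dots> = (LINT x|cube_measure. (\<Sum>n\<in>?N. ?g (x + lat n)))"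
        by (intro Bochner_Integration.integral_sum[symmetric] tile_integral(1)[OF gi gR])
      finally show ?thesis
        unfolding shift by (simp add: sum_distrib_left sum_distrib_right)
    qed
    have F_norm: "cmod (?F x) = cmod (?Z \<xi> x)" for x by (simp add: norm_mult)
    have "?F \<in> borel_measurable lebesgue"
      using L2_measurable[OF Z_L2] cis_meas by measurable
    then have F: "?F \<in> borel_measurable cube_measure" by (rule measurable_restrict_space1)
    have "(\<Sum>k\<in>A. (cmod (fourier f (\<xi> + (2 * pi) *\<^sub>R lat k)))\<^sup>2) \<le> (LINT x|cube_measure. (cmod (?F x))\<^sup>2)"
      unfolding four by (rule cube_Bessel[OF A F]) (unfold F_norm, rule L2_cube(2)[OF Z_L2])
    then show ?thesis
      unfolding F_norm .
  qed
  show "(LINT x|cube_measure. (cmod (?Z \<xi> x))\<^sup>2) \<le> real (card ?N) * L2_normsq f"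
  proof -
    have int: "integrable cube_measure (\<lambda>x. (cmod (f (x + lat n)))\<^sup>2)" for n
      by (rule L2_cube(2)[OF fn])
    have "(LINT x|cube_measure. (cmod (?Z \<xi> x))\<^sup>2) \<le> (LINT x|cube_measure. real (card ?N) * (\<Sum>n\<in>?N. (cmod (f (x + lat n)))\<^sup>2))"
    proof (rule integral_mono)
      fix x
      have "cmod (?Z \<xi> x) \<le> (\<Sum>n\<in>?N. cmod (f (x + lat n)))"
        using norm_sum[of "\<lambda>n. f (x + lat n) * cis (- (lat n \<bullet> \<xi>))" ?N] by (simp add: norm_mult)
      then have "(cmod (?Z \<xi> x))\<^sup>2 \<le> (\<Sum>n\<in>?N. 1 * cmod (f (x + lat n)))\<^sup>2" by (intro power_mono) auto
      also have "\<dots> \<le> real (card ?N) * (\<Sum>n\<in>?N. (cmod (f (x + lat n)))\<^sup>2)"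
        using Cauchy_Schwarz_ineq_sum[of "\<lambda>_. 1" "\<lambda>n. cmod (f (x + lat n))" ?N] by simp
      finally show "(cmod (?Z \<xi> x))\<^sup>2 \<le> real (card ?N) * (\<Sum>n\<in>?N. (cmod (f (x + lat n)))\<^sup>2)" .
    qed (use int L2_cube(2)[OF Z_L2] in auto)
    also have "\<dots> = real (card ?N) * L2_normsq f" using int by (simp add: nsq)
    finally show ?thesis .
  qed
  define c where "c n m = (LINT x|cube_measure. f (x + lat n) * cnj (f (x + lat m)))" for n m
  have prod_int: "integrable cube_measure (\<lambda>x. f (x + lat n) * cnj (f (x + lat m)))" for n m
    unfolding integrable_cube
    by (rule integrable_mult_indicator[OF lebesgue_unit_cube(1) L2_inner_integrable[OF fn fn]])
  \<comment> \<open>As a function of \<open>t\<close> the periodized energy is a trigonometric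
    polynomial; averaging over the cube keeps the terms \<open>n = m\<close>, which make up the
    squared norm of \<open>f\<close>.\<close>
  have expand: "complex_of_real (LINT x|cube_measure. (cmod (?Z ((2 * pi) *\<^sub>R t) x))\<^sup>2)
      = (\<Sum>n\<in>?N. \<Sum>m\<in>?N. c n m * ee (lat (m - n) \<bullet> t))" for t
  proof -
    have cis_ee: "cis (- (lat n \<bullet> ((2 * pi) *\<^sub>R t))) = ee (- (lat n \<bullet> t))" for n by (simp add: ee_def)
    have pt: "complex_of_real ((cmod (?Z ((2 * pi) *\<^sub>R t) x))\<^sup>2)
        = (\<Sum>n\<in>?N. \<Sum>m\<in>?N. ee (lat (m - n) \<bullet> t) * (f (x + lat n) * cnj (f (x + lat m))))" for x
      unfolding complex_norm_square cis_ee
      by (simp add: sum_product lat_diff inner_diff_left ee_diff ee_minus mult_ac) (rule sum.swap)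
    have "complex_of_real (LINT x|cube_measure. (cmod (?Z ((2 * pi) *\<^sub>R t) x))\<^sup>2)
        = (LINT x|cube_measure. (\<Sum>n\<in>?N. \<Sum>m\<in>?N. ee (lat (m - n) \<bullet> t) * (f (x + lat n) * cnj (f (x + lat m)))))"
      unfolding integral_complex_of_real[symmetric] pt ..
    also have "\<dots> = (\<Sum>n\<in>?N. \<Sum>m\<in>?N. c n m * ee (lat (m - n) \<bullet> t))"
      using prod_int by (simp add: c_def mult.commute)
    finally show ?thesis .
  qed
  let ?I = "\<lambda>t. LINT x|cube_measure. (cmod (?Z ((2 * pi) *\<^sub>R t) x))\<^sup>2"
  have "integrable cube_measure (\<lambda>t. complex_of_real (?I t))"
    unfolding expand by (intro Bochner_Integration.integrable_sum integrable_mult_right cube_ee)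
  then show "integrable cube_measure ?I" by (simp only: complex_of_real_integrable_eq)
  have "complex_of_real (LINT t|cube_measure. ?I t) = (LINT t|cube_measure. complex_of_real (?I t))"
    by (rule integral_complex_of_real[symmetric])
  also have "\<dots> = (LINT t|cube_measure. (\<Sum>n\<in>?N. \<Sum>m\<in>?N. c n m * ee (lat (m - n) \<bullet> t)))"
    by (simp only: expand)
  also have "\<dots> = (\<Sum>n\<in>?N. \<Sum>m\<in>?N. c n m * (LINT t|cube_measure. ee (lat (m - n) \<bullet> t)))"
    by (simp add: cube_ee(1))
  also have "\<dots> = (\<Sum>n\<in>?N. \<Sum>m\<in>?N. if n = m then c n m else 0)"
    by (intro sum.cong refl) (simp add: cube_ee(2))
  also have "\<dots> = (\<Sum>n\<in>?N. c n n)" using N1 by simp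
  also have "\<dots> = complex_of_real (L2_normsq f)"
    unfolding nsq of_real_sum integral_complex_of_real[symmetric] complex_norm_square c_def ..
  finally show "(LINT t|cube_measure. ?I t) = L2_normsq f" by (simp only: of_real_eq_iff)
qed

section \<open>Quadratic forms and the Loewner order\<close>

lemma herm_mat_of_real: "herm (mat (complex_of_real c)) = mat (complex_of_real c)"
  by (simp add: herm_def mat_def vec_eq_iff)

lemma herm_add: "herm (A + B) = herm A + herm B" and herm_diff: "herm (A - B) = herm A - herm B"
  by (simp_all add: herm_def vec_eq_iff)

definition qform :: "complex ^ 'n ^ 'n \<Rightarrow> complex ^ 'n \<Rightarrow> real"
  where "qform A x = Re (\<Sum>i\<in>UNIV. cnj (x $ i) * (A *v x) $ i)"

lemma qform_diff: "qform (A - B) x = qform A x - qform B x"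
  by (simp add: qform_def matrix_vector_mult_diff_rdistrib right_diff_distrib sum_subtractf)

lemma qform_add: "qform (A + B) x = qform A x + qform B x"
  by (simp add: qform_def matrix_vector_mult_add_rdistrib ring_distribs sum.distrib)

lemma qform_mat: "qform (mat (complex_of_real c)) x = c * (norm x)\<^sup>2"
proof -
  have "(mat (complex_of_real c) *v x) $ i = of_real c * x $ i" for i
    by (simp add: matrix_vector_mult_def mat_def if_distrib if_distribR cong: if_cong)
  then have "(\<Sum>i\<in>UNIV. cnj (x $ i) * (mat (complex_of_real c) *v x) $ i) = of_real (c * (norm x)\<^sup>2)"
    unfolding norm_vec_square of_real_mult of_real_sum complex_norm_square by (simp add: sum_distrib_left mult_ac)
  then show ?thesis by (simp add: qform_def)
qed

lemma loewner_le_qform: "loewner_le A B \<Longrightarrow> qform A x \<le> qform B x"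
proof -
  assume "loewner_le A B"
  then have "0 \<le> qform (B - A) x" by (simp only: loewner_le_def pos_semidef_def qform_def)
  then show ?thesis by (simp add: qform_diff)
qed

lemma loewner_leI: "herm A = A \<Longrightarrow> herm B = B \<Longrightarrow> (\<And>x. qform A x \<le> qform B x) \<Longrightarrow> loewner_le A B"
  by (simp only: loewner_le_def pos_semidef_def qform_def[symmetric] herm_diff qform_diff) simp

section \<open>Bounds for the bracket product and the Riesz property of the shifts\<close>

context refinable_vector
begin

text \<open>The constant is the number of cells in the periodization times the squared norms, summed
  over the components, and in particular the same for every \<open>\<xi>\<close>.\<close>

lemma vfourier_square_sum_le:
  "\<exists>D\<ge>0. \<forall>A \<xi>. finite A \<longrightarrow> (\<Sum>k\<in>A. (norm (vfourier \<psi> (\<xi> + (2 * pi) *\<^sub>R lat k)))\<^sup>2) \<le> D"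
proof -
  obtain R where R: "\<And>q. AE x in lebesgue. norm x > R \<longrightarrow> \<psi> x $ q = 0" using radius by blast
  have "\<forall>q. \<exists>D\<ge>0. \<forall>A \<xi>. finite A \<longrightarrow> (\<Sum>k\<in>A. (cmod (fourier (\<lambda>x. \<psi> x $ q) (\<xi> + (2 * pi) *\<^sub>R lat k)))\<^sup>2) \<le> D"
  proof
    fix q
    note per = periodization(1,2)[OF \<psi>_L2[of q] R[of q]]
    show "\<exists>D\<ge>0. \<forall>A \<xi>. finite A \<longrightarrow> (\<Sum>k\<in>A. (cmod (fourier (\<lambda>x. \<psi> x $ q) (\<xi> + (2 * pi) *\<^sub>R lat k)))\<^sup>2) \<le> D"
      using order_trans[OF per]
      by (intro exI[of _ "real (card (tiles R :: (int ^ 'd) set)) * L2_normsq (\<lambda>x. \<psi> x $ q)"]) (auto simp: L2_normsq_nonneg)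
  qed
  then obtain D where D: "\<And>q. D q \<ge> 0"
    "\<And>q A \<xi>. finite A \<Longrightarrow> (\<Sum>k\<in>A. (cmod (fourier (\<lambda>x. \<psi> x $ q) (\<xi> + (2 * pi) *\<^sub>R lat k)))\<^sup>2) \<le> D q"
    by metis
  show ?thesis
  proof (intro exI[of _ "\<Sum>q\<in>UNIV. D q"] conjI allI impI)
    show "0 \<le> (\<Sum>q\<in>UNIV. D q)" by (intro sum_nonneg D)
    fix A :: "(int ^ 'd) set" and \<xi> :: "real ^ 'd" assume A: "finite A"
    have "(\<Sum>k\<in>A. (norm (vfourier \<psi> (\<xi> + (2 * pi) *\<^sub>R lat k)))\<^sup>2)
        = (\<Sum>q\<in>UNIV. \<Sum>k\<in>A. (cmod (fourier (\<lambda>x. \<psi> x $ q) (\<xi> + (2 * pi) *\<^sub>R lat k)))\<^sup>2)"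
      unfolding norm_vec_square by (subst sum.swap) (simp add: vfourier_def)
    also have "\<dots> \<le> (\<Sum>q\<in>UNIV. D q)" by (intro sum_mono D A)
    finally show "(\<Sum>k\<in>A. (norm (vfourier \<psi> (\<xi> + (2 * pi) *\<^sub>R lat k)))\<^sup>2) \<le> (\<Sum>q\<in>UNIV. D q)" .
  qed
qed

lemma vfourier_square_summable: "(\<lambda>k. (norm (vfourier \<psi> (\<xi> + (2 * pi) *\<^sub>R lat k)))\<^sup>2) summable_on UNIV"
proof -
  obtain D where "\<forall>A \<xi>. finite A \<longrightarrow> (\<Sum>k\<in>A. (norm (vfourier \<psi> (\<xi> + (2 * pi) *\<^sub>R lat k)))\<^sup>2) \<le> D"
    using vfourier_square_sum_le by blast
  then show ?thesis
    by (intro nonneg_bdd_above_summable_on) (auto intro!: bdd_aboveI2[where M = D])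
qed

lemma bracket_has_sum:
  "((\<lambda>k. vfourier \<psi> (\<xi> + (2 * pi) *\<^sub>R lat k) $ i * cnj (vfourier \<psi> (\<xi> + (2 * pi) *\<^sub>R lat k) $ j))
    has_sum bracket (vfourier \<psi>) (vfourier \<psi>) \<xi> $ i $ j) UNIV"
proof -
  have "cmod (x $ i) * cmod (x $ j) \<le> (norm x)\<^sup>2" for x :: "complex ^ 'r"
    unfolding power2_eq_square by (intro mult_mono Finite_Cartesian_Product.norm_nth_le) auto
  then have "(\<lambda>k. vfourier \<psi> (\<xi> + (2 * pi) *\<^sub>R lat k) $ i * cnj (vfourier \<psi> (\<xi> + (2 * pi) *\<^sub>R lat k) $ j)) summable_on UNIV"
    by (intro abs_summable_summable[OF summable_on_comparison_test[OF vfourier_square_summable[of \<xi>]]])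
      (simp_all add: norm_mult)
  then show ?thesis
    by (simp add: bracket_def lat_def[symmetric])
qed

lemma bracket_herm: "herm (bracket (vfourier \<psi>) (vfourier \<psi>) \<xi>) = bracket (vfourier \<psi>) (vfourier \<psi>) \<xi>"
  by (simp add: herm_def bracket_def vec_eq_iff infsum_cnj[symmetric] mult.commute del: infsum_cnj)

text \<open>The bracket is a Gram matrix along the coset \<open>\<xi> + 2 \<pi> k\<close>: its form
  at \<open>x\<close> collects the squared values there of the transform of one fixed combination of
  the components of \<open>\<psi>\<close>.\<close>

lemma bracket_qform:
  "((\<lambda>k. (cmod (\<Sum>i\<in>UNIV. cnj (x $ i) * vfourier \<psi> (\<xi> + (2 * pi) *\<^sub>R lat k) $ i))\<^sup>2)
    has_sum qform (bracket (vfourier \<psi>) (vfourier \<psi>) \<xi>) x) UNIV"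
proof -
  let ?a = "\<lambda>k. vfourier \<psi> (\<xi> + (2 * pi) *\<^sub>R lat k)"
  let ?B = "bracket (vfourier \<psi>) (vfourier \<psi>) \<xi>"
  have "((\<lambda>k. \<Sum>i\<in>UNIV. \<Sum>j\<in>UNIV. (cnj (x $ i) * x $ j) * (?a k $ i * cnj (?a k $ j)))
      has_sum (\<Sum>i\<in>UNIV. \<Sum>j\<in>UNIV. (cnj (x $ i) * x $ j) * ?B $ i $ j)) UNIV"
    by (intro has_sum_finite_sum has_sum_cmult_right bracket_has_sum)
  moreover have "(\<Sum>i\<in>UNIV. \<Sum>j\<in>UNIV. (cnj (x $ i) * x $ j) * (?a k $ i * cnj (?a k $ j)))
      = of_real ((cmod (\<Sum>i\<in>UNIV. cnj (x $ i) * ?a k $ i))\<^sup>2)" for k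
    unfolding complex_norm_square by (simp add: sum_product mult_ac) (rule sum.swap)
  moreover have "(\<Sum>i\<in>UNIV. \<Sum>j\<in>UNIV. (cnj (x $ i) * x $ j) * ?B $ i $ j) = (\<Sum>i\<in>UNIV. cnj (x $ i) * (?B *v x) $ i)"
    by (simp add: matrix_vector_mult_def sum_distrib_left mult_ac)
  ultimately have "((\<lambda>k. complex_of_real ((cmod (\<Sum>i\<in>UNIV. cnj (x $ i) * ?a k $ i))\<^sup>2))
      has_sum (\<Sum>i\<in>UNIV. cnj (x $ i) * (?B *v x) $ i)) UNIV"
    by simp
  from has_sum_Re[OF this] show ?thesis by (simp add: qform_def)
qed

lemma bracket_upper:
  obtains D where "D \<ge> 0" "\<And>\<xi> x. qform (bracket (vfourier \<psi>) (vfourier \<psi>) \<xi>) x \<le> D * (norm x)\<^sup>2"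
proof -
  obtain D where D: "D \<ge> 0" "\<forall>A \<xi>. finite A \<longrightarrow> (\<Sum>k\<in>A. (norm (vfourier \<psi> (\<xi> + (2 * pi) *\<^sub>R lat k)))\<^sup>2) \<le> D"
    using vfourier_square_sum_le by blast
  show thesis
  proof (rule that[OF D(1)])
    fix \<xi> :: "real ^ 'd" and x :: "complex ^ 'r"
    let ?a = "\<lambda>k. vfourier \<psi> (\<xi> + (2 * pi) *\<^sub>R lat k)"
    have pt: "(cmod (\<Sum>i\<in>UNIV. cnj (x $ i) * ?a k $ i))\<^sup>2 \<le> (norm x)\<^sup>2 * (norm (?a k))\<^sup>2" for k
    proof -
      have "(cmod (\<Sum>i\<in>UNIV. cnj (x $ i) * ?a k $ i))\<^sup>2 \<le> (\<Sum>i\<in>UNIV. cmod (x $ i) * cmod (?a k $ i))\<^sup>2"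
        using norm_sum[of "\<lambda>i. cnj (x $ i) * ?a k $ i" UNIV] by (intro power_mono) (simp_all add: norm_mult)
      also have "\<dots> \<le> (norm x)\<^sup>2 * (norm (?a k))\<^sup>2"
        unfolding norm_vec_square by (rule Cauchy_Schwarz_ineq_sum)
      finally show ?thesis .
    qed
    show "qform (bracket (vfourier \<psi>) (vfourier \<psi>) \<xi>) x \<le> D * (norm x)\<^sup>2"
    proof (rule has_sum_le_finite_sums[OF bracket_qform])
      fix A :: "(int ^ 'd) set" assume A: "finite A"
      have "(\<Sum>k\<in>A. (cmod (\<Sum>i\<in>UNIV. cnj (x $ i) * ?a k $ i))\<^sup>2) \<le> (norm x)\<^sup>2 * (\<Sum>k\<in>A. (norm (?a k))\<^sup>2)"
        unfolding sum_distrib_left by (intro sum_mono pt)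
      also have "\<dots> \<le> (norm x)\<^sup>2 * D" using D(2) A by (intro mult_left_mono) auto
      finally show "(\<Sum>k\<in>A. (cmod (\<Sum>i\<in>UNIV. cnj (x $ i) * ?a k $ i))\<^sup>2) \<le> D * (norm x)\<^sup>2" by (simp add: mult.commute)
    qed
  qed
qed

text \<open>Adjoint of sampling at level 0, see \<open>l2_inner_coef_restrict\<close>. The sets
  \<open>A\<close> of shifts are finite, which preserves compact support and so allows
  periodization.\<close>

definition synth :: "(int ^ 'd) set \<Rightarrow> (int ^ 'd \<Rightarrow> complex ^ 'r) \<Rightarrow> real ^ 'd \<Rightarrow> complex"
  where "synth A w x = (\<Sum>k\<in>A. \<Sum>q\<in>UNIV. w k $ q * \<psi> (x - lat k) $ q)"

lemma shift_L2: "(\<lambda>x. \<psi> (x - lat k) $ q) \<in> L2"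
  using L2_affine[OF \<psi>_L2[of q], of "mat 1" "lat k"] by simp

lemma synth_L2: "synth A w \<in> L2"
  unfolding synth_def[abs_def] by (intro L2_sum L2_cmult shift_L2)

lemma shift_radius:
  "\<exists>R>0. \<forall>k q. AE x in lebesgue. norm (x - lat k) > R \<longrightarrow> \<psi> (x - lat k) $ q = 0"
proof -
  obtain R where R: "R > 0" "\<And>q. AE x in lebesgue. norm x > R \<longrightarrow> \<psi> x $ q = 0" using radius by blast
  have "AE x in lebesgue. norm (x - lat k) > R \<longrightarrow> \<psi> (x - lat k) $ q = 0" for k q
    using AE_lebesgue_affine[OF _ R(2)[of q], of "mat 1" "lat k"] by simp
  with R(1) show ?thesis by blast
qed

lemma synth_radius: "finite A \<Longrightarrow> \<exists>R. AE x in lebesgue. norm x > R \<longrightarrow> synth A w x = 0"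
proof -
  assume A: "finite A"
  obtain R where R: "\<And>k q. AE x in lebesgue. norm (x - lat k) > R \<longrightarrow> \<psi> (x - lat k) $ q = 0"
    using shift_radius by blast
  let ?K = "\<Sum>k\<in>A. norm (lat k)"
  have K: "k \<in> A \<Longrightarrow> norm (lat k) \<le> ?K" for k
    using A by (intro member_le_sum) auto
  have "AE x in lebesgue. \<forall>k\<in>A. \<forall>q\<in>UNIV. norm (x - lat k) > R \<longrightarrow> \<psi> (x - lat k) $ q = 0"
    using R A by (intro AE_finite_allI) auto
  then have "AE x in lebesgue. norm x > R + ?K \<longrightarrow> synth A w x = 0"
  proof eventually_elim
    fix x assume x: "\<forall>k\<in>A. \<forall>q\<in>UNIV. norm (x - lat k) > R \<longrightarrow> \<psi> (x - lat k) $ q = 0"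
    have "norm (x - lat k) > R" if "norm x > R + ?K" "k \<in> A" for k
      using that K[OF that(2)] norm_triangle_ineq2[of x "lat k"] by linarith
    with x show "norm x > R + ?K \<longrightarrow> synth A w x = 0" by (auto simp: synth_def intro!: sum.neutral)
  qed
  then show ?thesis by blast
qed

lemma fourier_synth:
  "fourier (synth A w) \<xi> = (\<Sum>q\<in>UNIV. (\<Sum>k\<in>A. w k $ q * cis (- (lat k \<bullet> \<xi>))) * vfourier \<psi> \<xi> $ q)"
proof -
  have shift_int: "integrable lebesgue (\<lambda>x. \<psi> (x - lat k) $ q * cis (- (x \<bullet> \<xi>)))"
    and shift_four: "(LINT x|lebesgue. \<psi> (x - lat k) $ q * cis (- (x \<bullet> \<xi>))) = cis (- (lat k \<bullet> \<xi>)) * vfourier \<psi> \<xi> $ q" for k q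
  proof -
    let ?G = "\<lambda>y. \<psi> y $ q * cis (- (y \<bullet> \<xi>)) * cis (- (lat k \<bullet> \<xi>))"
    have "(\<lambda>y. cis (- (y \<bullet> \<xi>))) \<in> borel_measurable lebesgue" by (rule measurable_completion) measurable
    then have Gm: "?G \<in> borel_measurable lebesgue"
      using borel_measurable_integrable[OF \<psi>_integrable[of q]] by measurable
    then have G: "integrable lebesgue ?G"
      by (rule Bochner_Integration.integrable_bound[OF \<psi>_integrable[of q]]) (simp add: norm_mult)
    have eq: "\<psi> (x - lat k) $ q * cis (- (x \<bullet> \<xi>)) = ?G (x - lat k)" for x
      by (simp add: cis_mult mult.assoc inner_diff_left)
    show "integrable lebesgue (\<lambda>x. \<psi> (x - lat k) $ q * cis (- (x \<bullet> \<xi>)))"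
      unfolding eq using lebesgue_integral_affine(1)[of "mat 1" ?G "lat k"] Gm G by simp
    have "(LINT x|lebesgue. ?G (x - lat k)) = (LINT x|lebesgue. ?G x)"
      using lebesgue_integral_affine(2)[of "mat 1" ?G "lat k"] Gm by simp
    then show "(LINT x|lebesgue. \<psi> (x - lat k) $ q * cis (- (x \<bullet> \<xi>))) = cis (- (lat k \<bullet> \<xi>)) * vfourier \<psi> \<xi> $ q"
      unfolding eq by (simp add: vfourier_def fourier_eq_cis mult.commute)
  qed
  have "fourier (synth A w) \<xi> = (LINT x|lebesgue. (\<Sum>k\<in>A. \<Sum>q\<in>UNIV. w k $ q * (\<psi> (x - lat k) $ q * cis (- (x \<bullet> \<xi>)))))"
    by (simp add: fourier_eq_cis synth_def sum_distrib_right mult.assoc)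
  also have "\<dots> = (\<Sum>k\<in>A. \<Sum>q\<in>UNIV. w k $ q * (cis (- (lat k \<bullet> \<xi>)) * vfourier \<psi> \<xi> $ q))"
    using shift_int by (simp add: shift_four)
  also have "\<dots> = (\<Sum>q\<in>UNIV. (\<Sum>k\<in>A. w k $ q * cis (- (lat k \<bullet> \<xi>))) * vfourier \<psi> \<xi> $ q)"
    by (subst sum.swap) (simp add: sum_distrib_right mult.assoc)
  finally show ?thesis .
qed

text \<open>The symbol \<open>y\<close> of \<open>w\<close> is periodic, so along a coset the
  transform of the combination is a fixed functional of the transform of \<open>\<psi>\<close>, and
  the bracket form is at most the periodized energy. Averaging over a period turns both sides into
  norms exactly.\<close>

lemma Riesz_lower_bound:
  assumes C: "C \<ge> 0" and lower: "AE \<xi> in lebesgue. loewner_le (mat (complex_of_real C)) (bracket (vfourier \<psi>) (vfourier \<psi>) \<xi>)"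
    and A: "finite A"
  shows "C * (\<Sum>k\<in>A. (norm (w k))\<^sup>2) \<le> L2_normsq (synth A w)"
proof -
  define y where "y \<xi> = (\<chi> q. \<Sum>k\<in>A. w k $ q * cis (- (lat k \<bullet> \<xi>)))" for \<xi> :: "real ^ 'd"
  obtain R where R: "AE x in lebesgue. norm x > R \<longrightarrow> synth A w x = 0" using synth_radius[OF A] by blast
  note per = periodization[OF synth_L2[of A w] R]
  let ?I = "\<lambda>\<xi>. LINT x|cube_measure. (cmod (\<Sum>n\<in>tiles R. synth A w (x + lat n) * cis (- (lat n \<bullet> \<xi>))))\<^sup>2"
  have "AE \<xi> in lebesgue. C * (norm (y \<xi>))\<^sup>2 \<le> ?I \<xi>"
    using lower
  proof eventually_elim
    fix \<xi> assume "loewner_le (mat (complex_of_real C)) (bracket (vfourier \<psi>) (vfourier \<psi>) \<xi>)"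
    \<comment> \<open>The conjugate enters because \<open>qform\<close> conjugates its
      vector.\<close>
    from loewner_le_qform[OF this, of "\<chi> q. cnj (y \<xi> $ q)"]
    have "C * (norm (y \<xi>))\<^sup>2 \<le> qform (bracket (vfourier \<psi>) (vfourier \<psi>) \<xi>) (\<chi> q. cnj (y \<xi> $ q))"
      by (simp add: qform_mat norm_vec_square)
    also have "\<dots> \<le> ?I \<xi>"
    proof (rule has_sum_le_finite_sums[OF bracket_qform])
      fix F :: "(int ^ 'd) set" assume F: "finite F"
      have "cis (- (lat k \<bullet> (\<xi> + (2 * pi) *\<^sub>R lat m))) = cis (- (lat k \<bullet> \<xi>))" for k m
      proof -
        have "cis (- (2 * pi * (lat k \<bullet> lat m))) = 1"
          using ee_lat_inner[of k m] ee_minus[of "lat k \<bullet> lat m"] by (simp add: ee_def)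
        moreover have "cis (- (lat k \<bullet> (\<xi> + (2 * pi) *\<^sub>R lat m))) = cis (- (lat k \<bullet> \<xi>)) * cis (- (2 * pi * (lat k \<bullet> lat m)))"
          by (simp add: cis_mult inner_add_right)
        ultimately show ?thesis by simp
      qed
      then have "fourier (synth A w) (\<xi> + (2 * pi) *\<^sub>R lat m) = (\<Sum>i\<in>UNIV. cnj ((\<chi> q. cnj (y \<xi> $ q)) $ i) * vfourier \<psi> (\<xi> + (2 * pi) *\<^sub>R lat m) $ i)" for m
        unfolding fourier_synth by (simp add: y_def)
      then show "(\<Sum>k\<in>F. (cmod (\<Sum>i\<in>UNIV. cnj ((\<chi> q. cnj (y \<xi> $ q)) $ i) * vfourier \<psi> (\<xi> + (2 * pi) *\<^sub>R lat k) $ i))\<^sup>2) \<le> ?I \<xi>"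
        using per(1)[OF F, of \<xi>] by simp
    qed
    finally show "C * (norm (y \<xi>))\<^sup>2 \<le> ?I \<xi>" .
  qed
  \<comment> \<open>The substitution \<open>\<xi> = 2 \<pi> t\<close> moves the estimate to the unit
    cube.\<close>
  moreover have scale: "mat (2 * pi) *v t - 0 = (2 * pi) *\<^sub>R t" for t :: "real ^ 'd"
    by (simp add: vec_eq_iff matrix_vector_mult_def mat_def if_distrib if_distribR cong: if_cong)
  moreover have "det (mat (2 * pi) :: real ^ 'd ^ 'd) \<noteq> 0"
    by (subst det_diagonal) (auto simp: mat_def)
  ultimately have "AE t in lebesgue. C * (norm (y ((2 * pi) *\<^sub>R t)))\<^sup>2 \<le> ?I ((2 * pi) *\<^sub>R t)"
    using AE_lebesgue_affine[of "mat (2 * pi) :: real ^ 'd ^ 'd" "\<lambda>\<xi>. C * (norm (y \<xi>))\<^sup>2 \<le> ?I \<xi>" 0] by simp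
  then have le: "AE t in cube_measure. C * (norm (y ((2 * pi) *\<^sub>R t)))\<^sup>2 \<le> ?I ((2 * pi) *\<^sub>R t)"
    by (subst AE_restrict_space_iff) (auto elim: eventually_mono simp: lebesgue_unit_cube)
  \<comment> \<open>The reflection \<open>n = - k\<close> accounts for the opposite signs in
    \<open>ee\<close> and in the Fourier transform.\<close>
  have y_eq: "(norm (y ((2 * pi) *\<^sub>R t)))\<^sup>2 = (\<Sum>q\<in>UNIV. (cmod (\<Sum>n\<in>uminus ` A. w (- n) $ q * ee (lat n \<bullet> t)))\<^sup>2)" for t
    unfolding norm_vec_square y_def by (simp add: sum.reindex inj_on_def lat_minus ee_def mult.assoc)
  have fin: "finite (uminus ` A)" using A by simp
  have y_int: "integrable cube_measure (\<lambda>t. (norm (y ((2 * pi) *\<^sub>R t)))\<^sup>2)"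
    unfolding y_eq by (intro Bochner_Integration.integrable_sum cube_trig_polynomial(1)[OF fin])
  have "(LINT t|cube_measure. (norm (y ((2 * pi) *\<^sub>R t)))\<^sup>2) = (\<Sum>q\<in>UNIV. \<Sum>n\<in>uminus ` A. (cmod (w (- n) $ q))\<^sup>2)"
    unfolding y_eq using cube_trig_polynomial[OF fin] by simp
  also have "\<dots> = (\<Sum>k\<in>A. (norm (w k))\<^sup>2)"
    unfolding norm_vec_square by (subst sum.swap) (simp add: sum.reindex inj_on_def)
  finally have "C * (\<Sum>k\<in>A. (norm (w k))\<^sup>2) = (LINT t|cube_measure. C * (norm (y ((2 * pi) *\<^sub>R t)))\<^sup>2)"
    by simp
  also have "\<dots> \<le> (LINT t|cube_measure. ?I ((2 * pi) *\<^sub>R t))"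
    using y_int per(3) le by (intro integral_mono_AE) auto
  also have "\<dots> = L2_normsq (synth A w)" by (rule per(4))
  finally show ?thesis .
qed

end

section \<open>Limits of quasi-projections\<close>

lemma le_indicator_abs: "t \<le> B * indicator S x \<Longrightarrow> t \<le> \<bar>B\<bar>" for t B :: real
  by (cases "x \<in> S") auto

lemma le_indicator_mem: "t \<le> B * indicator S x \<Longrightarrow> 0 < t \<Longrightarrow> x \<in> S" for t B :: real
  by (cases "x \<in> S") auto

text \<open>A lattice sum is the integral of a step function. After dilation this presents inner
  products of coefficients as integrals over one fixed space, to which dominated convergence
  applies.\<close>

lemma integral_floorv:
  fixes F :: "int ^ 'd \<Rightarrow> complex"
  assumes fin: "finite {k. F k \<noteq> 0}"
  shows "(\<lambda>y. F (floorv y)) \<in> borel_measurable lebesgue"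
    and "(LINT y|lebesgue. F (floorv y)) = (\<Sum>\<^sub>\<infinity>k. F k)"
proof -
  let ?S = "{k. F k \<noteq> 0}"
  have eq: "(\<lambda>y. F (floorv y)) = (\<lambda>y. \<Sum>k\<in>?S. indicator (floorv -` {k}) y *\<^sub>R F k)"
  proof
    fix y
    have "(\<Sum>k\<in>?S. indicator (floorv -` {k}) y *\<^sub>R F k) = (\<Sum>k\<in>?S. if k = floorv y then F k else 0)"
      by (intro sum.cong) (auto simp: indicator_def)
    also have "\<dots> = F (floorv y)" using fin by simp
    finally show "F (floorv y) = (\<Sum>k\<in>?S. indicator (floorv -` {k}) y *\<^sub>R F k)" ..
  qed
  have lm: "floorv -` {k :: int ^ 'd} \<in> lmeasurable" for k
    using emeasure_floorv[of k] floorv_borel[of k] by (auto simp: fmeasurable_def simp del: emeasure_completion)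
  have int: "has_bochner_integral lebesgue (\<lambda>y. indicator (floorv -` {k}) y *\<^sub>R F k) (F k)" for k
    using has_bochner_integral_indicator[of "floorv -` {k}" lebesgue "F k"] lm[of k] emeasure_floorv[of k]
    by (simp add: fmeasurable_def measure_def del: emeasure_completion)
  have "has_bochner_integral lebesgue (\<lambda>y. \<Sum>k\<in>?S. indicator (floorv -` {k}) y *\<^sub>R F k) (\<Sum>k\<in>?S. F k)"
    by (intro has_bochner_integral_sum int)
  then have hb: "has_bochner_integral lebesgue (\<lambda>y. F (floorv y)) (\<Sum>k\<in>?S. F k)"
    unfolding eq .
  then show "(\<lambda>y. F (floorv y)) \<in> borel_measurable lebesgue"
    by (rule borel_measurable_has_bochner_integral)
  have "(\<Sum>\<^sub>\<infinity>k. F k) = (\<Sum>\<^sub>\<infinity>k\<in>?S. F k)" by (rule infsum_cong_neutral) auto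
  also have "\<dots> = (\<Sum>k\<in>?S. F k)" using fin by simp
  finally show "(LINT y|lebesgue. F (floorv y)) = (\<Sum>\<^sub>\<infinity>k. F k)"
    using hb by (simp add: has_bochner_integral_iff)
qed

section \<open>Samples of test functions at increasing levels\<close>

context refinable_vector
begin

abbreviation (input) Mpow where "Mpow j \<equiv> matpow (rmat M) j"
abbreviation (input) Minvpow where "Minvpow j \<equiv> matpow (matrix_inv (rmat M)) j"

lemma Mpow_cancel: "Minvpow j *v (Mpow j *v x) = x" "Mpow j *v (Minvpow j *v x) = x"
  using matpow_inverse[OF matrix_inv_cancel(1)[OF det], of j] matpow_inverse[OF matrix_inv_cancel(2)[OF det], of j]
  by (simp_all add: matrix_vector_mul_assoc)

lemma det_Mpow: "det (Mpow j) \<noteq> 0" "det (Minvpow j) \<noteq> 0" "\<bar>det (Mpow j)\<bar> * \<bar>det (Minvpow j)\<bar> = 1"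
  using det by (simp_all add: det_matpow matrix_inv_cancel(5)[OF det] power_divide abs_mult[symmetric] field_simps)

text \<open>Pointwise decay on the finitely many coordinate vectors gives a rate
  \<open>\<eta>\<close> valid for all vectors at once.\<close>

lemma Minvpow_bound:
  obtains \<eta> where "\<And>j. 0 \<le> \<eta> j" "\<eta> \<longlonglongrightarrow> 0" "\<And>j z. norm (Minvpow j *v z) \<le> norm z * \<eta> j"
proof
  let ?\<eta> = "\<lambda>j. \<Sum>i\<in>UNIV. norm (Minvpow j *v axis i 1)"
  show "0 \<le> ?\<eta> j" for j by (intro sum_nonneg) simp
  have "(\<lambda>j. norm (Minvpow j *v axis i 1)) \<longlonglongrightarrow> 0" for i
    by (rule tendsto_norm_zero[OF inverse_powers_tendsto_0[OF dil]])
  then have "?\<eta> \<longlonglongrightarrow> (\<Sum>i\<in>(UNIV :: 'd set). 0)" by (intro tendsto_sum)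
  then show "?\<eta> \<longlonglongrightarrow> 0" by simp
  fix j and z :: "real ^ 'd"
  have "z = (\<Sum>i\<in>UNIV. z $ i *\<^sub>R axis i 1)"
    by (simp add: vec_eq_iff axis_def if_distrib cong: if_cong)
  then have "Minvpow j *v z = Minvpow j *v (\<Sum>i\<in>UNIV. z $ i *\<^sub>R axis i 1)" by simp
  also have "\<dots> = (\<Sum>i\<in>UNIV. z $ i *\<^sub>R (Minvpow j *v axis i 1))"
    by (simp add: linear_sum[OF matrix_vector_mul_linear] matrix_vector_mult_scaleR)
  finally have "norm (Minvpow j *v z) \<le> (\<Sum>i\<in>UNIV. norm (z $ i *\<^sub>R (Minvpow j *v axis i 1)))"
    by (simp only: norm_sum)
  also have "\<dots> \<le> (\<Sum>i\<in>UNIV. norm z * norm (Minvpow j *v axis i 1))"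
    by (intro sum_mono) (simp add: mult_right_mono component_le_norm_cart)
  finally show "norm (Minvpow j *v z) \<le> norm z * ?\<eta> j" by (simp add: sum_distrib_left)
qed

text \<open>Coefficients rescaled so that they converge: an average of \<open>f\<close> near the
  point \<open>M^{-j} k\<close>, weighted with the conjugate of a component of
  \<open>\<psi>\<close>.\<close>

definition scaled_coef :: "(real ^ 'd \<Rightarrow> complex) \<Rightarrow> nat \<Rightarrow> 'r \<Rightarrow> int ^ 'd \<Rightarrow> complex"
  where "scaled_coef f j q k = (LINT t|lebesgue. f (Minvpow j *v (t + lat k)) * cnj (\<psi> t $ q))"

lemma scaled_coef_eq:
  assumes f: "f \<in> L2"
  shows "scaled_coef f j q k = of_real (sqrt \<bar>det (Mpow j)\<bar>) * coef M \<psi> j f k $ q"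
proof -
  let ?s = "complex_of_real (sqrt \<bar>det (Minvpow j)\<bar>)"
  have UV: "Minvpow j ** Mpow j = mat 1" by (rule matpow_inverse[OF matrix_inv_cancel(2)[OF det]])
  have shift: "(\<lambda>x. \<psi> (x - lat k) $ q) \<in> L2"
    using L2_affine[OF \<psi>_L2[of q], of "mat 1" "lat k"] by simp
  let ?G = "\<lambda>x. dilate_shift (Minvpow j) 0 f x * cnj (\<psi> (x - lat k) $ q)"
  have G: "integrable lebesgue ?G"
    by (rule L2_inner_integrable[OF dilate_shift_L2[OF f det_Mpow(2)] shift])
  have "coef M \<psi> j f k $ q = (LINT x|lebesgue. ?G x)"
    unfolding coef_def using L2_inner_dilate_shift[OF f \<psi>_L2[of q] det_Mpow(1) UV, of "lat k"]
    by (simp add: L2_inner_def)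
  also have "\<dots> = (LINT t|lebesgue. ?G (t + lat k))"
    using lebesgue_integral_affine(2)[of "mat 1" ?G "- lat k"] borel_measurable_integrable[OF G] by simp
  also have "\<dots> = (LINT t|lebesgue. ?s * (f (Minvpow j *v (t + lat k)) * cnj (\<psi> t $ q)))"
    by (simp add: dilate_shift_def mult.assoc)
  also have "\<dots> = ?s * scaled_coef f j q k"
    unfolding scaled_coef_def by (rule integral_mult_right_zero)
  finally have c: "coef M \<psi> j f k $ q = ?s * scaled_coef f j q k" .
  have "sqrt \<bar>det (Mpow j)\<bar> * sqrt \<bar>det (Minvpow j)\<bar> = 1"
    using det_Mpow(3)[of j] by (simp flip: real_sqrt_mult)
  then have "complex_of_real (sqrt \<bar>det (Mpow j)\<bar>) * ?s = 1"
    by (simp only: of_real_mult[symmetric] of_real_1)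
  then show ?thesis unfolding c by (simp only: mult.assoc[symmetric]) simp
qed

text \<open>With \<open>k\<close> the integer part of \<open>M^j x\<close>, the argument differs
  from \<open>x\<close> by the image of a vector that is bounded for fixed \<open>t\<close>, and
  \<open>M^{-j}\<close> contracts it to 0.\<close>

lemma scaled_coef_arg: "Minvpow j *v (t + lat (floorv (Mpow j *v x))) = x + Minvpow j *v (t - fracv (Mpow j *v x))"
proof -
  have "t + lat (floorv (Mpow j *v x)) = Mpow j *v x + (t - fracv (Mpow j *v x))"
    by (simp add: fracv_def)
  then show ?thesis by (simp only: matrix_vector_right_distrib Mpow_cancel)
qed

lemma cube_norm_bound: obtains Q where "\<And>x :: real ^ 'd. norm (fracv x) \<le> Q" "Q \<ge> 0"
proof -
  obtain Q where Q: "\<And>x :: real ^ 'd. x \<in> unit_cube \<Longrightarrow> norm x \<le> Q"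
    using bounded_subset[OF bounded_cbox box_subset_unit_cube(2)] by (auto simp: bounded_iff)
  have "norm (fracv x) \<le> Q" for x :: "real ^ 'd" by (rule Q[OF fracv_in_unit_cube])
  moreover from this[of 0] have "Q \<ge> 0" using norm_ge_zero order_trans by blast
  ultimately show thesis using that by blast
qed

lemma Cc_arg_measurable:
  assumes "f \<in> Cc"
  shows "(\<lambda>t. f (Minvpow j *v (t + lat k)) * cnj (\<psi> t $ q)) \<in> borel_measurable lebesgue"
proof -
  have "continuous_on UNIV (\<lambda>t. f (Minvpow j *v (t + lat k)))"
  proof (rule continuous_on_compose2[of UNIV f UNIV])
    show "continuous_on UNIV f" using assms by (simp add: Cc_def)
    show "continuous_on UNIV (\<lambda>t. Minvpow j *v (t + lat k))"
      unfolding matrix_vector_right_distrib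
      by (intro continuous_on_add matrix_vector_mult_linear_continuous_on continuous_on_const)
  qed simp
  then have "(\<lambda>t. f (Minvpow j *v (t + lat k))) \<in> borel_measurable lebesgue"
    by (intro measurable_completion) (simp add: borel_measurable_continuous_onI)
  then show ?thesis using borel_measurable_integrable[OF \<psi>_integrable[of q]] by measurable
qed

lemma scaled_coef_tendsto:
  assumes f: "f \<in> Cc"
  shows "(\<lambda>j. scaled_coef f j q (floorv (Mpow j *v x))) \<longlonglongrightarrow> f x * cnj (vfourier \<psi> 0 $ q)"
proof -
  obtain \<eta> where \<eta>: "\<And>j. 0 \<le> \<eta> j" "\<eta> \<longlonglongrightarrow> 0" "\<And>j z. norm (Minvpow j *v z) \<le> norm z * \<eta> j"
    by (rule Minvpow_bound) blast
  obtain Q where Q: "\<And>x :: real ^ 'd. norm (fracv x) \<le> Q" by (rule cube_norm_bound) blast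
  obtain B R where BR: "\<And>x. cmod (f x) \<le> B * indicator (cball 0 R) x" using Cc_bounded[OF f] by blast
  have B: "cmod (f x) \<le> \<bar>B\<bar>" for x by (rule le_indicator_abs[OF BR])
  let ?k = "\<lambda>j. floorv (Mpow j *v x)"
  have "(\<lambda>j. LINT t|lebesgue. f (Minvpow j *v (t + lat (?k j))) * cnj (\<psi> t $ q)) \<longlonglongrightarrow> (LINT t|lebesgue. f x * cnj (\<psi> t $ q))"
  proof (rule integral_dominated_convergence[where w = "\<lambda>t. \<bar>B\<bar> * cmod (\<psi> t $ q)"])
    show "integrable lebesgue (\<lambda>t. \<bar>B\<bar> * cmod (\<psi> t $ q))"
      by (intro integrable_mult_right integrable_norm \<psi>_integrable)
    show "(\<lambda>t. f x * cnj (\<psi> t $ q)) \<in> borel_measurable lebesgue"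
      using borel_measurable_integrable[OF \<psi>_integrable[of q]] by measurable
    show "AE t in lebesgue. norm (f (Minvpow j *v (t + lat (?k j))) * cnj (\<psi> t $ q)) \<le> \<bar>B\<bar> * cmod (\<psi> t $ q)" for j
      using B by (intro AE_I2) (simp add: norm_mult mult_right_mono)
    have "(\<lambda>j. Minvpow j *v (t - fracv (Mpow j *v x))) \<longlonglongrightarrow> 0" for t
    proof (rule Lim_null_comparison)
      have "norm (Minvpow j *v (t - fracv (Mpow j *v x))) \<le> (norm t + Q) * \<eta> j" for j
      proof -
        have "norm (t - fracv (Mpow j *v x)) \<le> norm t + Q"
          using norm_triangle_ineq4[of t "fracv (Mpow j *v x)"] Q[of "Mpow j *v x"] by linarith
        then show ?thesis using \<eta>(3)[of j "t - fracv (Mpow j *v x)"] \<eta>(1)[of j] mult_right_mono order_trans by blast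
      qed
      then show "\<forall>\<^sub>F j in sequentially. norm (Minvpow j *v (t - fracv (Mpow j *v x))) \<le> (norm t + Q) * \<eta> j" by simp
      show "(\<lambda>j. (norm t + Q) * \<eta> j) \<longlonglongrightarrow> 0" by (rule tendsto_mult_right_zero[OF \<eta>(2)])
    qed
    then have "(\<lambda>j. x + Minvpow j *v (t - fracv (Mpow j *v x))) \<longlonglongrightarrow> x + 0" for t
      by (intro tendsto_add tendsto_const)
    then have "(\<lambda>j. f (Minvpow j *v (t + lat (?k j)))) \<longlonglongrightarrow> f x" for t
      unfolding scaled_coef_arg using f continuous_on_tendsto_compose[of UNIV f] by (auto simp: Cc_def)
    then show "AE t in lebesgue. (\<lambda>j. f (Minvpow j *v (t + lat (?k j))) * cnj (\<psi> t $ q)) \<longlonglongrightarrow> f x * cnj (\<psi> t $ q)"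
      by (intro AE_I2 tendsto_mult tendsto_const)
  qed (rule Cc_arg_measurable[OF f])
  moreover have "(LINT t|lebesgue. f x * cnj (\<psi> t $ q)) = f x * cnj (LINT t|lebesgue. \<psi> t $ q)"
    by simp
  moreover have "vfourier \<psi> 0 $ q = (LINT t|lebesgue. \<psi> t $ q)"
    by (simp add: vfourier_def fourier_def)
  ultimately show ?thesis by (simp only: scaled_coef_def)
qed

text \<open>One compactly supported bound for all levels. The points \<open>t\<close> of the support
  of \<open>\<psi>\<close>, the fractional parts and the contraction rates are all bounded, so
  \<open>f\<close> is evaluated within \<open>(R + Q) E\<close> of \<open>x\<close>.\<close>

lemma scaled_coef_bound:
  assumes f: "f \<in> Cc"
  shows "\<exists>B R. \<forall>j x q. cmod (scaled_coef f j q (floorv (Mpow j *v x))) \<le> B * indicator (cball 0 R) x"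
proof -
  obtain \<eta> where \<eta>: "\<And>j. 0 \<le> \<eta> j" "\<eta> \<longlonglongrightarrow> 0" "\<And>j z. norm (Minvpow j *v z) \<le> norm z * \<eta> j"
    by (rule Minvpow_bound) blast
  obtain Q where Q: "\<And>x :: real ^ 'd. norm (fracv x) \<le> Q" "Q \<ge> 0" by (rule cube_norm_bound) blast
  obtain B Rf where BR: "\<And>x. cmod (f x) \<le> B * indicator (cball 0 Rf) x" using Cc_bounded[OF f] by blast
  have B: "cmod (f x) \<le> \<bar>B\<bar>" for x by (rule le_indicator_abs[OF BR])
  obtain R where R: "R > 0" "\<And>q. AE x in lebesgue. norm x > R \<longrightarrow> \<psi> x $ q = 0" using radius by blast
  have "Bseq \<eta>" using \<eta>(2) convergent_imp_Bseq convergentI by blast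
  then obtain E where E: "E > 0" "\<And>j. \<eta> j \<le> E"
    unfolding Bseq_def by (metis abs_le_D1 real_norm_def)
  let ?C = "\<bar>B\<bar> * (\<Sum>q\<in>UNIV. LINT t|lebesgue. cmod (\<psi> t $ q))"
  let ?R = "Rf + (R + Q) * E"
  have "cmod (scaled_coef f j q (floorv (Mpow j *v x))) \<le> ?C * indicator (cball 0 ?R) x" for j x q
  proof (cases "norm x \<le> ?R")
    case True
    have "cmod (scaled_coef f j q (floorv (Mpow j *v x)))
        \<le> (LINT t|lebesgue. cmod (f (Minvpow j *v (t + lat (floorv (Mpow j *v x)))) * cnj (\<psi> t $ q)))"
      unfolding scaled_coef_def by (rule integral_norm_bound)
    also have "\<dots> \<le> (LINT t|lebesgue. \<bar>B\<bar> * cmod (\<psi> t $ q))"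
    proof (rule integral_mono_AE')
      show "AE t in lebesgue. cmod (f (Minvpow j *v (t + lat (floorv (Mpow j *v x)))) * cnj (\<psi> t $ q)) \<le> \<bar>B\<bar> * cmod (\<psi> t $ q)"
        using B by (intro AE_I2) (simp add: norm_mult mult_right_mono)
    qed (auto intro!: integrable_norm \<psi>_integrable)
    also have "\<dots> \<le> ?C"
      unfolding integral_mult_right_zero by (intro mult_left_mono member_le_sum) auto
    finally show ?thesis using True by simp
  next
    case far: False
    have "AE t in lebesgue. f (Minvpow j *v (t + lat (floorv (Mpow j *v x)))) * cnj (\<psi> t $ q) = 0"
      using R(2)[of q]
    proof eventually_elim
      fix t assume t: "norm t > R \<longrightarrow> \<psi> t $ q = 0"
      show "f (Minvpow j *v (t + lat (floorv (Mpow j *v x)))) * cnj (\<psi> t $ q) = 0"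
      proof (cases "norm t > R")
        case False
        have "norm (t - fracv (Mpow j *v x)) \<le> R + Q"
          using norm_triangle_ineq4[of t "fracv (Mpow j *v x)"] Q(1)[of "Mpow j *v x"] False by linarith
        then have "norm (t - fracv (Mpow j *v x)) * \<eta> j \<le> (R + Q) * E"
          using \<eta>(1)[of j] E(2)[of j] R(1) Q(2) by (intro mult_mono) auto
        then have "norm (Minvpow j *v (t - fracv (Mpow j *v x))) \<le> (R + Q) * E"
          using \<eta>(3)[of j "t - fracv (Mpow j *v x)"] by linarith
        then have "norm (x + Minvpow j *v (t - fracv (Mpow j *v x))) > Rf"
          using \<open>\<not> norm x \<le> ?R\<close> norm_diff_ineq[of x "Minvpow j *v (t - fracv (Mpow j *v x))"] by linarith
        then have "f (Minvpow j *v (t + lat (floorv (Mpow j *v x)))) = 0"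
          unfolding scaled_coef_arg using BR[of "x + Minvpow j *v (t - fracv (Mpow j *v x))"] by simp
        then show ?thesis by simp
      qed (use t in simp)
    qed
    then have "scaled_coef f j q (floorv (Mpow j *v x)) = (LINT t::real ^ 'd|lebesgue. 0)"
      unfolding scaled_coef_def by (intro integral_cong_AE Cc_arg_measurable[OF f]) auto
    then show ?thesis using far by simp
  qed
  then show ?thesis by blast
qed

lemma scaled_coef_finite: "f \<in> Cc \<Longrightarrow> finite {k. scaled_coef f j q k \<noteq> 0}"
proof -
  assume f: "f \<in> Cc"
  obtain B R where BR: "\<And>j x q. cmod (scaled_coef f j q (floorv (Mpow j *v x))) \<le> B * indicator (cball 0 R) x"
    using scaled_coef_bound[OF f] by blast
  have "{k. scaled_coef f j q k \<noteq> 0} \<subseteq> {k. lat k \<in> (*v) (Mpow j) ` cball 0 R}"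
  proof
    fix k assume "k \<in> {k. scaled_coef f j q k \<noteq> 0}"
    moreover have "floorv (Mpow j *v (Minvpow j *v lat k)) = k"
      using floorv_add_lat[of 0 k] by (simp add: Mpow_cancel) (simp add: floorv_def vec_eq_iff)
    ultimately have "Minvpow j *v lat k \<in> cball 0 R"
      using le_indicator_mem[OF BR[of j q "Minvpow j *v lat k"]] by simp
    then show "k \<in> {k. lat k \<in> (*v) (Mpow j) ` cball 0 R}"
      by (auto intro!: image_eqI[of _ _ "Minvpow j *v lat k"] simp: Mpow_cancel)
  qed
  moreover have "bounded ((*v) (Mpow j) ` cball 0 R)"
    by (rule bounded_linear_image[OF bounded_cball]) (rule matrix_vector_mul_bounded_linear)
  ultimately show ?thesis using finite_bounded_lattice finite_subset by blast
qed

end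

text \<open>Uniformly bounded functionals that converge on a dense set converge everywhere; this is
  applied to each argument of a sesquilinear form in turn.\<close>

lemma L2_limit_closure:
  fixes T :: "nat \<Rightarrow> (real ^ 'd \<Rightarrow> complex) \<Rightarrow> complex"
  assumes diff: "\<And>j f g. f \<in> L2 \<Longrightarrow> g \<in> L2 \<Longrightarrow> T j (\<lambda>x. f x - g x) = T j f - T j g"
    and bound: "\<And>j f. f \<in> L2 \<Longrightarrow> (cmod (T j f))\<^sup>2 \<le> K * L2_normsq f"
    and lim: "\<And>f. f \<in> Cc \<Longrightarrow> (\<lambda>j. T j f) \<longlonglongrightarrow> 0"
    and f: "f \<in> L2"
  shows "(\<lambda>j. T j f) \<longlonglongrightarrow> 0"
proof (rule LIMSEQ_I)
  fix r :: real assume r: "r > 0"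
  let ?e = "(r / 2)\<^sup>2 / (\<bar>K\<bar> + 1)"
  have e: "?e > 0" using r by simp
  obtain g where g: "g \<in> Cc" "L2_normsq (\<lambda>x. f x - g x) < ?e" using L2_Cc_dense[OF f e] by blast
  obtain J where J: "\<And>j. j \<ge> J \<Longrightarrow> cmod (T j g) < r / 2"
    using LIMSEQ_D[OF lim[OF g(1)], of "r / 2"] r by auto
  have "cmod (T j f - T j g) \<le> r / 2" for j
  proof -
    have "(cmod (T j f - T j g))\<^sup>2 \<le> K * L2_normsq (\<lambda>x. f x - g x)"
      using bound[OF L2_diff[OF f Cc_L2[OF g(1)]], of j] diff[OF f Cc_L2[OF g(1)]] by simp
    also have "\<dots> \<le> (\<bar>K\<bar> + 1) * L2_normsq (\<lambda>x. f x - g x)"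
      by (intro mult_right_mono L2_normsq_nonneg) auto
    also have "\<dots> \<le> (\<bar>K\<bar> + 1) * ?e" using g(2) by (intro mult_left_mono) auto
    also have "\<dots> = (r / 2)\<^sup>2" by (simp add: field_simps)
    finally show ?thesis by (rule power2_le_imp_le) (use r in simp)
  qed
  moreover have "cmod (T j f) \<le> cmod (T j f - T j g) + cmod (T j g)" for j
    using norm_triangle_ineq[of "T j f - T j g" "T j g"] by simp
  ultimately have "norm (T j f - 0) < r" if "j \<ge> J" for j
    using J[OF that] by (smt (verit) diff_zero field_sum_of_halves)
  then show "\<exists>no. \<forall>n\<ge>no. norm (T n f - 0) < r" by blast
qed

locale refinable_pair =
  P: refinable_vector M \<psi> + T: refinable_vector M \<psi>t
  for M :: "int ^ 'd ^ 'd" and \<psi> \<psi>t :: "real ^ 'd \<Rightarrow> complex ^ 'r" +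
  assumes normalized: "(\<Sum>q\<in>UNIV. cnj (vfourier \<psi> 0 $ q) * vfourier \<psi>t 0 $ q) = 1"
begin

text \<open>The inner product is a Riemann sum written as the integral of a step function. Its
  integrand converges to \<open>f x * cnj (g x)\<close> times the pairing of the two transforms at
  0, which the normalisation makes 1.\<close>

lemma coef_inner_tendsto_Cc:
  assumes f: "f \<in> Cc" and g: "g \<in> Cc"
  shows "(\<lambda>j. l2_inner (coef M \<psi> j f) (coef M \<psi>t j g)) \<longlonglongrightarrow> L2_inner f g"
proof -
  define H where "H j k = (\<Sum>q\<in>UNIV. P.scaled_coef f j q k * cnj (T.scaled_coef g j q k))" for j k
  have H_fin: "finite {k. H j k \<noteq> 0}" for j
  proof -
    have "{k. H j k \<noteq> 0} \<subseteq> (\<Union>q\<in>UNIV. {k. P.scaled_coef f j q k \<noteq> 0})"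
      by (auto simp: H_def intro: ccontr)
    then show ?thesis by (rule finite_subset) (auto intro: P.scaled_coef_finite[OF f])
  qed
  let ?U = "\<lambda>j. matpow (rmat M) j"
  have H_meas: "(\<lambda>x. H j (floorv (?U j *v x))) \<in> borel_measurable lebesgue" for j
    using lebesgue_integral_affine(3)[OF P.det_Mpow(1)[of j] integral_floorv(1)[OF H_fin[of j]], of 0] by simp
  have eq: "l2_inner (coef M \<psi> j f) (coef M \<psi>t j g) = (LINT x|lebesgue. H j (floorv (?U j *v x)))" for j
  proof -
    have sq: "complex_of_real (sqrt \<bar>det (?U j)\<bar>) * complex_of_real (sqrt \<bar>det (?U j)\<bar>) = of_real \<bar>det (?U j)\<bar>"
      by (simp flip: of_real_mult)
    have "H j k = of_real \<bar>det (?U j)\<bar> * (\<Sum>q\<in>UNIV. coef M \<psi> j f k $ q * cnj (coef M \<psi>t j g k $ q))" for k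
      unfolding H_def P.scaled_coef_eq[OF Cc_L2[OF f]] T.scaled_coef_eq[OF Cc_L2[OF g]] sq[symmetric]
      by (simp add: sum_distrib_left mult_ac)
    then have "(\<Sum>\<^sub>\<infinity>k. H j k) = of_real \<bar>det (?U j)\<bar> * l2_inner (coef M \<psi> j f) (coef M \<psi>t j g)"
      unfolding l2_inner_def by (simp only: infsum_cmult_right')
    moreover have "(LINT x|lebesgue. H j (floorv (?U j *v x))) = (1 / \<bar>det (?U j)\<bar>) *\<^sub>R (\<Sum>\<^sub>\<infinity>k. H j k)"
      using lebesgue_integral_affine(2)[OF P.det_Mpow(1)[of j] integral_floorv(1)[OF H_fin[of j]], of 0] integral_floorv(2)[OF H_fin[of j]] by simp
    ultimately show ?thesis using P.det_Mpow(1)[of j] by (simp add: scaleR_conv_of_real)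
  qed
  obtain B1 R1 where 1: "\<And>j x q. cmod (P.scaled_coef f j q (floorv (?U j *v x))) \<le> B1 * indicator (cball 0 R1) x"
    using P.scaled_coef_bound[OF f] by blast
  obtain B2 R2 where 2: "\<And>j x q. cmod (T.scaled_coef g j q (floorv (?U j *v x))) \<le> B2 * indicator (cball 0 R2) x"
    using T.scaled_coef_bound[OF g] by blast
  let ?lim = "\<lambda>x. \<Sum>q\<in>UNIV. (f x * cnj (vfourier \<psi> 0 $ q)) * cnj (g x * cnj (vfourier \<psi>t 0 $ q))"
  have lim_eq: "?lim x = f x * cnj (g x)" for x
  proof -
    have "?lim x = (f x * cnj (g x)) * (\<Sum>q\<in>UNIV. cnj (vfourier \<psi> 0 $ q) * vfourier \<psi>t 0 $ q)"
      by (simp add: sum_distrib_left mult_ac)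
    then show ?thesis by (simp add: normalized)
  qed
  have "(\<lambda>j. LINT x|lebesgue. H j (floorv (?U j *v x))) \<longlonglongrightarrow> (LINT x|lebesgue. ?lim x)"
  proof (rule integral_dominated_convergence[where w = "\<lambda>x. (real CARD('r) * (\<bar>B1\<bar> * \<bar>B2\<bar>)) * indicator (cball 0 R1) x"])
    show "?lim \<in> borel_measurable lebesgue"
      unfolding lim_eq by (rule borel_measurable_integrable[OF L2_inner_integrable[OF Cc_L2[OF f] Cc_L2[OF g]]])
    show "AE x in lebesgue. (\<lambda>j. H j (floorv (?U j *v x))) \<longlonglongrightarrow> ?lim x"
      unfolding H_def by (intro AE_I2 tendsto_sum tendsto_mult tendsto_cnj P.scaled_coef_tendsto[OF f] T.scaled_coef_tendsto[OF g])
    show "AE x in lebesgue. norm (H j (floorv (?U j *v x))) \<le> (real CARD('r) * (\<bar>B1\<bar> * \<bar>B2\<bar>)) * indicator (cball 0 R1) x" for j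
    proof (intro AE_I2)
      fix x :: "real ^ 'd"
      have "cmod (P.scaled_coef f j q (floorv (?U j *v x)) * cnj (T.scaled_coef g j q (floorv (?U j *v x)))) \<le> (\<bar>B1\<bar> * indicator (cball 0 R1) x) * \<bar>B2\<bar>" for q
        unfolding norm_mult complex_mod_cnj
      proof (rule mult_mono)
        show "cmod (P.scaled_coef f j q (floorv (?U j *v x))) \<le> \<bar>B1\<bar> * indicator (cball 0 R1) x"
          using 1[of j q x] by (rule order_trans) (intro mult_right_mono, auto)
        show "cmod (T.scaled_coef g j q (floorv (?U j *v x))) \<le> \<bar>B2\<bar>"
          by (rule le_indicator_abs[OF 2])
      qed auto
      then have "norm (H j (floorv (?U j *v x))) \<le> (\<Sum>q\<in>(UNIV :: 'r set). (\<bar>B1\<bar> * indicator (cball 0 R1) x) * \<bar>B2\<bar>)"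
        unfolding H_def by (intro norm_sum[THEN order_trans] sum_mono)
      then show "norm (H j (floorv (?U j *v x))) \<le> (real CARD('r) * (\<bar>B1\<bar> * \<bar>B2\<bar>)) * indicator (cball 0 R1) x"
        by (simp add: mult_ac)
    qed
    show "integrable lebesgue (\<lambda>x::real ^ 'd. (real CARD('r) * (\<bar>B1\<bar> * \<bar>B2\<bar>)) * indicator (cball 0 R1) x)"
      by (rule integrable_indicator_cball)
  qed (rule H_meas)
  then show ?thesis unfolding eq lim_eq L2_inner_def .
qed

text \<open>The error form is bounded uniformly in \<open>j\<close>, so test functions are replaced
  by general ones in the first argument and then in the second.\<close>

lemma coef_inner_tendsto:
  assumes f: "f \<in> L2" and g: "g \<in> L2"
  shows "(\<lambda>j. l2_inner (coef M \<psi> j f) (coef M \<psi>t j g)) \<longlonglongrightarrow> L2_inner f g"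
proof -
  obtain B1 where B1: "B1 > 0" "\<And>f j. f \<in> L2 \<Longrightarrow> coef M \<psi> j f \<in> l2 \<and> l2_normsq (coef M \<psi> j f) \<le> B1 * L2_normsq f"
    using P.coef_bounded by blast
  obtain B2 where B2: "B2 > 0" "\<And>f j. f \<in> L2 \<Longrightarrow> coef M \<psi>t j f \<in> l2 \<and> l2_normsq (coef M \<psi>t j f) \<le> B2 * L2_normsq f"
    using T.coef_bounded by blast
  define E where "E j f g = l2_inner (coef M \<psi> j f) (coef M \<psi>t j g) - L2_inner f g" for j f g
  have bound: "(cmod (E j f g))\<^sup>2 \<le> (2 * (B1 * B2) + 2) * (L2_normsq f * L2_normsq g)" if "f \<in> L2" "g \<in> L2" for j f g
  proof -
    have "(cmod (l2_inner (coef M \<psi> j f) (coef M \<psi>t j g)))\<^sup>2 \<le> l2_normsq (coef M \<psi> j f) * l2_normsq (coef M \<psi>t j g)"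
      using B1(2) B2(2) that by (intro l2_Cauchy_Schwarz) auto
    also have "\<dots> \<le> (B1 * L2_normsq f) * (B2 * L2_normsq g)"
      using B1 B2 that by (intro mult_mono) (auto simp: L2_normsq_nonneg l2_normsq_nonneg)
    finally have "(cmod (l2_inner (coef M \<psi> j f) (coef M \<psi>t j g)))\<^sup>2 \<le> (B1 * B2) * (L2_normsq f * L2_normsq g)"
      by (simp add: mult_ac)
    then show ?thesis
      using norm_diff_square_le[of "l2_inner (coef M \<psi> j f) (coef M \<psi>t j g)" "L2_inner f g"] L2_Cauchy_Schwarz[OF that]
      unfolding E_def by (simp add: algebra_simps)
  qed
  have diff1: "E j (\<lambda>x. f x - f' x) g = E j f g - E j f' g" if "f \<in> L2" "f' \<in> L2" "g \<in> L2" for j f f' g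
    using that by (simp add: E_def coef_diff P.\<psi>_L2 P.det l2_inner_diff_left P.coef_l2 T.coef_l2 L2_inner_diff_left)
  have diff2: "E j f (\<lambda>x. g x - g' x) = E j f g - E j f g'" if "f \<in> L2" "g \<in> L2" "g' \<in> L2" for j f g g'
    using that by (simp add: E_def coef_diff T.\<psi>_L2 P.det l2_inner_diff_right P.coef_l2 T.coef_l2 L2_inner_diff_right)
  have base: "(\<lambda>j. E j f g) \<longlonglongrightarrow> 0" if "f \<in> Cc" "g \<in> Cc" for f g
    unfolding E_def using coef_inner_tendsto_Cc[OF that] by (simp add: LIM_zero_iff)
  have step: "(\<lambda>j. E j f g) \<longlonglongrightarrow> 0" if f: "f \<in> L2" and g: "g \<in> Cc" for f g
  proof (rule L2_limit_closure[where T = "\<lambda>j f. E j f g" and K = "(2 * (B1 * B2) + 2) * L2_normsq g"])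
    show "(cmod (E j f g))\<^sup>2 \<le> (2 * (B1 * B2) + 2) * L2_normsq g * L2_normsq f" if "f \<in> L2" for j f
      using bound[OF that Cc_L2[OF g], of j] by (simp only: mult_ac)
    show "E j (\<lambda>x. f x - f' x) g = E j f g - E j f' g" if "f \<in> L2" "f' \<in> L2" for j f f'
      by (rule diff1[OF that Cc_L2[OF g]])
    show "(\<lambda>j. E j f g) \<longlonglongrightarrow> 0" if "f \<in> Cc" for f by (rule base[OF that g])
  qed (rule f)
  have "(\<lambda>j. E j f g) \<longlonglongrightarrow> 0"
  proof (rule L2_limit_closure[where T = "\<lambda>j g. E j f g" and K = "(2 * (B1 * B2) + 2) * L2_normsq f"])
    show "(cmod (E j f g))\<^sup>2 \<le> (2 * (B1 * B2) + 2) * L2_normsq f * L2_normsq g" if "g \<in> L2" for j g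
      using bound[OF f that, of j] by (simp only: mult_ac)
    show "E j f (\<lambda>x. g x - g' x) = E j f g - E j f g'" if "g \<in> L2" "g' \<in> L2" for j g g'
      by (rule diff2[OF f that])
    show "(\<lambda>j. E j f g) \<longlonglongrightarrow> 0" if "g \<in> Cc" for g by (rule step[OF f that])
  qed (rule g)
  then show ?thesis unfolding E_def by (simp add: LIM_zero_iff)
qed

end

section \<open>Perfect reconstruction\<close>

text \<open>The coefficient of \<open>cis (- (lat m \<bullet> \<xi>))\<close> in entry
  \<open>(i, j)\<close> of the conjugate transpose of \<open>mseq_hat b \<xi>\<close> times
  \<open>mseq_hat bt\<close> at the frequency \<open>\<xi> + 2 \<pi> \<omega>\<close>.\<close>

definition correlation ::
    "(int ^ 'd \<Rightarrow> complex ^ 'r ^ 'q) \<Rightarrow> (int ^ 'd \<Rightarrow> complex ^ 'r ^ 'q)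
      \<Rightarrow> real ^ 'd \<Rightarrow> int ^ 'd \<Rightarrow> 'r \<Rightarrow> 'r \<Rightarrow> complex"
  where "correlation b bt \<omega> m i j =
    (\<Sum>p | b p \<noteq> 0. \<Sum>t\<in>UNIV. cnj (b p $ t $ i) * bt (p + m) $ t $ j * ee (- (\<omega> \<bullet> lat (p + m))))"

lemma sum_rotate:
  "(\<Sum>x\<in>A. \<Sum>y\<in>B. \<Sum>z\<in>C. g x y z) = (\<Sum>y\<in>B. \<Sum>z\<in>C. \<Sum>x\<in>A. g x y z)"
  by (subst sum.swap[of _ A]) (intro sum.cong refl sum.swap)

lemma filter_product_eq_correlation:
  fixes b bt :: "int ^ 'd \<Rightarrow> complex ^ 'r ^ 'q"
  assumes b: "finitely_supported b" and D: "finite D" "\<And>p q. b p \<noteq> 0 \<Longrightarrow> bt q \<noteq> 0 \<Longrightarrow> q - p \<in> D"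
  shows "(herm (mseq_hat b \<xi>) ** mseq_hat bt (\<xi> + (2 * pi) *\<^sub>R \<omega>)) $ i $ j
    = (\<Sum>m\<in>D. correlation b bt \<omega> m i j * cis (- (lat m \<bullet> \<xi>)))"
proof -
  let ?P = "{p. b p \<noteq> 0}"
  have P: "finite ?P" using b by (simp add: finitely_supported_def)
  have b_hat: "cnj (seq_hat (\<lambda>k. b k $ t $ i) \<xi>) = (\<Sum>p\<in>?P. cnj (b p $ t $ i) * cis (lat p \<bullet> \<xi>))" for t
    by (subst seq_hat_eq[OF P]) (auto simp: cis_cnj)
  have bt_hat: "seq_hat (\<lambda>k. bt k $ t $ j) \<eta> = (\<Sum>m\<in>D. bt (p + m) $ t $ j * cis (- (lat (p + m) \<bullet> \<eta>)))"
    if p: "p \<in> ?P" for t p \<eta>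
  proof -
    have "seq_hat (\<lambda>k. bt k $ t $ j) \<eta> = (\<Sum>k\<in>(\<lambda>m. p + m) ` D. bt k $ t $ j * cis (- (lat k \<bullet> \<eta>)))"
    proof (rule seq_hat_eq)
      fix k assume k: "k \<notin> (\<lambda>m. p + m) ` D"
      have "bt k = 0"
      proof (rule ccontr)
        assume "bt k \<noteq> 0"
        then have "k - p \<in> D" using p D(2) by blast
        then have "k \<in> (\<lambda>m. p + m) ` D" by (intro image_eqI[of _ _ "k - p"]) auto
        with k show False by blast
      qed
      then show "bt k $ t $ j = 0" by simp
    qed (simp add: D)
    then show ?thesis by (subst (asm) sum.reindex) (auto simp: inj_on_def)
  qed
  have ph: "cis (lat p \<bullet> \<xi>) * cis (- (lat (p + m) \<bullet> (\<xi> + (2 * pi) *\<^sub>R \<omega>)))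
      = ee (- (\<omega> \<bullet> lat (p + m))) * cis (- (lat m \<bullet> \<xi>))" for p m
    by (simp add: ee_def cis_mult lat_add inner_add_left inner_add_right inner_commute algebra_simps)
  have "(herm (mseq_hat b \<xi>) ** mseq_hat bt (\<xi> + (2 * pi) *\<^sub>R \<omega>)) $ i $ j
      = (\<Sum>t\<in>UNIV. \<Sum>p\<in>?P. \<Sum>m\<in>D. cnj (b p $ t $ i) * bt (p + m) $ t $ j
          * (cis (lat p \<bullet> \<xi>) * cis (- (lat (p + m) \<bullet> (\<xi> + (2 * pi) *\<^sub>R \<omega>)))))"
    unfolding matrix_matrix_mult_def herm_def mseq_hat_def vec_lambda_beta b_hat sum_distrib_right
    by (intro sum.cong refl, subst bt_hat, assumption) (simp add: sum_distrib_left mult_ac)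
  also have "\<dots> = (\<Sum>m\<in>D. \<Sum>t\<in>UNIV. \<Sum>p\<in>?P. cnj (b p $ t $ i) * bt (p + m) $ t $ j
          * (ee (- (\<omega> \<bullet> lat (p + m))) * cis (- (lat m \<bullet> \<xi>))))"
    unfolding ph by (rule sum_rotate[symmetric])
  also have "\<dots> = (\<Sum>m\<in>D. \<Sum>p\<in>?P. \<Sum>t\<in>UNIV. cnj (b p $ t $ i) * bt (p + m) $ t $ j
          * (ee (- (\<omega> \<bullet> lat (p + m))) * cis (- (lat m \<bullet> \<xi>))))"
    by (intro sum.cong[OF refl] sum.swap)
  also have "\<dots> = (\<Sum>m\<in>D. correlation b bt \<omega> m i j * cis (- (lat m \<bullet> \<xi>)))"
    by (simp only: correlation_def sum_distrib_right mult.assoc)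
  finally show ?thesis .
qed

section \<open>Filter banks tested on single sites\<close>

abbreviation site :: "int ^ 'd \<Rightarrow> complex ^ 'p \<Rightarrow> int ^ 'd \<Rightarrow> complex ^ 'p"
  where "site k x \<equiv> (\<lambda>m. if m = k then x else 0)"

lemma site_l2: "site k x \<in> l2"
  by (rule l2_finite_support) (rule finite_subset[of _ "{k}"], auto)

lemma transition_site:
  "transition b M (site k x) n = sqrt \<bar>det (rmat M)\<bar> *\<^sub>R (x v* herm (b (k - M *v n)))"
proof -
  have "(\<Sum>\<^sub>\<infinity>m. site k x m v* herm (b (m - M *v n))) = (\<Sum>\<^sub>\<infinity>m\<in>{k}. site k x m v* herm (b (m - M *v n)))"
    by (rule infsum_cong_neutral) auto
  then show ?thesis by (simp add: transition_def)
qed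

lemma l2_inner_site:
  "l2_inner (site k x) (site k' y) = (if k = k' then \<Sum>i\<in>UNIV. x $ i * cnj (y $ i) else 0)"
proof -
  have "l2_inner (site k x) (site k' y) = (\<Sum>\<^sub>\<infinity>m\<in>{k}. \<Sum>i\<in>UNIV. site k x m $ i * cnj (site k' y m $ i))"
    unfolding l2_inner_def by (rule infsum_cong_neutral) auto
  then show ?thesis by simp
qed

text \<open>Only those \<open>p\<close> congruent to \<open>k\<close> modulo the image of
  \<open>M\<close> contribute. \<open>sum_Omega_ee\<close> writes this congruence as a sum of
  characters over \<open>Omega M\<close>, which brings in exactly the coefficients of the
  frequency-side products.\<close>

lemma transition_site_inner:
  fixes b bt :: "int ^ 'd \<Rightarrow> complex ^ 'r ^ 'q"
  assumes b: "finitely_supported b" and det: "det (rmat M) \<noteq> 0"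
  shows "l2_inner (transition b M (site k x)) (transition bt M (site k' y))
    = (\<Sum>i\<in>UNIV. \<Sum>j\<in>UNIV. x $ i * cnj (y $ j) * (\<Sum>\<omega>\<in>Omega M. ee (\<omega> \<bullet> lat k') * correlation b bt \<omega> (k' - k) i j))"
proof -
  let ?P = "{p. b p \<noteq> 0}"
  let ?D = "complex_of_real \<bar>det (rmat M)\<bar>"
  have P: "finite ?P" using b by (simp add: finitely_supported_def)
  define h where "h p = (\<Sum>t\<in>UNIV. (\<Sum>i\<in>UNIV. x $ i * cnj (b p $ t $ i))
      * (\<Sum>j\<in>UNIV. cnj (y $ j) * bt (p + (k' - k)) $ t $ j))" for p
  have h0: "h p = 0" if "p \<notin> ?P" for p using that by (simp add: h_def)
  have "l2_inner (transition b M (site k x)) (transition bt M (site k' y)) = (\<Sum>\<^sub>\<infinity>n. ?D * h (k - M *v n))"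
  proof (unfold l2_inner_def, rule infsum_cong)
    fix n
    have sq: "complex_of_real (sqrt \<bar>det (rmat M)\<bar>) * complex_of_real (sqrt \<bar>det (rmat M)\<bar>) = ?D"
      by (metis abs_ge_zero of_real_mult real_sqrt_mult_self abs_abs)
    have e: "k - M *v n + (k' - k) = k' - M *v n" by simp
    show "(\<Sum>i\<in>UNIV. transition b M (site k x) n $ i * cnj (transition bt M (site k' y) n $ i)) = ?D * h (k - M *v n)"
      unfolding h_def e transition_site sq[symmetric]
      by (simp add: vector_matrix_mult_def herm_def sum_distrib_left scaleR_conv_of_real[where 'a = complex] mult_ac)
  qed
  also have "\<dots> = (\<Sum>\<^sub>\<infinity>p\<in>range (\<lambda>n. k - M *v n). ?D * h p)"
    using infsum_reindex[of "\<lambda>n. k - M *v n" UNIV "\<lambda>p. ?D * h p"] matrix_int_inj[OF det]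
    by (auto simp: inj_def o_def)
  also have "\<dots> = (\<Sum>\<^sub>\<infinity>p\<in>?P. (if k - p \<in> range ((*v) M) then ?D else 0) * h p)"
  proof (rule infsum_cong_neutral)
    fix p assume "p \<in> ?P - range (\<lambda>n. k - M *v n)"
    moreover have "p \<in> range (\<lambda>n. k - M *v n)" if "k - p = M *v n" for n
      using that by (intro image_eqI[of _ _ n]) (simp_all flip: that)
    ultimately have "k - p \<notin> range ((*v) M)" by blast
    then show "(if k - p \<in> range ((*v) M) then ?D else 0) * h p = 0" by simp
  qed (use h0 in auto)
  also have "\<dots> = (\<Sum>p\<in>?P. (\<Sum>\<omega>\<in>Omega M. ee (\<omega> \<bullet> lat (k - p))) * h p)"
    by (simp only: infsum_finite[OF P] sum_Omega_ee[OF det])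
  also have "\<dots> = (\<Sum>p\<in>?P. \<Sum>\<omega>\<in>Omega M. \<Sum>t\<in>UNIV. \<Sum>i\<in>UNIV. \<Sum>j\<in>UNIV. x $ i * cnj (y $ j) * (ee (\<omega> \<bullet> lat k')
      * (cnj (b p $ t $ i) * bt (p + (k' - k)) $ t $ j * ee (- (\<omega> \<bullet> lat (p + (k' - k)))))))"
  proof (rule sum.cong[OF refl])
    fix p
    have "ee (\<omega> \<bullet> lat (k - p)) = ee (\<omega> \<bullet> lat k') * ee (- (\<omega> \<bullet> lat (p + (k' - k))))" for \<omega>
      by (simp add: ee_add[symmetric] lat_add lat_diff inner_add_right inner_diff_right algebra_simps)
    moreover have "h p = (\<Sum>t\<in>UNIV. \<Sum>i\<in>UNIV. \<Sum>j\<in>UNIV. x $ i * cnj (b p $ t $ i) * (cnj (y $ j) * bt (p + (k' - k)) $ t $ j))"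
      unfolding h_def sum_product ..
    ultimately show "(\<Sum>\<omega>\<in>Omega M. ee (\<omega> \<bullet> lat (k - p))) * h p
      = (\<Sum>\<omega>\<in>Omega M. \<Sum>t\<in>UNIV. \<Sum>i\<in>UNIV. \<Sum>j\<in>UNIV. x $ i * cnj (y $ j) * (ee (\<omega> \<bullet> lat k')
      * (cnj (b p $ t $ i) * bt (p + (k' - k)) $ t $ j * ee (- (\<omega> \<bullet> lat (p + (k' - k)))))))"
      by (simp only: sum_distrib_right) (simp only: sum_distrib_left mult_ac)
  qed
  also have "\<dots> = (\<Sum>i\<in>UNIV. \<Sum>j\<in>UNIV. \<Sum>\<omega>\<in>Omega M. \<Sum>p\<in>?P. \<Sum>t\<in>UNIV. x $ i * cnj (y $ j) * (ee (\<omega> \<bullet> lat k')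
      * (cnj (b p $ t $ i) * bt (p + (k' - k)) $ t $ j * ee (- (\<omega> \<bullet> lat (p + (k' - k)))))))"
    by (subst sum_rotate[where A = "UNIV :: 'q set"], subst sum_rotate[where A = "Omega M"], subst sum_rotate[where A = ?P])
       (intro sum.cong[OF refl] sum.swap)
  also have "\<dots> = (\<Sum>i\<in>UNIV. \<Sum>j\<in>UNIV. x $ i * cnj (y $ j) * (\<Sum>\<omega>\<in>Omega M. ee (\<omega> \<bullet> lat k') * correlation b bt \<omega> (k' - k) i j))"
    by (simp only: correlation_def sum_distrib_left)
  finally show ?thesis .
qed

text \<open>The zero set of a trigonometric polynomial is closed, so it is everything as soon as it
  has full measure; independence of the exponentials does the rest.\<close>

lemma trig_polynomial_coeff_zero:
  fixes g :: "int ^ 'd \<Rightarrow> complex"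
  assumes "finite D" and AE: "AE \<xi> in lebesgue. (\<Sum>m\<in>D. g m * cis (- (lat m \<bullet> \<xi>))) = 0" and "m \<in> D"
  shows "g m = 0"
proof (rule characters_independent[where F = D and ch = "\<lambda>m \<xi>. cis (- (lat m \<bullet> \<xi>))"])
  have cl: "closed {\<xi>. (\<Sum>m\<in>D. g m * cis (- (lat m \<bullet> \<xi>))) = 0}"
    by (intro closed_Collect_eq continuous_intros)
  show "(\<Sum>m\<in>D. g m * cis (- (lat m \<bullet> \<xi>))) = 0" for \<xi>
    using mem_closed_if_AE_lebesgue[OF cl, of \<xi>] AE by simp
  fix m n :: "int ^ 'd" assume "m \<noteq> n"
  then obtain i where i: "m $ i \<noteq> n $ i" by (auto simp: vec_eq_iff)
  \<comment> \<open>Chosen so that the two phases differ by \<open>\<pi>\<close> and the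
    exponentials by a sign.\<close>
  let ?\<xi> = "axis i (pi / of_int (m $ i - n $ i)) :: real ^ 'd"
  have "lat m \<bullet> ?\<xi> - lat n \<bullet> ?\<xi> = pi"
    using i by (simp add: inner_axis' inner_commute[of "lat _"] inner_axis diff_divide_distrib[symmetric] left_diff_distrib[symmetric] field_simps)
  then have e: "lat m \<bullet> ?\<xi> = lat n \<bullet> ?\<xi> + pi" by linarith
  have "cis (- (lat m \<bullet> ?\<xi>)) = cis (- (lat n \<bullet> ?\<xi>)) * cis (- pi)"
    unfolding e cis_mult by simp
  then have "cis (- (lat m \<bullet> ?\<xi>)) = - cis (- (lat n \<bullet> ?\<xi>))"
    by (simp add: complex_eq_iff)
  then have "cis (- (lat m \<bullet> ?\<xi>)) \<noteq> cis (- (lat n \<bullet> ?\<xi>))"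
    using cis_neq_zero[of "- (lat n \<bullet> ?\<xi>)"] by simp
  then show "\<exists>\<xi>. cis (- (lat m \<bullet> \<xi>)) \<noteq> cis (- (lat n \<bullet> \<xi>))" by blast
qed (use assms in \<open>auto simp: inner_add_right cis_mult\<close>)

text \<open>Two points of the half-open cube differ by less than 1 in every coordinate, so distinct
  ones define distinct characters of the integer lattice.\<close>

lemma lattice_characters_independent:
  fixes g :: "real ^ 'd \<Rightarrow> complex"
  assumes "finite F" "F \<subseteq> unit_cube" and zero: "\<And>k. (\<Sum>\<omega>\<in>F. g \<omega> * ee (\<omega> \<bullet> lat k)) = 0" and "\<omega> \<in> F"
  shows "g \<omega> = 0"
proof (rule characters_independent[where F = F and ch = "\<lambda>\<omega> k. ee (\<omega> \<bullet> lat k)"])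
  fix \<omega> \<omega>' assume F: "\<omega> \<in> F" "\<omega>' \<in> F" and "\<omega> \<noteq> \<omega>'"
  then obtain i where i: "\<omega> $ i \<noteq> \<omega>' $ i" by (auto simp: vec_eq_iff)
  have l: "x \<bullet> lat (axis i 1) = x $ i" for x :: "real ^ 'd"
  proof -
    have "lat (axis i 1 :: int ^ 'd) = axis i 1" by (simp add: vec_eq_iff axis_def)
    then show ?thesis by (simp add: inner_axis)
  qed
  have "ee (\<omega> $ i) \<noteq> ee (\<omega>' $ i)"
  proof
    assume "ee (\<omega> $ i) = ee (\<omega>' $ i)"
    then have "ee (\<omega> $ i - \<omega>' $ i) = 1"
      unfolding ee_diff by (metis complex_norm_square norm_ee of_real_1 one_power2)
    then obtain z where z: "\<omega> $ i - \<omega>' $ i = of_int z" using ee_eq_1_imp_Ints Ints_cases by metis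
    have "0 \<le> \<omega> $ i" "\<omega> $ i < 1" "0 \<le> \<omega>' $ i" "\<omega>' $ i < 1" using F assms(2) by (auto simp: unit_cube_def)
    then have "\<bar>\<omega> $ i - \<omega>' $ i\<bar> < 1" by linarith
    then have "z = 0" unfolding z by linarith
    with z i show False by simp
  qed
  then show "\<exists>k. ee (\<omega> \<bullet> lat k) \<noteq> ee (\<omega>' \<bullet> lat k)" using l by metis
qed (use assms in \<open>auto simp: lat_add inner_add_right ee_add\<close>)

lemma sum_axis_axis:
  "(\<Sum>i'\<in>UNIV. \<Sum>j'\<in>UNIV. axis i 1 $ i' * cnj (axis j 1 $ j') * g i' j') = g i j" for g :: "'n::finite \<Rightarrow> 'n \<Rightarrow> complex"
proof -
  have "(\<Sum>i'\<in>UNIV. \<Sum>j'\<in>UNIV. axis i 1 $ i' * cnj (axis j 1 $ j') * g i' j')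
      = (\<Sum>i'\<in>UNIV. if i' = i then (\<Sum>j'\<in>UNIV. if j' = j then g i' j' else 0) else 0)"
  proof (rule sum.cong[OF refl])
    fix i'
    have "axis i 1 $ i' * cnj (axis j 1 $ j') * g i' j' = (if j' = j then (if i' = i then g i' j' else 0) else 0)" for j'
      by (simp add: axis_def)
    then show "(\<Sum>j'\<in>UNIV. axis i 1 $ i' * cnj (axis j 1 $ j') * g i' j')
        = (if i' = i then (\<Sum>j'\<in>UNIV. if j' = j then g i' j' else 0) else 0)" by simp
  qed
  then show ?thesis by simp
qed

text \<open>One step of analysis and synthesis in weak form: synthesis is the adjoint of analysis
  with the dual bank, so perfect reconstruction means equality with \<open>l2_inner\<close>.\<close>

definition pr_form ::
    "nat \<Rightarrow> (nat \<Rightarrow> int ^ 'd ^ 'd)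
      \<Rightarrow> (int ^ 'd \<Rightarrow> complex ^ 'r ^ 'r) \<Rightarrow> (nat \<Rightarrow> int ^ 'd \<Rightarrow> complex ^ 'r ^ 1)
      \<Rightarrow> (int ^ 'd \<Rightarrow> complex ^ 'r ^ 'r) \<Rightarrow> (nat \<Rightarrow> int ^ 'd \<Rightarrow> complex ^ 'r ^ 1)
      \<Rightarrow> (int ^ 'd \<Rightarrow> complex ^ 'r) \<Rightarrow> (int ^ 'd \<Rightarrow> complex ^ 'r) \<Rightarrow> complex"
  where "pr_form s M b0 b bt0 bt v w =
    l2_inner (transition b0 (M 0) v) (transition bt0 (M 0) w)
    + (\<Sum>l = 1..s. l2_inner (transition (b l) (M l) v) (transition (bt l) (M l) w))"

section \<open>Equivalence of the filter bank condition with perfect reconstruction\<close>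

locale filter_banks =
  fixes s :: nat and M :: "nat \<Rightarrow> int ^ 'd ^ 'd"
    and b0 bt0 :: "int ^ 'd \<Rightarrow> complex ^ 'r ^ 'r"
    and b bt :: "nat \<Rightarrow> int ^ 'd \<Rightarrow> complex ^ 'r ^ 1"
  assumes fin0: "finitely_supported b0" "finitely_supported bt0"
    and fin: "l \<in> {1..s} \<Longrightarrow> finitely_supported (b l)" "l \<in> {1..s} \<Longrightarrow> finitely_supported (bt l)"
    and det: "l \<in> {0..s} \<Longrightarrow> det (rmat (M l)) \<noteq> 0"
begin

abbreviation "PR \<equiv> pr_form s M b0 b bt0 bt"

abbreviation "Freq \<equiv> (\<Union>l\<in>{0..s}. Omega (M l))"

text \<open>The coefficient of \<open>cis (- (lat m \<bullet> \<xi>))\<close> on the left of the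
  filter bank condition at the frequency \<open>\<omega>\<close>; the condition says that it is a
  Kronecker symbol.\<close>

definition Dcoef :: "real ^ 'd \<Rightarrow> int ^ 'd \<Rightarrow> 'r \<Rightarrow> 'r \<Rightarrow> complex"
  where "Dcoef \<omega> m i j = indicator (Omega (M 0)) \<omega> * correlation b0 bt0 \<omega> m i j
    + (\<Sum>l = 1..s. indicator (Omega (M l)) \<omega> * correlation (b l) (bt l) \<omega> m i j)"

lemma finite_Freq: "finite Freq" by (simp add: card_Omega(1) det)

lemma Freq_unit_cube: "Freq \<subseteq> unit_cube" by (auto simp: Omega_iff)

lemma zero_in_Freq: "0 \<in> Freq" using zero_in_Omega by force

text \<open>Indicators extend the sums over the different \<open>Omega (M l)\<close> to the common
  finite set \<open>Freq\<close>, so that all dilations together form a single combination of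
  lattice characters.\<close>

lemma PR_site:
  "PR (site k x) (site k' y) =
    (\<Sum>i\<in>UNIV. \<Sum>j\<in>UNIV. x $ i * cnj (y $ j) * (\<Sum>\<omega>\<in>Freq. ee (\<omega> \<bullet> lat k') * Dcoef \<omega> (k' - k) i j))"
proof -
  have ext: "(\<Sum>\<omega>\<in>Omega (M l). ee (\<omega> \<bullet> lat k') * c \<omega>)
      = (\<Sum>\<omega>\<in>Freq. ee (\<omega> \<bullet> lat k') * (indicator (Omega (M l)) \<omega> * c \<omega>))" if "l \<in> {0..s}" for l and c :: "_ \<Rightarrow> complex"
    by (rule sum.mono_neutral_cong_left[OF finite_Freq]) (use that in auto)
  have "PR (site k x) (site k' y) =
      (\<Sum>i\<in>UNIV. \<Sum>j\<in>UNIV. x $ i * cnj (y $ j) * (\<Sum>\<omega>\<in>Freq. ee (\<omega> \<bullet> lat k') * (indicator (Omega (M 0)) \<omega> * correlation b0 bt0 \<omega> (k' - k) i j)))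
      + (\<Sum>l = 1..s. (\<Sum>i\<in>UNIV. \<Sum>j\<in>UNIV. x $ i * cnj (y $ j) * (\<Sum>\<omega>\<in>Freq. ee (\<omega> \<bullet> lat k') * (indicator (Omega (M l)) \<omega> * correlation (b l) (bt l) \<omega> (k' - k) i j))))"
    unfolding pr_form_def
    by (intro arg_cong2[of _ _ _ _ "(+)"] sum.cong refl; subst transition_site_inner) (use fin0 fin det ext in auto)
  also have "\<dots> = (\<Sum>i\<in>UNIV. \<Sum>j\<in>UNIV. x $ i * cnj (y $ j) * (\<Sum>\<omega>\<in>Freq. ee (\<omega> \<bullet> lat k') * Dcoef \<omega> (k' - k) i j))"
    unfolding Dcoef_def distrib_left sum.distrib
    by (simp only: sum_distrib_left sum.swap[of _ "UNIV :: 'r set" "{1..s}"] sum.swap[of _ Freq "{1..s}"])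
  finally show ?thesis .
qed

text \<open>For fixed \<open>m\<close>, pairs of sites with difference \<open>m\<close> give one
  relation for each \<open>k'\<close>; together they state that a combination of distinct characters
  vanishes.\<close>

lemma PR_imp_Dcoef:
  assumes "\<And>k k' x y. PR (site k x) (site k' y) = l2_inner (site k x) (site k' y)" and \<omega>: "\<omega> \<in> Freq"
  shows "Dcoef \<omega> m i j = (if \<omega> = 0 \<and> m = 0 \<and> i = j then 1 else 0)"
proof -
  let ?\<delta> = "\<lambda>\<omega>. if \<omega> = 0 \<and> m = 0 \<and> i = j then 1 else (0::complex)"
  have "Dcoef \<omega> m i j - ?\<delta> \<omega> = 0"
  proof (rule lattice_characters_independent[OF finite_Freq Freq_unit_cube _ \<omega>])
    fix k' :: "int ^ 'd"
    have "(\<Sum>\<omega>\<in>Freq. ee (\<omega> \<bullet> lat k') * Dcoef \<omega> (k' - (k' - m)) i j) = PR (site (k' - m) (axis i 1)) (site k' (axis j 1))"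
      unfolding PR_site sum_axis_axis ..
    also have "\<dots> = (if m = 0 \<and> i = j then 1 else 0)"
    proof -
      have "(\<Sum>t\<in>UNIV. axis i 1 $ t * cnj (axis j 1 $ t)) = (\<Sum>t\<in>UNIV. if t = i then (if i = j then 1 else 0) else 0 :: complex)"
        by (intro sum.cong refl) (auto simp: axis_def)
      then show ?thesis unfolding assms(1) l2_inner_site by auto
    qed
    finally have 1: "(\<Sum>\<omega>\<in>Freq. ee (\<omega> \<bullet> lat k') * Dcoef \<omega> m i j) = (if m = 0 \<and> i = j then 1 else 0)" by simp
    have "(\<Sum>\<omega>\<in>Freq. ?\<delta> \<omega> * ee (\<omega> \<bullet> lat k')) = (\<Sum>\<omega>\<in>Freq. if \<omega> = 0 then (if m = 0 \<and> i = j then 1 else 0) else 0)"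
      by (intro sum.cong) auto
    also have "\<dots> = (if m = 0 \<and> i = j then 1 else 0)" using finite_Freq zero_in_Freq by (subst sum.delta) auto
    finally have 2: "(\<Sum>\<omega>\<in>Freq. ?\<delta> \<omega> * ee (\<omega> \<bullet> lat k')) = (if m = 0 \<and> i = j then 1 else 0)" .
    show "(\<Sum>\<omega>\<in>Freq. (Dcoef \<omega> m i j - ?\<delta> \<omega>) * ee (\<omega> \<bullet> lat k')) = 0"
      unfolding left_diff_distrib sum_subtractf 2 using 1 by (simp add: mult.commute)
  qed
  then show ?thesis by simp
qed

lemma Dcoef_imp_PR_site:
  assumes D: "\<And>\<omega> m i j. \<omega> \<in> Freq \<Longrightarrow> Dcoef \<omega> m i j = (if \<omega> = 0 \<and> m = 0 \<and> i = j then 1 else 0)"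
  shows "PR (site k x) (site k' y) = l2_inner (site k x) (site k' y)"
proof -
  have "(\<Sum>\<omega>\<in>Freq. ee (\<omega> \<bullet> lat k') * Dcoef \<omega> m i j) = (\<Sum>\<omega>\<in>Freq. if \<omega> = 0 then (if m = 0 \<and> i = j then 1 else 0) else 0)" for m i j
    by (intro sum.cong) (auto simp: D)
  then have "(\<Sum>\<omega>\<in>Freq. ee (\<omega> \<bullet> lat k') * Dcoef \<omega> m i j) = (if m = 0 \<and> i = j then 1 else 0)" for m i j
    using finite_Freq zero_in_Freq by (subst (asm) sum.delta) auto
  then show ?thesis
    unfolding PR_site l2_inner_site by (auto simp: if_distrib[of "\<lambda>x. _ * x"] cong: if_cong)
qed

text \<open>A common finite set of differences of support points serves all filters. It contains 0
  so that the constant identity matrix on the other side of the condition is expanded over the same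
  set.\<close>

lemma fb_entry:
  "\<exists>D. finite D \<and> 0 \<in> D \<and> (\<forall>\<omega> \<xi> i j.
    (indicator (Omega (M 0)) \<omega> *\<^sub>R (herm (mseq_hat b0 \<xi>) ** mseq_hat bt0 (\<xi> + (2 * pi) *\<^sub>R \<omega>))
      + (\<Sum>l = 1..s. indicator (Omega (M l)) \<omega> *\<^sub>R (herm (mseq_hat (b l) \<xi>) ** mseq_hat (bt l) (\<xi> + (2 * pi) *\<^sub>R \<omega>)))) $ i $ j
    = (\<Sum>m\<in>D. Dcoef \<omega> m i j * cis (- (lat m \<bullet> \<xi>)))) \<and> (\<forall>m \<omega> i j. m \<notin> D \<longrightarrow> Dcoef \<omega> m i j = 0)"
proof -
  let ?S = "\<lambda>b bt. (\<lambda>(p, q). q - p) ` ({p. b p \<noteq> 0} \<times> {q. bt q \<noteq> 0})"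
  let ?D = "insert 0 (?S b0 bt0 \<union> (\<Union>l\<in>{1..s}. ?S (b l) (bt l)))"
  have finD: "finite ?D"
    using fin0 fin by (auto simp: finitely_supported_def intro!: finite_imageI finite_cartesian_product)
  have "(indicator (Omega (M 0)) \<omega> *\<^sub>R (herm (mseq_hat b0 \<xi>) ** mseq_hat bt0 (\<xi> + (2 * pi) *\<^sub>R \<omega>))
      + (\<Sum>l = 1..s. indicator (Omega (M l)) \<omega> *\<^sub>R (herm (mseq_hat (b l) \<xi>) ** mseq_hat (bt l) (\<xi> + (2 * pi) *\<^sub>R \<omega>)))) $ i $ j
    = (\<Sum>m\<in>?D. Dcoef \<omega> m i j * cis (- (lat m \<bullet> \<xi>)))" for \<omega> \<xi> i j
  proof -
    have 0: "(herm (mseq_hat b0 \<xi>) ** mseq_hat bt0 (\<xi> + (2 * pi) *\<^sub>R \<omega>)) $ i $ j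
        = (\<Sum>m\<in>?D. correlation b0 bt0 \<omega> m i j * cis (- (lat m \<bullet> \<xi>)))"
      by (rule filter_product_eq_correlation[OF fin0(1) finD]) force
    have 1: "(herm (mseq_hat (b l) \<xi>) ** mseq_hat (bt l) (\<xi> + (2 * pi) *\<^sub>R \<omega>)) $ i $ j
        = (\<Sum>m\<in>?D. correlation (b l) (bt l) \<omega> m i j * cis (- (lat m \<bullet> \<xi>)))" if "l \<in> {1..s}" for l
      by (rule filter_product_eq_correlation[OF fin(1)[OF that] finD]) (use that in force)
    have ind: "(indicator S \<omega> *\<^sub>R z :: complex) = indicator S \<omega> * z" for S z
      by (simp add: indicator_def)
    have "(indicator (Omega (M 0)) \<omega> *\<^sub>R (herm (mseq_hat b0 \<xi>) ** mseq_hat bt0 (\<xi> + (2 * pi) *\<^sub>R \<omega>))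
      + (\<Sum>l = 1..s. indicator (Omega (M l)) \<omega> *\<^sub>R (herm (mseq_hat (b l) \<xi>) ** mseq_hat (bt l) (\<xi> + (2 * pi) *\<^sub>R \<omega>)))) $ i $ j
      = indicator (Omega (M 0)) \<omega> * (herm (mseq_hat b0 \<xi>) ** mseq_hat bt0 (\<xi> + (2 * pi) *\<^sub>R \<omega>)) $ i $ j
      + (\<Sum>l = 1..s. indicator (Omega (M l)) \<omega> * (herm (mseq_hat (b l) \<xi>) ** mseq_hat (bt l) (\<xi> + (2 * pi) *\<^sub>R \<omega>)) $ i $ j)"
      by (simp add: ind)
    also have "\<dots> = indicator (Omega (M 0)) \<omega> * (\<Sum>m\<in>?D. correlation b0 bt0 \<omega> m i j * cis (- (lat m \<bullet> \<xi>)))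
      + (\<Sum>l = 1..s. indicator (Omega (M l)) \<omega> * (\<Sum>m\<in>?D. correlation (b l) (bt l) \<omega> m i j * cis (- (lat m \<bullet> \<xi>))))"
      unfolding 0 by (intro arg_cong2[of _ _ _ _ "(+)"] refl sum.cong arg_cong2[of _ _ _ _ "(*)"] 1)
    also have "\<dots> = (\<Sum>m\<in>?D. Dcoef \<omega> m i j * cis (- (lat m \<bullet> \<xi>)))"
      unfolding Dcoef_def distrib_right sum.distrib sum_distrib_right sum_distrib_left sum.swap[of _ "{1..s}" ?D]
      by (simp only: mult.assoc)
    finally show ?thesis .
  qed
  moreover have "Dcoef \<omega> m i j = 0" if m: "m \<notin> ?D" for m \<omega> i j
  proof -
    have c0: "correlation \<beta> \<gamma> \<omega> m i j = 0" if "m \<notin> ?S \<beta> \<gamma>" for \<beta> \<gamma> :: "int ^ 'd \<Rightarrow> complex ^ 'r ^ 'q"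
    proof -
      have "\<gamma> (p + m) = 0" if "\<beta> p \<noteq> 0" for p
      proof (rule ccontr)
        assume "\<gamma> (p + m) \<noteq> 0"
        then have "m \<in> ?S \<beta> \<gamma>" using \<open>\<beta> p \<noteq> 0\<close> by (intro image_eqI[of _ _ "(p, p + m)"]) auto
        with \<open>m \<notin> ?S \<beta> \<gamma>\<close> show False by blast
      qed
      then show ?thesis by (simp add: correlation_def)
    qed
    have "correlation (b l) (bt l) \<omega> m i j = 0" if "l \<in> {1..s}" for l
      by (rule c0) (use m that in blast)
    moreover have "correlation b0 bt0 \<omega> m i j = 0" by (rule c0) (use m in blast)
    ultimately show ?thesis by (simp add: Dcoef_def)
  qed
  ultimately show ?thesis using finD by (intro exI[of _ ?D]) blast
qed

lemma dual_framelet_filter_bank_iff_Dcoef: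
  "dual_framelet_filter_bank s M b0 b bt0 bt \<longleftrightarrow>
    (\<forall>\<omega>\<in>Freq. \<forall>m i j. Dcoef \<omega> m i j = (if \<omega> = 0 \<and> m = 0 \<and> i = j then 1 else 0))"
proof -
  obtain D where D: "finite D" "0 \<in> D"
    and eq: "\<And>\<omega> \<xi> i j.
    (indicator (Omega (M 0)) \<omega> *\<^sub>R (herm (mseq_hat b0 \<xi>) ** mseq_hat bt0 (\<xi> + (2 * pi) *\<^sub>R \<omega>))
      + (\<Sum>l = 1..s. indicator (Omega (M l)) \<omega> *\<^sub>R (herm (mseq_hat (b l) \<xi>) ** mseq_hat (bt l) (\<xi> + (2 * pi) *\<^sub>R \<omega>)))) $ i $ j
    = (\<Sum>m\<in>D. Dcoef \<omega> m i j * cis (- (lat m \<bullet> \<xi>)))"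
    and out: "\<And>m \<omega> i j. m \<notin> D \<Longrightarrow> Dcoef \<omega> m i j = 0"
    using fb_entry by blast
  define \<delta> where "\<delta> \<omega> m i j = (if \<omega> = 0 \<and> m = 0 \<and> i = j then 1 else (0::complex))"
    for \<omega> :: "real ^ 'd" and m :: "int ^ 'd" and i j :: 'r
  have rhs: "((if \<omega> = 0 then mat 1 else 0) :: complex ^ 'r ^ 'r) $ i $ j = (\<Sum>m\<in>D. \<delta> \<omega> m i j * cis (- (lat m \<bullet> \<xi>)))" for \<omega> \<xi> i j
  proof -
    have "(\<Sum>m\<in>D. \<delta> \<omega> m i j * cis (- (lat m \<bullet> \<xi>))) = (\<Sum>m\<in>D. if m = 0 then (if \<omega> = 0 \<and> i = j then 1 else 0) else 0)"
      by (intro sum.cong) (auto simp: \<delta>_def)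
    also have "\<dots> = (if \<omega> = 0 \<and> i = j then 1 else 0)" using D by (subst sum.delta) auto
    finally show ?thesis by (simp add: mat_def)
  qed
  have "dual_framelet_filter_bank s M b0 b bt0 bt \<longleftrightarrow>
      (AE \<xi> in lebesgue. \<forall>\<omega>\<in>Freq. \<forall>i j. (\<Sum>m\<in>D. (Dcoef \<omega> m i j - \<delta> \<omega> m i j) * cis (- (lat m \<bullet> \<xi>))) = 0)"
  proof -
    have "(X = Y) \<longleftrightarrow> (\<forall>i j. X $ i $ j = Y $ i $ j)" for X Y :: "complex ^ 'r ^ 'r"
      by (simp add: vec_eq_iff)
    then have entrywise: "(X = (if \<omega> = 0 then mat 1 else 0)) \<longleftrightarrow> (\<forall>i j. X $ i $ j - (\<Sum>m\<in>D. \<delta> \<omega> m i j * cis (- (lat m \<bullet> \<xi>))) = 0)"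
      for X :: "complex ^ 'r ^ 'r" and \<omega> \<xi>
      by (simp add: rhs[of \<omega> _ _ \<xi>, symmetric])
    show ?thesis
      unfolding dual_framelet_filter_bank_def
    proof (rule arg_cong[where f = "\<lambda>P. AE \<xi> in lebesgue. P \<xi>"], rule ext)
      fix \<xi>
      show "(\<forall>\<omega>\<in>Freq.
        indicator (Omega (M 0)) \<omega> *\<^sub>R (herm (mseq_hat b0 \<xi>) ** mseq_hat bt0 (\<xi> + (2 * pi) *\<^sub>R \<omega>))
        + (\<Sum>l = 1..s. indicator (Omega (M l)) \<omega> *\<^sub>R (herm (mseq_hat (b l) \<xi>) ** mseq_hat (bt l) (\<xi> + (2 * pi) *\<^sub>R \<omega>)))
        = (if \<omega> = 0 then mat 1 else 0))
        \<longleftrightarrow> (\<forall>\<omega>\<in>Freq. \<forall>i j. (\<Sum>m\<in>D. (Dcoef \<omega> m i j - \<delta> \<omega> m i j) * cis (- (lat m \<bullet> \<xi>))) = 0)"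
        by (simp only: entrywise[where \<xi> = \<xi>] eq left_diff_distrib sum_subtractf)
    qed
  qed
  also have "\<dots> \<longleftrightarrow> (\<forall>\<omega>\<in>Freq. \<forall>m i j. Dcoef \<omega> m i j = \<delta> \<omega> m i j)"
  proof
    assume AE: "AE \<xi> in lebesgue. \<forall>\<omega>\<in>Freq. \<forall>i j. (\<Sum>m\<in>D. (Dcoef \<omega> m i j - \<delta> \<omega> m i j) * cis (- (lat m \<bullet> \<xi>))) = 0"
    show "\<forall>\<omega>\<in>Freq. \<forall>m i j. Dcoef \<omega> m i j = \<delta> \<omega> m i j"
    proof (intro ballI allI)
      fix \<omega> m i j assume \<omega>: "\<omega> \<in> Freq"
      show "Dcoef \<omega> m i j = \<delta> \<omega> m i j"
      proof (cases "m \<in> D")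
        case True
        have "Dcoef \<omega> m i j - \<delta> \<omega> m i j = 0"
        proof (rule trig_polynomial_coeff_zero[OF D(1) _ True])
          show "AE \<xi> in lebesgue. (\<Sum>m\<in>D. (Dcoef \<omega> m i j - \<delta> \<omega> m i j) * cis (- (lat m \<bullet> \<xi>))) = 0"
            using AE
          proof eventually_elim
            case (elim \<xi>)
            show ?case by (rule elim[rule_format, OF \<omega>])
          qed
        qed
        then show ?thesis by simp
      next
        case False
        then show ?thesis using D(2) by (auto simp: out \<delta>_def)
      qed
    qed
  qed simp
  finally show ?thesis unfolding \<delta>_def .
qed

lemma det_0: "det (rmat (M 0)) \<noteq> 0" by (rule det) simp

lemma transitions_l2:
  assumes "v \<in> l2"
  shows "transition b0 (M 0) v \<in> l2" "transition bt0 (M 0) v \<in> l2"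
    "l \<in> {1..s} \<Longrightarrow> transition (b l) (M l) v \<in> l2" "l \<in> {1..s} \<Longrightarrow> transition (bt l) (M l) v \<in> l2"
  using assms by (auto intro!: transition_l2 fin0 fin det)

lemma PR_diff:
  assumes "v \<in> l2" "v' \<in> l2" "w \<in> l2" "w' \<in> l2"
  shows "PR (\<lambda>k. v k - v' k) w = PR v w - PR v' w" "PR v (\<lambda>k. w k - w' k) = PR v w - PR v w'"
proof -
  have "(\<Sum>l = 1..s. l2_inner (transition (b l) (M l) (\<lambda>k. v k - v' k)) (transition (bt l) (M l) w))
      = (\<Sum>l = 1..s. l2_inner (transition (b l) (M l) v) (transition (bt l) (M l) w)
        - l2_inner (transition (b l) (M l) v') (transition (bt l) (M l) w))"
    by (intro sum.cong refl) (simp add: transition_diff fin l2_inner_diff_left transitions_l2 assms)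
  then show "PR (\<lambda>k. v k - v' k) w = PR v w - PR v' w"
    unfolding pr_form_def by (simp add: transition_diff fin0 l2_inner_diff_left transitions_l2 assms sum_subtractf)
  have "(\<Sum>l = 1..s. l2_inner (transition (b l) (M l) v) (transition (bt l) (M l) (\<lambda>k. w k - w' k)))
      = (\<Sum>l = 1..s. l2_inner (transition (b l) (M l) v) (transition (bt l) (M l) w)
        - l2_inner (transition (b l) (M l) v) (transition (bt l) (M l) w'))"
    by (intro sum.cong refl) (simp add: transition_diff fin l2_inner_diff_right transitions_l2 assms)
  then show "PR v (\<lambda>k. w k - w' k) = PR v w - PR v w'"
    unfolding pr_form_def by (simp add: transition_diff fin0 l2_inner_diff_right transitions_l2 assms sum_subtractf)
qed

lemma transition_inner_bounded:
  assumes "finitely_supported \<beta>" "finitely_supported \<beta>t" "det (rmat N) \<noteq> 0"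
  shows "\<exists>K \<ge> 0. \<forall>v \<in> l2. \<forall>w \<in> l2.
    cmod (l2_inner (transition \<beta> N v) (transition \<beta>t N w)) \<le> K * sqrt (l2_normsq v * l2_normsq w)"
proof -
  obtain K1 where K1: "K1 \<ge> 0" "\<And>v. v \<in> l2 \<Longrightarrow> transition \<beta> N v \<in> l2 \<and> l2_normsq (transition \<beta> N v) \<le> K1 * l2_normsq v"
    by (rule transition_bounded_aux[OF assms(1,3)]) blast
  obtain K2 where K2: "K2 \<ge> 0" "\<And>v. v \<in> l2 \<Longrightarrow> transition \<beta>t N v \<in> l2 \<and> l2_normsq (transition \<beta>t N v) \<le> K2 * l2_normsq v"
    by (rule transition_bounded_aux[OF assms(2,3)]) blast
  have "cmod (l2_inner (transition \<beta> N v) (transition \<beta>t N w)) \<le> sqrt (K1 * K2) * sqrt (l2_normsq v * l2_normsq w)"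
    if "v \<in> l2" "w \<in> l2" for v w
  proof -
    have "(cmod (l2_inner (transition \<beta> N v) (transition \<beta>t N w)))\<^sup>2 \<le> l2_normsq (transition \<beta> N v) * l2_normsq (transition \<beta>t N w)"
      using K1 K2 that by (intro l2_Cauchy_Schwarz) auto
    also have "\<dots> \<le> (K1 * l2_normsq v) * (K2 * l2_normsq w)"
      using K1 K2 that by (intro mult_mono) (auto simp: l2_normsq_nonneg)
    also have "\<dots> = (K1 * K2) * (l2_normsq v * l2_normsq w)" by simp
    finally show ?thesis
      using real_le_rsqrt[of "cmod (l2_inner (transition \<beta> N v) (transition \<beta>t N w))" "(K1 * K2) * (l2_normsq v * l2_normsq w)"]
      by (simp add: real_sqrt_mult)
  qed
  then show ?thesis using K1(1) K2(1) by (intro exI[of _ "sqrt (K1 * K2)"]) auto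
qed

lemma PR_bounded:
  "\<exists>K \<ge> 0. \<forall>v \<in> l2. \<forall>w \<in> l2. cmod (PR v w) \<le> K * sqrt (l2_normsq v * l2_normsq w)"
proof -
  obtain K0 where K0: "K0 \<ge> 0" "\<forall>v \<in> l2. \<forall>w \<in> l2.
      cmod (l2_inner (transition b0 (M 0) v) (transition bt0 (M 0) w)) \<le> K0 * sqrt (l2_normsq v * l2_normsq w)"
    using transition_inner_bounded[OF fin0 det_0] by blast
  have "\<forall>l\<in>{1..s}. \<exists>K \<ge> 0. \<forall>v \<in> l2. \<forall>w \<in> l2.
      cmod (l2_inner (transition (b l) (M l) v) (transition (bt l) (M l) w)) \<le> K * sqrt (l2_normsq v * l2_normsq w)"
    by (intro ballI transition_inner_bounded fin det) auto
  then obtain K where K: "\<forall>l\<in>{1..s}. K l \<ge> 0 \<and> (\<forall>v \<in> l2. \<forall>w \<in> l2.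
      cmod (l2_inner (transition (b l) (M l) v) (transition (bt l) (M l) w)) \<le> K l * sqrt (l2_normsq v * l2_normsq w))"
    by metis
  have "cmod (PR v w) \<le> (K0 + (\<Sum>l = 1..s. K l)) * sqrt (l2_normsq v * l2_normsq w)" if "v \<in> l2" "w \<in> l2" for v w
    unfolding pr_form_def distrib_right sum_distrib_right
    by (intro norm_triangle_mono K0(2)[rule_format] sum_norm_le that) (use K that in auto)
  then show ?thesis using K0(1) K by (intro exI[of _ "K0 + (\<Sum>l = 1..s. K l)"]) (auto intro!: add_nonneg_nonneg sum_nonneg)
qed

text \<open>Continuity of the reconstruction error, in the shape that the vanishing criteria for
  functionals on \<open>l2\<close> expect in either argument.\<close>

lemma PR_error_bounded:
  "\<exists>K. \<forall>v \<in> l2. \<forall>w \<in> l2. (cmod (PR v w - l2_inner v w))\<^sup>2 \<le> K * l2_normsq v * l2_normsq w"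
proof -
  obtain K where K: "K \<ge> 0" "\<And>v w. v \<in> l2 \<Longrightarrow> w \<in> l2 \<Longrightarrow> cmod (PR v w) \<le> K * sqrt (l2_normsq v * l2_normsq w)"
    using PR_bounded by blast
  have bound: "(cmod (PR v w - l2_inner v w))\<^sup>2 \<le> ((K + 1)\<^sup>2 * l2_normsq v) * l2_normsq w" if "v \<in> l2" "w \<in> l2" for v w
  proof -
    have "cmod (l2_inner v w) \<le> sqrt (l2_normsq v * l2_normsq w)"
      using l2_Cauchy_Schwarz[OF that] by (rule real_le_rsqrt)
    then have "cmod (PR v w - l2_inner v w) \<le> (K + 1) * sqrt (l2_normsq v * l2_normsq w)"
      using norm_triangle_ineq4[of "PR v w" "l2_inner v w"] K(2)[OF that] by (simp add: distrib_right)
    then have "(cmod (PR v w - l2_inner v w))\<^sup>2 \<le> ((K + 1) * sqrt (l2_normsq v * l2_normsq w))\<^sup>2"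
      by (intro power_mono) auto
    then show ?thesis by (simp add: power_mult_distrib l2_normsq_nonneg)
  qed
  then show ?thesis by blast
qed

lemma PR_site_imp_PR:
  assumes site: "\<And>k k' x y. PR (site k x) (site k' y) = l2_inner (site k x) (site k' y)"
    and v: "v \<in> l2" and w: "w \<in> l2"
  shows "PR v w = l2_inner v w"
proof -
  obtain K where bound: "\<And>v w. v \<in> l2 \<Longrightarrow> w \<in> l2 \<Longrightarrow> (cmod (PR v w - l2_inner v w))\<^sup>2 \<le> K * l2_normsq v * l2_normsq w"
    using PR_error_bounded by blast
  have "PR (site k x) w - l2_inner (site k x) w = 0" for k x
  proof (rule l2_functional_zero[where F = "\<lambda>w. PR (site k x) w - l2_inner (site k x) w", OF _ _ _ w])
    show "(cmod (PR (site k x) w - l2_inner (site k x) w))\<^sup>2 \<le> (K * l2_normsq (site k x)) * l2_normsq w" if "w \<in> l2" for w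
      using bound[OF site_l2 that] by simp
  qed (simp_all add: PR_diff(2)[OF site_l2 site_l2] l2_inner_diff_right site_l2 site)
  then have "PR v w - l2_inner v w = 0"
  proof (intro l2_functional_zero[where F = "\<lambda>v. PR v w - l2_inner v w", OF _ _ _ v])
    show "(cmod (PR v w - l2_inner v w))\<^sup>2 \<le> (K * l2_normsq w) * l2_normsq v" if "v \<in> l2" for v
      using bound[OF that w] by (simp add: mult_ac)
  qed (simp_all add: PR_diff(1)[OF _ _ w w] l2_inner_diff_left w)
  then show ?thesis by simp
qed

text \<open>Both sides are equivalent to the same values of \<open>Dcoef\<close>: the filter bank
  condition by independence of exponentials in \<open>\<xi>\<close>, reconstruction by independence
  of characters in the site.\<close>

theorem dual_framelet_filter_bank_iff_PR:
  "dual_framelet_filter_bank s M b0 b bt0 bt \<longleftrightarrow> (\<forall>v\<in>l2. \<forall>w\<in>l2. PR v w = l2_inner v w)"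
proof
  assume "dual_framelet_filter_bank s M b0 b bt0 bt"
  then have "PR (site k x) (site k' y) = l2_inner (site k x) (site k' y)" for k x k' y
    unfolding dual_framelet_filter_bank_iff_Dcoef by (intro Dcoef_imp_PR_site) blast
  from PR_site_imp_PR[OF this] show "\<forall>v\<in>l2. \<forall>w\<in>l2. PR v w = l2_inner v w"
    by (intro ballI)
next
  assume "\<forall>v\<in>l2. \<forall>w\<in>l2. PR v w = l2_inner v w"
  then have "PR (site k x) (site k' y) = l2_inner (site k x) (site k' y)" for k x k' y
    by (simp add: site_l2)
  from PR_imp_Dcoef[OF this] show "dual_framelet_filter_bank s M b0 b bt0 bt"
    unfolding dual_framelet_filter_bank_iff_Dcoef by (intro ballI allI)
qed

end

section \<open>Affine systems and filter banks\<close>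

text \<open>One affine system with its filter bank; a pair of systems interprets it twice. The
  refinement equations are recorded as almost everywhere identities in time, the form in which inner
  products see them.\<close>

locale affine_bank =
  refinable_vector "M 0" psi0
  for M :: "nat \<Rightarrow> int ^ 'd ^ 'd" and psi0 :: "real ^ 'd \<Rightarrow> complex ^ 'r" +
  fixes s :: nat and b0 :: "int ^ 'd \<Rightarrow> complex ^ 'r ^ 'r"
    and b :: "nat \<Rightarrow> int ^ 'd \<Rightarrow> complex ^ 'r ^ 1"
    and psi :: "nat \<Rightarrow> real ^ 'd \<Rightarrow> complex"
  assumes fin0: "finitely_supported b0" and fin: "l \<in> {1..s} \<Longrightarrow> finitely_supported (b l)"
    and detl: "l \<in> {1..s} \<Longrightarrow> det (rmat (M l)) \<noteq> 0"
    and refine0: "AE x in lebesgue. psi0 x $ i = refine_sum (M 0) {p. b0 p \<noteq> 0} (\<lambda>q p. b0 p $ i $ q) psi0 x"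
    and psi_L2: "l \<in> {1..s} \<Longrightarrow> psi l \<in> L2"
    and refine: "l \<in> {1..s} \<Longrightarrow>
      AE x in lebesgue. psi l x = refine_sum (M 0) {p. b l p \<noteq> 0} (\<lambda>q p. b l p $ 1 $ q) psi0 x"
begin

abbreviation "cf \<equiv> coef (M 0) psi0"
abbreviation "T0 \<equiv> transition b0 (M 0)"
abbreviation "T l \<equiv> transition (b l) (M l)"
abbreviation "Q \<equiv> analysis_normsq s M b0 b"

lemma T_l2: "v \<in> l2 \<Longrightarrow> T0 v \<in> l2" "v \<in> l2 \<Longrightarrow> l \<in> {1..s} \<Longrightarrow> T l v \<in> l2"
  using transition_l2 fin0 fin det detl by blast+

lemma coef_cascade:
  assumes f: "f \<in> L2"
  shows "cf j f = T0 (cf (Suc j) f)"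
proof -
  have inv: "matrix_inv (rmat (M 0)) *v lat (M 0 *v n) = lat n" for n
    by (simp add: rmat_mult_lat[symmetric] matrix_inv_cancel[OF det])
  have "cf j f n $ i = T0 (cf (Suc j) f) n $ i" for n i
    using refined_inner_transition[OF \<psi>_L2[of i] refine0[of i] fin0 f, of "M 0" j n] det
    by (simp add: inv coef_def)
  then show ?thesis by (simp add: fun_eq_iff vec_eq_iff)
qed

lemma det_rel_dilation: "det (rel_dilation M l) = det (rmat (M l)) / det (rmat (M 0))"
  using det_mul[of "matrix_inv (rmat (M 0))" "rmat (M 0)"] det matrix_inv_cancel[OF det]
  by (simp add: rel_dilation_def det_mul det_I field_simps)

lemma AS_L2: "i \<in> AS_indices s \<Longrightarrow> AS M psi0 psi i \<in> L2"
proof (cases i)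
  case (Generator q k)
  then show ?thesis using shift_L2 by (simp add: generator_shift_def[abs_def] lat_def[symmetric])
next
  case (Wavelet l j k)
  assume "i \<in> AS_indices s"
  then have "l \<in> {1..s}" using Wavelet by (auto simp: AS_indices_def)
  then show ?thesis
    unfolding Wavelet AS.simps wavelet_def using det by (intro L2_cmult dilate_shift_L2 psi_L2) (auto simp: det_matpow)
qed

lemma AS_Generator: "L2_inner f (AS M psi0 psi (Generator q k)) = cf 0 f k $ q"
  by (simp add: coef_0 generator_shift_def[abs_def] lat_def[symmetric])

lemma AS_Wavelet:
  assumes f: "f \<in> L2" and l: "l \<in> {1..s}"
  shows "L2_inner f (AS M psi0 psi (Wavelet l j k)) = T l (cf (Suc j) f) k $ 1"
proof -
  let ?D = "L2_inner f (dilate_shift (matpow (rmat (M 0)) j) (matrix_inv (rmat (M 0)) *v lat (M l *v k)) (psi l))"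
  have w: "wavelet M psi l j k = dilate_shift (matpow (rmat (M 0)) j) (matrix_inv (rmat (M 0)) *v lat (M l *v k)) (psi l)"
    unfolding wavelet_def rel_dilation_def lat_def[symmetric]
    by (simp add: matrix_vector_mul_assoc[symmetric] rmat_mult_lat)
  \<comment> \<open>The weight in the affine system is what turns the factor of \<open>M 0\<close>
    into that of \<open>M l\<close> required by \<open>transition\<close>.\<close>
  have sq: "sqrt \<bar>det (rel_dilation M l)\<bar> * sqrt \<bar>det (rmat (M 0))\<bar> = sqrt \<bar>det (rmat (M l))\<bar>"
    using det by (simp add: det_rel_dilation real_sqrt_mult[symmetric] abs_mult)
  have "of_real (sqrt \<bar>det (rmat (M 0))\<bar>) * (of_real (sqrt \<bar>det (rel_dilation M l)\<bar>) * ?D)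
      = of_real (sqrt \<bar>det (rel_dilation M l)\<bar> * sqrt \<bar>det (rmat (M 0))\<bar>) * ?D"
    by simp
  also have "\<dots> = of_real (sqrt \<bar>det (rmat (M l))\<bar>) * ?D" by (simp only: sq)
  also have "\<dots> = of_real (sqrt \<bar>det (rmat (M 0))\<bar>) * (T l (cf (Suc j) f) k $ 1)"
    by (rule refined_inner_transition[OF psi_L2[OF l] refine[OF l] fin[OF l] f])
  finally show ?thesis using det by (simp add: L2_inner_cmult_right w)
qed

lemma lowpass_coef: "f \<in> L2 \<Longrightarrow> i \<le> J \<Longrightarrow> lowpass_coeffs M b0 (cf J f) i = cf (J - i) f"
proof (induction i)
  case (Suc i)
  then have "lowpass_coeffs M b0 (cf J f) (Suc i) = T0 (cf (Suc (J - Suc i)) f)"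
    by (simp add: lowpass_coeffs_def Suc_diff_Suc)
  also have "\<dots> = cf (J - Suc i) f" by (rule coef_cascade[OF Suc.prems(1), symmetric])
  finally show ?case .
qed (simp add: lowpass_coeffs_def)

lemma lowpass_l2: "v \<in> l2 \<Longrightarrow> lowpass_coeffs M b0 v j \<in> l2"
  by (induction j) (simp_all add: lowpass_coeffs_def T_l2)

lemma analysis_coef:
  assumes f: "f \<in> L2"
  shows "Q J (cf J f) = (\<Sum>(l, j)\<in>{1..s} \<times> {..<J}. l2_normsq (T l (cf (Suc j) f))) + l2_normsq (cf 0 f)"
proof -
  have "(\<Sum>i = 1..J. \<Sum>l = 1..s. l2_normsq (T l (lowpass_coeffs M b0 (cf J f) (i - 1))))
      = (\<Sum>i = 1..J. \<Sum>l = 1..s. l2_normsq (T l (cf (Suc (J - i)) f)))"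
    by (intro sum.cong refl) (auto simp: lowpass_coef[OF f] Suc_diff_le)
  also have "\<dots> = (\<Sum>j<J. \<Sum>l = 1..s. l2_normsq (T l (cf (Suc j) f)))"
    \<comment> \<open>Step \<open>i\<close> of a filter bank started at level \<open>J\<close>
      produces the wavelet coefficients of level \<open>J - i\<close>.\<close>
    by (rule sum.reindex_bij_witness[of _ "\<lambda>j. J - j" "\<lambda>i. J - i"]) auto
  also have "\<dots> = (\<Sum>(l, j)\<in>{1..s} \<times> {..<J}. l2_normsq (T l (cf (Suc j) f)))"
    by (subst sum.swap) (rule sum.cartesian_product)
  finally show ?thesis by (simp add: analysis_normsq_def lowpass_coef[OF f])
qed

section \<open>Energy of the affine system below a level\<close>

definition level_indices :: "nat \<Rightarrow> ('r, 'd) as_index set"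
  where "level_indices J = (\<Union>(l, j)\<in>{1..s} \<times> {..<J}. range (Wavelet l j)) \<union> (\<Union>q\<in>UNIV. range (Generator q))"

lemma mem_level_indices: "Generator q k \<in> level_indices J" "Wavelet l j k \<in> level_indices J \<longleftrightarrow> l \<in> {1..s} \<and> j < J"
  unfolding level_indices_def by blast+

lemma level_indices_subset: "level_indices J \<subseteq> AS_indices s"
  by (auto simp: level_indices_def AS_indices_def)

lemma finite_AS_indices_subset:
  assumes "finite F" "F \<subseteq> AS_indices s"
  shows "\<exists>J \<ge> 1. F \<subseteq> level_indices J"
proof -
  define h where "h i = (case i of Wavelet l j k \<Rightarrow> j | Generator q k \<Rightarrow> 0)" for i :: "('r, 'd) as_index"
  \<comment> \<open>The level of a wavelet in \<open>level_indices J\<close> is strictly below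
    \<open>J\<close>, and stability speaks of \<open>J \<ge> 1\<close>; the successor meets both
    demands.\<close>
  have "i \<in> level_indices (Suc (Max (insert 0 (h ` F))))" if "i \<in> F" for i
  proof -
    have "h i \<le> Max (insert 0 (h ` F))" using assms(1) that by (intro Max_ge) auto
    moreover have "i \<in> AS_indices s" using that assms(2) by blast
    ultimately show ?thesis by (cases i) (auto simp: h_def[of "Wavelet _ _ _"] mem_level_indices AS_indices_def)
  qed
  then show ?thesis by (intro exI[of _ "Suc (Max (insert 0 (h ` F)))"]) auto
qed

definition coef_square :: "(real ^ 'd \<Rightarrow> complex) \<Rightarrow> ('r, 'd) as_index \<Rightarrow> real"
  where "coef_square f i = (cmod (L2_inner f (AS M psi0 psi i)))\<^sup>2"

lemma analysis_has_sum:
  assumes f: "f \<in> L2"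
  shows "(coef_square f has_sum Q J (cf J f)) (level_indices J)"
  unfolding analysis_coef[OF f] level_indices_def
proof (rule has_sum_Un_disjoint)
  show "(coef_square f has_sum (\<Sum>(l, j)\<in>{1..s} \<times> {..<J}. l2_normsq (T l (cf (Suc j) f)))) (\<Union>(l, j)\<in>{1..s} \<times> {..<J}. range (Wavelet l j))"
  proof (rule sum_has_sum)
    fix x :: "nat \<times> nat" assume "x \<in> {1..s} \<times> {..<J}"
    then obtain l j where x: "x = (l, j)" and l: "l \<in> {1..s}" by auto
    have "(norm v)\<^sup>2 = (cmod (v $ 1))\<^sup>2" for v :: "complex ^ 1"
      by (simp add: norm_vec_square sum_1)
    then have "coef_square f (Wavelet l j k) = (norm (T l (cf (Suc j) f) k))\<^sup>2" for k
      by (simp add: coef_square_def AS_Wavelet[OF f l] del: AS.simps)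
    moreover have "((\<lambda>k. (norm (T l (cf (Suc j) f) k))\<^sup>2) has_sum l2_normsq (T l (cf (Suc j) f))) UNIV"
      unfolding l2_normsq_def by (intro has_sum_infsum l2_summable T_l2 coef_l2 f l)
    ultimately show "(coef_square f has_sum (case x of (l, j) \<Rightarrow> l2_normsq (T l (cf (Suc j) f)))) (case x of (l, j) \<Rightarrow> range (Wavelet l j))"
      unfolding x prod.case by (subst has_sum_reindex) (auto simp: inj_def o_def)
  qed auto
  show "(coef_square f has_sum l2_normsq (cf 0 f)) (\<Union>q\<in>UNIV. range (Generator q))"
  proof -
    have s: "(\<lambda>k. (cmod (cf 0 f k $ q))\<^sup>2) summable_on UNIV" for q
      by (rule l2_component[OF coef_l2[OF f]])
    have "l2_normsq (cf 0 f) = (\<Sum>q\<in>UNIV. \<Sum>\<^sub>\<infinity>k. (cmod (cf 0 f k $ q))\<^sup>2)"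
      unfolding l2_normsq_def norm_vec_square
      by (intro infsumI has_sum_finite_sum has_sum_infsum s)
    moreover have "(coef_square f has_sum (\<Sum>q\<in>UNIV. \<Sum>\<^sub>\<infinity>k. (cmod (cf 0 f k $ q))\<^sup>2)) (\<Union>q\<in>UNIV. range (Generator q))"
    proof (rule sum_has_sum)
      show "(coef_square f has_sum (\<Sum>\<^sub>\<infinity>k. (cmod (cf 0 f k $ q))\<^sup>2)) (range (Generator q))" for q
        using has_sum_infsum[OF s[of q]] by (subst has_sum_reindex) (simp_all add: inj_def o_def coef_square_def AS_Generator del: AS.simps)
    qed auto
    ultimately show ?thesis by simp
  qed
qed auto

lemma coef_square_nonneg: "0 \<le> coef_square f i" by (simp add: coef_square_def)

text \<open>A finite part of the system lies below some level \<open>J\<close>, where its energy is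
  at most that of \<open>J\<close> filter bank steps applied to the level \<open>J\<close>
  coefficients. The constant is the product of the stability constant and the level-independent
  bound of \<open>coef_bounded\<close>.\<close>

lemma stable_imp_Bessel:
  assumes c: "c > 0" "\<And>J v. J \<ge> 1 \<Longrightarrow> v \<in> l2 \<Longrightarrow> Q J v \<le> c * l2_normsq v"
  shows "\<exists>B > 0. \<forall>f \<in> L2. coef_square f summable_on AS_indices s \<and> (\<Sum>\<^sub>\<infinity>i\<in>AS_indices s. coef_square f i) \<le> B * L2_normsq f"
proof -
  obtain B where B: "B > 0" "\<And>f j. f \<in> L2 \<Longrightarrow> cf j f \<in> l2 \<and> l2_normsq (cf j f) \<le> B * L2_normsq f"
    using coef_bounded by blast
  have fin: "sum (coef_square f) F \<le> c * B * L2_normsq f" if f: "f \<in> L2" and F: "finite F" "F \<subseteq> AS_indices s" for f F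
  proof -
    obtain J where J: "J \<ge> 1" "F \<subseteq> level_indices J" using finite_AS_indices_subset[OF F] by blast
    have "sum (coef_square f) F \<le> Q J (cf J f)"
      by (rule has_sum_mono2[OF has_sum_finite[OF F(1)] analysis_has_sum[OF f] J(2)]) (rule coef_square_nonneg)
    also have "\<dots> \<le> c * l2_normsq (cf J f)" using B(2)[OF f] c(2)[OF J(1)] by blast
    also have "\<dots> \<le> c * (B * L2_normsq f)" using B(2)[OF f] c(1) by (intro mult_left_mono) auto
    finally show ?thesis by (simp only: mult.assoc)
  qed
  have s: "coef_square f summable_on AS_indices s" if "f \<in> L2" for f
    using fin[OF that] by (intro nonneg_bdd_above_summable_on coef_square_nonneg bdd_aboveI[where M = "c * B * L2_normsq f"]) auto
  then show ?thesis
    using infsum_le_finite_sums[OF s fin] B(1) c(1) by (intro exI[of _ "c * B"]) auto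
qed

lemma analysis_le_frame_sum:
  assumes f: "f \<in> L2" and s: "coef_square f summable_on AS_indices s"
  shows "Q J (cf J f) \<le> (\<Sum>\<^sub>\<infinity>i\<in>AS_indices s. coef_square f i)"
  by (rule has_sum_mono2[OF analysis_has_sum[OF f] has_sum_infsum[OF s] level_indices_subset]) (rule coef_square_nonneg)

lemma lowpass_diff: "lowpass_coeffs M b0 (\<lambda>k. v k - w k) j = (\<lambda>k. lowpass_coeffs M b0 v j k - lowpass_coeffs M b0 w j k)"
  by (induction j) (simp_all add: lowpass_coeffs_def transition_diff[OF fin0])

lemma lowpass_bounded: "\<exists>K \<ge> 0. \<forall>v \<in> l2. l2_normsq (lowpass_coeffs M b0 v j) \<le> K * l2_normsq v"
proof (induction j)
  case 0
  show ?case by (intro exI[of _ 1]) (simp add: lowpass_coeffs_def)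
next
  case (Suc j)
  obtain K where K: "K \<ge> 0" "\<And>v. v \<in> l2 \<Longrightarrow> l2_normsq (lowpass_coeffs M b0 v j) \<le> K * l2_normsq v"
    using Suc by blast
  obtain K0 where K0: "K0 \<ge> 0" "\<And>v. v \<in> l2 \<Longrightarrow> T0 v \<in> l2 \<and> l2_normsq (T0 v) \<le> K0 * l2_normsq v"
    by (rule transition_bounded_aux[OF fin0 det]) blast
  have "l2_normsq (lowpass_coeffs M b0 v (Suc j)) \<le> (K0 * K) * l2_normsq v" if v: "v \<in> l2" for v
  proof -
    have "l2_normsq (lowpass_coeffs M b0 v (Suc j)) \<le> K0 * l2_normsq (lowpass_coeffs M b0 v j)"
      using K0(2)[OF lowpass_l2[OF v, of j]] by (simp add: lowpass_coeffs_def)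
    also have "\<dots> \<le> K0 * (K * l2_normsq v)" using K(2)[OF v] K0(1) by (rule mult_left_mono)
    finally show ?thesis by (simp only: mult.assoc)
  qed
  then show ?case using K0(1) K(1) by (intro exI[of _ "K0 * K"]) auto
qed

text \<open>The constant may depend on \<open>J\<close>: the bound only controls approximation
  errors at a fixed \<open>J\<close>.\<close>

lemma analysis_bounded: "\<exists>K \<ge> 0. \<forall>v \<in> l2. Q J v \<le> K * l2_normsq v"
proof -
  obtain K where K: "\<And>j. K j \<ge> 0" "\<And>j v. v \<in> l2 \<Longrightarrow> l2_normsq (lowpass_coeffs M b0 v j) \<le> K j * l2_normsq v"
    using lowpass_bounded by metis
  have "\<forall>l\<in>{1..s}. \<exists>C \<ge> 0. \<forall>v \<in> l2. l2_normsq (T l v) \<le> C * l2_normsq v"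
  proof
    fix l assume l: "l \<in> {1..s}"
    show "\<exists>C \<ge> 0. \<forall>v \<in> l2. l2_normsq (T l v) \<le> C * l2_normsq v"
      by (rule transition_bounded_aux[OF fin[OF l] detl[OF l]]) blast
  qed
  then obtain C where C: "\<forall>l\<in>{1..s}. C l \<ge> 0 \<and> (\<forall>v \<in> l2. l2_normsq (T l v) \<le> C l * l2_normsq v)" by metis
  let ?K = "(\<Sum>j = 1..J. \<Sum>l = 1..s. C l * K (j - 1)) + K J"
  have "Q J v \<le> ?K * l2_normsq v" if v: "v \<in> l2" for v
    unfolding analysis_normsq_def distrib_right sum_distrib_right
  proof (intro add_mono sum_mono K(2) v)
    fix j l assume "l \<in> {1..s}"
    then have "l2_normsq (T l (lowpass_coeffs M b0 v (j - 1))) \<le> C l * l2_normsq (lowpass_coeffs M b0 v (j - 1))"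
      using C lowpass_l2[OF v] by blast
    also have "\<dots> \<le> C l * (K (j - 1) * l2_normsq v)"
      using C \<open>l \<in> {1..s}\<close> K(2)[OF v] by (intro mult_left_mono) auto
    finally show "l2_normsq (T l (lowpass_coeffs M b0 v (j - 1))) \<le> C l * K (j - 1) * l2_normsq v"
      by (simp only: mult.assoc)
  qed
  moreover have "?K \<ge> 0" using C K(1) by (intro add_nonneg_nonneg sum_nonneg mult_nonneg_nonneg) auto
  ultimately show ?thesis by blast
qed

lemma analysis_le_diff:
  assumes v: "v \<in> l2" and w: "w \<in> l2"
  shows "Q J v \<le> 2 * Q J (\<lambda>k. v k - w k) + 2 * Q J w"
proof -
  have le: "l2_normsq x \<le> 2 * l2_normsq (\<lambda>k. x k - y k) + 2 * l2_normsq y" if "x \<in> l2" "y \<in> l2"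
    for x y :: "int ^ 'd \<Rightarrow> complex ^ 'q"
    using l2_normsq_add_le[OF l2_diff[OF that] that(2)] by simp
  have "Q J v \<le> (\<Sum>j = 1..J. \<Sum>l = 1..s. 2 * l2_normsq (T l (lowpass_coeffs M b0 (\<lambda>k. v k - w k) (j - 1)))
        + 2 * l2_normsq (T l (lowpass_coeffs M b0 w (j - 1))))
      + (2 * l2_normsq (lowpass_coeffs M b0 (\<lambda>k. v k - w k) J) + 2 * l2_normsq (lowpass_coeffs M b0 w J))"
    unfolding analysis_normsq_def lowpass_diff
    by (intro add_mono sum_mono, subst transition_diff[OF fin], assumption) (intro le lowpass_l2 T_l2 v w; assumption)+
  also have "\<dots> = 2 * Q J (\<lambda>k. v k - w k) + 2 * Q J w"
    by (simp add: analysis_normsq_def sum.distrib sum_distrib_left algebra_simps)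
  finally show ?thesis .
qed

end

section \<open>Density of the sampled functions\<close>

context refinable_vector
begin

text \<open>A compactly supported function meets only finitely many shifts; this keeps the iterates
  in \<open>Richardson\<close> finite.\<close>

lemma coef_synth_finite:
  assumes A: "finite A"
  shows "finite {k. coef M \<psi> 0 (synth A w) k \<noteq> 0}"
proof -
  obtain R where R: "AE x in lebesgue. norm x > R \<longrightarrow> synth A w x = 0" using synth_radius[OF A] by blast
  obtain R' where R': "\<And>k q. AE x in lebesgue. norm (x - lat k) > R' \<longrightarrow> \<psi> (x - lat k) $ q = 0"
    using shift_radius by blast
  have "{k. coef M \<psi> 0 (synth A w) k \<noteq> 0} \<subseteq> {k. lat k \<in> cball 0 (R + R')}"
  proof
    fix k assume "k \<in> {k. coef M \<psi> 0 (synth A w) k \<noteq> 0}"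
    then obtain q where q: "coef M \<psi> 0 (synth A w) k $ q \<noteq> 0" by (auto simp: vec_eq_iff)
    show "k \<in> {k. lat k \<in> cball 0 (R + R')}"
    proof (rule ccontr)
      assume "k \<notin> {k. lat k \<in> cball 0 (R + R')}"
      then have k: "norm (lat k) > R + R'" by simp
      have "AE x in lebesgue. synth A w x * cnj (\<psi> (x - lat k) $ q) = 0"
        using R R'[of k q]
      proof eventually_elim
        fix x assume x: "norm x > R \<longrightarrow> synth A w x = 0" "norm (x - lat k) > R' \<longrightarrow> \<psi> (x - lat k) $ q = 0"
        have "norm x > R \<or> norm (x - lat k) > R'"
          using k norm_triangle_ineq4[of x "x - lat k"] by auto
        with x show "synth A w x * cnj (\<psi> (x - lat k) $ q) = 0" by auto
      qed
      then have "coef M \<psi> 0 (synth A w) k $ q = (LINT x::real ^ 'd|lebesgue. 0)"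
        unfolding coef_0 L2_inner_def
        by (intro integral_cong_AE borel_measurable_integrable L2_inner_integrable synth_L2 shift_L2) auto
      with q show False by simp
    qed
  qed
  then show ?thesis by (rule finite_subset) (rule finite_bounded_lattice[OF bounded_cball])
qed

lemma l2_inner_coef_restrict:
  assumes A: "finite A" and f: "f \<in> L2"
  shows "l2_inner (coef M \<psi> 0 f) (restrict_seq A w) = L2_inner f (synth A w)"
proof -
  have "l2_inner (coef M \<psi> 0 f) (restrict_seq A w) = (\<Sum>\<^sub>\<infinity>k\<in>A. \<Sum>q\<in>UNIV. coef M \<psi> 0 f k $ q * cnj (w k $ q))"
    unfolding l2_inner_def by (rule infsum_cong_neutral) (auto simp: restrict_seq_def)
  also have "\<dots> = (\<Sum>k\<in>A. \<Sum>q\<in>UNIV. L2_inner f (\<lambda>x. w k $ q * \<psi> (x - lat k) $ q))"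
    using A by (simp add: coef_0 L2_inner_cmult_right mult.commute)
  also have "\<dots> = L2_inner f (synth A w)"
    unfolding synth_def[abs_def] by (subst L2_inner_sum_right; (intro assms L2_sum L2_cmult shift_L2 sum.cong refl)?)
      (subst L2_inner_sum_right; (intro assms L2_cmult shift_L2 refl finite)?)
  finally show ?thesis .
qed

lemma synth_restrict: "finite D \<Longrightarrow> A \<subseteq> D \<Longrightarrow> synth A w = synth D (restrict_seq A w)"
  unfolding synth_def[abs_def] fun_eq_iff
  by (auto intro!: sum.mono_neutral_cong_left simp: restrict_seq_def)

section \<open>Consequences of a lower bracket bound\<close>

context
  fixes C :: real
  assumes C: "C > 0"
    and lower: "AE \<xi> in lebesgue. loewner_le (mat (complex_of_real C)) (bracket (vfourier \<psi>) (vfourier \<psi>) \<xi>)"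
begin

lemma Riesz: "finite A \<Longrightarrow> C * l2_normsq (restrict_seq A w) \<le> L2_normsq (synth A w)"
proof -
  assume A: "finite A"
  have "l2_normsq (restrict_seq A w) = (\<Sum>\<^sub>\<infinity>k\<in>A. (norm (w k))\<^sup>2)"
    unfolding l2_normsq_def by (rule infsum_cong_neutral) (auto simp: restrict_seq_def)
  then show ?thesis using Riesz_lower_bound[OF _ lower A, of w] C A by simp
qed

text \<open>Pairing \<open>h = synth A w\<close> with itself passes to sequences by adjointness. The
  weight \<open>1 / C\<close> is chosen so that \<open>Riesz\<close> absorbs the term with
  \<open>w\<close> into one of the two copies of \<open>L2_normsq h\<close>.\<close>

lemma synth_le_coef:
  assumes A: "finite A"
  shows "C * L2_normsq (synth A w) \<le> l2_normsq (coef M \<psi> 0 (synth A w))"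
proof -
  let ?h = "synth A w" and ?u = "restrict_seq A w"
  have "cmod (L2_inner ?h ?h) = L2_normsq ?h" by (simp add: L2_inner_self L2_normsq_nonneg)
  then have "2 * L2_normsq ?h = 2 * cmod (l2_inner (coef M \<psi> 0 ?h) ?u)"
    by (simp add: l2_inner_coef_restrict[OF A synth_L2])
  also have "\<dots> \<le> 1 / C * l2_normsq (coef M \<psi> 0 ?h) + l2_normsq ?u / (1 / C)"
    using C by (intro l2_inner_amgm coef_l2 synth_L2 restrict_seq_l2 A) auto
  also have "\<dots> \<le> 1 / C * l2_normsq (coef M \<psi> 0 ?h) + L2_normsq ?h"
    using Riesz[OF A, of w] C by (simp add: mult.commute)
  finally have "L2_normsq ?h \<le> l2_normsq (coef M \<psi> 0 ?h) / C" by simp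
  then show ?thesis using C by (simp add: field_simps)
qed

text \<open>Richardson iteration for the Gram operator, sampling after synthesis, which lies between
  \<open>C\<close> and \<open>B\<close>. A step of size \<open>1 / B\<close> along the residual
  \<open>r\<close> lowers its squared norm at least by the factor \<open>1 - C / B\<close>: the
  linear term gains twice \<open>L2_normsq (synth S r) / B\<close>, and the quadratic term gives
  back at most one copy of it.\<close>

lemma Richardson:
  assumes v: "finite {k. v k \<noteq> 0}" and B: "B > 0" "C \<le> B"
    "\<And>f. f \<in> L2 \<Longrightarrow> l2_normsq (coef M \<psi> 0 f) \<le> B * L2_normsq f"
  shows "\<exists>A w. finite A \<and> l2_normsq (\<lambda>k. v k - coef M \<psi> 0 (synth A w) k) \<le> (1 - C / B) ^ n * l2_normsq v"
proof (induction n)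
  case 0
  have "coef M \<psi> 0 (synth {} w) k = 0" for w k
    by (simp add: vec_eq_iff coef_0 synth_def[abs_def] L2_inner_def)
  then show ?case by (intro exI[of _ "{}"]) simp
next
  case (Suc n)
  then obtain A w where A: "finite A" and IH: "l2_normsq (\<lambda>k. v k - coef M \<psi> 0 (synth A w) k) \<le> (1 - C / B) ^ n * l2_normsq v"
    by blast
  define r where "r k = v k - coef M \<psi> 0 (synth A w) k" for k
  define S where "S = {k. r k \<noteq> 0}"
  have S: "finite S"
    by (rule finite_subset[OF _ finite_UnI[OF v coef_synth_finite[OF A, of w]]]) (auto simp: S_def r_def)
  have rS: "restrict_seq S r = r" by (auto simp: restrict_seq_def S_def)
  have r_l2: "r \<in> l2" using S by (intro l2_finite_support) (simp add: S_def)
  let ?t = "complex_of_real (1 / B)"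
  define h where "h = (\<lambda>x. ?t * synth S r x)"
  have h: "h \<in> L2" unfolding h_def by (intro L2_cmult synth_L2)
  let ?D = "A \<union> S"
  let ?w' = "\<lambda>k. restrict_seq A w k + ?t *s r k"
  have new: "synth ?D ?w' = (\<lambda>x. synth A w x + h x)"
  proof -
    have "synth ?D ?w' x = synth ?D (restrict_seq A w) x + ?t * synth ?D (restrict_seq S r) x" for x
      unfolding rS by (simp add: synth_def ring_distribs sum.distrib sum_distrib_left mult.assoc)
    then show ?thesis using synth_restrict[of ?D A w] synth_restrict[of ?D S r] A S by (simp add: h_def fun_eq_iff)
  qed
  let ?u = "coef M \<psi> 0 h"
  have u_l2: "?u \<in> l2" by (rule coef_l2[OF h])
  have r': "v k - coef M \<psi> 0 (synth ?D ?w') k = r k - ?u k" for k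
  proof -
    have "coef M \<psi> 0 (synth ?D ?w') k = coef M \<psi> 0 (synth A w) k + ?u k"
      unfolding vec_eq_iff vector_add_component coef_0 new by (simp add: L2_inner_add_left synth_L2 h shift_L2)
    then show ?thesis by (simp add: r_def)
  qed
  have "L2_inner h (synth S r) = ?t * of_real (L2_normsq (synth S r))"
    unfolding h_def L2_inner_cmult_left L2_inner_self ..
  then have ur: "l2_inner ?u r = of_real (L2_normsq (synth S r) / B)"
    using l2_inner_coef_restrict[OF S h, of r] by (simp add: rS)
  then have ru: "l2_inner r ?u = of_real (L2_normsq (synth S r) / B)"
    using l2_inner_cnj[of ?u r] by simp
  have "L2_normsq h = L2_normsq (synth S r) / B\<^sup>2"
    unfolding L2_normsq_def h_def by (simp add: norm_mult norm_divide power_mult_distrib power_divide)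
  then have uu: "l2_normsq ?u \<le> L2_normsq (synth S r) / B"
    using B(3)[OF h] B(1) by (simp add: power2_eq_square)
  have "complex_of_real (l2_normsq (\<lambda>k. r k - ?u k)) = of_real (l2_normsq r - 2 * (L2_normsq (synth S r) / B) + l2_normsq ?u)"
    using r_l2 u_l2 by (simp add: l2_inner_self[symmetric] l2_diff l2_inner_diff_left l2_inner_diff_right ur ru)
  then have "l2_normsq (\<lambda>k. r k - ?u k) = l2_normsq r - 2 * (L2_normsq (synth S r) / B) + l2_normsq ?u"
    by (simp only: of_real_eq_iff)
  also have "\<dots> \<le> l2_normsq r - L2_normsq (synth S r) / B" using uu by simp
  also have "\<dots> \<le> l2_normsq r - C * l2_normsq r / B"
    using Riesz[OF S, of r] B(1) by (simp add: rS divide_right_mono)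
  also have "\<dots> = (1 - C / B) * l2_normsq r" by (simp add: algebra_simps)
  also have "\<dots> \<le> (1 - C / B) * ((1 - C / B) ^ n * l2_normsq v)"
    using IH B C by (intro mult_left_mono) (auto simp: r_def[abs_def])
  finally have "l2_normsq (\<lambda>k. v k - coef M \<psi> 0 (synth ?D ?w') k) \<le> (1 - C / B) ^ Suc n * l2_normsq v"
    unfolding r' by (simp add: mult.assoc)
  then show ?case using A S by (intro exI[of _ ?D] exI[of _ ?w']) simp
qed

text \<open>Truncate \<open>v\<close>, then iterate. The residual never exceeds the truncated
  \<open>v\<close> in norm, so the samples have squared norm at most \<open>2 + 2\<close> times that
  of \<open>v\<close>, and \<open>synth_le_coef\<close> turns this into
  \<open>4 / C\<close>.\<close>

theorem coef_dense:
  assumes v: "v \<in> l2" and e: "e > 0"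
  shows "\<exists>f \<in> L2. l2_normsq (\<lambda>k. v k - coef M \<psi> 0 f k) < e \<and> L2_normsq f \<le> 4 / C * l2_normsq v"
proof -
  obtain B where B: "B > 0" "\<And>f. f \<in> L2 \<Longrightarrow> l2_normsq (coef M \<psi> 0 f) \<le> B * L2_normsq f"
    using coef_bounded by metis
  \<comment> \<open>Enlarging the Bessel bound to \<open>B + C\<close> ensures that it is at least
    \<open>C\<close> and that the contraction factor lies strictly between 0 and 1.\<close>
  have B': "B + C > 0" "C \<le> B + C" "\<And>f. f \<in> L2 \<Longrightarrow> l2_normsq (coef M \<psi> 0 f) \<le> (B + C) * L2_normsq f"
  proof -
    show "B + C > 0" "C \<le> B + C" using B C by auto
    fix f :: "real ^ 'd \<Rightarrow> complex" assume "f \<in> L2"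
    from B(2)[OF this] show "l2_normsq (coef M \<psi> 0 f) \<le> (B + C) * L2_normsq f"
      using C L2_normsq_nonneg[of f] by (simp add: distrib_right add_increasing2)
  qed
  obtain A where A: "finite A" "l2_normsq (\<lambda>k. v k - restrict_seq A v k) < e / 4"
    using l2_truncate[OF v, of "e / 4"] e by auto
  let ?v = "restrict_seq A v"
  have v_l2: "?v \<in> l2" and v_le: "l2_normsq ?v \<le> l2_normsq v"
    using A(1) v by (auto intro: restrict_seq_l2 restrict_seq_normsq_le)
  have v_fin: "finite {k. ?v k \<noteq> 0}"
    by (rule finite_subset[OF _ A(1)]) (auto simp: restrict_seq_def)
  have "(\<lambda>n. (1 - C / (B + C)) ^ n * l2_normsq ?v) \<longlonglongrightarrow> 0 * l2_normsq ?v"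
    using C B(1) by (intro tendsto_mult tendsto_const LIMSEQ_power_zero) (auto simp: field_simps)
  from order_tendstoD(2)[OF this, of "e / 4"] e
  obtain n where n: "(1 - C / (B + C)) ^ n * l2_normsq ?v < e / 4"
    by (auto simp: eventually_sequentially)
  obtain D w where D: "finite D" "l2_normsq (\<lambda>k. ?v k - coef M \<psi> 0 (synth D w) k) \<le> (1 - C / (B + C)) ^ n * l2_normsq ?v"
    using Richardson[OF v_fin B'] by blast
  let ?f = "synth D w"
  let ?u = "coef M \<psi> 0 ?f"
  have u: "?u \<in> l2" by (rule coef_l2[OF synth_L2])
  have "l2_normsq (\<lambda>k. v k - ?u k) \<le> 2 * l2_normsq (\<lambda>k. v k - ?v k) + 2 * l2_normsq (\<lambda>k. ?v k - ?u k)"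
    using l2_normsq_add_le[OF l2_diff[OF v v_l2] l2_diff[OF v_l2 u]] by simp
  then have 1: "l2_normsq (\<lambda>k. v k - ?u k) < e" using A(2) n D(2) by linarith
  have "(1 - C / (B + C)) ^ n \<le> 1" using C B(1) by (intro power_le_one) (auto simp: field_simps)
  then have "(1 - C / (B + C)) ^ n * l2_normsq ?v \<le> l2_normsq ?v"
    by (intro mult_left_le_one_le l2_normsq_nonneg) (use C B(1) in \<open>auto intro!: zero_le_power simp: field_simps\<close>)
  then have "l2_normsq (\<lambda>k. ?v k - ?u k) \<le> l2_normsq ?v" using D(2) by linarith
  moreover have "l2_normsq ?u \<le> 2 * l2_normsq ?v + 2 * l2_normsq (\<lambda>k. ?v k - ?u k)"
    using l2_normsq_diff_le[OF v_l2 l2_diff[OF v_l2 u]] by simp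
  ultimately have "C * L2_normsq ?f \<le> 4 * l2_normsq v"
    using synth_le_coef[OF D(1), of w] v_le by linarith
  then have "L2_normsq ?f \<le> 4 / C * l2_normsq v" using C by (simp add: field_simps)
  with 1 show ?thesis using synth_L2 by blast
qed

end

end

context affine_bank
begin

text \<open>Up to a small error \<open>v\<close> is \<open>cf 0 f\<close>, which equals
  \<open>cf J h\<close> for a dilate \<open>h\<close> of \<open>f\<close> with the same norm; there
  \<open>J\<close> filter bank steps are part of the frame sum of \<open>h\<close>. The norm control
  in \<open>coef_dense\<close> gives \<open>B * (4 / C)\<close>, and splitting off the error doubles
  it.\<close>

lemma Bessel_imp_stable_upper:
  assumes C: "C > 0"
    and lower: "AE \<xi> in lebesgue. loewner_le (mat (complex_of_real C)) (bracket (vfourier psi0) (vfourier psi0) \<xi>)"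
    and B: "B > 0" "\<And>f. f \<in> L2 \<Longrightarrow> coef_square f summable_on AS_indices s \<and> (\<Sum>\<^sub>\<infinity>i\<in>AS_indices s. coef_square f i) \<le> B * L2_normsq f"
  shows "\<exists>c > 0. \<forall>J. \<forall>v \<in> l2. Q J v \<le> c * l2_normsq v"
proof -
  have "Q J v \<le> (2 * (B * (4 / C))) * l2_normsq v" if v: "v \<in> l2" for J v
  proof (rule field_le_epsilon)
    fix e :: real assume e: "e > 0"
    obtain K where K: "K \<ge> 0" "\<And>v. v \<in> l2 \<Longrightarrow> Q J v \<le> K * l2_normsq v"
      using analysis_bounded by blast
    \<comment> \<open>The tolerance depends on \<open>J\<close> through \<open>K\<close>, while the
      constant in front of \<open>l2_normsq v\<close> does not.\<close>
    obtain f where f: "f \<in> L2" and approx: "l2_normsq (\<lambda>k. v k - cf 0 f k) < e / (2 * K + 1)"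
      and le: "L2_normsq f \<le> 4 / C * l2_normsq v"
      using coef_dense[OF C lower v, of "e / (2 * K + 1)"] e K(1) by auto
    define h where "h = dilate_shift (matpow (rmat (M 0)) J) 0 f"
    have h: "h \<in> L2" unfolding h_def by (rule dilate_shift_L2[OF f]) (simp add: det_matpow det)
    have cf_h: "cf J h = cf 0 f" using coef_dilate_Suc[OF f, of 0 J] by (simp add: h_def)
    have norm_h: "L2_normsq h = L2_normsq f" unfolding h_def by (rule L2_normsq_dilate[OF f]) (simp add: det_matpow det)
    have "Q J (cf 0 f) \<le> B * L2_normsq f"
      using analysis_le_frame_sum[OF h, of J] B(2)[OF h] by (simp add: cf_h norm_h)
    also have "\<dots> \<le> B * (4 / C * l2_normsq v)" using le B(1) by (intro mult_left_mono) auto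
    finally have 1: "Q J (cf 0 f) \<le> B * (4 / C) * l2_normsq v" by simp
    have cf: "cf 0 f \<in> l2" by (rule coef_l2[OF f])
    have "2 * Q J (\<lambda>k. v k - cf 0 f k) \<le> 2 * (K * l2_normsq (\<lambda>k. v k - cf 0 f k))"
      using K(2)[OF l2_diff[OF v cf]] by simp
    also have "\<dots> \<le> (2 * K + 1) * l2_normsq (\<lambda>k. v k - cf 0 f k)"
      using l2_normsq_nonneg[of "\<lambda>k. v k - cf 0 f k"] by (simp add: distrib_right)
    also have "\<dots> \<le> (2 * K + 1) * (e / (2 * K + 1))"
      using approx K(1) by (intro mult_left_mono) auto
    also have "\<dots> = e" using K(1) by simp
    finally show "Q J v \<le> (2 * (B * (4 / C))) * l2_normsq v + e"
      using analysis_le_diff[OF v cf, of J] 1 by simp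
  qed
  then show ?thesis using B(1) C by (intro exI[of _ "2 * (B * (4 / C))"]) auto
qed

end

section \<open>Pairs of affine systems\<close>

locale affine_pair =
  A: affine_bank M psi0 s b0 b psi + X: affine_bank M psit0 s bt0 bt psit
  for M :: "nat \<Rightarrow> int ^ 'd ^ 'd" and psi0 psit0 :: "real ^ 'd \<Rightarrow> complex ^ 'r"
    and s b0 b psi bt0 bt psit +
  assumes normalized: "(\<Sum>q\<in>UNIV. cnj (vfourier psi0 0 $ q) * vfourier psit0 0 $ q) = 1"
begin

sublocale lim: refinable_pair "M 0" psi0 psit0
  by unfold_locales (rule normalized)

sublocale filter_banks s M b0 bt0 b bt
proof unfold_locales
  show "l \<in> {0..s} \<Longrightarrow> det (rmat (M l)) \<noteq> 0" for l
    using A.det A.detl[of l] by (cases "l = 0") auto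
qed (use A.fin0 A.fin X.fin0 X.fin in auto)

definition wavelet_product :: "(real ^ 'd \<Rightarrow> complex) \<Rightarrow> (real ^ 'd \<Rightarrow> complex) \<Rightarrow> nat \<Rightarrow> nat \<Rightarrow> int ^ 'd \<Rightarrow> complex"
  where "wavelet_product f g l j k = A.T l (A.cf (Suc j) f) k $ 1 * cnj (X.T l (X.cf (Suc j) g) k $ 1)"

definition level_inner :: "(real ^ 'd \<Rightarrow> complex) \<Rightarrow> (real ^ 'd \<Rightarrow> complex) \<Rightarrow> nat \<Rightarrow> nat \<Rightarrow> complex"
  where "level_inner f g l j = l2_inner (A.T l (A.cf (Suc j) f)) (X.T l (X.cf (Suc j) g))"

lemma infsum_wavelet_product: "(\<Sum>\<^sub>\<infinity>k. wavelet_product f g l j k) = level_inner f g l j"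
  by (simp add: level_inner_def wavelet_product_def l2_inner_def sum_1)

lemma wavelet_term:
  assumes "f \<in> L2" "g \<in> L2" "l \<in> {1..s}"
  shows "complex_of_real \<bar>det (rel_dilation M l)\<bar> * L2_inner f (wavelet M psi l j k) * L2_inner (wavelet M psit l j k) g = wavelet_product f g l j k"
proof -
  have sq: "complex_of_real \<bar>det (rel_dilation M l)\<bar>
      = of_real (sqrt \<bar>det (rel_dilation M l)\<bar>) * of_real (sqrt \<bar>det (rel_dilation M l)\<bar>)"
    by (simp flip: of_real_mult)
  have "wavelet_product f g l j k = L2_inner f (AS M psi0 psi (Wavelet l j k)) * cnj (L2_inner g (AS M psit0 psit (Wavelet l j k)))"
    unfolding wavelet_product_def A.AS_Wavelet[OF assms(1,3)] X.AS_Wavelet[OF assms(2,3)] ..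
  then show ?thesis by (simp add: L2_inner_cmult_right L2_inner_cnj sq)
qed

lemma generator_term:
  "(\<Sum>q\<in>UNIV. L2_inner f (generator_shift psi0 q k) * L2_inner (generator_shift psit0 q k) g)
    = (\<Sum>q\<in>UNIV. A.cf 0 f k $ q * cnj (X.cf 0 g k $ q))"
  by (simp only: A.AS_Generator[symmetric] X.AS_Generator[symmetric] AS.simps L2_inner_cnj)

text \<open>The framelet property in terms of coefficient sequences, with the sums over
  \<open>k\<close> collected into inner products level by level. Absolute convergence of the
  generator part is settled here by square summability.\<close>

lemma dual_framelet_iff:
  "dual_framelet s M psi0 psi psit0 psit \<longleftrightarrow>
    is_frame (AS_indices s) (AS M psi0 psi) \<and> is_frame (AS_indices s) (AS M psit0 psit) \<and>
    (\<forall>f \<in> L2. \<forall>g \<in> L2. (\<forall>l\<in>{1..s}. (\<lambda>(j, k). cmod (wavelet_product f g l j k)) summable_on UNIV) \<and>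
      L2_inner f g = l2_inner (A.cf 0 f) (X.cf 0 g) + (\<Sum>l = 1..s. \<Sum>\<^sub>\<infinity>j. level_inner f g l j))"
proof -
  have 1: "(\<lambda>k. cmod (\<Sum>q\<in>UNIV. A.cf 0 f k $ q * cnj (X.cf 0 g k $ q))) summable_on UNIV" if "f \<in> L2" "g \<in> L2" for f g
    by (intro l2_inner_abs_summable A.coef_l2 X.coef_l2 that)
  have 2: "(\<Sum>\<^sub>\<infinity>k. \<Sum>q\<in>UNIV. A.cf 0 f k $ q * cnj (X.cf 0 g k $ q)) = l2_inner (A.cf 0 f) (X.cf 0 g)" for f g
    by (simp add: l2_inner_def)
  have 3: "(\<Sum>l = 1..s. \<Sum>\<^sub>\<infinity>j. \<Sum>\<^sub>\<infinity>k. complex_of_real \<bar>det (rel_dilation M l)\<bar> * L2_inner f (wavelet M psi l j k) * L2_inner (wavelet M psit l j k) g)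
      = (\<Sum>l = 1..s. \<Sum>\<^sub>\<infinity>j. level_inner f g l j)" if "f \<in> L2" "g \<in> L2" for f g
    by (intro sum.cong refl) (simp add: wavelet_term that infsum_wavelet_product)
  have 4: "(\<forall>l\<in>{1..s}. (\<lambda>(j, k). cmod (complex_of_real \<bar>det (rel_dilation M l)\<bar> * L2_inner f (wavelet M psi l j k) * L2_inner (wavelet M psit l j k) g)) summable_on UNIV)
      \<longleftrightarrow> (\<forall>l\<in>{1..s}. (\<lambda>(j, k). cmod (wavelet_product f g l j k)) summable_on UNIV)" if "f \<in> L2" "g \<in> L2" for f g
    by (intro ball_cong refl) (simp only: wavelet_term that)
  show ?thesis
    unfolding dual_framelet_def Let_def generator_term 2
    by (simp only: 1 3 4 simp_thms cong: ball_cong)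
qed

text \<open>Each product is dominated by the sum of the two squared coefficients, taken over one
  wavelet block of the index set.\<close>

lemma wavelet_product_summable:
  assumes f: "f \<in> L2" "A.coef_square f summable_on AS_indices s" and g: "g \<in> L2" "X.coef_square g summable_on AS_indices s"
    and l: "l \<in> {1..s}"
  shows "(\<lambda>(j, k). cmod (wavelet_product f g l j k)) summable_on UNIV"
proof (rule summable_on_comparison_test)
  let ?w = "\<lambda>(j, k). Wavelet l j k :: ('r, 'd) as_index"
  have inj: "inj ?w" by (auto simp: inj_def)
  have sub: "range ?w \<subseteq> AS_indices s" using l by (auto simp: AS_indices_def)
  have "A.coef_square f summable_on range ?w" "X.coef_square g summable_on range ?w"
    using summable_on_subset_banach[OF f(2) sub] summable_on_subset_banach[OF g(2) sub] .
  then show "(\<lambda>x. A.coef_square f (?w x) + X.coef_square g (?w x)) summable_on UNIV"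
    unfolding summable_on_reindex[OF inj] o_def by (rule summable_on_add)
  fix x :: "nat \<times> (int ^ 'd)"
  obtain j k where x: "x = (j, k)" by force
  have "cmod (wavelet_product f g l j k) \<le> (cmod (A.T l (A.cf (Suc j) f) k $ 1))\<^sup>2 + (cmod (X.T l (X.cf (Suc j) g) k $ 1))\<^sup>2"
  proof -
    have "x * y \<le> x\<^sup>2 + y\<^sup>2" if "0 \<le> x" "0 \<le> y" for x y :: real
      using sum_squares_bound[of x y] mult_nonneg_nonneg[OF that] by linarith
    then show ?thesis unfolding wavelet_product_def norm_mult complex_mod_cnj by simp
  qed
  then show "(case x of (j, k) \<Rightarrow> cmod (wavelet_product f g l j k)) \<le> A.coef_square f (?w x) + X.coef_square g (?w x)"
    by (simp add: x A.coef_square_def X.coef_square_def A.AS_Wavelet[OF f(1) l] X.AS_Wavelet[OF g(1) l] del: AS.simps)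
qed auto

lemma level_inner_summable:
  assumes "(\<lambda>(j, k). cmod (wavelet_product f g l j k)) summable_on UNIV"
  shows "(\<lambda>j. level_inner f g l j) summable_on UNIV"
proof -
  have "(\<lambda>(j, k). wavelet_product f g l j k) summable_on (UNIV \<times> UNIV)"
    by (rule abs_summable_summable) (use assms in \<open>simp add: case_prod_beta'\<close>)
  then have "(\<lambda>j. \<Sum>\<^sub>\<infinity>k. wavelet_product f g l j k) summable_on UNIV"
    by (rule summable_on_Sigma_banach)
  then show ?thesis unfolding infsum_wavelet_product .
qed

section \<open>From filter banks to framelets\<close>

lemma telescope:
  assumes PR: "\<forall>v\<in>l2. \<forall>w\<in>l2. PR v w = l2_inner v w" and v: "v \<in> l2" and w: "w \<in> l2"
  shows "l2_inner v w = (\<Sum>j<J. \<Sum>l = 1..s. l2_inner (A.T l (lowpass_coeffs M b0 v j)) (X.T l (lowpass_coeffs M bt0 w j)))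
    + l2_inner (lowpass_coeffs M b0 v J) (lowpass_coeffs M bt0 w J)"
proof (induction J)
  case (Suc J)
  have "l2_inner (lowpass_coeffs M b0 v J) (lowpass_coeffs M bt0 w J)
      = l2_inner (lowpass_coeffs M b0 v (Suc J)) (lowpass_coeffs M bt0 w (Suc J))
      + (\<Sum>l = 1..s. l2_inner (A.T l (lowpass_coeffs M b0 v J)) (X.T l (lowpass_coeffs M bt0 w J)))"
    using PR[rule_format, OF A.lowpass_l2[OF v, of J] X.lowpass_l2[OF w, of J]] by (simp add: pr_form_def lowpass_coeffs_def)
  then show ?case using Suc by (simp add: algebra_simps)
qed (simp add: lowpass_coeffs_def)

text \<open>The same weight \<open>t\<close> is used at every level, so that the separate
  inequalities add up to the energies of the two banks.\<close>

lemma analysis_amgm: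
  assumes PR: "\<forall>v\<in>l2. \<forall>w\<in>l2. PR v w = l2_inner v w" and v: "v \<in> l2" and w: "w \<in> l2" and t: "t > 0"
  shows "2 * cmod (l2_inner v w) \<le> t * A.Q J v + X.Q J w / t"
proof -
  let ?v = "lowpass_coeffs M b0 v" and ?w = "lowpass_coeffs M bt0 w"
  have shift: "(\<Sum>j = 1..J. F (j - 1)) = (\<Sum>j<J. F j)" for F :: "nat \<Rightarrow> real"
    using sum.atLeast1_atMost_eq[of "\<lambda>j. F (j - 1)" J] by simp
  have "2 * cmod (l2_inner v w) \<le> (\<Sum>j<J. \<Sum>l = 1..s. 2 * cmod (l2_inner (A.T l (?v j)) (X.T l (?w j)))) + 2 * cmod (l2_inner (?v J) (?w J))"
  proof -
    have "cmod (l2_inner v w) \<le> (\<Sum>j<J. \<Sum>l = 1..s. cmod (l2_inner (A.T l (?v j)) (X.T l (?w j)))) + cmod (l2_inner (?v J) (?w J))"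
      by (subst telescope[OF PR v w, of J]) (intro norm_triangle_mono sum_norm_le order_refl; assumption)+
    then show ?thesis by (simp add: sum_distrib_left[symmetric])
  qed
  also have "\<dots> \<le> (\<Sum>j<J. \<Sum>l = 1..s. t * l2_normsq (A.T l (?v j)) + l2_normsq (X.T l (?w j)) / t) + (t * l2_normsq (?v J) + l2_normsq (?w J) / t)"
    by (intro add_mono sum_mono l2_inner_amgm A.T_l2 X.T_l2 A.lowpass_l2 X.lowpass_l2 v w t)
  also have "\<dots> = t * A.Q J v + X.Q J w / t"
    unfolding analysis_normsq_def shift[of "\<lambda>j. \<Sum>l = 1..s. l2_normsq (A.T l (?v j))"] shift[of "\<lambda>j. \<Sum>l = 1..s. l2_normsq (X.T l (?w j))"]
    by (simp add: sum.distrib sum_distrib_left sum_divide_distrib add_divide_distrib algebra_simps)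
  finally show ?thesis .
qed

lemma coef_telescope:
  assumes PR: "\<forall>v\<in>l2. \<forall>w\<in>l2. PR v w = l2_inner v w" and f: "f \<in> L2" and g: "g \<in> L2"
  shows "l2_inner (A.cf J f) (X.cf J g) = l2_inner (A.cf 0 f) (X.cf 0 g) + (\<Sum>j<J. \<Sum>l = 1..s. level_inner f g l j)"
proof (induction J)
  case (Suc J)
  have "l2_inner (A.cf (Suc J) f) (X.cf (Suc J) g) = l2_inner (A.cf J f) (X.cf J g) + (\<Sum>l = 1..s. level_inner f g l J)"
    using PR[rule_format, OF A.coef_l2[OF f, of "Suc J"] X.coef_l2[OF g, of "Suc J"]]
    by (simp only: pr_form_def level_inner_def A.coef_cascade[OF f, of J, symmetric] X.coef_cascade[OF g, of J, symmetric])
  then show ?case using Suc by simp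
qed simp

lemma filter_bank_imp_framelet:
  assumes fb: "dual_framelet_filter_bank s M b0 b bt0 bt" and st: "l2_stable s M b0 b" "l2_stable s M bt0 bt"
  shows "dual_framelet s M psi0 psi psit0 psit"
proof -
  note PR = fb[unfolded dual_framelet_filter_bank_iff_PR]
  obtain c where "c > 0" "\<And>J v. J \<ge> 1 \<Longrightarrow> v \<in> l2 \<Longrightarrow> A.Q J v \<le> c * l2_normsq v"
    using st(1) unfolding l2_stable_def by blast
  from A.stable_imp_Bessel[OF this] obtain B where B: "B > 0"
    "\<And>f. f \<in> L2 \<Longrightarrow> A.coef_square f summable_on AS_indices s \<and> (\<Sum>\<^sub>\<infinity>i\<in>AS_indices s. A.coef_square f i) \<le> B * L2_normsq f"
    by blast
  obtain c' where "c' > 0" "\<And>J v. J \<ge> 1 \<Longrightarrow> v \<in> l2 \<Longrightarrow> X.Q J v \<le> c' * l2_normsq v"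
    using st(2) unfolding l2_stable_def by blast
  from X.stable_imp_Bessel[OF this] obtain B' where B': "B' > 0"
    "\<And>f. f \<in> L2 \<Longrightarrow> X.coef_square f summable_on AS_indices s \<and> (\<Sum>\<^sub>\<infinity>i\<in>AS_indices s. X.coef_square f i) \<le> B' * L2_normsq f"
    by blast
  \<comment> \<open>Limit of \<open>analysis_amgm\<close> along the levels: the left side converges
    to twice the squared norm, and the right side stays below the two weighted frame sums.\<close>
  have amgm: "2 * L2_normsq f \<le> t * (\<Sum>\<^sub>\<infinity>i\<in>AS_indices s. A.coef_square f i) + (\<Sum>\<^sub>\<infinity>i\<in>AS_indices s. X.coef_square f i) / t"
    if f: "f \<in> L2" and t: "t > 0" for f t
  proof (rule LIMSEQ_le_const2)
    show "(\<lambda>J. 2 * cmod (l2_inner (A.cf J f) (X.cf J f))) \<longlonglongrightarrow> 2 * L2_normsq f"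
      using tendsto_mult_left[OF tendsto_norm[OF lim.coef_inner_tendsto[OF f f]], of 2]
      by (simp add: L2_inner_self L2_normsq_nonneg)
    have "2 * cmod (l2_inner (A.cf J f) (X.cf J f)) \<le> t * (\<Sum>\<^sub>\<infinity>i\<in>AS_indices s. A.coef_square f i) + (\<Sum>\<^sub>\<infinity>i\<in>AS_indices s. X.coef_square f i) / t" for J
    proof -
      have "2 * cmod (l2_inner (A.cf J f) (X.cf J f)) \<le> t * A.Q J (A.cf J f) + X.Q J (X.cf J f) / t"
        by (rule analysis_amgm[OF PR A.coef_l2[OF f] X.coef_l2[OF f] t])
      also have "\<dots> \<le> t * (\<Sum>\<^sub>\<infinity>i\<in>AS_indices s. A.coef_square f i) + (\<Sum>\<^sub>\<infinity>i\<in>AS_indices s. X.coef_square f i) / t"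
        using t B(2)[OF f] B'(2)[OF f]
        by (intro add_mono mult_left_mono divide_right_mono A.analysis_le_frame_sum X.analysis_le_frame_sum f) auto
      finally show ?thesis .
    qed
    then show "\<exists>N. \<forall>J\<ge>N. 2 * cmod (l2_inner (A.cf J f) (X.cf J f)) \<le> t * (\<Sum>\<^sub>\<infinity>i\<in>AS_indices s. A.coef_square f i) + (\<Sum>\<^sub>\<infinity>i\<in>AS_indices s. X.coef_square f i) / t"
      by blast
  qed
  \<comment> \<open>With \<open>t = B'\<close> the dual term is at most \<open>L2_normsq f\<close>,
    which leaves the lower frame bound \<open>1 / B'\<close>.\<close>
  have "L2_normsq f \<le> B' * (\<Sum>\<^sub>\<infinity>i\<in>AS_indices s. A.coef_square f i)" if f: "f \<in> L2" for f
  proof -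
    have "(\<Sum>\<^sub>\<infinity>i\<in>AS_indices s. X.coef_square f i) / B' \<le> L2_normsq f"
      using B'(2)[OF f] B'(1) by (simp add: divide_le_eq mult.commute)
    then show ?thesis using amgm[OF f B'(1)] by linarith
  qed
  then have frame: "is_frame (AS_indices s) (AS M psi0 psi)"
    unfolding is_frame_def A.coef_square_def[symmetric] using A.AS_L2 B B'(1)
    by (intro conjI ballI exI[of _ "1 / B'"] exI[of _ B]) (auto simp: divide_le_eq mult.commute)
  \<comment> \<open>With the roles exchanged the weight becomes \<open>1 / B\<close>.\<close>
  have "L2_normsq f \<le> B * (\<Sum>\<^sub>\<infinity>i\<in>AS_indices s. X.coef_square f i)" if f: "f \<in> L2" for f
  proof -
    have "1 / B * (\<Sum>\<^sub>\<infinity>i\<in>AS_indices s. A.coef_square f i) \<le> L2_normsq f"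
      using B(2)[OF f] B(1) by (simp add: divide_le_eq mult.commute)
    then show ?thesis using amgm[OF f, of "1 / B"] B(1) by (simp add: mult.commute)
  qed
  then have frame': "is_frame (AS_indices s) (AS M psit0 psit)"
    unfolding is_frame_def X.coef_square_def[symmetric] using X.AS_L2 B' B(1)
    by (intro conjI ballI exI[of _ "1 / B"] exI[of _ B']) (auto simp: divide_le_eq mult.commute)
  have rec: "(\<forall>l\<in>{1..s}. (\<lambda>(j, k). cmod (wavelet_product f g l j k)) summable_on UNIV) \<and>
      L2_inner f g = l2_inner (A.cf 0 f) (X.cf 0 g) + (\<Sum>l = 1..s. \<Sum>\<^sub>\<infinity>j. level_inner f g l j)"
    if f: "f \<in> L2" and g: "g \<in> L2" for f g
  proof
    show sm: "\<forall>l\<in>{1..s}. (\<lambda>(j, k). cmod (wavelet_product f g l j k)) summable_on UNIV"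
      using wavelet_product_summable[OF f _ g] B(2)[OF f] B'(2)[OF g] by blast
    have "(\<lambda>J. \<Sum>j<J. level_inner f g l j) \<longlonglongrightarrow> (\<Sum>\<^sub>\<infinity>j. level_inner f g l j)" if "l \<in> {1..s}" for l
      using has_sum_imp_sums[OF has_sum_infsum[OF level_inner_summable[OF sm[rule_format, OF that]]]] by (simp add: sums_def)
    then have lim: "(\<lambda>J. l2_inner (A.cf 0 f) (X.cf 0 g) + (\<Sum>l = 1..s. \<Sum>j<J. level_inner f g l j))
        \<longlonglongrightarrow> l2_inner (A.cf 0 f) (X.cf 0 g) + (\<Sum>l = 1..s. \<Sum>\<^sub>\<infinity>j. level_inner f g l j)"
      by (intro tendsto_add tendsto_const tendsto_sum)
    have "(\<lambda>J. l2_inner (A.cf J f) (X.cf J g)) = (\<lambda>J. l2_inner (A.cf 0 f) (X.cf 0 g) + (\<Sum>l = 1..s. \<Sum>j<J. level_inner f g l j))"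
      by (rule ext, subst coef_telescope[OF PR f g], subst sum.swap) (rule refl)
    with lim have "(\<lambda>J. l2_inner (A.cf J f) (X.cf J g)) \<longlonglongrightarrow> l2_inner (A.cf 0 f) (X.cf 0 g) + (\<Sum>l = 1..s. \<Sum>\<^sub>\<infinity>j. level_inner f g l j)"
      by (rule ssubst[rotated])
    then show "L2_inner f g = l2_inner (A.cf 0 f) (X.cf 0 g) + (\<Sum>l = 1..s. \<Sum>\<^sub>\<infinity>j. level_inner f g l j)"
      by (rule LIMSEQ_unique[OF lim.coef_inner_tendsto[OF f g]])
  qed
  show ?thesis
    unfolding dual_framelet_iff by (rule conjI, rule frame, rule conjI, rule frame', intro ballI, rule rec)
qed

text \<open>Comparing the reconstruction of \<open>f\<close> with that of its dilate shifts the wavelet levels by one,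
  and the surplus terms are one step of the filter bank applied to \<open>A.cf 0 f\<close>.\<close>

lemma framelet_imp_PR_coef:
  assumes dual: "dual_framelet s M psi0 psi psit0 psit" and f: "f \<in> L2" and g: "g \<in> L2"
  shows "PR (A.cf 0 f) (X.cf 0 g) = l2_inner (A.cf 0 f) (X.cf 0 g)"
proof -
  define D where "D h = dilate_shift (matpow (rmat (M 0)) 1) 0 h" for h
  have det1: "det (matpow (rmat (M 0)) 1) \<noteq> 0" by (simp add: det_matpow A.det)
  have D: "D f \<in> L2" "D g \<in> L2" unfolding D_def using f g det1 by (auto intro: dilate_shift_L2)
  have cD: "A.cf (Suc j) (D f) = A.cf j f" "X.cf (Suc j) (D g) = X.cf j g" for j
    unfolding D_def using A.coef_dilate_Suc[OF f, of j 1] X.coef_dilate_Suc[OF g, of j 1] by simp_all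
  have c0: "A.cf 0 (D f) = A.T0 (A.cf 0 f)" "X.cf 0 (D g) = X.T0 (X.cf 0 g)"
    using A.coef_cascade[OF D(1), of 0] X.coef_cascade[OF D(2), of 0] by (simp_all only: cD)
  have level_inner: "level_inner (D f) (D g) l 0 = l2_inner (A.T l (A.cf 0 f)) (X.T l (X.cf 0 g))" "level_inner (D f) (D g) l (Suc j) = level_inner f g l j" for l j
    by (simp_all only: level_inner_def cD)
  have id: "L2_inner f g = l2_inner (A.cf 0 f) (X.cf 0 g) + (\<Sum>l = 1..s. \<Sum>\<^sub>\<infinity>j. level_inner f g l j)"
    "L2_inner (D f) (D g) = l2_inner (A.cf 0 (D f)) (X.cf 0 (D g)) + (\<Sum>l = 1..s. \<Sum>\<^sub>\<infinity>j. level_inner (D f) (D g) l j)"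
    "l \<in> {1..s} \<Longrightarrow> (\<lambda>(j, k). cmod (wavelet_product f g l j k)) summable_on UNIV"
    "l \<in> {1..s} \<Longrightarrow> (\<lambda>(j, k). cmod (wavelet_product (D f) (D g) l j k)) summable_on UNIV" for l
    using dual f g D unfolding dual_framelet_iff by blast+
  have "(\<Sum>\<^sub>\<infinity>j. level_inner (D f) (D g) l j) = level_inner (D f) (D g) l 0 + (\<Sum>\<^sub>\<infinity>j. level_inner f g l j)" if l: "l \<in> {1..s}" for l
  proof -
    have "level_inner (D f) (D g) l sums (\<Sum>\<^sub>\<infinity>j. level_inner (D f) (D g) l j)"
      by (intro has_sum_imp_sums has_sum_infsum level_inner_summable id l)
    moreover have "(\<lambda>j. level_inner (D f) (D g) l (Suc j)) sums (\<Sum>\<^sub>\<infinity>j. level_inner f g l j)"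
      unfolding level_inner by (intro has_sum_imp_sums has_sum_infsum level_inner_summable id l)
    then have "level_inner (D f) (D g) l sums ((\<Sum>\<^sub>\<infinity>j. level_inner f g l j) + level_inner (D f) (D g) l 0)" by (rule sums_Suc)
    ultimately show ?thesis using sums_unique2 by (metis add.commute)
  qed
  then have "(\<Sum>l = 1..s. \<Sum>\<^sub>\<infinity>j. level_inner (D f) (D g) l j)
      = (\<Sum>l = 1..s. l2_inner (A.T l (A.cf 0 f)) (X.T l (X.cf 0 g))) + (\<Sum>l = 1..s. \<Sum>\<^sub>\<infinity>j. level_inner f g l j)"
    by (simp add: level_inner sum.distrib)
  moreover have "L2_inner (D f) (D g) = L2_inner f g" unfolding D_def by (rule L2_inner_dilate[OF f g det1])
  ultimately show ?thesis using id(1,2) by (simp add: pr_form_def c0)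
qed

section \<open>From framelets back to filter banks\<close>

context
  fixes C :: real
  assumes C: "C > 0"
    and lower: "AE \<xi> in lebesgue. loewner_le (mat (complex_of_real C)) (bracket (vfourier psi0) (vfourier psi0) \<xi>)"
    and lower_dual: "AE \<xi> in lebesgue. loewner_le (mat (complex_of_real C)) (bracket (vfourier psit0) (vfourier psit0) \<xi>)"
    and dual: "dual_framelet s M psi0 psi psit0 psit"
begin

text \<open>The identity known for sampled sequences extends by density in one argument at a time:
  in \<open>w\<close> with a sampled first argument, and then in \<open>v\<close>.\<close>

lemma framelet_imp_PR:
  assumes v: "v \<in> l2" and w: "w \<in> l2"
  shows "PR v w = l2_inner v w"
proof -
  obtain K where K: "\<And>v w. v \<in> l2 \<Longrightarrow> w \<in> l2 \<Longrightarrow> (cmod (PR v w - l2_inner v w))\<^sup>2 \<le> K * l2_normsq v * l2_normsq w"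
    using PR_error_bounded by blast
  have 1: "PR (A.cf 0 f) w - l2_inner (A.cf 0 f) w = 0" if f: "f \<in> L2" for f
  proof (rule l2_functional_zero_dense[where F = "\<lambda>w. PR (A.cf 0 f) w - l2_inner (A.cf 0 f) w", OF _ K[OF A.coef_l2[OF f]] _ w])
    note cf = A.coef_l2[OF f, of 0]
    show "PR (A.cf 0 f) (\<lambda>k. v k - w k) - l2_inner (A.cf 0 f) (\<lambda>k. v k - w k)
        = PR (A.cf 0 f) v - l2_inner (A.cf 0 f) v - (PR (A.cf 0 f) w - l2_inner (A.cf 0 f) w)" if "v \<in> l2" "w \<in> l2" for v w
      using that cf by (simp add: PR_diff(2)[OF cf cf] l2_inner_diff_right)
    fix e :: real assume "e > 0"
    from X.coef_dense[OF C lower_dual w this]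
    obtain g where g: "g \<in> L2" "l2_normsq (\<lambda>k. w k - X.cf 0 g k) < e" by blast
    then show "\<exists>u\<in>l2. PR (A.cf 0 f) u - l2_inner (A.cf 0 f) u = 0 \<and> l2_normsq (\<lambda>k. w k - u k) < e"
      using framelet_imp_PR_coef[OF dual f g(1)] X.coef_l2[OF g(1), of 0] by (intro bexI[of _ "X.cf 0 g"]) auto
  qed
  have "PR v w - l2_inner v w = 0"
  proof (rule l2_functional_zero_dense[where F = "\<lambda>v. PR v w - l2_inner v w" and K = "K * l2_normsq w", OF _ _ _ v])
    show "PR (\<lambda>k. v k - v' k) w - l2_inner (\<lambda>k. v k - v' k) w = PR v w - l2_inner v w - (PR v' w - l2_inner v' w)"
      if "v \<in> l2" "v' \<in> l2" for v v'
      using that w by (simp add: PR_diff(1)[OF _ _ w w] l2_inner_diff_left)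
    show "(cmod (PR v w - l2_inner v w))\<^sup>2 \<le> K * l2_normsq w * l2_normsq v" if "v \<in> l2" for v
      using K[OF that w] by (simp only: mult_ac)
    fix e :: real assume "e > 0"
    from A.coef_dense[OF C lower v this]
    obtain f where f: "f \<in> L2" "l2_normsq (\<lambda>k. v k - A.cf 0 f k) < e" by blast
    then show "\<exists>u\<in>l2. PR u w - l2_inner u w = 0 \<and> l2_normsq (\<lambda>k. v k - u k) < e"
      using 1[OF f(1)] A.coef_l2[OF f(1), of 0] by (intro bexI[of _ "A.cf 0 f"]) auto
  qed
  then show ?thesis by simp
qed

lemma framelet_imp_filter_bank:
  "dual_framelet_filter_bank s M b0 b bt0 bt" "l2_stable s M b0 b" "l2_stable s M bt0 bt"
proof -
  show "dual_framelet_filter_bank s M b0 b bt0 bt"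
    unfolding dual_framelet_filter_bank_iff_PR by (intro ballI framelet_imp_PR)
  note PR = this[unfolded dual_framelet_filter_bank_iff_PR]
  have frames: "is_frame (AS_indices s) (AS M psi0 psi)" "is_frame (AS_indices s) (AS M psit0 psit)"
    using dual by (simp_all add: dual_framelet_def)
  obtain B where "B > 0"
    "\<And>f. f \<in> L2 \<Longrightarrow> A.coef_square f summable_on AS_indices s \<and> (\<Sum>\<^sub>\<infinity>i\<in>AS_indices s. A.coef_square f i) \<le> B * L2_normsq f"
    using frames(1) unfolding is_frame_def A.coef_square_def[symmetric] by blast
  from A.Bessel_imp_stable_upper[OF C lower this]
  obtain c where c: "c > 0" "\<And>J v. v \<in> l2 \<Longrightarrow> A.Q J v \<le> c * l2_normsq v" by blast
  obtain B' where "B' > 0"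
    "\<And>f. f \<in> L2 \<Longrightarrow> X.coef_square f summable_on AS_indices s \<and> (\<Sum>\<^sub>\<infinity>i\<in>AS_indices s. X.coef_square f i) \<le> B' * L2_normsq f"
    using frames(2) unfolding is_frame_def X.coef_square_def[symmetric] by blast
  from X.Bessel_imp_stable_upper[OF C lower_dual this]
  obtain c' where c': "c' > 0" "\<And>J v. v \<in> l2 \<Longrightarrow> X.Q J v \<le> c' * l2_normsq v" by blast
  have amgm: "2 * l2_normsq v \<le> t * A.Q J v + X.Q J v / t" if "v \<in> l2" "t > 0" for v t J
    using analysis_amgm[OF PR that(1,1,2), of J] by (simp add: l2_inner_self that l2_normsq_nonneg)
  \<comment> \<open>The weight \<open>c'\<close> reduces the dual energy to at most
    \<open>l2_normsq v\<close>: the lower stability constant of one bank is the reciprocal of the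
    upper constant of the other.\<close>
  have "1 / c' * l2_normsq v \<le> A.Q J v" if v: "v \<in> l2" for J v
  proof -
    have "X.Q J v / c' \<le> l2_normsq v" using c'(2)[OF v] c'(1) by (simp add: divide_le_eq mult.commute)
    then have "l2_normsq v \<le> c' * A.Q J v" using amgm[OF v c'(1), of J] by linarith
    then show ?thesis using c'(1) by (simp add: divide_le_eq mult.commute)
  qed
  then show "l2_stable s M b0 b"
    unfolding l2_stable_def using c c'(1) by (intro exI[of _ "1 / c'"] exI[of _ c]) auto
  have "1 / c * l2_normsq v \<le> X.Q J v" if v: "v \<in> l2" for J v
  proof -
    have "1 / c * A.Q J v \<le> l2_normsq v" using c(2)[OF v] c(1) by (simp add: divide_le_eq mult.commute)
    then have "l2_normsq v \<le> c * X.Q J v" using amgm[OF v, of "1 / c" J] c(1) by (simp add: mult.commute)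
    then show ?thesis using c(1) by (simp add: divide_le_eq mult.commute)
  qed
  then show "l2_stable s M bt0 bt"
    unfolding l2_stable_def using c' c(1) by (intro exI[of _ "1 / c"] exI[of _ c']) auto
qed

end

text \<open>Compact support bounds each bracket at every point through \<open>bracket_upper\<close>.
  The summand 1 in the constant makes it positive.\<close>

lemma bracket_bounded:
  "\<exists>C > 0. AE \<xi> in lebesgue. loewner_le
    (bracket (vfourier psi0) (vfourier psi0) \<xi> + bracket (vfourier psit0) (vfourier psit0) \<xi>) (mat (complex_of_real C))"
proof -
  obtain D where D: "D \<ge> 0" "\<And>\<xi> x. qform (bracket (vfourier psi0) (vfourier psi0) \<xi>) x \<le> D * (norm x)\<^sup>2"
    using A.bracket_upper by blast
  obtain D' where D': "D' \<ge> 0" "\<And>\<xi> x. qform (bracket (vfourier psit0) (vfourier psit0) \<xi>) x \<le> D' * (norm x)\<^sup>2"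
    using X.bracket_upper by blast
  have "loewner_le (bracket (vfourier psi0) (vfourier psi0) \<xi> + bracket (vfourier psit0) (vfourier psit0) \<xi>)
      (mat (complex_of_real (D + D' + 1)))" for \<xi>
  proof (rule loewner_leI)
    fix x :: "complex ^ 'r"
    show "qform (bracket (vfourier psi0) (vfourier psi0) \<xi> + bracket (vfourier psit0) (vfourier psit0) \<xi>) x
        \<le> qform (mat (complex_of_real (D + D' + 1))) x"
      unfolding qform_add qform_mat distrib_right by (intro add_increasing2 add_mono D(2) D'(2)) auto
  qed (simp_all only: herm_add A.bracket_herm X.bracket_herm herm_mat_of_real)
  then show ?thesis using D(1) D'(1) by (intro exI[of _ "D + D' + 1"]) auto
qed

end

section \<open>From the Fourier hypotheses to refinement equations in time\<close>

lemma fourier_refine_sum_mask: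
  fixes b :: "int ^ 'd \<Rightarrow> complex ^ 'r ^ 'q" and \<psi> :: "real ^ 'd \<Rightarrow> complex ^ 'r"
  assumes "det (rmat M) \<noteq> 0" and b: "finitely_supported b" and "\<And>q. (\<lambda>x. \<psi> x $ q) \<in> L2" "\<And>q. integrable lebesgue (\<lambda>x. \<psi> x $ q)"
  shows "fourier (refine_sum M {p. b p \<noteq> 0} (\<lambda>q p. b p $ i $ q) \<psi>) \<xi>
    = (mseq_hat b (inv_transpose M *v \<xi>) *v vfourier \<psi> (inv_transpose M *v \<xi>)) $ i"
  using b by (subst fourier_refine_sum) (auto simp: assms finitely_supported_def matrix_vector_mult_def mseq_hat_def)

text \<open>Injectivity of the Fourier transform identifies each function with its explicit
  \<open>refine_sum\<close>: among integrable functions for the components of \<open>psi0\<close>,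
  and by comparison with an integrable candidate for \<open>psi l\<close>, whose transform is known
  only as an \<open>L2\<close> limit.\<close>

lemma affine_bankI:
  fixes M :: "nat \<Rightarrow> int ^ 'd ^ 'd" and psi0 :: "real ^ 'd \<Rightarrow> complex ^ 'r"
  assumes fin0: "finitely_supported b0" and fin: "\<And>l. l \<in> {1..s} \<Longrightarrow> finitely_supported (b l)"
    and dil_M: "\<And>l. l \<in> {0..s} \<Longrightarrow> dilation_matrix (M l)"
    and psi0_L2: "\<And>q. (\<lambda>x. psi0 x $ q) \<in> L2" and cs: "compactly_supported psi0"
    and refine: "\<And>\<xi>. vfourier psi0 (transpose (rmat (M 0)) *v \<xi>) = mseq_hat b0 \<xi> *v vfourier psi0 \<xi>"
    and psi: "\<And>l. l \<in> {1..s} \<Longrightarrow> has_L2_fourier (psi l)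
        (\<lambda>\<xi>. (mseq_hat (b l) (inv_transpose (M 0) *v \<xi>) *v vfourier psi0 (inv_transpose (M 0) *v \<xi>)) $ 1)"
  shows "affine_bank M psi0 s b0 b psi"
proof -
  interpret refinable_vector "M 0" psi0
  proof unfold_locales
    show "dilation_matrix (M 0)" by (rule dil_M) simp
  qed (rule psi0_L2 cs)+
  have fP: "finite {p. \<beta> p \<noteq> 0}" if "finitely_supported \<beta>" for \<beta> :: "int ^ 'd \<Rightarrow> complex ^ 'r ^ 'q"
    using that by (simp add: finitely_supported_def)
  show ?thesis
  proof unfold_locales
    fix i
    show "AE x in lebesgue. psi0 x $ i = refine_sum (M 0) {p. b0 p \<noteq> 0} (\<lambda>q p. b0 p $ i $ q) psi0 x"
    proof (rule fourier_L1_unique[OF \<psi>_integrable refine_sum_integrable])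
      fix \<xi>
      have "fourier (\<lambda>x. psi0 x $ i) \<xi> = vfourier psi0 (transpose (rmat (M 0)) *v (inv_transpose (M 0) *v \<xi>)) $ i"
        by (simp add: inv_transpose_cancel[OF det] vfourier_def del: transpose_matrix_vector)
      then show "fourier (\<lambda>x. psi0 x $ i) \<xi> = fourier (refine_sum (M 0) {p. b0 p \<noteq> 0} (\<lambda>q p. b0 p $ i $ q) psi0) \<xi>"
        by (simp only: refine fourier_refine_sum_mask[OF det fin0 \<psi>_L2 \<psi>_integrable])
    qed (use det fP[OF fin0] \<psi>_L2 \<psi>_integrable in auto)
  next
    fix l assume l: "l \<in> {1..s}"
    show "psi l \<in> L2" using psi[OF l] by (simp add: has_L2_fourier_def)
    show "det (rmat (M l)) \<noteq> 0" using dil_M[of l] l by (simp add: dilation_det_nz)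
    show "AE x in lebesgue. psi l x = refine_sum (M 0) {p. b l p \<noteq> 0} (\<lambda>q p. b l p $ 1 $ q) psi0 x"
      by (rule fourier_L2_unique[OF psi[OF l] refine_sum_L2 refine_sum_integrable])
        (use det fP[OF fin[OF l]] \<psi>_L2 \<psi>_integrable in \<open>auto simp: fourier_refine_sum_mask[OF det fin[OF l] \<psi>_L2 \<psi>_integrable]\<close>)
  qed (use fin0 fin in auto)
qed

theorem theorem5p9:
  fixes s :: nat
    and M :: "nat \<Rightarrow> int ^ 'd ^ 'd"
    and b0 bt0 :: "int ^ 'd \<Rightarrow> complex ^ 'r ^ 'r"
    and b bt :: "nat \<Rightarrow> int ^ 'd \<Rightarrow> complex ^ 'r ^ 1"
    and psi0 psit0 :: "real ^ 'd \<Rightarrow> complex ^ 'r"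
    and psi psit :: "nat \<Rightarrow> real ^ 'd \<Rightarrow> complex"
  assumes s: "1 \<le> s"
    and fin0: "finitely_supported b0" "finitely_supported bt0"
    and fin: "\<And>l. l \<in> {1..s} \<Longrightarrow> finitely_supported (b l)"
      "\<And>l. l \<in> {1..s} \<Longrightarrow> finitely_supported (bt l)"
    and dil: "\<And>l. l \<in> {0..s} \<Longrightarrow> dilation_matrix (M l)"
    and psi0_L2: "\<And>q. (\<lambda>x. psi0 x $ q) \<in> L2" "\<And>q. (\<lambda>x. psit0 x $ q) \<in> L2"
    and std: "standard_refinable (M 0) b0 psi0" "standard_refinable (M 0) bt0 psit0"
    and refine:
      "\<And>\<xi>. vfourier psi0 (transpose (rmat (M 0)) *v \<xi>) = mseq_hat b0 \<xi> *v vfourier psi0 \<xi>"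
      "\<And>\<xi>. vfourier psit0 (transpose (rmat (M 0)) *v \<xi>) = mseq_hat bt0 \<xi> *v vfourier psit0 \<xi>"
    and normalized: "(\<Sum>q\<in>UNIV. cnj (vfourier psi0 0 $ q) * vfourier psit0 0 $ q) = 1"
    and psi: "\<And>l. l \<in> {1..s} \<Longrightarrow> has_L2_fourier (psi l)
        (\<lambda>\<xi>. (mseq_hat (b l) (inv_transpose (M 0) *v \<xi>)
                *v vfourier psi0 (inv_transpose (M 0) *v \<xi>)) $ 1)"
    and psit: "\<And>l. l \<in> {1..s} \<Longrightarrow> has_L2_fourier (psit l)
        (\<lambda>\<xi>. (mseq_hat (bt l) (inv_transpose (M 0) *v \<xi>)
                *v vfourier psit0 (inv_transpose (M 0) *v \<xi>)) $ 1)"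
  shows
    "let
       stmt_i =
         (dual_framelet_filter_bank s M b0 b bt0 bt \<and> l2_stable s M b0 b \<and> l2_stable s M bt0 bt);
       stmt_ii =
         (dual_framelet s M psi0 psi psit0 psit \<and>
          (\<exists>C > 0. AE \<xi> in lebesgue.
            loewner_le (bracket (vfourier psi0) (vfourier psi0) \<xi>
                + bracket (vfourier psit0) (vfourier psit0) \<xi>)
              (mat (complex_of_real C))))
     in (stmt_i \<longrightarrow> stmt_ii) \<and>
        ((\<exists>C' > 0.
            (AE \<xi> in lebesgue. loewner_le (mat (complex_of_real C'))
              (bracket (vfourier psi0) (vfourier psi0) \<xi>)) \<and>
            (AE \<xi> in lebesgue. loewner_le (mat (complex_of_real C'))
              (bracket (vfourier psit0) (vfourier psit0) \<xi>)))
          \<longrightarrow> stmt_ii \<longrightarrow> stmt_i)"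
proof -
  have cs: "compactly_supported psi0" "compactly_supported psit0"
    using std by (simp_all add: standard_refinable_def)
  interpret affine_pair M psi0 psit0 s b0 b psi bt0 bt psit
    by (intro affine_pair.intro affine_bankI affine_pair_axioms.intro fin0 fin dil psi0_L2 cs refine normalized psi psit)
  show ?thesis
    unfolding Let_def
  proof (intro conjI impI; (elim conjE exE)?)
    assume "dual_framelet_filter_bank s M b0 b bt0 bt" "l2_stable s M b0 b" "l2_stable s M bt0 bt"
    then show "dual_framelet s M psi0 psi psit0 psit" by (rule filter_bank_imp_framelet)
  next
    show "\<exists>C > 0. AE \<xi> in lebesgue. loewner_le (bracket (vfourier psi0) (vfourier psi0) \<xi>
        + bracket (vfourier psit0) (vfourier psit0) \<xi>) (mat (complex_of_real C))"
      by (rule bracket_bounded)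
  next
    fix C :: real
    assume C: "C > 0" "AE \<xi> in lebesgue. loewner_le (mat (complex_of_real C)) (bracket (vfourier psi0) (vfourier psi0) \<xi>)"
      "AE \<xi> in lebesgue. loewner_le (mat (complex_of_real C)) (bracket (vfourier psit0) (vfourier psit0) \<xi>)"
      and dual: "dual_framelet s M psi0 psi psit0 psit"
    note fb = framelet_imp_filter_bank[OF C dual]
    show "dual_framelet_filter_bank s M b0 b bt0 bt" by (rule fb)
    show "l2_stable s M b0 b" by (rule fb)
    show "l2_stable s M bt0 bt" by (rule fb)
  qed
qed

end
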